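(* There is a canonical bijection between (i) the symmetric nc-functions $f$ that are freely holomorphic on $\mathbb{M}^2$, and (ii) the holomorphic functions $F_{oo}$ on the Zariski-free manifold $\mathcal{G}$ that are conditionally nc (as functions on the subset $\mathcal{G}$ of $\mathbb{M}^3$) and have the property that for every $w\in\mathbb{M}^2$ there is a free neighborhood $U$ of $w$ such that $F_{oo}$ is bounded on $\pi(U)\cap\mathcal{G}$. Under this bijection $f$ and $F_{oo}$ correspond if and only if $f(w)=F_{oo}(\pi(w))$ for all $w\in\bigcup_{\gamma,\tau}\omega_{\gamma\tau}(\mathcal{U}_\gamma)$.
   Context: **Basics.** $\mathbb{M}_n$ is the algebra of $n\times n$ complex matrices, $\mathbb{M}^d=\bigcup_{n\ge1}\mathbb{M}_n^d$ (disjoint union), with points $x=(x^1,\dots,x^d)$. Direct sums $x\oplus y$ and similarities $s^{-1}xs$ are taken componentwise. An *nc-set* is a subset of $\mathbb{M}^d$ closed under direct sums. A function $f:D\to\mathbb{M}^1$, $D\subseteq\mathbb{M}^d$, is *graded* if $f(x)\in\mathbb{M}_n$ whenever $x\in D\cap\mathbb{M}_n^d$. An *nc-function* is a graded function $f$ on an nc-set $D$ such that $f(x\oplus y)=f(x)\oplus f(y)$ for $x,y\in D$, and $f(s^{-1}xs)=s^{-1}f(x)s$ whenever $x\in D\cap\mathbb{M}_n^d$, $s\in\mathbb{M}_n$ is invertible and $s^{-1}xs\in D$. Boundedness refers to operator norms of values, uniformly over all levels $n$. A function $f$ on $\mathbb{M}^2$ is *symmetric* if $f(w^1,w^2)=f(w^2,w^1)$.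 **Topologies.** A set $D\subseteq\mathbb{M}^d$ is finitely open if $D\cap\mathbb{M}_n^d$ is open in $\mathbb{M}_n^d$ for every $n$. A topology on $\mathbb{M}^d$ is *admissible* if it has a basis of finitely open nc-sets. The *free topology* has as base the sets $B_\delta=\{x:\|[\delta_{ij}(x)]\|<1\}$, $\delta$ a (rectangular) matrix of free polynomials (polynomials over $\mathbb{C}$ in non-commuting variables); freely open sets are free domains. For an admissible topology $\tau$, a graded function $f$ on $D$ is *$\tau$-holomorphic* if $D\in\tau$, every $x\in D$ has a neighborhood $U\in\tau$, $U\subseteq D$, that is an nc-set on which $f$ is an nc-function, and every $x\in D$ has a $\tau$-neighborhood on which $f$ is bounded. With $\tau$ the free topology one says freely holomorphic. A *free variety* in a free domain $D$ is a set $\{x\in D: g(x)=0\ \forall g\in E\}$, $E$ a set of freely holomorphic functions on $D$. The *Zariski-free topology* has as base the sets $D\setminus T$, $D$ a free domain and $T$ a finite union of free varieties in $D$; it is admissible. **The map $\pi$ and the manifold $\mathcal{G}$.** $\pi:\mathbb{M}^2\to\mathbb{M}^3$ is $\pi(w^1,w^2)=(\tfrac12(w^1+w^2),\tfrac14(w^1-w^2)^2,\tfrac18(w^1-w^2)(w^1+w^2)(w^1-w^2))$. Let $\Gamma$ be the set of finite subsets of $\mathbb{C}\setminus\{0\}$. For each $\gamma\in\Gamma$ fix $r_\gamma>0$ with $r_\gamma<\min\{\min_{c\in\gamma}|c|,\ \tfrac14\min_{c\ne d\in\gamma}|c-d|\}$, let $\Delta_\gamma=\bigcup_{c\in\gamma}\{z:|z-c|<r_\gamma\}$,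 and fix a holomorphic branch $s_\gamma$ of $\sqrt z$ on $\Delta_\gamma$. For $\tau\in\{-1,1\}^\gamma$ let $\iota_{\gamma\tau}(z)=\tau(c)$ if $|z-c|<r_\gamma$, $c\in\gamma$. Let $D_\gamma=\{x\in\mathbb{M}^1:\sigma(x)\subseteq\Delta_\gamma\}$ and, via the holomorphic functional calculus, $I_{\gamma\tau}(x)=\iota_{\gamma\tau}(x)$ and $S_{\gamma\tau}(x)=s_\gamma(x)\iota_{\gamma\tau}(x)$ for $x\in D_\gamma$. Let $\mathcal{U}_\gamma=\{(u,x)\in\mathbb{M}^2: x\in D_\gamma,\ uI_{\gamma\tau}(x)\ne I_{\gamma\tau}(x)u$ for every nonconstant $\tau\in\{-1,1\}^\gamma\}$, a Zariski-freely open set. Put $\omega_{\gamma\tau}(u,x)=(u+S_{\gamma\tau}(x),u-S_{\gamma\tau}(x))$ and $\Phi_{\gamma\tau}(u,x)=(u,x,S_{\gamma\tau}(x)uS_{\gamma\tau}(x))$ on $\mathcal{U}_\gamma$, and $\mathcal{G}=\bigcup_{\gamma\in\Gamma}\bigcup_{\tau\in\{-1,1\}^\gamma}\Phi_{\gamma\tau}(\mathcal{U}_\gamma)\subseteq\mathbb{M}^3$. $\mathcal{G}$ carries the topology with base $\{\Phi_{\gamma\tau}(U): U\subseteq\mathcal{U}_\gamma$ Zariski-freely open$\}$ and the atlas of charts $\Phi_{\gamma\tau}^{-1}:\Phi_{\gamma\tau}(\mathcal{U}_\gamma)\to\mathcal{U}_\gamma$. A function $F:\mathcal{G}\to\mathbb{M}^1$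 is *holomorphic* if $F\circ\Phi_{\gamma\tau}$ is holomorphic on $\mathcal{U}_\gamma$ with respect to the Zariski-free topology for all $\gamma,\tau$. **Conditionally nc.** A graded function $f$ on an arbitrary set $D\subseteq\mathbb{M}^d$ is *conditionally nc* if (i) $f(s^{-1}xs)=s^{-1}f(x)s$ whenever $x,s^{-1}xs\in D$, and (ii) there is a graded function $\hat f$ on $\hat D=\{y:\exists x\in D,\ x\oplus y\in D\}$ such that $f(x\oplus y)=f(x)\oplus\hat f(y)$ whenever $x\in D$ and $x\oplus y\in D$. *)

theory Defs
  imports
    "HOL-Complex_Analysis.Complex_Analysis"
    "HOL-Library.Poly_Mapping"
    "Jordan_Normal_Form.Spectral_Radius"
    "Jordan_Normal_Form.Gauss_Jordan_Elimination"
begin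

hide_const (open) Finite_Cartesian_Product.mat Finite_Cartesian_Product.vec

section \<open>The nc universe\<close>

text \<open>A point of $M_n^d$ is a list of length \<open>d\<close> of \<open>n \<times> n\<close> matrices; the union over the levels
  is disjoint because \<open>d \<ge> 1\<close> throughout. Elements of $M^1$ that occur as values of functions,
  or as arguments of the functional calculus, are plain matrices instead of one-element lists.\<close>

type_synonym point = "complex mat list"

definition M_level :: "nat \<Rightarrow> nat \<Rightarrow> point set" where
  "M_level d n = {x. length x = d \<and> set x \<subseteq> carrier_mat n n}"

definition M :: "nat \<Rightarrow> point set" where
  "M d = (\<Union>n\<in>{1..}. M_level d n)"

definition lvl :: "point \<Rightarrow> nat" where
  "lvl x = dim_row (hd x)"

definition mat_dsum :: "complex mat \<Rightarrow> complex mat \<Rightarrow> complex mat" where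
  "mat_dsum A B = four_block_mat A (0\<^sub>m (dim_row A) (dim_col B)) (0\<^sub>m (dim_row B) (dim_col A)) B"

definition dsum :: "point \<Rightarrow> point \<Rightarrow> point" where
  "dsum x y = map2 mat_dsum x y"

definition mat_inv :: "complex mat \<Rightarrow> complex mat" where
  "mat_inv A = the (mat_inverse A)"

definition conjugate_by :: "complex mat \<Rightarrow> point \<Rightarrow> point" where
  "conjugate_by s x = map (\<lambda>a. mat_inv s * a * s) x"

definition vnorm :: "complex vec \<Rightarrow> real" where
  "vnorm v = sqrt (\<Sum>i<dim_vec v. (cmod (vec_index v i))\<^sup>2)"

definition op_norm :: "complex mat \<Rightarrow> real" where
  "op_norm A = Sup {vnorm (A *\<^sub>v v) | v. v \<in> carrier_vec (dim_col A) \<and> vnorm v \<le> 1}"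

section \<open>nc-functions\<close>

definition nc_set :: "nat \<Rightarrow> point set \<Rightarrow> bool" where
  "nc_set d D \<longleftrightarrow> D \<subseteq> M d \<and> (\<forall>x\<in>D. \<forall>y\<in>D. dsum x y \<in> D)"

definition graded :: "point set \<Rightarrow> (point \<Rightarrow> complex mat) \<Rightarrow> bool" where
  "graded D f \<longleftrightarrow> (\<forall>x\<in>D. f x \<in> carrier_mat (lvl x) (lvl x))"

definition respects_similarities :: "point set \<Rightarrow> (point \<Rightarrow> complex mat) \<Rightarrow> bool" where
  "respects_similarities D f \<longleftrightarrow>
     (\<forall>x\<in>D. \<forall>s\<in>carrier_mat (lvl x) (lvl x).
        invertible_mat s \<longrightarrow> conjugate_by s x \<in> D \<longrightarrow> f (conjugate_by s x) = mat_inv s * f x * s)"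

definition nc_function :: "nat \<Rightarrow> point set \<Rightarrow> (point \<Rightarrow> complex mat) \<Rightarrow> bool" where
  "nc_function d D f \<longleftrightarrow> nc_set d D \<and> graded D f \<and>
     (\<forall>x\<in>D. \<forall>y\<in>D. f (dsum x y) = mat_dsum (f x) (f y)) \<and> respects_similarities D f"

definition conditionally_nc :: "nat \<Rightarrow> point set \<Rightarrow> (point \<Rightarrow> complex mat) \<Rightarrow> bool" where
  "conditionally_nc d D f \<longleftrightarrow> D \<subseteq> M d \<and> graded D f \<and> respects_similarities D f \<and>
     (\<exists>fhat. graded {y \<in> M d. \<exists>x\<in>D. dsum x y \<in> D} fhat \<and>
        (\<forall>x\<in>D. \<forall>y\<in>M d. dsum x y \<in> D \<longrightarrow> f (dsum x y) = mat_dsum (f x) (fhat y)))"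

definition bounded_fun_on :: "point set \<Rightarrow> (point \<Rightarrow> complex mat) \<Rightarrow> bool" where
  "bounded_fun_on U f \<longleftrightarrow> (\<exists>C. \<forall>x\<in>U. op_norm (f x) \<le> C)"

definition nc_holomorphic ::
    "nat \<Rightarrow> point topology \<Rightarrow> point set \<Rightarrow> (point \<Rightarrow> complex mat) \<Rightarrow> bool" where
  "nc_holomorphic d T D f \<longleftrightarrow> openin T D \<and> graded D f \<and>
     (\<forall>x\<in>D. \<exists>U. openin T U \<and> x \<in> U \<and> U \<subseteq> D \<and> nc_function d U f) \<and>
     (\<forall>x\<in>D. \<exists>U. openin T U \<and> x \<in> U \<and> U \<subseteq> D \<and> bounded_fun_on U f)"

section \<open>The free topology\<close>

text \<open>A polynomial in non-commuting variables is a finitely supported family of coefficients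
  indexed by words; the letter \<open>i\<close> stands for the variable with index \<open>i < d\<close>.\<close>

type_synonym free_poly = "nat list \<Rightarrow>\<^sub>0 complex"

definition free_polys :: "nat \<Rightarrow> free_poly set" where
  "free_polys d = {p. Poly_Mapping.keys p \<subseteq> lists {..<d}}"

definition eval_word :: "point \<Rightarrow> nat list \<Rightarrow> complex mat" where
  "eval_word x w = foldr (\<lambda>i A. x ! i * A) w (1\<^sub>m (lvl x))"

definition eval_poly :: "free_poly \<Rightarrow> point \<Rightarrow> complex mat" where
  "eval_poly p x = mat (lvl x) (lvl x)
     (\<lambda>ij. \<Sum>w\<in>Poly_Mapping.keys p. Poly_Mapping.lookup p w * (eval_word x w $$ ij))"

definition eval_poly_mat :: "free_poly mat \<Rightarrow> point \<Rightarrow> complex mat" where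
  "eval_poly_mat \<delta> x = mat (dim_row \<delta> * lvl x) (dim_col \<delta> * lvl x)
     (\<lambda>(i,j). eval_poly (\<delta> $$ (i div lvl x, j div lvl x)) x $$ (i mod lvl x, j mod lvl x))"

definition free_ball :: "nat \<Rightarrow> free_poly mat \<Rightarrow> point set" where
  "free_ball d \<delta> = {x \<in> M d. op_norm (eval_poly_mat \<delta> x) < 1}"

text \<open>This base, and the one of the Zariski-free topology, are closed under binary intersections,
  so the generated topology consists of the unions of base sets.\<close>

definition free_topology :: "nat \<Rightarrow> point topology" where
  "free_topology d = topology_generated_by {free_ball d \<delta> | \<delta>. elements_mat \<delta> \<subseteq> free_polys d}"

section \<open>The Zariski-free topology\<close>

definition free_variety :: "nat \<Rightarrow> point set \<Rightarrow> point set \<Rightarrow> bool" where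
  "free_variety d D V \<longleftrightarrow>
     (\<exists>E. (\<forall>g\<in>E. nc_holomorphic d (free_topology d) D g) \<and>
          V = {x \<in> D. \<forall>g\<in>E. g x = 0\<^sub>m (lvl x) (lvl x)})"

definition zariski_free_topology :: "nat \<Rightarrow> point topology" where
  "zariski_free_topology d = topology_generated_by
     {D - \<Union>\<V> | D \<V>. openin (free_topology d) D \<and> finite \<V> \<and> (\<forall>V\<in>\<V>. free_variety d D V)}"

section \<open>Functional calculus\<close>

text \<open>The Riesz--Dunford integral of \<open>h(z) (z - x)\<inverse>\<close>, divided by \<open>2\<pi>\<i>\<close>, over the cycle that
  consists of one small circle around each eigenvalue of \<open>x\<close>. The residue of a function is by
  definition its integral over small circles, divided by \<open>2\<pi>\<i>\<close>.\<close>

definition fun_calc :: "(complex \<Rightarrow> complex) \<Rightarrow> complex mat \<Rightarrow> complex mat" where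
  "fun_calc h x = mat (dim_row x) (dim_row x)
     (\<lambda>ij. \<Sum>\<mu>\<in>spectrum x. residue (\<lambda>z. h z * (mat_inv (z \<cdot>\<^sub>m 1\<^sub>m (dim_row x) - x) $$ ij)) \<mu>)"

section \<open>The map \<open>\<pi>\<close> and the manifold \<open>\<G>\<close>\<close>

definition pi_map :: "point \<Rightarrow> point" where
  "pi_map w = (let p = w ! 0 + w ! 1; m = w ! 0 - w ! 1 in
     [(1/2) \<cdot>\<^sub>m p, (1/4) \<cdot>\<^sub>m (m * m), (1/8) \<cdot>\<^sub>m (m * p * m)])"

definition Gam :: "complex set set" where
  "Gam = {\<gamma>. finite \<gamma> \<and> 0 \<notin> \<gamma>}"

definition Disks :: "(complex set \<Rightarrow> real) \<Rightarrow> complex set \<Rightarrow> complex set" where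
  "Disks r \<gamma> = (\<Union>c\<in>\<gamma>. ball c (r \<gamma>))"

text \<open>Minima over empty sets impose no condition.\<close>

definition sqrt_data :: "(complex set \<Rightarrow> real) \<Rightarrow> (complex set \<Rightarrow> complex \<Rightarrow> complex) \<Rightarrow> bool" where
  "sqrt_data r s \<longleftrightarrow> (\<forall>\<gamma>\<in>Gam.
     0 < r \<gamma> \<and> (\<forall>c\<in>\<gamma>. r \<gamma> < cmod c) \<and> (\<forall>c\<in>\<gamma>. \<forall>d\<in>\<gamma>. c \<noteq> d \<longrightarrow> r \<gamma> < (1/4) * cmod (c - d)) \<and>
     s \<gamma> holomorphic_on Disks r \<gamma> \<and> (\<forall>z\<in>Disks r \<gamma>. (s \<gamma> z)\<^sup>2 = z))"

definition signs :: "complex set \<Rightarrow> (complex \<Rightarrow> complex) set" where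
  "signs \<gamma> = (\<gamma> \<rightarrow>\<^sub>E {-1, 1})"

definition iota :: "(complex set \<Rightarrow> real) \<Rightarrow> complex set \<Rightarrow> (complex \<Rightarrow> complex) \<Rightarrow> complex \<Rightarrow> complex" where
  "iota r \<gamma> \<tau> z = \<tau> (THE c. c \<in> \<gamma> \<and> cmod (z - c) < r \<gamma>)"

definition Dom :: "(complex set \<Rightarrow> real) \<Rightarrow> complex set \<Rightarrow> complex mat set" where
  "Dom r \<gamma> = {x. \<exists>n\<ge>1. x \<in> carrier_mat n n \<and> spectrum x \<subseteq> Disks r \<gamma>}"

definition I_op :: "(complex set \<Rightarrow> real) \<Rightarrow> complex set \<Rightarrow> (complex \<Rightarrow> complex) \<Rightarrow> complex mat \<Rightarrow> complex mat" where
  "I_op r \<gamma> \<tau> = fun_calc (iota r \<gamma> \<tau>)"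

definition S_op :: "(complex set \<Rightarrow> real) \<Rightarrow> (complex set \<Rightarrow> complex \<Rightarrow> complex) \<Rightarrow>
    complex set \<Rightarrow> (complex \<Rightarrow> complex) \<Rightarrow> complex mat \<Rightarrow> complex mat" where
  "S_op r s \<gamma> \<tau> = fun_calc (\<lambda>z. s \<gamma> z * iota r \<gamma> \<tau> z)"

definition U_set :: "(complex set \<Rightarrow> real) \<Rightarrow> complex set \<Rightarrow> point set" where
  "U_set r \<gamma> = {[u, x] | u x. [u, x] \<in> M 2 \<and> x \<in> Dom r \<gamma> \<and>
     (\<forall>\<tau>\<in>signs \<gamma>. (\<exists>c\<in>\<gamma>. \<exists>d\<in>\<gamma>. \<tau> c \<noteq> \<tau> d) \<longrightarrow> u * I_op r \<gamma> \<tau> x \<noteq> I_op r \<gamma> \<tau> x * u)}"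

definition omega_map :: "(complex set \<Rightarrow> real) \<Rightarrow> (complex set \<Rightarrow> complex \<Rightarrow> complex) \<Rightarrow>
    complex set \<Rightarrow> (complex \<Rightarrow> complex) \<Rightarrow> point \<Rightarrow> point" where
  "omega_map r s \<gamma> \<tau> p = (let u = p ! 0; S = S_op r s \<gamma> \<tau> (p ! 1) in [u + S, u - S])"

definition Phi_map :: "(complex set \<Rightarrow> real) \<Rightarrow> (complex set \<Rightarrow> complex \<Rightarrow> complex) \<Rightarrow>
    complex set \<Rightarrow> (complex \<Rightarrow> complex) \<Rightarrow> point \<Rightarrow> point" where
  "Phi_map r s \<gamma> \<tau> p = (let u = p ! 0; x = p ! 1; S = S_op r s \<gamma> \<tau> x in [u, x, S * u * S])"

definition G_man :: "(complex set \<Rightarrow> real) \<Rightarrow> (complex set \<Rightarrow> complex \<Rightarrow> complex) \<Rightarrow> point set" where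
  "G_man r s = (\<Union>\<gamma>\<in>Gam. \<Union>\<tau>\<in>signs \<gamma>. Phi_map r s \<gamma> \<tau> ` U_set r \<gamma>)"

definition holomorphic_on_G :: "(complex set \<Rightarrow> real) \<Rightarrow> (complex set \<Rightarrow> complex \<Rightarrow> complex) \<Rightarrow>
    (point \<Rightarrow> complex mat) \<Rightarrow> bool" where
  "holomorphic_on_G r s F \<longleftrightarrow> (\<forall>\<gamma>\<in>Gam. \<forall>\<tau>\<in>signs \<gamma>.
     nc_holomorphic 2 (zariski_free_topology 2) (U_set r \<gamma>) (F \<circ> Phi_map r s \<gamma> \<tau>))"

section \<open>The two classes of functions\<close>

text \<open>Functions on a set are represented by their \<^const>\<open>extensional\<close> representatives.\<close>

definition symmetric :: "(point \<Rightarrow> complex mat) \<Rightarrow> bool" where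
  "symmetric f \<longleftrightarrow> (\<forall>w1 w2. [w1, w2] \<in> M 2 \<longrightarrow> f [w1, w2] = f [w2, w1])"

definition symmetric_free_functions :: "(point \<Rightarrow> complex mat) set" where
  "symmetric_free_functions = {f \<in> extensional (M 2).
     symmetric f \<and> nc_function 2 (M 2) f \<and> nc_holomorphic 2 (free_topology 2) (M 2) f}"

definition G_functions :: "(complex set \<Rightarrow> real) \<Rightarrow> (complex set \<Rightarrow> complex \<Rightarrow> complex) \<Rightarrow>
    (point \<Rightarrow> complex mat) set" where
  "G_functions r s = {F \<in> extensional (G_man r s).
     holomorphic_on_G r s F \<and> conditionally_nc 3 (G_man r s) F \<and>
     (\<forall>w\<in>M 2. \<exists>U. openin (free_topology 2) U \<and> w \<in> U \<and>
        bounded_fun_on (pi_map ` U \<inter> G_man r s) F)}"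

end

theory Submission
  imports Defs
begin

text \<open>In the coordinates \<open>w = (u + v, u - v)\<close> the map \<open>\<pi>\<close> is \<open>(u, v\<^sup>2, v u v)\<close>. Two preimages
  \<open>(u + v, u - v)\<close> and \<open>(u + v', u - v')\<close> of a point of \<open>\<G>\<close> have commuting invertible \<open>v\<close>, \<open>v'\<close> with
  the same square, and an intertwining argument shows that a symmetric nc-function has the same
  value at both; hence it descends to \<open>\<G>\<close>.

  Conversely, let \<open>F\<close> be given and call \<open>w\<close> branched if \<open>v\<close> is one of the functions \<open>S\<^sub>\<gamma>\<^sub>\<tau>\<close> of \<open>v\<^sup>2\<close>. If \<open>a\<close> is
  in the image of \<open>\<omega>\<^sub>\<gamma>\<^sub>\<tau>\<close>, then so is \<open>a \<oplus> w\<close>; so the function \<open>F'\<close> with \<open>F(y \<oplus> z) = F(y) \<oplus> F'(z)\<close>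
  makes \<open>F' \<circ> \<pi>\<close> an nc-function on the branched points, and it inherits the local bounds of \<open>F\<close>. A
  bounded nc-function is holomorphic along lines, and \<open>w + t(1, -1)\<close> is branched for all but finitely
  many \<open>t\<close>. The values at arbitrary \<open>w\<close> are therefore obtained from Riemann's theorem on removable
  singularities, and the nc-identities and the bounds pass to the limit \<open>t \<rightarrow> 0\<close>. Uniqueness holds
  because the images of the \<open>\<omega>\<^sub>\<gamma>\<^sub>\<tau>\<close> are dense along lines in the branched points.\<close>

text \<open>The obstacle throughout is uniformity in the matrix size: neighbourhoods and bounds in
  the free topology speak about all levels at once. Norm-closeness to a fixed matrix x makes no
  sense across levels, but \<open>op_norm (poly_mat q y) < \<epsilon>\<close> does, with q an
  annihilating polynomial of x. Such a condition is a free ball, it confines the spectrum of y to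
  discs around the zeros of q, and for bounded y it makes h(y) a polynomial p(y) up to an error of
  the order of \<open>op_norm (poly_mat q y)\<close>. Hence the residue definition of
  \<open>fun_calc\<close> is traded for interpolation polynomials at once, and all constants are
  kept independent of n.

  The second obstacle is that F is given only where u fails to commute with each nonconstant sign
  operator. Passing to direct sums removes this restriction because noncommutation is already
  decided by the first block. What is left is a condition on v alone: v is branched exactly if no
  two eigenvalues of v, equal ones included, add up to zero. This is why shifting v by a scalar t
  suffices to reach the branched points.\<close>

unbundle no vec_syntax and no fps_syntax

section \<open>Norms of matrices\<close>

lemma mult_mat_vec_in_carrier_iff [simp]: "A *\<^sub>v v \<in> carrier_vec m \<longleftrightarrow> dim_row A = m"
  unfolding carrier_vec_def by simp

lemma in_carrier_mat_iff [simp]: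
  "A * B \<in> carrier_mat m k \<longleftrightarrow> dim_row A = m \<and> dim_col B = k"
  "A + B \<in> carrier_mat m k \<longleftrightarrow> dim_row B = m \<and> dim_col B = k"
  "A - B \<in> carrier_mat m k \<longleftrightarrow> dim_row B = m \<and> dim_col B = k"
  unfolding carrier_mat_def by simp_all

lemma vnorm_L2_set: "vnorm v = L2_set (\<lambda>i. cmod (v $ i)) {..<dim_vec v}"
  by (simp add: vnorm_def L2_set_def)

lemma vnorm_nonneg [simp]: "0 \<le> vnorm v"
  by (simp add: vnorm_L2_set L2_set_nonneg)

lemma vnorm_add_le:
  assumes "u \<in> carrier_vec n" "v \<in> carrier_vec n"
  shows "vnorm (u + v) \<le> vnorm u + vnorm v"
proof -
  have "vnorm (u + v) \<le> L2_set (\<lambda>i. cmod (u $ i) + cmod (v $ i)) {..<n}"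
    using assms unfolding vnorm_L2_set by (auto intro!: L2_set_mono norm_triangle_ineq)
  also have "\<dots> \<le> vnorm u + vnorm v"
    using assms by (auto simp: vnorm_L2_set intro: L2_set_triangle_ineq)
  finally show ?thesis .
qed

lemma vnorm_smult: "vnorm (c \<cdot>\<^sub>v v) = cmod c * vnorm v"
  unfolding vnorm_L2_set by (subst L2_set_right_distrib) (auto intro!: L2_set_cong simp: norm_mult)

lemma cmod_index_le_vnorm: "i < dim_vec v \<Longrightarrow> cmod (v $ i) \<le> vnorm v"
  unfolding vnorm_L2_set by (rule member_le_L2_set) auto

lemma vnorm_le_sum: "vnorm v \<le> (\<Sum>i<dim_vec v. cmod (v $ i))"
  unfolding vnorm_L2_set by (rule L2_set_le_sum) auto

lemma vnorm_zero [simp]: "vnorm (0\<^sub>v n) = 0"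
  by (simp add: vnorm_L2_set L2_set_def)

lemma vnorm_eq_0D: "vnorm v = 0 \<Longrightarrow> v = 0\<^sub>v (dim_vec v)"
  using cmod_index_le_vnorm[of _ v] by (intro eq_vecI) auto

lemma vnorm_unit_vec: "j < n \<Longrightarrow> vnorm (unit_vec n j) = 1"
  by (simp add: vnorm_def if_distrib[of "\<lambda>x. (cmod x)\<^sup>2"] unit_vec_def cong: if_cong)

lemma vnorm_append: "(vnorm (a @\<^sub>v b))\<^sup>2 = (vnorm a)\<^sup>2 + (vnorm b)\<^sup>2"
proof -
  have *: "(\<Sum>i<m + k. g i) = (\<Sum>i<m. g i) + (\<Sum>i<k. g (m + i))" for m k and g :: "nat \<Rightarrow> real"
    by (induction k) (auto simp: algebra_simps)
  show ?thesis
    unfolding vnorm_def by (subst (1 2 3) real_sqrt_pow2) (auto simp: sum_nonneg *)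
qed

lemma vnorm_append_ge: "vnorm a \<le> vnorm (a @\<^sub>v b)" "vnorm b \<le> vnorm (a @\<^sub>v b)"
  by (rule power2_le_imp_le; simp add: vnorm_append)+

lemma vnorm_append_le: "vnorm (a @\<^sub>v b) \<le> vnorm a + vnorm b"
  by (rule power2_le_imp_le) (simp_all add: vnorm_append power2_sum)

lemma vnorm_mult_mat_vec_le_sum:
  assumes "v \<in> carrier_vec (dim_col A)"
  shows "vnorm (A *\<^sub>v v) \<le> (\<Sum>i<dim_row A. \<Sum>j<dim_col A. cmod (A $$ (i,j))) * vnorm v"
proof -
  have "vnorm (A *\<^sub>v v) \<le> (\<Sum>i<dim_row A. cmod ((A *\<^sub>v v) $ i))"
    using vnorm_le_sum[of "A *\<^sub>v v"] by simp
  also have "\<dots> \<le> (\<Sum>i<dim_row A. \<Sum>j<dim_col A. cmod (A $$ (i,j)) * vnorm v)"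
  proof (rule sum_mono)
    fix i assume i: "i \<in> {..<dim_row A}"
    have "cmod ((A *\<^sub>v v) $ i) = cmod (\<Sum>j<dim_col A. A $$ (i,j) * v $ j)"
      using i assms by (simp add: scalar_prod_def atLeast0LessThan)
    also have "\<dots> \<le> (\<Sum>j<dim_col A. cmod (A $$ (i,j)) * vnorm v)"
      using assms by (intro order_trans[OF norm_sum] sum_mono)
        (auto simp: norm_mult intro!: mult_left_mono cmod_index_le_vnorm)
    finally show "cmod ((A *\<^sub>v v) $ i) \<le> (\<Sum>j<dim_col A. cmod (A $$ (i,j)) * vnorm v)" .
  qed
  finally show ?thesis by (simp add: sum_distrib_right)
qed

text \<open>\<open>Sup\<close> of reals is informative only for sets that are bounded above; the sum
  of the moduli of all entries provides a bound.\<close>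

lemma op_norm_set_bdd:
  "bdd_above {vnorm (A *\<^sub>v v) | v. v \<in> carrier_vec (dim_col A) \<and> vnorm v \<le> 1}"
proof (rule bdd_aboveI)
  fix x assume "x \<in> {vnorm (A *\<^sub>v v) | v. v \<in> carrier_vec (dim_col A) \<and> vnorm v \<le> 1}"
  then obtain v where v: "x = vnorm (A *\<^sub>v v)" "v \<in> carrier_vec (dim_col A)" "vnorm v \<le> 1" by blast
  show "x \<le> (\<Sum>i<dim_row A. \<Sum>j<dim_col A. cmod (A $$ (i,j))) * 1"
    unfolding v(1)
    by (rule order_trans[OF vnorm_mult_mat_vec_le_sum[OF v(2)] mult_left_mono[OF v(3)]])
      (simp add: sum_nonneg)
qed

lemma op_norm_nonneg [simp]: "0 \<le> op_norm A"
  unfolding op_norm_def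
  by (rule cSup_upper2[OF _ _ op_norm_set_bdd, of "vnorm (A *\<^sub>v 0\<^sub>v (dim_col A))"]) auto

lemma mult_mat_vec_smult:
  fixes A :: "complex mat"
  assumes "v \<in> carrier_vec (dim_col A)"
  shows "A *\<^sub>v (c \<cdot>\<^sub>v v) = c \<cdot>\<^sub>v (A *\<^sub>v v)"
  using assms by (intro eq_vecI) auto

lemma vnorm_mult_mat_vec:
  assumes "v \<in> carrier_vec (dim_col A)"
  shows "vnorm (A *\<^sub>v v) \<le> op_norm A * vnorm v"
proof (cases "vnorm v = 0")
  case True
  then have "v = 0\<^sub>v (dim_col A)" using vnorm_eq_0D[of v] assms by auto
  then show ?thesis by (metis True mult_zero_right vnorm_mult_mat_vec_le_sum assms)
next
  case False
  define c where "c = complex_of_real (1 / vnorm v)"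
  have "vnorm (A *\<^sub>v (c \<cdot>\<^sub>v v)) \<le> op_norm A"
    unfolding op_norm_def using False assms
    by (intro cSup_upper op_norm_set_bdd CollectI exI[of _ "c \<cdot>\<^sub>v v"]) (auto simp: vnorm_smult c_def norm_divide)
  moreover have "vnorm v > 0" using False vnorm_nonneg[of v] by linarith
  ultimately show ?thesis
    by (simp add: mult_mat_vec_smult[OF assms] vnorm_smult c_def norm_divide divide_le_eq)
qed

lemma op_norm_leI:
  assumes "\<And>v. v \<in> carrier_vec (dim_col A) \<Longrightarrow> vnorm (A *\<^sub>v v) \<le> K * vnorm v" "0 \<le> K"
  shows "op_norm A \<le> K"
  unfolding op_norm_def
proof (rule cSup_least)
  show "{vnorm (A *\<^sub>v v) | v. v \<in> carrier_vec (dim_col A) \<and> vnorm v \<le> 1} \<noteq> {}"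
    by (auto intro!: exI[of _ "0\<^sub>v (dim_col A)"])
  fix x assume "x \<in> {vnorm (A *\<^sub>v v) | v. v \<in> carrier_vec (dim_col A) \<and> vnorm v \<le> 1}"
  then obtain v where v: "x = vnorm (A *\<^sub>v v)" "v \<in> carrier_vec (dim_col A)" "vnorm v \<le> 1" by blast
  show "x \<le> K"
    using order_trans[OF assms(1)[OF v(2)] mult_left_mono[OF v(3) assms(2)]] v(1) by simp
qed

lemma op_norm_le_sum: "op_norm A \<le> (\<Sum>i<dim_row A. \<Sum>j<dim_col A. cmod (A $$ (i,j)))"
  by (intro op_norm_leI vnorm_mult_mat_vec_le_sum) (auto intro!: sum_nonneg)

lemma cmod_index_le_op_norm:
  assumes "i < dim_row A" "j < dim_col A"
  shows "cmod (A $$ (i,j)) \<le> op_norm A"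
proof -
  have "A $$ (i,j) = (A *\<^sub>v unit_vec (dim_col A) j) $ i"
    using assms by auto
  moreover have "cmod ((A *\<^sub>v unit_vec (dim_col A) j) $ i) \<le> op_norm A * vnorm (unit_vec (dim_col A) j)"
    using assms by (intro order_trans[OF cmod_index_le_vnorm vnorm_mult_mat_vec]) auto
  ultimately show ?thesis using assms by (simp add: vnorm_unit_vec)
qed

lemma op_norm_zero [simp]: "op_norm (0\<^sub>m m n) = 0"
  using op_norm_le_sum[of "0\<^sub>m m n"] op_norm_nonneg[of "0\<^sub>m m n"] by simp

lemma op_norm_one: "op_norm (1\<^sub>m n) \<le> 1"
  by (rule op_norm_leI) auto

lemma op_norm_add:
  assumes "A \<in> carrier_mat m n" "B \<in> carrier_mat m n"
  shows "op_norm (A + B) \<le> op_norm A + op_norm B"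
proof (rule op_norm_leI)
  fix v :: "complex vec" assume "v \<in> carrier_vec (dim_col (A + B))"
  then have v: "v \<in> carrier_vec n" using assms by auto
  have "vnorm ((A + B) *\<^sub>v v) = vnorm (A *\<^sub>v v + B *\<^sub>v v)"
    using add_mult_distrib_mat_vec[OF assms v] by simp
  also have "\<dots> \<le> vnorm (A *\<^sub>v v) + vnorm (B *\<^sub>v v)"
    using assms by (intro vnorm_add_le[of _ m]) simp_all
  also have "\<dots> \<le> op_norm A * vnorm v + op_norm B * vnorm v"
    using assms v by (intro add_mono vnorm_mult_mat_vec) auto
  finally show "vnorm ((A + B) *\<^sub>v v) \<le> (op_norm A + op_norm B) * vnorm v"
    by (simp add: algebra_simps)
qed auto

lemma op_norm_smult_le: "op_norm (c \<cdot>\<^sub>m A) \<le> cmod c * op_norm A"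
proof (rule op_norm_leI)
  fix v :: "complex vec" assume "v \<in> carrier_vec (dim_col (c \<cdot>\<^sub>m A))"
  then have v: "v \<in> carrier_vec (dim_col A)" by auto
  have "(c \<cdot>\<^sub>m A) *\<^sub>v v = c \<cdot>\<^sub>v (A *\<^sub>v v)"
    using v by (intro eq_vecI) auto
  then show "vnorm ((c \<cdot>\<^sub>m A) *\<^sub>v v) \<le> cmod c * op_norm A * vnorm v"
    using mult_left_mono[OF vnorm_mult_mat_vec[OF v], of "cmod c"]
    by (simp add: vnorm_smult mult.assoc)
qed auto

lemma op_norm_smult: "op_norm (c \<cdot>\<^sub>m A) = cmod c * op_norm A"
proof (cases "c = 0")
  case True
  have "op_norm (c \<cdot>\<^sub>m A) \<le> 0" using op_norm_smult_le[of c A] True by simp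
  then have "op_norm (c \<cdot>\<^sub>m A) = 0" using op_norm_nonneg[of "c \<cdot>\<^sub>m A"] by linarith
  then show ?thesis using True by simp
next
  case False
  have "op_norm A = op_norm (inverse c \<cdot>\<^sub>m (c \<cdot>\<^sub>m A))"
    using False by (auto intro!: arg_cong[of _ _ op_norm] eq_matI)
  also have "\<dots> \<le> cmod (inverse c) * op_norm (c \<cdot>\<^sub>m A)" by (rule op_norm_smult_le)
  finally have "cmod c * op_norm A \<le> op_norm (c \<cdot>\<^sub>m A)"
    using False by (simp add: norm_inverse inverse_eq_divide norm_divide divide_simps mult.commute)
  then show ?thesis using op_norm_smult_le[of c A] by linarith
qed

lemma op_norm_uminus: "op_norm (- A) = op_norm A"
proof -
  have "- A = (-1) \<cdot>\<^sub>m A" by (intro eq_matI) auto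
  then show ?thesis by (simp only: op_norm_smult) simp
qed

lemma op_norm_diff:
  assumes "A \<in> carrier_mat m n" "B \<in> carrier_mat m n"
  shows "op_norm (A - B) \<le> op_norm A + op_norm B"
proof -
  have "A - B = A + - B" using assms by (intro eq_matI) auto
  then show ?thesis using op_norm_add[of A m n "- B"] assms by (simp add: op_norm_uminus)
qed

lemma op_norm_minus_commute:
  assumes "A \<in> carrier_mat m n" "B \<in> carrier_mat m n"
  shows "op_norm (A - B) = op_norm (B - A)"
proof -
  have "A - B = - (B - A)" using assms by (intro eq_matI) auto
  then show ?thesis by (simp only: op_norm_uminus)
qed

lemma op_norm_mult:
  assumes "A \<in> carrier_mat m n" "B \<in> carrier_mat n k"
  shows "op_norm (A * B) \<le> op_norm A * op_norm B"
proof (rule op_norm_leI)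
  fix v :: "complex vec" assume "v \<in> carrier_vec (dim_col (A * B))"
  then have v: "v \<in> carrier_vec k" using assms by auto
  have "vnorm ((A * B) *\<^sub>v v) = vnorm (A *\<^sub>v (B *\<^sub>v v))"
    using assoc_mult_mat_vec[OF assms v] by simp
  also have "\<dots> \<le> op_norm A * vnorm (B *\<^sub>v v)"
    using assms by (intro vnorm_mult_mat_vec) auto
  also have "\<dots> \<le> op_norm A * (op_norm B * vnorm v)"
    using assms v by (intro mult_left_mono vnorm_mult_mat_vec) auto
  finally show "vnorm ((A * B) *\<^sub>v v) \<le> op_norm A * op_norm B * vnorm v" by simp
qed auto

text \<open>Each block is tested on vectors padded with zeros, and discarding a part of the result
  does not increase the norm. Below, the corner \<open>B\<close> carries differences of values of an
  nc-function, and \<open>D\<close> the second summand of a value at a direct sum.\<close>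

lemma op_norm_four_block_ge:
  assumes c: "A \<in> carrier_mat m n" "B \<in> carrier_mat m k" "C \<in> carrier_mat l n" "D \<in> carrier_mat l k"
  shows "op_norm A \<le> op_norm (four_block_mat A B C D)"
    and "op_norm B \<le> op_norm (four_block_mat A B C D)"
    and "op_norm D \<le> op_norm (four_block_mat A B C D)"
proof -
  let ?M = "four_block_mat A B C D"
  have M: "?M \<in> carrier_mat (m + l) (n + k)" using c by simp
  have le: "vnorm (?M *\<^sub>v (a @\<^sub>v d)) \<le> op_norm ?M * vnorm (a @\<^sub>v d)"
    if "a \<in> carrier_vec n" "d \<in> carrier_vec k" for a d
    using that M by (intro vnorm_mult_mat_vec) auto
  have z: "vnorm (a @\<^sub>v 0\<^sub>v j) = vnorm a" "vnorm (0\<^sub>v j @\<^sub>v a) = vnorm a" for a j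
    by (rule power2_eq_imp_eq; simp add: vnorm_append)+
  have z0: "X *\<^sub>v 0\<^sub>v j = 0\<^sub>v i" if "X \<in> carrier_mat i j" for X :: "complex mat" and i j
    using that by (intro eq_vecI) auto
  have z0: "A *\<^sub>v 0\<^sub>v n = 0\<^sub>v m" "B *\<^sub>v 0\<^sub>v k = 0\<^sub>v m" "C *\<^sub>v 0\<^sub>v n = 0\<^sub>v l" "D *\<^sub>v 0\<^sub>v k = 0\<^sub>v l"
    "\<And>x :: complex vec. x \<in> carrier_vec m \<Longrightarrow> x + 0\<^sub>v m = x" "\<And>x :: complex vec. x \<in> carrier_vec l \<Longrightarrow> x + 0\<^sub>v l = x"
    "\<And>x :: complex vec. x \<in> carrier_vec m \<Longrightarrow> 0\<^sub>v m + x = x" "\<And>x :: complex vec. x \<in> carrier_vec l \<Longrightarrow> 0\<^sub>v l + x = x"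
    using c by (auto intro: z0)
  show "op_norm A \<le> op_norm ?M"
  proof (rule op_norm_leI)
    fix v :: "complex vec" assume "v \<in> carrier_vec (dim_col A)"
    then have v: "v \<in> carrier_vec n" using c by auto
    have "?M *\<^sub>v (v @\<^sub>v 0\<^sub>v k) = (A *\<^sub>v v) @\<^sub>v (C *\<^sub>v v)"
      using four_block_mat_mult_vec[OF c v zero_carrier_vec] c v by (simp add: z0)
    then show "vnorm (A *\<^sub>v v) \<le> op_norm ?M * vnorm v"
      using le[OF v zero_carrier_vec] vnorm_append_ge(1)[of "A *\<^sub>v v" "C *\<^sub>v v"] by (simp add: z)
  qed simp
  show "op_norm B \<le> op_norm ?M"
  proof (rule op_norm_leI)
    fix v :: "complex vec" assume "v \<in> carrier_vec (dim_col B)"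
    then have v: "v \<in> carrier_vec k" using c by auto
    have "?M *\<^sub>v (0\<^sub>v n @\<^sub>v v) = (B *\<^sub>v v) @\<^sub>v (D *\<^sub>v v)"
      using four_block_mat_mult_vec[OF c zero_carrier_vec v] c v by (simp add: z0)
    then show "vnorm (B *\<^sub>v v) \<le> op_norm ?M * vnorm v"
      using le[OF zero_carrier_vec v] vnorm_append_ge(1)[of "B *\<^sub>v v" "D *\<^sub>v v"] by (simp add: z)
  qed simp
  show "op_norm D \<le> op_norm ?M"
  proof (rule op_norm_leI)
    fix v :: "complex vec" assume "v \<in> carrier_vec (dim_col D)"
    then have v: "v \<in> carrier_vec k" using c by auto
    have "?M *\<^sub>v (0\<^sub>v n @\<^sub>v v) = (B *\<^sub>v v) @\<^sub>v (D *\<^sub>v v)"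
      using four_block_mat_mult_vec[OF c zero_carrier_vec v] c v by (simp add: z0)
    then show "vnorm (D *\<^sub>v v) \<le> op_norm ?M * vnorm v"
      using le[OF zero_carrier_vec v] vnorm_append_ge(2)[where a = "B *\<^sub>v v" and b = "D *\<^sub>v v"] by (simp add: z)
  qed simp
qed

lemma op_norm_four_block_le:
  assumes c: "A \<in> carrier_mat m n" "B \<in> carrier_mat m k" "C \<in> carrier_mat l n" "D \<in> carrier_mat l k"
  shows "op_norm (four_block_mat A B C D) \<le> op_norm A + op_norm B + op_norm C + op_norm D"
proof (rule op_norm_leI)
  let ?M = "four_block_mat A B C D"
  fix v :: "complex vec" assume "v \<in> carrier_vec (dim_col ?M)"
  then have v: "v \<in> carrier_vec (n + k)" using c by auto
  define a where "a = vec_first v n"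
  define d where "d = vec_last v k"
  have v_eq: "v = a @\<^sub>v d" using v by (simp add: a_def d_def)
  have ad: "a \<in> carrier_vec n" "d \<in> carrier_vec k" by (auto simp: a_def d_def)
  have le: "vnorm a \<le> vnorm v" "vnorm d \<le> vnorm v" unfolding v_eq by (rule vnorm_append_ge)+
  have b: "vnorm (X *\<^sub>v w) \<le> op_norm X * vnorm v"
    if "w \<in> carrier_vec (dim_col X)" "vnorm w \<le> vnorm v" for X w
    by (rule order_trans[OF vnorm_mult_mat_vec[OF that(1)] mult_left_mono[OF that(2)]]) simp
  have "vnorm (?M *\<^sub>v v) \<le> vnorm (A *\<^sub>v a + B *\<^sub>v d) + vnorm (C *\<^sub>v a + D *\<^sub>v d)"
    unfolding v_eq four_block_mat_mult_vec[OF c ad] by (rule vnorm_append_le)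
  also have "\<dots> \<le> (vnorm (A *\<^sub>v a) + vnorm (B *\<^sub>v d)) + (vnorm (C *\<^sub>v a) + vnorm (D *\<^sub>v d))"
    using c ad by (intro add_mono vnorm_add_le[of _ m] vnorm_add_le[of _ l]) auto
  also have "\<dots> \<le> (op_norm A * vnorm v + op_norm B * vnorm v) + (op_norm C * vnorm v + op_norm D * vnorm v)"
    using c ad le by (intro add_mono b) auto
  finally show "vnorm (?M *\<^sub>v v) \<le> (op_norm A + op_norm B + op_norm C + op_norm D) * vnorm v"
    by (simp add: algebra_simps)
qed simp

lemma L2_set_sum_le:
  assumes "finite I"
  shows "L2_set (\<lambda>k. \<Sum>i\<in>I. f i k) K \<le> (\<Sum>i\<in>I. L2_set (f i) K)"
  using assms
proof (induction rule: finite_induct)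
  case (insert i I)
  then show ?case
    using L2_set_triangle_ineq[of "f i" "\<lambda>k. \<Sum>i\<in>I. f i k" K] by simp
qed (simp add: L2_set_def)

lemma sum_div_mod:
  fixes g :: "nat \<Rightarrow> nat \<Rightarrow> 'a::comm_monoid_add"
  assumes "0 < n"
  shows "(\<Sum>k<a * n. g (k div n) (k mod n)) = (\<Sum>I<a. \<Sum>i<n. g I i)"
proof -
  have "(\<Sum>I<a. \<Sum>i<n. g I i) = (\<Sum>(I,i)\<in>{..<a} \<times> {..<n}. g I i)"
    by (simp add: sum.cartesian_product)
  also have "\<dots> = (\<Sum>k<a * n. g (k div n) (k mod n))"
  proof (rule sum.reindex_bij_witness[where i = "\<lambda>k. (k div n, k mod n)" and j = "\<lambda>(I,i). I * n + i"])
    fix p assume p: "p \<in> {..<a} \<times> {..<n}"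
    obtain I i where Ii: "p = (I, i)" "I < a" "i < n" using p by auto
    have "I * n + i < Suc I * n" using Ii by simp
    also have "\<dots> \<le> a * n" using Ii by (intro mult_le_mono1) simp
    finally show "(case p of (I, i) \<Rightarrow> I * n + i) \<in> {..<a * n}" using Ii by simp
  qed (use assms in \<open>auto simp: less_mult_imp_div_less\<close>)
  finally show ?thesis by simp
qed

text \<open>The estimate does not involve \<open>n\<close>; it is what makes matrices of polynomials
  Lipschitz uniformly over all levels. Row \<open>k\<close> of the large matrix is row
  \<open>k mod n\<close> of block row \<open>k div n\<close>, as in
  \<open>eval_poly_mat\<close>.\<close>

lemma op_norm_block_mat_le:
  assumes n: "0 < n" and B: "\<And>I J. B I J \<in> carrier_mat n n"
  shows "op_norm (mat (a * n) (b * n) (\<lambda>(i,j). B (i div n) (j div n) $$ (i mod n, j mod n)))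
     \<le> (\<Sum>I<a. \<Sum>J<b. op_norm (B I J))" (is "op_norm ?M \<le> _")
proof (rule op_norm_leI)
  fix v :: "complex vec" assume "v \<in> carrier_vec (dim_col ?M)"
  then have v: "v \<in> carrier_vec (b * n)" by simp
  define w where "w J = vec n (\<lambda>j. v $ (J * n + j))" for J
  have w: "w J \<in> carrier_vec n" for J by (simp add: w_def)
  have idx: "J * n + j < b * n" if "J < b" "j < n" for J j
  proof -
    have "J * n + j < Suc J * n" using that by simp
    also have "\<dots> \<le> b * n" using that by (intro mult_le_mono1) simp
    finally show ?thesis .
  qed
  have wn: "vnorm (w J) \<le> vnorm v" if "J < b" for J
  proof -
    have "(\<Sum>j<n. (cmod (v $ (J * n + j)))\<^sup>2) = (\<Sum>k\<in>(\<lambda>j. J * n + j) ` {..<n}. (cmod (v $ k))\<^sup>2)"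
      by (subst sum.reindex) (auto simp: inj_on_def)
    also have "\<dots> \<le> (\<Sum>k<b * n. (cmod (v $ k))\<^sup>2)"
      using idx[OF that] by (intro sum_mono2) auto
    finally show ?thesis using v by (simp add: vnorm_def w_def)
  qed
  have Mv: "(?M *\<^sub>v v) $ k = (\<Sum>J<b. (B (k div n) J *\<^sub>v w J) $ (k mod n))" if k: "k < a * n" for k
  proof -
    have kn: "k mod n < n" using n by simp
    have "(?M *\<^sub>v v) $ k = (\<Sum>j<b * n. B (k div n) (j div n) $$ (k mod n, j mod n) * v $ (j div n * n + j mod n))"
      using k v by (simp add: scalar_prod_def atLeast0LessThan)
    also have "\<dots> = (\<Sum>J<b. \<Sum>j<n. B (k div n) J $$ (k mod n, j) * v $ (J * n + j))"
      by (rule sum_div_mod[OF n])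
    also have "\<dots> = (\<Sum>J<b. (B (k div n) J *\<^sub>v w J) $ (k mod n))"
      using kn carrier_matD[OF B] by (intro sum.cong refl)
        (auto simp: scalar_prod_def atLeast0LessThan w_def)
    finally show ?thesis .
  qed
  \<comment> \<open>The case distinction spreads row \<open>k\<close> over all block rows, so that
    Minkowski's inequality can treat the blocks one by one; block \<open>(I, J)\<close> contributes
    only at the \<open>n\<close> indices with \<open>k div n = I\<close>.\<close>
  have "(vnorm (?M *\<^sub>v v)) \<le> L2_set (\<lambda>k. \<Sum>I<a. \<Sum>J<b. if k div n = I then cmod ((B I J *\<^sub>v w J) $ (k mod n)) else 0) {..<a * n}"
    unfolding vnorm_L2_set
  proof (simp, rule L2_set_mono)
    fix k assume "k \<in> {..<a * n}"
    then have k: "k < a * n" by simp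
    then have ka: "k div n < a" by (simp add: less_mult_imp_div_less)
    have "cmod ((?M *\<^sub>v v) $ k) \<le> (\<Sum>J<b. cmod ((B (k div n) J *\<^sub>v w J) $ (k mod n)))"
      unfolding Mv[OF k] by (rule norm_sum)
    also have "\<dots> = (\<Sum>I<a. if k div n = I then (\<Sum>J<b. cmod ((B I J *\<^sub>v w J) $ (k mod n))) else 0)"
      using ka by simp
    also have "\<dots> = (\<Sum>I<a. \<Sum>J<b. if k div n = I then cmod ((B I J *\<^sub>v w J) $ (k mod n)) else 0)"
      by (intro sum.cong) auto
    finally show "cmod ((?M *\<^sub>v v) $ k) \<le> (\<Sum>I<a. \<Sum>J<b. if k div n = I then cmod ((B I J *\<^sub>v w J) $ (k mod n)) else 0)" .
  qed simp
  also have "\<dots> \<le> (\<Sum>I<a. \<Sum>J<b. L2_set (\<lambda>k. if k div n = I then cmod ((B I J *\<^sub>v w J) $ (k mod n)) else 0) {..<a * n})"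
    by (intro order_trans[OF L2_set_sum_le] sum_mono L2_set_sum_le) auto
  also have "\<dots> \<le> (\<Sum>I<a. \<Sum>J<b. op_norm (B I J) * vnorm v)"
  proof (intro sum_mono)
    fix I J assume IJ: "I \<in> {..<a}" "J \<in> {..<b}"
    have "(\<Sum>k<a * n. (if k div n = I then cmod ((B I J *\<^sub>v w J) $ (k mod n)) else 0)\<^sup>2)
       = (\<Sum>I'<a. \<Sum>i<n. (if I' = I then cmod ((B I J *\<^sub>v w J) $ i) else 0)\<^sup>2)"
      by (rule sum_div_mod[OF n])
    also have "\<dots> = (\<Sum>I'<a. if I' = I then (\<Sum>i<n. (cmod ((B I J *\<^sub>v w J) $ i))\<^sup>2) else 0)"
      by (intro sum.cong) auto
    also have "\<dots> = (\<Sum>i<n. (cmod ((B I J *\<^sub>v w J) $ i))\<^sup>2)" using IJ by simp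
    finally have "L2_set (\<lambda>k. if k div n = I then cmod ((B I J *\<^sub>v w J) $ (k mod n)) else 0) {..<a * n} = vnorm (B I J *\<^sub>v w J)"
      using B[of I J] by (simp add: L2_set_def vnorm_def)
    also have "\<dots> \<le> op_norm (B I J) * vnorm (w J)"
      using B[of I J] w[of J] by (intro vnorm_mult_mat_vec) auto
    also have "\<dots> \<le> op_norm (B I J) * vnorm v"
      using wn IJ by (intro mult_left_mono) auto
    finally show "L2_set (\<lambda>k. if k div n = I then cmod ((B I J *\<^sub>v w J) $ (k mod n)) else 0) {..<a * n} \<le> op_norm (B I J) * vnorm v" .
  qed
  finally show "vnorm (?M *\<^sub>v v) \<le> (\<Sum>I<a. \<Sum>J<b. op_norm (B I J)) * vnorm v"
    by (simp add: sum_distrib_right)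
qed (simp add: sum_nonneg)

section \<open>Inverses, direct sums and spectra of matrices\<close>

lemma mat_inv:
  assumes A: "A \<in> carrier_mat n n"
    and inj: "\<And>v. v \<in> carrier_vec n \<Longrightarrow> A *\<^sub>v v = 0\<^sub>v n \<Longrightarrow> v = 0\<^sub>v n"
  shows "mat_inv A \<in> carrier_mat n n" "A * mat_inv A = 1\<^sub>m n" "mat_inv A * A = 1\<^sub>m n"
proof -
  have "det A \<noteq> 0" using det_0_iff_vec_prod_zero_field[OF A] inj by blast
  then have "A \<in> Units (ring_mat TYPE(complex) n n)" by (rule det_non_zero_imp_unit[OF A])
  then obtain B where "mat_inverse A = Some B" using mat_inverse(1)[OF A, of n] by (cases "mat_inverse A") auto
  from mat_inverse(2)[OF A this] this
  show "mat_inv A \<in> carrier_mat n n" "A * mat_inv A = 1\<^sub>m n" "mat_inv A * A = 1\<^sub>m n"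
    by (auto simp: mat_inv_def)
qed

text \<open>In finite dimension a right inverse is also a left inverse; this gives injectivity, and
  then \<open>mat_inverse\<close> succeeds.\<close>

lemma mat_inv_eqI:
  assumes A: "A \<in> carrier_mat n n" and B: "B \<in> carrier_mat n n" and AB: "A * B = 1\<^sub>m n"
  shows "mat_inv A = B"
proof -
  have BA: "B * A = 1\<^sub>m n" by (rule mat_mult_left_right_inverse[OF A B AB])
  have inj: "v = 0\<^sub>v n" if v: "v \<in> carrier_vec n" "A *\<^sub>v v = 0\<^sub>v n" for v
  proof -
    have "v = (B * A) *\<^sub>v v" using v BA by simp
    also have "\<dots> = B *\<^sub>v 0\<^sub>v n" using assoc_mult_mat_vec[OF B A v(1)] v by simp
    also have "\<dots> = 0\<^sub>v n" using B by (intro eq_vecI) auto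
    finally show ?thesis .
  qed
  note mi = mat_inv[OF A inj]
  have "mat_inv A = (B * A) * mat_inv A" using mi BA by simp
  also have "\<dots> = B * (A * mat_inv A)" by (rule assoc_mult_mat[OF B A mi(1)])
  finally show ?thesis using mi(2) B by simp
qed

lemma invertible_mat_inv:
  assumes "A \<in> carrier_mat n n" "invertible_mat A"
  shows "mat_inv A \<in> carrier_mat n n" "A * mat_inv A = 1\<^sub>m n" "mat_inv A * A = 1\<^sub>m n"
proof -
  obtain B where B: "A * B = 1\<^sub>m (dim_row A)" "B * A = 1\<^sub>m (dim_row B)"
    using assms unfolding invertible_mat_def inverts_mat_def by blast
  have "dim_row B = n" using arg_cong[OF B(2), of dim_col] assms by simp
  moreover have "dim_col B = n" using arg_cong[OF B(1), of dim_col] assms by simp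
  ultimately have Bc: "B \<in> carrier_mat n n" by auto
  have "mat_inv A = B" using mat_inv_eqI[OF assms(1) Bc] B assms by simp
  then show "mat_inv A \<in> carrier_mat n n" "A * mat_inv A = 1\<^sub>m n" "mat_inv A * A = 1\<^sub>m n"
    using B Bc assms by auto
qed

lemma invertible_matI:
  assumes "A \<in> carrier_mat n n" "B \<in> carrier_mat n n" "A * B = 1\<^sub>m n" "B * A = 1\<^sub>m n"
  shows "invertible_mat A"
  using assms unfolding invertible_mat_def inverts_mat_def by auto

lemma mat_dsum_carrier [simp]:
  "A \<in> carrier_mat n m \<Longrightarrow> B \<in> carrier_mat k l \<Longrightarrow> mat_dsum A B \<in> carrier_mat (n + k) (m + l)"
  by (auto simp: mat_dsum_def)

lemma dim_mat_dsum [simp]: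
  "dim_row (mat_dsum A B) = dim_row A + dim_row B" "dim_col (mat_dsum A B) = dim_col A + dim_col B"
  by (auto simp: mat_dsum_def)

lemma mat_dsum_mult:
  assumes "A \<in> carrier_mat n n" "B \<in> carrier_mat m m" "C \<in> carrier_mat n n" "D \<in> carrier_mat m m"
  shows "mat_dsum A B * mat_dsum C D = mat_dsum (A * C) (B * D)"
  using assms unfolding mat_dsum_def
  by (subst mult_four_block_mat[of _ n n _ m _ m]) auto

lemma mat_dsum_add:
  assumes "A \<in> carrier_mat n n" "B \<in> carrier_mat m m" "C \<in> carrier_mat n n" "D \<in> carrier_mat m m"
  shows "mat_dsum A B + mat_dsum C D = mat_dsum (A + C) (B + D)"
  using assms unfolding mat_dsum_def by (intro eq_matI) auto

lemma mat_dsum_diff: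
  assumes "A \<in> carrier_mat n n" "B \<in> carrier_mat m m" "C \<in> carrier_mat n n" "D \<in> carrier_mat m m"
  shows "mat_dsum A B - mat_dsum C D = mat_dsum (A - C) (B - D)"
  using assms unfolding mat_dsum_def by (intro eq_matI) auto

lemma mat_dsum_smult:
  assumes "A \<in> carrier_mat n n" "B \<in> carrier_mat m m"
  shows "c \<cdot>\<^sub>m mat_dsum A B = mat_dsum (c \<cdot>\<^sub>m A) (c \<cdot>\<^sub>m B)"
  using assms unfolding mat_dsum_def by (intro eq_matI) auto

lemma mat_dsum_one: "mat_dsum (1\<^sub>m n) (1\<^sub>m m) = 1\<^sub>m (n + m)"
  by (simp add: mat_dsum_def)

lemma mat_dsum_zero: "mat_dsum (0\<^sub>m n n) (0\<^sub>m m m) = 0\<^sub>m (n + m) (n + m)"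
  by (simp add: mat_dsum_def)

lemma four_block_mat_inject:
  assumes "A \<in> carrier_mat n m" "B \<in> carrier_mat n l" "C \<in> carrier_mat k m" "D \<in> carrier_mat k l"
    and "A' \<in> carrier_mat n m" "B' \<in> carrier_mat n l" "C' \<in> carrier_mat k m" "D' \<in> carrier_mat k l"
    and eq: "four_block_mat A B C D = four_block_mat A' B' C' D'"
  shows "A = A' \<and> B = B' \<and> C = C' \<and> D = D'"
proof -
  have ix: "four_block_mat A B C D $$ (i,j) = four_block_mat A' B' C' D' $$ (i,j)" for i j
    using eq by simp
  have "A = A'"
  proof (rule eq_matI)
    fix i j assume "i < dim_row A'" "j < dim_col A'"
    then show "A $$ (i,j) = A' $$ (i,j)" using ix[of i j] assms(1-8) by auto
  qed (use assms(1-8) in auto)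
  moreover have "B = B'"
  proof (rule eq_matI)
    fix i j assume "i < dim_row B'" "j < dim_col B'"
    then show "B $$ (i,j) = B' $$ (i,j)" using ix[of i "m + j"] assms(1-8) by auto
  qed (use assms(1-8) in auto)
  moreover have "C = C'"
  proof (rule eq_matI)
    fix i j assume "i < dim_row C'" "j < dim_col C'"
    then show "C $$ (i,j) = C' $$ (i,j)" using ix[of "n + i" j] assms(1-8) by auto
  qed (use assms(1-8) in auto)
  moreover have "D = D'"
  proof (rule eq_matI)
    fix i j assume "i < dim_row D'" "j < dim_col D'"
    then show "D $$ (i,j) = D' $$ (i,j)" using ix[of "n + i" "m + j"] assms(1-8) by auto
  qed (use assms(1-8) in auto)
  ultimately show ?thesis by blast
qed

lemma mat_dsum_inject:
  assumes "A \<in> carrier_mat n n" "B \<in> carrier_mat m m" "C \<in> carrier_mat n n" "D \<in> carrier_mat m m"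
    and "mat_dsum A B = mat_dsum C D"
  shows "A = C \<and> B = D"
  using four_block_mat_inject[of A n n "0\<^sub>m n m" m "0\<^sub>m m n" m B C "0\<^sub>m n m" "0\<^sub>m m n" D] assms
  by (auto simp: mat_dsum_def)

lemma spectrumI:
  assumes "A \<in> carrier_mat n n" "v \<in> carrier_vec n" "v \<noteq> 0\<^sub>v n" "A *\<^sub>v v = k \<cdot>\<^sub>v v"
  shows "k \<in> spectrum A"
  using assms unfolding spectrum_def eigenvalue_def eigenvector_def by auto

lemma spectrumE:
  assumes "k \<in> spectrum A" "A \<in> carrier_mat n n"
  obtains v where "v \<in> carrier_vec n" "v \<noteq> 0\<^sub>v n" "A *\<^sub>v v = k \<cdot>\<^sub>v v"
  using assms unfolding spectrum_def eigenvalue_def eigenvector_def by auto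

lemma smult_one_minus_mult_vec:
  assumes x: "x \<in> carrier_mat n n" and v: "v \<in> carrier_vec n"
  shows "(z \<cdot>\<^sub>m 1\<^sub>m n - x) *\<^sub>v v = z \<cdot>\<^sub>v v - x *\<^sub>v (v :: complex vec)"
proof -
  have "(z \<cdot>\<^sub>m 1\<^sub>m n) *\<^sub>v v = z \<cdot>\<^sub>v v" using v by (intro eq_vecI) auto
  then show ?thesis using minus_mult_distrib_mat_vec[of "z \<cdot>\<^sub>m 1\<^sub>m n" n n x v] x v by simp
qed

lemma resolvent:
  assumes x: "x \<in> carrier_mat n n" and z: "z \<notin> spectrum x"
  shows "mat_inv (z \<cdot>\<^sub>m 1\<^sub>m n - x) \<in> carrier_mat n n"
    "(z \<cdot>\<^sub>m 1\<^sub>m n - x) * mat_inv (z \<cdot>\<^sub>m 1\<^sub>m n - x) = 1\<^sub>m n"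
    "mat_inv (z \<cdot>\<^sub>m 1\<^sub>m n - x) * (z \<cdot>\<^sub>m 1\<^sub>m n - x) = 1\<^sub>m n"
proof -
  have c: "z \<cdot>\<^sub>m 1\<^sub>m n - x \<in> carrier_mat n n" using x by auto
  have inj: "v = 0\<^sub>v n" if v: "v \<in> carrier_vec n" "(z \<cdot>\<^sub>m 1\<^sub>m n - x) *\<^sub>v v = 0\<^sub>v n" for v
  proof (rule ccontr)
    assume ne: "v \<noteq> 0\<^sub>v n"
    have eq0: "z \<cdot>\<^sub>v v - x *\<^sub>v v = 0\<^sub>v n" using v smult_one_minus_mult_vec[OF x v(1)] by simp
    have "x *\<^sub>v v = z \<cdot>\<^sub>v v"
    proof (rule eq_vecI)
      fix i assume "i < dim_vec (z \<cdot>\<^sub>v v)"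
      then have i: "i < n" using v by simp
      have "(z \<cdot>\<^sub>v v - x *\<^sub>v v) $ i = 0" using eq0 i by simp
      then show "(x *\<^sub>v v) $ i = (z \<cdot>\<^sub>v v) $ i" using i v x by simp
    qed (use x v in auto)
    then show False using spectrumI[OF x v(1) ne] z by simp
  qed
  show "mat_inv (z \<cdot>\<^sub>m 1\<^sub>m n - x) \<in> carrier_mat n n"
    "(z \<cdot>\<^sub>m 1\<^sub>m n - x) * mat_inv (z \<cdot>\<^sub>m 1\<^sub>m n - x) = 1\<^sub>m n"
    "mat_inv (z \<cdot>\<^sub>m 1\<^sub>m n - x) * (z \<cdot>\<^sub>m 1\<^sub>m n - x) = 1\<^sub>m n"
    using mat_inv[OF c inj] by auto
qed

lemma spectrum_similar_subset:
  fixes A :: "complex mat"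
  assumes "A \<in> carrier_mat n n" "s \<in> carrier_mat n n" "t \<in> carrier_mat n n" "s * t = 1\<^sub>m n"
  shows "spectrum (t * A * s) \<subseteq> spectrum A"
proof
  have ts: "t * s = 1\<^sub>m n" by (rule mat_mult_left_right_inverse[OF assms(2-4)])
  fix k assume "k \<in> spectrum (t * A * s)"
  then obtain v where v: "v \<in> carrier_vec n" "v \<noteq> 0\<^sub>v n" "(t * A * s) *\<^sub>v v = k \<cdot>\<^sub>v v"
    using assms by (elim spectrumE[where n = n]) auto
  have "s *\<^sub>v (k \<cdot>\<^sub>v v) = s *\<^sub>v (t *\<^sub>v (A *\<^sub>v (s *\<^sub>v v)))"
    using v(1) assms by (simp add: v(3)[symmetric] assoc_mult_mat_vec[of _ n n _ n])
  also have "\<dots> = (s * t) *\<^sub>v (A *\<^sub>v (s *\<^sub>v v))"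
    using v assms by (subst assoc_mult_mat_vec[of _ n n _ n]) auto
  also have "\<dots> = A *\<^sub>v (s *\<^sub>v v)" using assms v by simp
  finally have *: "A *\<^sub>v (s *\<^sub>v v) = k \<cdot>\<^sub>v (s *\<^sub>v v)" using v assms by (simp add: mult_mat_vec_smult)
  have "s *\<^sub>v v \<noteq> 0\<^sub>v n"
  proof
    assume "s *\<^sub>v v = 0\<^sub>v n"
    then have "(t * s) *\<^sub>v v = t *\<^sub>v 0\<^sub>v n" using assoc_mult_mat_vec[OF assms(3,2) v(1)] by simp
    also have "\<dots> = 0\<^sub>v n" using assms by (intro eq_vecI) auto
    finally show False using ts v by simp
  qed
  then show "k \<in> spectrum A" using * assms v by (intro spectrumI[of _ n "s *\<^sub>v v"]) auto
qed

lemma mult_mat_zero_vec: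
  "(X :: complex mat) \<in> carrier_mat i j \<Longrightarrow> X *\<^sub>v 0\<^sub>v j = 0\<^sub>v i"
  by (intro eq_vecI) auto

lemma append_vec_eq_0:
  assumes "a \<in> carrier_vec n" "b \<in> carrier_vec m"
  shows "a @\<^sub>v b = 0\<^sub>v (n + m) \<longleftrightarrow> a = 0\<^sub>v n \<and> b = 0\<^sub>v m"
proof -
  have "0\<^sub>v (n + m) = 0\<^sub>v n @\<^sub>v (0\<^sub>v m :: 'a vec)" by (intro eq_vecI) auto
  then show ?thesis using append_vec_eq[OF assms(1), of "0\<^sub>v n" b "0\<^sub>v m"] by auto
qed

lemma smult_append_vec: "k \<cdot>\<^sub>v (a @\<^sub>v b) = (k \<cdot>\<^sub>v a) @\<^sub>v (k \<cdot>\<^sub>v b)"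
  by (intro eq_vecI) auto

text \<open>Split an eigenvector into \<open>(a, b)\<close>. The lower row makes \<open>b\<close> an
  eigenvector of \<open>B\<close> unless \<open>b = 0\<close>, and in that case the upper row makes
  \<open>a\<close> an eigenvector of \<open>A\<close>.\<close>

lemma spectrum_block_upper:
  fixes A :: "complex mat"
  assumes A: "A \<in> carrier_mat n n" and B: "B \<in> carrier_mat m m" and T: "T \<in> carrier_mat n m"
  shows "spectrum (four_block_mat A T (0\<^sub>m m n) B) \<subseteq> spectrum A \<union> spectrum B"
proof
  fix k assume "k \<in> spectrum (four_block_mat A T (0\<^sub>m m n) B)"
  then obtain w where w: "w \<in> carrier_vec (n + m)" "w \<noteq> 0\<^sub>v (n + m)"
    "four_block_mat A T (0\<^sub>m m n) B *\<^sub>v w = k \<cdot>\<^sub>v w"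
    using A B by (elim spectrumE[where n = "n + m"]) auto
  define a where "a = vec_first w n"
  define b where "b = vec_last w m"
  have ab: "a \<in> carrier_vec n" "b \<in> carrier_vec m" "w = a @\<^sub>v b"
    using w by (auto simp: a_def b_def)
  have z: "0\<^sub>m m n *\<^sub>v a = 0\<^sub>v m" using ab by (intro eq_vecI) auto
  have "(A *\<^sub>v a + T *\<^sub>v b) @\<^sub>v (0\<^sub>m m n *\<^sub>v a + B *\<^sub>v b) = (k \<cdot>\<^sub>v a) @\<^sub>v (k \<cdot>\<^sub>v b)"
    using four_block_mat_mult_vec[OF A T zero_carrier_mat B ab(1,2)] w(3) ab(3)
    by (simp add: smult_append_vec)
  then have "A *\<^sub>v a + T *\<^sub>v b = k \<cdot>\<^sub>v a" and Bb: "B *\<^sub>v b = k \<cdot>\<^sub>v b"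
    using append_vec_eq[of "A *\<^sub>v a + T *\<^sub>v b" n "k \<cdot>\<^sub>v a"] ab A B T z by auto
  then have Aa: "A *\<^sub>v a = k \<cdot>\<^sub>v a" if "b = 0\<^sub>v m"
    using that mult_mat_zero_vec[OF T] A ab by simp
  show "k \<in> spectrum A \<union> spectrum B"
    using spectrumI[OF A ab(1) _ Aa] spectrumI[OF B ab(2) _ Bb] w(2) append_vec_eq_0[OF ab(1,2)] ab(3) by auto
qed

lemma spectrum_mat_dsum:
  assumes A: "A \<in> carrier_mat n n" and B: "B \<in> carrier_mat m m"
  shows "spectrum (mat_dsum A B) = spectrum A \<union> spectrum B"
proof
  show "spectrum (mat_dsum A B) \<subseteq> spectrum A \<union> spectrum B"
    using spectrum_block_upper[OF A B zero_carrier_mat] A B by (simp add: mat_dsum_def)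
  have *: "mat_dsum A B *\<^sub>v (a @\<^sub>v b) = (A *\<^sub>v a) @\<^sub>v (B *\<^sub>v b)"
    if "a \<in> carrier_vec n" "b \<in> carrier_vec m" for a b
  proof -
    have "0\<^sub>m n m *\<^sub>v b = 0\<^sub>v n" "0\<^sub>m m n *\<^sub>v a = 0\<^sub>v m" using that by (auto intro!: eq_vecI)
    then show ?thesis
      using four_block_mat_mult_vec[OF A zero_carrier_mat zero_carrier_mat B that] that A B
      by (simp add: mat_dsum_def)
  qed
  show "spectrum A \<union> spectrum B \<subseteq> spectrum (mat_dsum A B)"
  proof
    fix k assume "k \<in> spectrum A \<union> spectrum B"
    then show "k \<in> spectrum (mat_dsum A B)"
    proof
      assume "k \<in> spectrum A"
      then obtain v where v: "v \<in> carrier_vec n" "v \<noteq> 0\<^sub>v n" "A *\<^sub>v v = k \<cdot>\<^sub>v v" using A by (rule spectrumE)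
      have "k \<cdot>\<^sub>v (0\<^sub>v m :: complex vec) = 0\<^sub>v m" by (intro eq_vecI) auto
      then show ?thesis using v A B *[OF v(1) zero_carrier_vec] append_vec_eq_0[OF v(1) zero_carrier_vec, of m]
        by (intro spectrumI[of _ "n + m" "v @\<^sub>v 0\<^sub>v m"]) (auto simp: mult_mat_zero_vec smult_append_vec)
    next
      assume "k \<in> spectrum B"
      then obtain v where v: "v \<in> carrier_vec m" "v \<noteq> 0\<^sub>v m" "B *\<^sub>v v = k \<cdot>\<^sub>v v" using B by (rule spectrumE)
      have "k \<cdot>\<^sub>v (0\<^sub>v n :: complex vec) = 0\<^sub>v n" by (intro eq_vecI) auto
      then show ?thesis using v A B *[OF zero_carrier_vec v(1)] append_vec_eq_0[OF zero_carrier_vec v(1), of n]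
        by (intro spectrumI[of _ "n + m" "0\<^sub>v n @\<^sub>v v"]) (auto simp: mult_mat_zero_vec smult_append_vec)
    qed
  qed
qed

section \<open>Polynomials of matrices\<close>

text \<open>Horner's scheme, so that the algebraic identities follow by induction over
  \<open>pCons\<close>.\<close>

definition poly_mat :: "complex poly \<Rightarrow> complex mat \<Rightarrow> complex mat" where
  "poly_mat p A = fold_coeffs (\<lambda>a B. a \<cdot>\<^sub>m 1\<^sub>m (dim_row A) + A * B) p (0\<^sub>m (dim_row A) (dim_row A))"

lemma poly_mat_0 [simp]: "poly_mat 0 A = 0\<^sub>m (dim_row A) (dim_row A)"
  by (simp add: poly_mat_def)

lemma poly_mat_pCons:
  assumes "A \<in> carrier_mat n n"
  shows "poly_mat (pCons a p) A = a \<cdot>\<^sub>m 1\<^sub>m n + A * poly_mat p A"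
proof (cases "a = 0 \<and> p = 0")
  \<comment> \<open>Here \<open>pCons a p\<close> is \<open>0\<close>, for which
    \<open>fold_coeffs\<close> performs no step at all.\<close>
  case True
  have "(0::complex) \<cdot>\<^sub>m 1\<^sub>m n = 0\<^sub>m n n" by (intro eq_matI) auto
  then show ?thesis using assms True by simp
next
  case False
  then show ?thesis using assms
    unfolding poly_mat_def
    by (cases "p = 0") (auto simp: fold_coeffs_pCons_coeff_not_0_eq fold_coeffs_pCons_not_0_0_eq)
qed

lemma poly_mat_carrier [simp]:
  assumes "A \<in> carrier_mat n n"
  shows "poly_mat p A \<in> carrier_mat n n"
  by (induction p) (use assms in \<open>auto simp: poly_mat_pCons\<close>)

lemma dim_poly_mat [simp]:
  assumes "A \<in> carrier_mat n n"
  shows "dim_row (poly_mat p A) = n" "dim_col (poly_mat p A) = n"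
  using poly_mat_carrier[OF assms, of p] by auto

lemma poly_mat_const:
  assumes "A \<in> carrier_mat n n"
  shows "poly_mat [:c:] A = c \<cdot>\<^sub>m 1\<^sub>m n"
  using assms by (simp add: poly_mat_pCons)

lemma poly_mat_linear:
  assumes "A \<in> carrier_mat n n"
  shows "poly_mat [:a, 1:] A = a \<cdot>\<^sub>m 1\<^sub>m n + A"
proof -
  have "(1::complex) \<cdot>\<^sub>m 1\<^sub>m n = 1\<^sub>m n" by (intro eq_matI) auto
  then show ?thesis using assms poly_mat_const[OF assms, of 1] by (simp add: poly_mat_pCons[OF assms, of a])
qed

lemma poly_mat_id:
  assumes "A \<in> carrier_mat n n"
  shows "poly_mat [:0, 1:] A = A"
  unfolding poly_mat_linear[OF assms] using assms by (intro eq_matI) auto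

lemma poly_mat_add:
  assumes A: "A \<in> carrier_mat n n"
  shows "poly_mat (p + q) A = poly_mat p A + poly_mat q A"
proof (induction p q rule: poly_induct2)
  case (pCons a p b q)
  have "(a + b) \<cdot>\<^sub>m 1\<^sub>m n + A * (poly_mat p A + poly_mat q A)
    = (a \<cdot>\<^sub>m 1\<^sub>m n + A * poly_mat p A) + (b \<cdot>\<^sub>m 1\<^sub>m n + A * poly_mat q A)"
    unfolding mult_add_distrib_mat[OF A poly_mat_carrier[OF A] poly_mat_carrier[OF A]]
    using A by (intro eq_matI) (auto simp: algebra_simps)
  then show ?case using pCons by (simp add: poly_mat_pCons[OF A])
qed (use A in auto)

lemma poly_mat_smult:
  assumes A: "A \<in> carrier_mat n n"
  shows "poly_mat (Polynomial.smult c p) A = c \<cdot>\<^sub>m poly_mat p A"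
proof (induction p)
  case (pCons a p)
  have "(c * a) \<cdot>\<^sub>m 1\<^sub>m n + A * (c \<cdot>\<^sub>m poly_mat p A) = c \<cdot>\<^sub>m (a \<cdot>\<^sub>m 1\<^sub>m n + A * poly_mat p A)"
    unfolding mult_smult_distrib[OF A poly_mat_carrier[OF A]]
    using A by (intro eq_matI) (auto simp: algebra_simps)
  then show ?case using pCons by (simp add: poly_mat_pCons[OF A])
qed (use A in auto)

lemma poly_mat_mult:
  assumes A: "A \<in> carrier_mat n n"
  shows "poly_mat (p * q) A = poly_mat p A * poly_mat q A"
proof (induction p)
  case (pCons a p)
  have "poly_mat (pCons a p * q) A = a \<cdot>\<^sub>m poly_mat q A + A * (poly_mat p A * poly_mat q A)"
    using A pCons by (simp add: poly_mat_add[OF A] poly_mat_smult[OF A] poly_mat_pCons[OF A])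
      (auto intro!: eq_matI)
  also have "\<dots> = (a \<cdot>\<^sub>m 1\<^sub>m n + A * poly_mat p A) * poly_mat q A"
    using A by (subst add_mult_distrib_mat[of _ n n _ _ n])
      (auto simp: assoc_mult_mat[of _ n n _ n _ n] mult_smult_assoc_mat[of _ n n _ n])
  finally show ?case by (simp add: poly_mat_pCons[OF A])
qed (use A in auto)

text \<open>Induction over Horner's scheme, moving \<open>T\<close> past one factor at a time. For
  \<open>A = B\<close> it says that whatever commutes with a matrix commutes with its
  polynomials.\<close>

lemma poly_mat_intertwine:
  assumes A: "A \<in> carrier_mat n n" and B: "B \<in> carrier_mat m m" and T: "T \<in> carrier_mat n m"
    and AT: "A * T = T * B"
  shows "poly_mat p A * T = T * poly_mat p B"
proof (induction p)
  case (pCons a p)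
  have 1: "1\<^sub>m n * T = T" "T * 1\<^sub>m m = T" using T by auto
  have "poly_mat (pCons a p) A * T = a \<cdot>\<^sub>m T + A * (poly_mat p A * T)"
    using A T unfolding poly_mat_pCons[OF A]
    by (subst add_mult_distrib_mat[of _ n n _ _ m])
      (auto simp: assoc_mult_mat[of _ n n _ n _ m] mult_smult_assoc_mat[of _ n n _ m])
  also have "A * (poly_mat p A * T) = (A * T) * poly_mat p B"
    using A B T pCons by (simp add: assoc_mult_mat[of _ n n _ m _ m])
  also have "\<dots> = T * (B * poly_mat p B)"
    unfolding AT using A B T by (simp add: assoc_mult_mat[of _ n m _ m _ m])
  also have "a \<cdot>\<^sub>m T + T * (B * poly_mat p B) = T * poly_mat (pCons a p) B"
    using B T unfolding poly_mat_pCons[OF B]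
    by (subst mult_add_distrib_mat[of _ n m _ m]) (auto simp: mult_smult_distrib[of _ n m _ m])
  finally show ?case .
qed (use A B T in auto)

lemma poly_mat_dsum:
  assumes "A \<in> carrier_mat n n" "B \<in> carrier_mat m m"
  shows "poly_mat p (mat_dsum A B) = mat_dsum (poly_mat p A) (poly_mat p B)"
proof (induction p)
  case (pCons a p)
  then show ?case using assms
    by (simp add: poly_mat_pCons[of _ "n + m"] poly_mat_pCons[of _ n] poly_mat_pCons[of _ m]
      mat_dsum_mult[of _ n _ m] mat_dsum_add[of _ n _ m, symmetric] mat_dsum_smult[of _ n _ m, symmetric] mat_dsum_one)
qed (use assms in \<open>auto simp: mat_dsum_zero\<close>)

lemma poly_mat_eigenvector:
  assumes A: "A \<in> carrier_mat n n" and v: "v \<in> carrier_vec n" "A *\<^sub>v v = k \<cdot>\<^sub>v v"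
  shows "poly_mat p A *\<^sub>v v = poly p k \<cdot>\<^sub>v v"
proof (induction p)
  case 0
  show ?case using A v by (intro eq_vecI) auto
next
  case (pCons a p)
  have 1: "(a \<cdot>\<^sub>m 1\<^sub>m n) *\<^sub>v v = a \<cdot>\<^sub>v v" using v by (intro eq_vecI) auto
  have "poly_mat (pCons a p) A *\<^sub>v v = (a \<cdot>\<^sub>m 1\<^sub>m n) *\<^sub>v v + A *\<^sub>v (poly_mat p A *\<^sub>v v)"
    unfolding poly_mat_pCons[OF A] using A v
    by (subst add_mult_distrib_mat_vec[of _ n n]) (auto simp: assoc_mult_mat_vec[of _ n n _ n])
  also have "\<dots> = a \<cdot>\<^sub>v v + (poly p k * k) \<cdot>\<^sub>v v"
    using A v pCons 1 by (simp add: mult_mat_vec_smult smult_smult_assoc)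
  finally show ?case using v by (simp add: add_smult_distrib_vec[symmetric] mult.commute)
qed

lemma poly_mat_monom:
  assumes A: "A \<in> carrier_mat n n"
  shows "poly_mat (monom c k) A = c \<cdot>\<^sub>m A ^\<^sub>m k"
proof (induction k)
  case 0
  show ?case using A by (simp add: monom_0 poly_mat_const[OF A])
next
  case (Suc k)
  have comm: "A * A ^\<^sub>m k = A ^\<^sub>m k * A"
    using A by (induction k) (auto simp: assoc_mult_mat[of _ n n _ n _ n, symmetric])
  have "(0::complex) \<cdot>\<^sub>m 1\<^sub>m n = 0\<^sub>m n n" by (intro eq_matI) auto
  then show ?case using A Suc comm
    by (simp add: monom_Suc poly_mat_pCons[OF A] mult_smult_distrib[OF A pow_carrier_mat[OF A]])
qed

text \<open>The \<open>n * n + 1\<close> powers with exponents from \<open>0\<close> to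
  \<open>n * n\<close> are linearly dependent in a space of dimension \<open>n * n\<close>.\<close>

lemma annihilating_poly_exists:
  assumes A: "A \<in> carrier_mat n n"
  shows "\<exists>q. q \<noteq> 0 \<and> poly_mat q A = 0\<^sub>m n n"
proof -
  define N where "N = Suc (n * n)"
  \<comment> \<open>Column \<open>k\<close> lists the entries of the \<open>k\<close>-th power. The
    additional zero row makes the matrix square and singular, and a kernel vector gives the
    coefficients of a linear relation.\<close>
  define K where "K = mat N N (\<lambda>(r,k). if r < n * n then (A ^\<^sub>m k) $$ (r div n, r mod n) else 0)"
  have K: "K \<in> carrier_mat N N" by (simp add: K_def)
  have "K = mat\<^sub>r N N (\<lambda>i. if i = n * n then 0\<^sub>v N else row K i)"
    by (intro eq_matI) (auto simp: K_def N_def)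
  then have "det K = 0"
    using det_row_0[of "n * n" N "row K"] K by (auto simp: N_def)
  then obtain v where v: "v \<in> carrier_vec N" "v \<noteq> 0\<^sub>v N" "K *\<^sub>v v = 0\<^sub>v N"
    using det_0_iff_vec_prod_zero_field[OF K] by blast
  define q where "q = (\<Sum>k<N. monom (v $ k) k)"
  have co: "coeff q k = v $ k" if "k < N" for k
    using that by (simp add: q_def coeff_sum)
  have "q \<noteq> 0"
  proof
    assume "q = 0"
    then have "v = 0\<^sub>v N" using co v by (intro eq_vecI) auto
    then show False using v by simp
  qed
  moreover have "poly_mat q A = 0\<^sub>m n n"
  proof (rule eq_matI)
    fix i j assume "i < dim_row (0\<^sub>m n n :: complex mat)" "j < dim_col (0\<^sub>m n n :: complex mat)"
    then have ij: "i < n" "j < n" by auto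
    have r: "i * n + j < n * n"
    proof -
      have "i * n + j < Suc i * n" using ij by simp
      also have "\<dots> \<le> n * n" using ij by (intro mult_le_mono1) simp
      finally show ?thesis .
    qed
    have S: "poly_mat (\<Sum>k\<in>S. monom (v $ k) k) A $$ (i,j) = (\<Sum>k\<in>S. v $ k * (A ^\<^sub>m k) $$ (i,j))"
      if "finite S" for S
      using that
    proof (induction rule: finite_induct)
      case (insert k S)
      then show ?case using A ij by (simp add: poly_mat_add[OF A] poly_mat_monom[OF A])
    qed (use A ij in auto)
    have "poly_mat q A $$ (i,j) = (\<Sum>k<N. v $ k * (A ^\<^sub>m k) $$ (i,j))"
      unfolding q_def by (rule S) simp
    also have "\<dots> = (K *\<^sub>v v) $ (i * n + j)"
      using r ij v(1) by (simp add: K_def scalar_prod_def atLeast0LessThan N_def mult.commute)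
    also have "\<dots> = 0" using v r by (simp add: N_def)
    finally show "poly_mat q A $$ (i,j) = 0\<^sub>m n n $$ (i,j)" using ij by simp
  qed (use A in auto)
  ultimately show ?thesis by blast
qed

text \<open>An annihilating polynomial of least degree has no zero \<open>k\<close> off the
  spectrum: there \<open>k - A\<close> is invertible and the linear factor could be
  cancelled.\<close>

lemma annihilating_poly:
  assumes A: "A \<in> carrier_mat n n"
  obtains q where "q \<noteq> 0" "poly_mat q A = 0\<^sub>m n n" "\<And>k. poly q k = 0 \<Longrightarrow> k \<in> spectrum A"
proof -
  define P where "P q \<longleftrightarrow> q \<noteq> 0 \<and> poly_mat q A = 0\<^sub>m n n" for q
  obtain q where q: "P q" "\<And>p. P p \<Longrightarrow> degree q \<le> degree p"
    using ex_has_least_nat[of P _ degree] annihilating_poly_exists[OF A] unfolding P_def by meson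
  have "k \<in> spectrum A" if "poly q k = 0" for k
  proof (rule ccontr)
    assume k: "k \<notin> spectrum A"
    have "[:- k, 1:] dvd q" using that poly_eq_0_iff_dvd by blast
    then obtain p where p: "q = [:- k, 1:] * p" by (rule dvdE)
    have p0: "p \<noteq> 0" using q p by (auto simp: P_def)
    have Ap: "poly_mat p A \<in> carrier_mat n n" using A by simp
    let ?X = "k \<cdot>\<^sub>m 1\<^sub>m n - A"
    have X: "?X \<in> carrier_mat n n" using A by simp
    have "poly_mat [:- k, 1:] A = - ?X"
      unfolding poly_mat_linear[OF A] using A by (intro eq_matI) auto
    moreover have "poly_mat q A = poly_mat [:- k, 1:] A * poly_mat p A"
      unfolding p by (rule poly_mat_mult[OF A])
    ultimately have "- ?X * poly_mat p A = 0\<^sub>m n n"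
      using q(1) by (simp add: P_def)
    moreover have "- 0\<^sub>m n n = (0\<^sub>m n n :: complex mat)" by (intro eq_matI) auto
    ultimately have "?X * poly_mat p A = 0\<^sub>m n n"
      using X Ap uminus_mult_left_mat[of ?X "poly_mat p A"] A uminus_uminus_mat[of "?X * poly_mat p A"] by auto
    then have "mat_inv ?X * (?X * poly_mat p A) = 0\<^sub>m n n" using resolvent[OF A k] by simp
    then have "poly_mat p A = 0\<^sub>m n n"
      using resolvent[OF A k] X Ap by (simp add: assoc_mult_mat[of _ n n _ n _ n, symmetric])
    then have "degree q \<le> degree p" using q(2)[of p] p0 by (simp add: P_def)
    moreover have "degree q = Suc (degree p)" unfolding p using p0 by (subst degree_mult_eq) auto
    ultimately show False by simp
  qed
  then show thesis using that q(1) unfolding P_def by blast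
qed

lemma poly_spectrum_eq_0:
  assumes A: "A \<in> carrier_mat n n" and q: "poly_mat q A = 0\<^sub>m n n" and k: "k \<in> spectrum A"
  shows "poly q k = 0"
proof -
  obtain v where v: "v \<in> carrier_vec n" "v \<noteq> 0\<^sub>v n" "A *\<^sub>v v = k \<cdot>\<^sub>v v" using k A by (rule spectrumE)
  have "0\<^sub>m n n *\<^sub>v v = 0\<^sub>v n" using v(1) by (intro eq_vecI) auto
  then have "poly q k \<cdot>\<^sub>v v = 0\<^sub>v n"
    using poly_mat_eigenvector[OF A v(1,3), of q] by (simp add: q)
  then show ?thesis using v
    by (metis (no_types, lifting) carrier_vecD mult_eq_0_iff eq_vecI index_smult_vec(1) index_zero_vec)
qed

text \<open>\<open>C\<close> is chosen before the size \<open>n\<close>, as bounds in the free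
  topology require.\<close>

lemma poly_mat_bounded:
  "\<exists>C\<ge>0. \<forall>n A. A \<in> carrier_mat n n \<longrightarrow> op_norm A \<le> R \<longrightarrow> op_norm (poly_mat p A) \<le> C"
proof (induction p)
  case 0
  show ?case by (intro exI[of _ 0]) auto
next
  case (pCons a p)
  then obtain C where C: "C \<ge> 0" "\<And>n A. A \<in> carrier_mat n n \<Longrightarrow> op_norm A \<le> R \<Longrightarrow> op_norm (poly_mat p A) \<le> C"
    by blast
  have "op_norm (poly_mat (pCons a p) A) \<le> cmod a + \<bar>R\<bar> * C"
    if A: "A \<in> carrier_mat n n" and R: "op_norm A \<le> R" for n A
  proof -
    have "op_norm (poly_mat (pCons a p) A) \<le> op_norm (a \<cdot>\<^sub>m 1\<^sub>m n) + op_norm (A * poly_mat p A)"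
      unfolding poly_mat_pCons[OF A] using A by (intro op_norm_add[of _ n n]) auto
    also have "\<dots> \<le> cmod a * 1 + op_norm A * op_norm (poly_mat p A)"
      unfolding op_norm_smult using A by (intro add_mono mult_left_mono op_norm_one op_norm_mult[of _ n n _ n]) auto
    also have "\<dots> \<le> cmod a * 1 + \<bar>R\<bar> * C"
      using C(2)[OF A R] R by (intro add_mono mult_mono) auto
    finally show ?thesis by simp
  qed
  then show ?case using C(1) by (intro exI[of _ "cmod a + \<bar>R\<bar> * C"]) auto
qed

section \<open>The functional calculus\<close>

lemma poly_divided_difference_step:
  assumes x: "x \<in> carrier_mat n n" and Q: "Q \<in> carrier_mat n n"
    and eq: "(z \<cdot>\<^sub>m 1\<^sub>m n - x) * Q = poly p z \<cdot>\<^sub>m 1\<^sub>m n - poly_mat p x"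
  shows "(z \<cdot>\<^sub>m 1\<^sub>m n - x) * (poly p z \<cdot>\<^sub>m 1\<^sub>m n + x * Q) = poly (pCons a p) z \<cdot>\<^sub>m 1\<^sub>m n - poly_mat (pCons a p) x"
proof -
  let ?Y = "z \<cdot>\<^sub>m 1\<^sub>m n - x"
  let ?P = "poly_mat p x"
  have P: "?P \<in> carrier_mat n n" and Y: "?Y \<in> carrier_mat n n" using x by auto
  have "?Y * x = x * ?Y"
    using x by (subst minus_mult_distrib_mat[of _ n n _ _ n], simp_all, subst mult_minus_distrib_mat[of _ n n _ n])
      (auto simp: mult_smult_assoc_mat[of _ n n _ n] mult_smult_distrib[of _ n n _ n])
  then have "?Y * (x * Q) = x * (?Y * Q)"
    using assoc_mult_mat[OF Y x Q] assoc_mult_mat[OF x Y Q] by simp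
  also have "\<dots> = poly p z \<cdot>\<^sub>m x - x * ?P"
    unfolding eq using x P
    by (subst mult_minus_distrib_mat[of _ n n _ n]) (auto simp: mult_smult_distrib[of _ n n _ n])
  finally have 1: "?Y * (x * Q) = poly p z \<cdot>\<^sub>m x - x * ?P" .
  have 2: "?Y * (poly p z \<cdot>\<^sub>m 1\<^sub>m n) = poly p z \<cdot>\<^sub>m ?Y"
    using Y by (simp add: mult_smult_distrib[of _ n n _ n])
  have "?Y * (poly p z \<cdot>\<^sub>m 1\<^sub>m n + x * Q) = poly p z \<cdot>\<^sub>m ?Y + (poly p z \<cdot>\<^sub>m x - x * ?P)"
    using x Q Y by (subst mult_add_distrib_mat[of _ n n _ n]) (auto simp: 1 2)
  also have "\<dots> = poly (pCons a p) z \<cdot>\<^sub>m 1\<^sub>m n - (a \<cdot>\<^sub>m 1\<^sub>m n + x * ?P)"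
    using x P by (intro eq_matI) (auto simp: algebra_simps)
  finally show ?thesis by (simp add: poly_mat_pCons[OF x])
qed

text \<open>\<open>Q\<close> is the difference quotient \<open>(p(z) - p(x)) / (z - x)\<close>. The
  preceding recursion replaces \<open>p\<close> by \<open>a + z p\<close> and \<open>Q\<close> by
  \<open>p(z) + x Q\<close>, so holomorphy in \<open>z\<close> is inherited in each step.\<close>

lemma poly_divided_difference_holomorphic:
  assumes x: "x \<in> carrier_mat n n"
  shows "\<exists>Q. (\<forall>z. Q z \<in> carrier_mat n n \<and> (z \<cdot>\<^sub>m 1\<^sub>m n - x) * Q z = poly p z \<cdot>\<^sub>m 1\<^sub>m n - poly_mat p x)
     \<and> (\<forall>i<n. \<forall>j<n. (\<lambda>z. Q z $$ (i,j)) holomorphic_on UNIV)"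
proof (induction p)
  case 0
  have "(z \<cdot>\<^sub>m 1\<^sub>m n - x) * 0\<^sub>m n n = poly 0 z \<cdot>\<^sub>m 1\<^sub>m n - poly_mat 0 x" for z
    using x by (intro eq_matI) auto
  then show ?case by (intro exI[of _ "\<lambda>_. 0\<^sub>m n n"]) auto
next
  case (pCons a p)
  then obtain Q where Q: "\<And>z. Q z \<in> carrier_mat n n"
      "\<And>z. (z \<cdot>\<^sub>m 1\<^sub>m n - x) * Q z = poly p z \<cdot>\<^sub>m 1\<^sub>m n - poly_mat p x"
      "\<And>i j. i < n \<Longrightarrow> j < n \<Longrightarrow> (\<lambda>z. Q z $$ (i,j)) holomorphic_on UNIV" by blast
  have "(\<lambda>z. (poly p z \<cdot>\<^sub>m 1\<^sub>m n + x * Q z) $$ (i,j)) holomorphic_on UNIV" if ij: "i < n" "j < n" for i j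
  proof -
    have "(poly p z \<cdot>\<^sub>m 1\<^sub>m n + x * Q z) $$ (i,j) = poly p z * (1\<^sub>m n $$ (i,j)) + (\<Sum>k<n. x $$ (i,k) * Q z $$ (k,j))" for z
      using ij x Q(1)[of z] by (auto simp: scalar_prod_def atLeast0LessThan)
    moreover have "(\<lambda>z. poly p z * (1\<^sub>m n $$ (i,j)) + (\<Sum>k<n. x $$ (i,k) * Q z $$ (k,j))) holomorphic_on UNIV"
      using Q(3) ij by (intro holomorphic_intros) auto
    ultimately show ?thesis by simp
  qed
  then show ?case
    using poly_divided_difference_step[OF x Q(1,2)] carrier_matD[OF Q(1)] x
    by (intro exI[of _ "\<lambda>z. poly p z \<cdot>\<^sub>m 1\<^sub>m n + x * Q z"]) auto
qed

text \<open>The same recursion with norms: from the bound \<open>C\<close> for \<open>Q\<close> and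
  a bound \<open>D\<close> for \<open>p\<close> on the disc of radius \<open>R\<close>, the next
  quotient is bounded by \<open>D + R * C\<close>, whatever the size \<open>n\<close>.\<close>

lemma poly_divided_difference_bounded:
  assumes R: "0 \<le> R"
  shows "\<exists>C\<ge>0. \<forall>n x z. x \<in> carrier_mat n n \<longrightarrow> op_norm x \<le> R \<longrightarrow> cmod z \<le> R \<longrightarrow>
    (\<exists>Q. Q \<in> carrier_mat n n \<and> (z \<cdot>\<^sub>m 1\<^sub>m n - x) * Q = poly p z \<cdot>\<^sub>m 1\<^sub>m n - poly_mat p x \<and> op_norm Q \<le> C)"
proof (induction p)
  case 0
  have "(z \<cdot>\<^sub>m 1\<^sub>m n - x) * 0\<^sub>m n n = poly 0 z \<cdot>\<^sub>m 1\<^sub>m n - poly_mat 0 x" if "x \<in> carrier_mat n n" for n z x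
    using that by (intro eq_matI) auto
  then show ?case by (intro exI[of _ 0]) (auto intro!: exI[of _ "0\<^sub>m _ _"])
next
  case (pCons a p)
  then obtain C where C: "C \<ge> 0" "\<And>n x z. x \<in> carrier_mat n n \<Longrightarrow> op_norm x \<le> R \<Longrightarrow> cmod z \<le> R \<Longrightarrow>
    \<exists>Q. Q \<in> carrier_mat n n \<and> (z \<cdot>\<^sub>m 1\<^sub>m n - x) * Q = poly p z \<cdot>\<^sub>m 1\<^sub>m n - poly_mat p x \<and> op_norm Q \<le> C" by blast
  have "bounded (poly p ` cball 0 R)"
    by (intro compact_imp_bounded compact_continuous_image continuous_intros) simp
  then obtain D where "\<forall>z\<in>cball 0 R. cmod (poly p z) \<le> D" by (auto simp: bounded_iff)
  then have D: "cmod (poly p z) \<le> D" if "cmod z \<le> R" for z using that by simp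
  have D0: "0 \<le> D" using D[of 0] R norm_ge_zero[of "poly p 0"] by (simp add: order_trans del: norm_ge_zero)
  have "\<exists>Q. Q \<in> carrier_mat n n \<and> (z \<cdot>\<^sub>m 1\<^sub>m n - x) * Q = poly (pCons a p) z \<cdot>\<^sub>m 1\<^sub>m n - poly_mat (pCons a p) x \<and> op_norm Q \<le> D + R * C"
    if x: "x \<in> carrier_mat n n" "op_norm x \<le> R" and z: "cmod z \<le> R" for n x z
  proof -
    obtain Q where Q: "Q \<in> carrier_mat n n" "(z \<cdot>\<^sub>m 1\<^sub>m n - x) * Q = poly p z \<cdot>\<^sub>m 1\<^sub>m n - poly_mat p x" "op_norm Q \<le> C"
      using C(2)[OF x z] by blast
    have "op_norm (poly p z \<cdot>\<^sub>m 1\<^sub>m n + x * Q) \<le> op_norm (poly p z \<cdot>\<^sub>m 1\<^sub>m n) + op_norm (x * Q)"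
      using x Q by (intro op_norm_add[of _ n n]) auto
    also have "\<dots> \<le> D * 1 + op_norm x * op_norm Q"
      unfolding op_norm_smult using x Q D[OF z] D0 by (intro add_mono mult_mono op_norm_one op_norm_mult[of _ n n _ n]) auto
    also have "\<dots> \<le> D * 1 + R * C"
      using x Q R by (intro add_left_mono mult_mono) auto
    finally show ?thesis
      using poly_divided_difference_step[OF x(1) Q(1,2), of a] x Q(1)
      by (intro exI[of _ "poly p z \<cdot>\<^sub>m 1\<^sub>m n + x * Q"]) auto
  qed
  then show ?case using C(1) R D0 by (intro exI[of _ "D + R * C"]) auto
qed

lemma resolvent_eq:
  assumes x: "x \<in> carrier_mat n n" and z: "z \<notin> spectrum x" and Q: "Q \<in> carrier_mat n n"
    and eq: "(z \<cdot>\<^sub>m 1\<^sub>m n - x) * Q = B"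
  shows "Q = mat_inv (z \<cdot>\<^sub>m 1\<^sub>m n - x) * B"
  using resolvent[OF x z] x Q by (simp add: eq[symmetric] assoc_mult_mat[of _ n n _ n _ n, symmetric])

lemma finite_spectrum [simp]: "(x :: complex mat) \<in> carrier_mat n n \<Longrightarrow> finite (spectrum x)"
  by (rule card_finite_spectrum)

lemma closed_spectrum [simp]: "(x :: complex mat) \<in> carrier_mat n n \<Longrightarrow> closed (spectrum x)"
  by (intro finite_imp_closed finite_spectrum)

text \<open>For an annihilating \<open>q\<close> the difference quotient is \<open>q(z)\<close>
  times the resolvent. So the resolvent is entire up to division by \<open>q\<close>, whose zeros
  can be taken to lie in the spectrum.\<close>

lemma resolvent_holomorphic:
  assumes x: "x \<in> carrier_mat n n" and ij: "i < n" "j < n"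
  shows "(\<lambda>z. mat_inv (z \<cdot>\<^sub>m 1\<^sub>m n - x) $$ (i,j)) holomorphic_on (- spectrum x)"
proof -
  obtain q where q: "q \<noteq> 0" "poly_mat q x = 0\<^sub>m n n" "\<And>k. poly q k = 0 \<Longrightarrow> k \<in> spectrum x"
    using annihilating_poly[OF x] by blast
  obtain Q where Q: "\<And>z. Q z \<in> carrier_mat n n"
      "\<And>z. (z \<cdot>\<^sub>m 1\<^sub>m n - x) * Q z = poly q z \<cdot>\<^sub>m 1\<^sub>m n - poly_mat q x"
      "\<And>i j. i < n \<Longrightarrow> j < n \<Longrightarrow> (\<lambda>z. Q z $$ (i,j)) holomorphic_on UNIV"
    using poly_divided_difference_holomorphic[OF x, of q] by blast
  have "mat_inv (z \<cdot>\<^sub>m 1\<^sub>m n - x) $$ (i,j) = Q z $$ (i,j) / poly q z" if z: "z \<in> - spectrum x" for z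
  proof -
    have "poly q z \<cdot>\<^sub>m 1\<^sub>m n - poly_mat q x = poly q z \<cdot>\<^sub>m 1\<^sub>m n" unfolding q(2) by (intro eq_matI) auto
    then have "Q z = mat_inv (z \<cdot>\<^sub>m 1\<^sub>m n - x) * (poly q z \<cdot>\<^sub>m 1\<^sub>m n)"
      using resolvent_eq[OF x _ Q(1) Q(2)] z by simp
    also have "\<dots> = poly q z \<cdot>\<^sub>m mat_inv (z \<cdot>\<^sub>m 1\<^sub>m n - x)"
      using resolvent(1)[OF x, of z] z by (simp add: mult_smult_distrib[of _ n n _ n])
    finally show ?thesis using q(3)[of z] z ij resolvent(1)[OF x, of z] by auto
  qed
  moreover have "(\<lambda>z. Q z $$ (i,j) / poly q z) holomorphic_on (- spectrum x)"
    using q(3) by (intro holomorphic_intros holomorphic_on_subset[OF Q(3)] ij) auto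
  ultimately show ?thesis by (metis (no_types, lifting) holomorphic_transform)
qed

lemma isolated_open_nbhd:
  fixes S :: "complex set"
  assumes "finite S" "open \<Omega>" "\<mu> \<in> \<Omega>"
  shows "open (\<Omega> - (S - {\<mu>}))" "\<mu> \<in> \<Omega> - (S - {\<mu>})" "\<Omega> - (S - {\<mu>}) - {\<mu>} \<subseteq> \<Omega> - S"
  using assms by (auto intro!: open_Diff finite_imp_closed finite_Diff)

lemma residue_sum_lmul:
  assumes "open s" "z \<in> s" "finite I" "\<And>i. i \<in> I \<Longrightarrow> f i holomorphic_on s - {z}"
  shows "residue (\<lambda>w. \<Sum>i\<in>I. c i * f i w) z = (\<Sum>i\<in>I. c i * residue (f i) z)"
  using assms(3,4)
proof (induction rule: finite_induct)
  case (insert i I)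
  then show ?case using assms(1,2)
    by (simp, subst residue_add[of s]) (auto intro!: holomorphic_intros residue_lmul[of s] simp: residue_lmul[of s])
qed (simp add: residue_const)

text \<open>Winding numbers are 1 inside the circle and 0 outside. The larger radius
  \<open>R'\<close> supplies the connected open set that the residue theorem asks for.\<close>

lemma sum_residues_circle:
  assumes S: "finite S" and \<Omega>: "open \<Omega>" and f: "f holomorphic_on \<Omega> - S" and R: "0 < R" "R < R'" "ball a R' \<subseteq> \<Omega>"
    and ne: "\<And>z. z \<in> S \<Longrightarrow> cmod (z - a) \<noteq> R"
  shows "contour_integral (circlepath a R) f = 2 * pi * \<i> * (\<Sum>\<mu>\<in>S \<inter> ball a R. residue f \<mu>)"
proof -
  have img: "path_image (circlepath a R) = sphere a R" using R by simp
  have w1: "winding_number (circlepath a R) p = 1" if "p \<in> ball a R" for p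
    using that R by (intro winding_number_circlepath) (auto simp: dist_norm norm_minus_commute)
  have w0: "winding_number (circlepath a R) p = 0" if "p \<notin> cball a R" for p
    using that R by (intro winding_number_zero_outside[of _ "cball a R"]) auto
  have "contour_integral (circlepath a R) f = 2 * pi * \<i> *
      (\<Sum>p\<in>S \<inter> ball a R'. winding_number (circlepath a R) p * residue f p)"
  proof (rule Residue_theorem[of "ball a R'"])
    show "f holomorphic_on ball a R' - S \<inter> ball a R'"
      by (rule holomorphic_on_subset[OF f]) (use R in auto)
    show "path_image (circlepath a R) \<subseteq> ball a R' - S \<inter> ball a R'"
      unfolding img using R ne by (auto simp: dist_norm norm_minus_commute)
    show "\<forall>z. z \<notin> ball a R' \<longrightarrow> winding_number (circlepath a R) z = 0"
      using R by (auto intro!: w0)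
  qed (use S in auto)
  also have "(\<Sum>p\<in>S \<inter> ball a R'. winding_number (circlepath a R) p * residue f p)
      = (\<Sum>p\<in>S \<inter> ball a R. residue f p)"
  proof (rule sum.mono_neutral_cong_right)
    show "\<forall>p\<in>S \<inter> ball a R' - S \<inter> ball a R. winding_number (circlepath a R) p * residue f p = 0"
    proof
      fix p assume p: "p \<in> S \<inter> ball a R' - S \<inter> ball a R"
      then have "p \<notin> cball a R" using ne[of p] by (auto simp: dist_norm norm_minus_commute)
      then show "winding_number (circlepath a R) p * residue f p = 0" by (simp add: w0)
    qed
  qed (use S R w1 in auto)
  finally show ?thesis .
qed

lemma dim_fun_calc [simp]: "dim_row (fun_calc h x) = dim_row x" "dim_col (fun_calc h x) = dim_row x"
  by (simp_all add: fun_calc_def)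

lemma fun_calc_carrier [simp]: "x \<in> carrier_mat n n \<Longrightarrow> fun_calc h x \<in> carrier_mat n n"
  by (intro carrier_matI) auto

lemma fun_calc_index:
  assumes "x \<in> carrier_mat n n" "i < n" "j < n"
  shows "fun_calc h x $$ (i,j) = (\<Sum>\<mu>\<in>spectrum x. residue (\<lambda>z. h z * mat_inv (z \<cdot>\<^sub>m 1\<^sub>m n - x) $$ (i,j)) \<mu>)"
  using assms by (auto simp: fun_calc_def)

text \<open>The resolvent R satisfies \<open>z R = 1 + x R\<close>. For large \<open>z\<close> this
  yields the decay \<open>1 / (cmod z - op_norm x)\<close>.\<close>

lemma op_norm_resolvent_far:
  assumes x: "x \<in> carrier_mat n n" and z: "z \<notin> spectrum x"
  shows "op_norm (mat_inv (z \<cdot>\<^sub>m 1\<^sub>m n - x)) * (cmod z - op_norm x) \<le> 1"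
proof -
  let ?R = "mat_inv (z \<cdot>\<^sub>m 1\<^sub>m n - x)"
  note r = resolvent[OF x z]
  have "z \<cdot>\<^sub>m ?R - x * ?R = 1\<^sub>m n"
    using r(1,2) x by (subst (asm) minus_mult_distrib_mat[of _ n n _ _ n]) (auto simp: mult_smult_assoc_mat[of _ n n _ n])
  then have "z \<cdot>\<^sub>m ?R = 1\<^sub>m n + x * ?R"
  proof -
    assume e: "z \<cdot>\<^sub>m ?R - x * ?R = 1\<^sub>m n"
    have "z \<cdot>\<^sub>m ?R = (z \<cdot>\<^sub>m ?R - x * ?R) + x * ?R" using r(1) x by (intro eq_matI) auto
    then show ?thesis unfolding e .
  qed
  then have "cmod z * op_norm ?R = op_norm (1\<^sub>m n + x * ?R)" by (simp add: op_norm_smult[symmetric])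
  also have "\<dots> \<le> op_norm (1\<^sub>m n) + op_norm (x * ?R)" using x r(1) by (intro op_norm_add[of _ n n]) auto
  also have "\<dots> \<le> 1 + op_norm x * op_norm ?R" using x r(1) by (intro add_mono op_norm_one op_norm_mult[of _ n n _ n]) auto
  finally show ?thesis by (simp add: algebra_simps)
qed

lemma cmod_spectrum_le_op_norm:
  assumes x: "x \<in> carrier_mat n n" and k: "k \<in> spectrum x"
  shows "cmod k \<le> op_norm x"
proof -
  obtain v where v: "v \<in> carrier_vec n" "v \<noteq> 0\<^sub>v n" "x *\<^sub>v v = k \<cdot>\<^sub>v v" using k x by (rule spectrumE)
  have "cmod k * vnorm v \<le> op_norm x * vnorm v"
    using vnorm_mult_mat_vec[of v x] v x by (simp add: vnorm_smult)
  moreover have "vnorm v > 0" using vnorm_eq_0D[of v] vnorm_nonneg[of v] v by (auto simp: less_le)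
  ultimately show ?thesis by simp
qed

text \<open>The residues of the resolvent R are compared with the integral of \<open>1 / z\<close>
  over a circle of radius \<rho>. The integrands differ by \<open>x R(z) / z\<close>, which is of
  the order of the inverse square of \<rho>, so the difference \<open>T\<close> vanishes as \<rho>
  grows.\<close>

lemma fun_calc_one:
  assumes x: "x \<in> carrier_mat n n"
  shows "fun_calc (\<lambda>_. 1) x = 1\<^sub>m n"
proof (rule eq_matI)
  fix i j assume "i < dim_row (1\<^sub>m n :: complex mat)" "j < dim_col (1\<^sub>m n :: complex mat)"
  then have ij: "i < n" "j < n" by auto
  let ?r = "op_norm x"
  let ?R = "\<lambda>z. mat_inv (z \<cdot>\<^sub>m 1\<^sub>m n - x)"
  let ?f = "\<lambda>z. ?R z $$ (i,j)"
  let ?d = "1\<^sub>m n $$ (i,j) :: complex"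
  define T where "T = fun_calc (\<lambda>_. 1) x $$ (i,j) - ?d"
  have bound: "cmod T \<le> ?r / (\<rho> - ?r)" if \<rho>: "\<rho> > ?r" for \<rho>
  proof -
    have \<rho>0: "\<rho> > 0" using \<rho> op_norm_nonneg[of x] by linarith
    have sp: "spectrum x \<subseteq> ball 0 \<rho>" using cmod_spectrum_le_op_norm[OF x] \<rho> by force
    have "contour_integral (circlepath 0 \<rho>) ?f = 2 * pi * \<i> * (\<Sum>\<mu>\<in>spectrum x \<inter> ball 0 \<rho>. residue ?f \<mu>)"
      using \<rho>0 x ij sp
      by (intro sum_residues_circle[of _ UNIV _ _ "\<rho> + 1"]) (auto simp: Compl_eq_Diff_UNIV[symmetric] intro: resolvent_holomorphic)
    also have "spectrum x \<inter> ball 0 \<rho> = spectrum x" using sp by blast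
    finally have 1: "contour_integral (circlepath 0 \<rho>) ?f = 2 * pi * \<i> * (fun_calc (\<lambda>_. 1) x $$ (i,j))"
      using ij x by (simp add: fun_calc_index)
    have 2: "contour_integral (circlepath 0 \<rho>) (\<lambda>z. ?d / (z - 0)) = 2 * pi * \<i> * ?d"
      using \<rho>0 by (intro Cauchy_integral_circlepath_simple[THEN contour_integral_unique, THEN trans]) auto
    have fi: "?f contour_integrable_on circlepath 0 \<rho>"
      using x ij sp \<rho>0
      by (intro contour_integrable_holomorphic_simple[of _ "- spectrum x"] resolvent_holomorphic) auto
    have di: "(\<lambda>z. ?d / (z - 0)) contour_integrable_on circlepath 0 \<rho>"
      using \<rho>0 by (intro contour_integrable_holomorphic_simple[of _ "- {0}"] holomorphic_intros) auto
    have hd: "((\<lambda>z. ?f z - ?d / (z - 0)) has_contour_integral (2 * pi * \<i> * T)) (circlepath 0 \<rho>)"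
      using has_contour_integral_diff[OF has_contour_integral_integral[OF fi] has_contour_integral_integral[OF di]]
      unfolding 1 2 T_def by (simp add: algebra_simps)
    have "cmod (2 * pi * \<i> * T) \<le> ?r / (\<rho> * (\<rho> - ?r)) * (2 * pi * \<rho>)"
    proof (rule has_contour_integral_bound_circlepath[OF hd])
      fix z :: complex assume z: "cmod (z - 0) = \<rho>"
      then have zs: "z \<notin> spectrum x" and z0: "z \<noteq> 0" using sp \<rho>0 by auto
      note r = resolvent[OF x zs]
      have "z \<cdot>\<^sub>m ?R z - x * ?R z = 1\<^sub>m n"
        using r(1,2) x by (subst (asm) minus_mult_distrib_mat[of _ n n _ _ n]) (auto simp: mult_smult_assoc_mat[of _ n n _ n])
      from arg_cong[OF this, of "\<lambda>M. M $$ (i,j)"]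
      have "z * ?f z - (x * ?R z) $$ (i,j) = ?d" using ij x r(1) by simp
      then have "?f z - ?d / (z - 0) = (x * ?R z) $$ (i,j) / z" using z0 by (simp add: field_simps)
      then have "cmod (?f z - ?d / (z - 0)) = cmod ((x * ?R z) $$ (i,j)) / \<rho>" using z by (simp add: norm_divide)
      also have "\<dots> \<le> (?r * (1 / (\<rho> - ?r))) / \<rho>"
      proof (intro divide_right_mono)
        have "cmod ((x * ?R z) $$ (i,j)) \<le> op_norm (x * ?R z)"
          using ij x r(1) by (intro cmod_index_le_op_norm) auto
        also have "\<dots> \<le> ?r * op_norm (?R z)" using x r(1) by (intro op_norm_mult[of _ n n _ n]) auto
        also have "\<dots> \<le> ?r * (1 / (\<rho> - ?r))"
          using op_norm_resolvent_far[OF x zs] \<rho> z by (intro mult_left_mono) (simp_all add: field_simps)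
        finally show "cmod ((x * ?R z) $$ (i,j)) \<le> ?r * (1 / (\<rho> - ?r))" .
      qed (use \<rho>0 in auto)
      finally show "cmod (?f z - ?d / (z - 0)) \<le> ?r / (\<rho> * (\<rho> - ?r))"
        by (simp add: mult.commute)
    qed (use \<rho> \<rho>0 in auto)
    also have "?r / (\<rho> * (\<rho> - ?r)) * (2 * pi * \<rho>) = (2 * pi) * (?r / (\<rho> - ?r))"
      using \<rho>0 by simp
    finally have "(2 * pi) * cmod T \<le> (2 * pi) * (?r / (\<rho> - ?r))"
      by (simp add: norm_mult)
    then show ?thesis by (rule mult_left_le_imp_le) simp
  qed
  have "T = 0"
  proof (rule ccontr)
    assume "T \<noteq> 0"
    then have T: "cmod T > 0" by simp
    \<comment> \<open>With this radius the bound reads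
      \<open>cmod T \<le> cmod T * (?r / (?r + 1))\<close>, which is absurd.\<close>
    define \<rho> where "\<rho> = ?r + (?r + 1) / cmod T"
    have pos: "(?r + 1) / cmod T > 0" using T op_norm_nonneg[of x] by (intro divide_pos_pos) linarith+
    have "cmod T \<le> ?r / ((?r + 1) / cmod T)" using bound[of \<rho>] pos by (simp add: \<rho>_def)
    also have "\<dots> = cmod T * (?r / (?r + 1))" by simp
    also have "\<dots> < cmod T * 1" using T op_norm_nonneg[of x]
      by (intro mult_strict_left_mono, subst divide_less_eq_1_pos) linarith+
    finally show False by simp
  qed
  then show "fun_calc (\<lambda>_. 1) x $$ (i,j) = 1\<^sub>m n $$ (i,j)" by (simp add: T_def)
qed (use x in auto)

text \<open>With the resolvent R one has \<open>p(z) R(z) = Qp(z) + R(z) p(x)\<close>, and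
  \<open>q(z) R(z) = Qq(z)\<close> because \<open>q(x) = 0\<close>. So up to functions without
  residues, \<open>h(z) R(z)\<close> is \<open>R(z) p(x)\<close>, and \<open>fun_calc_one\<close>
  turns the residues of R into the identity.\<close>

lemma fun_calc_eq_poly_mat:
  assumes x: "x \<in> carrier_mat n n" and \<Omega>: "open \<Omega>" "spectrum x \<subseteq> \<Omega>" and g: "g holomorphic_on \<Omega>"
    and q: "poly_mat q x = 0\<^sub>m n n" and h: "\<And>z. z \<in> \<Omega> \<Longrightarrow> h z = poly p z + poly q z * g z"
  shows "fun_calc h x = poly_mat p x"
proof (rule eq_matI)
  fix i j assume "i < dim_row (poly_mat p x)" "j < dim_col (poly_mat p x)"
  then have ij: "i < n" "j < n" using x by auto
  let ?R = "\<lambda>z. mat_inv (z \<cdot>\<^sub>m 1\<^sub>m n - x)"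
  let ?P = "poly_mat p x"
  obtain Qp where Qp: "\<And>z. Qp z \<in> carrier_mat n n"
      "\<And>z. (z \<cdot>\<^sub>m 1\<^sub>m n - x) * Qp z = poly p z \<cdot>\<^sub>m 1\<^sub>m n - poly_mat p x"
      "\<And>i j. i < n \<Longrightarrow> j < n \<Longrightarrow> (\<lambda>z. Qp z $$ (i,j)) holomorphic_on UNIV"
    using poly_divided_difference_holomorphic[OF x, of p] by blast
  obtain Qq where Qq: "\<And>z. Qq z \<in> carrier_mat n n"
      "\<And>z. (z \<cdot>\<^sub>m 1\<^sub>m n - x) * Qq z = poly q z \<cdot>\<^sub>m 1\<^sub>m n - poly_mat q x"
      "\<And>i j. i < n \<Longrightarrow> j < n \<Longrightarrow> (\<lambda>z. Qq z $$ (i,j)) holomorphic_on UNIV"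
    using poly_divided_difference_holomorphic[OF x, of q] by blast
  define A where "A z = (\<Sum>k<n. ?P $$ (k,j) * ?R z $$ (i,k))" for z
  define B where "B z = Qp z $$ (i,j) + g z * Qq z $$ (i,j)" for z
  have eq: "h z * ?R z $$ (i,j) = A z + B z" if z: "z \<in> \<Omega>" "z \<notin> spectrum x" for z
  proof -
    note r = resolvent(1)[OF x z(2)]
    have "Qp z = ?R z * (poly p z \<cdot>\<^sub>m 1\<^sub>m n - ?P)" by (rule resolvent_eq[OF x z(2) Qp(1,2)])
    also have "\<dots> = poly p z \<cdot>\<^sub>m ?R z - ?R z * ?P"
      using r x by (subst mult_minus_distrib_mat[of _ n n _ n]) (auto simp: mult_smult_distrib[of _ n n _ n])
    finally have "Qp z $$ (i,j) = poly p z * ?R z $$ (i,j) - A z"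
      using ij r x by (auto simp: scalar_prod_def atLeast0LessThan A_def mult.commute)
    moreover have "poly q z \<cdot>\<^sub>m 1\<^sub>m n - poly_mat q x = poly q z \<cdot>\<^sub>m 1\<^sub>m n" unfolding q by (intro eq_matI) auto
    then have "Qq z = ?R z * (poly q z \<cdot>\<^sub>m 1\<^sub>m n)" using resolvent_eq[OF x z(2) Qq(1,2)] by simp
    then have "Qq z $$ (i,j) = poly q z * ?R z $$ (i,j)"
      using ij r x by (simp add: mult_smult_distrib[of _ n n _ n])
    ultimately show ?thesis using h[OF z(1)] by (simp add: B_def algebra_simps)
  qed
  have res: "residue (\<lambda>z. h z * ?R z $$ (i,j)) \<mu> = (\<Sum>k<n. ?P $$ (k,j) * residue (\<lambda>z. ?R z $$ (i,k)) \<mu>)"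
    if \<mu>: "\<mu> \<in> spectrum x" for \<mu>
  proof -
    define s where "s = \<Omega> - (spectrum x - {\<mu>})"
    have s: "open s" "\<mu> \<in> s" "s - {\<mu>} \<subseteq> \<Omega> - spectrum x"
      using isolated_open_nbhd[of "spectrum x" \<Omega> \<mu>] x \<Omega> \<mu> unfolding s_def by auto
    have Rh: "(\<lambda>z. ?R z $$ (i,k)) holomorphic_on s - {\<mu>}" if "k < n" for k
      by (rule holomorphic_on_subset[OF resolvent_holomorphic[OF x ij(1) that]]) (use s in auto)
    have Ah: "A holomorphic_on s - {\<mu>}" unfolding A_def by (intro holomorphic_intros Rh) auto
    have Bh: "B holomorphic_on s"
      unfolding B_def using ij
      by (intro holomorphic_intros holomorphic_on_subset[OF Qp(3)] holomorphic_on_subset[OF Qq(3)] holomorphic_on_subset[OF g]) (auto simp: s_def)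
    have "residue (\<lambda>z. h z * ?R z $$ (i,j)) \<mu> = residue (\<lambda>z. A z + B z) \<mu>"
    proof (rule residue_cong)
      have "eventually (\<lambda>z. z \<in> s - {\<mu>}) (at \<mu>)" using eventually_at_in_open[OF s(1,2)] .
      then show "eventually (\<lambda>z. h z * ?R z $$ (i,j) = A z + B z) (at \<mu>)"
        by eventually_elim (use s eq in auto)
    qed simp
    also have "\<dots> = residue A \<mu> + residue B \<mu>"
      by (rule residue_add[OF s(1,2) Ah holomorphic_on_subset[OF Bh]]) auto
    also have "residue B \<mu> = 0" by (rule residue_holo[OF s(1,2) Bh])
    also have "residue A \<mu> = (\<Sum>k<n. ?P $$ (k,j) * residue (\<lambda>z. ?R z $$ (i,k)) \<mu>)"
      unfolding A_def by (rule residue_sum_lmul[OF s(1,2)]) (auto intro: Rh)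
    finally show ?thesis by simp
  qed
  have "fun_calc h x $$ (i,j) = (\<Sum>\<mu>\<in>spectrum x. \<Sum>k<n. ?P $$ (k,j) * residue (\<lambda>z. ?R z $$ (i,k)) \<mu>)"
    using res by (simp add: fun_calc_index[OF x ij])
  also have "\<dots> = (\<Sum>k<n. ?P $$ (k,j) * (\<Sum>\<mu>\<in>spectrum x. residue (\<lambda>z. ?R z $$ (i,k)) \<mu>))"
    by (subst sum.swap) (simp add: sum_distrib_left)
  also have "\<dots> = (\<Sum>k<n. ?P $$ (k,j) * fun_calc (\<lambda>_. 1) x $$ (i,k))"
    using ij by (simp add: fun_calc_index[OF x])
  also have "\<dots> = (\<Sum>k<n. if k = i then ?P $$ (k,j) else 0)"
    unfolding fun_calc_one[OF x] using ij by (intro sum.cong) auto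
  also have "\<dots> = ?P $$ (i,j)" using ij by simp
  finally show "fun_calc h x $$ (i,j) = ?P $$ (i,j)" .
qed (use x in auto)

text \<open>Hermite interpolation with remainder: one zero \<open>a\<close> of \<open>q\<close> is
  split off at a time and \<open>h\<close> is replaced by \<open>(h(z) - h(a)) / (z - a)\<close>,
  which stays holomorphic at \<open>a\<close>. Multiple zeros are covered because the induction runs
  over linear factors.\<close>

lemma holomorphic_interpolation:
  fixes h :: "complex \<Rightarrow> complex"
  assumes "open \<Omega>" "h holomorphic_on \<Omega>" "q \<noteq> 0" "\<And>z. poly q z = 0 \<Longrightarrow> z \<in> \<Omega>"
  shows "\<exists>p g. g holomorphic_on \<Omega> \<and> (\<forall>z\<in>\<Omega>. h z = poly p z + poly q z * g z)"
  using assms(2-)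
proof (induction "degree q" arbitrary: q h)
  case 0
  then obtain c where c: "q = [:c:]" "c \<noteq> 0" by (metis degree_eq_zeroE pCons_0_0)
  have "(\<lambda>z. h z / c) holomorphic_on \<Omega>" using 0 c by (intro holomorphic_intros) auto
  then show ?case using c by (intro exI[of _ 0] exI[of _ "\<lambda>z. h z / c"]) auto
next
  case (Suc d)
  then have "\<not> constant (poly q)" by (simp add: constant_degree)
  then obtain a where a: "poly q a = 0" using fundamental_theorem_of_algebra by blast
  then have "[:- a, 1:] dvd q" using poly_eq_0_iff_dvd by blast
  then obtain q' where q': "q = [:- a, 1:] * q'" by (rule dvdE)
  have q'0: "q' \<noteq> 0" using q' Suc by auto
  have d: "d = degree q'" using Suc(2) q' q'0 by (simp add: degree_mult_eq del: mult_pCons_left)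
  define h1 where "h1 z = (if z = a then deriv h a else h z / (z - a) - h a / (z - a))" for z
  have h1: "h1 holomorphic_on \<Omega>"
    unfolding h1_def by (rule pole_theorem_open[OF Suc(3) assms(1)]) auto
  have "\<And>z. poly q' z = 0 \<Longrightarrow> z \<in> \<Omega>" using Suc(5) q' by auto
  from Suc(1)[OF d h1 q'0 this] obtain p g where
    pg: "g holomorphic_on \<Omega>" "\<And>z. z \<in> \<Omega> \<Longrightarrow> h1 z = poly p z + poly q' z * g z" by blast
  have "h z = poly ([:h a:] + [:- a, 1:] * p) z + poly q z * g z" if "z \<in> \<Omega>" for z
  proof -
    have "h z = h a + (z - a) * h1 z" by (simp add: h1_def diff_divide_distrib[symmetric])
    then show ?thesis using pg(2)[OF that] by (simp add: q' algebra_simps)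
  qed
  then show ?case using pg(1) by blast
qed

text \<open>\<open>p\<close> is determined by \<open>q\<close> and \<open>h\<close> before any
  matrix is chosen, so one polynomial serves all matrices annihilated by \<open>q\<close>. This
  reduces intertwining, direct sums and similarities to polynomials.\<close>

lemma fun_calc_common_poly:
  assumes "open \<Omega>" "h holomorphic_on \<Omega>" "q \<noteq> 0" "\<And>z. poly q z = 0 \<Longrightarrow> z \<in> \<Omega>"
  obtains p where "\<And>n x. x \<in> carrier_mat n n \<Longrightarrow> poly_mat q x = 0\<^sub>m n n \<Longrightarrow> fun_calc h x = poly_mat p x"
    "\<And>z. poly q z = 0 \<Longrightarrow> poly p z = h z"
proof -
  obtain p g where pg: "g holomorphic_on \<Omega>" "\<And>z. z \<in> \<Omega> \<Longrightarrow> h z = poly p z + poly q z * g z"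
    using holomorphic_interpolation[OF assms] by blast
  show thesis
  proof (rule that)
    fix n x assume x: "x \<in> carrier_mat n n" "poly_mat q x = 0\<^sub>m n n"
    have "spectrum x \<subseteq> \<Omega>" using poly_spectrum_eq_0[OF x] assms(4) by blast
    then show "fun_calc h x = poly_mat p x"
      by (rule fun_calc_eq_poly_mat[OF x(1) assms(1) _ pg(1) x(2) pg(2)])
  qed (use pg(2) assms(4) in auto)
qed

lemma fun_calc_poly:
  assumes x: "x \<in> carrier_mat n n" and "open \<Omega>" "h holomorphic_on \<Omega>" "spectrum x \<subseteq> \<Omega>"
  obtains p where "fun_calc h x = poly_mat p x" "\<And>k. k \<in> spectrum x \<Longrightarrow> poly p k = h k"
proof -
  obtain q where q: "q \<noteq> 0" "poly_mat q x = 0\<^sub>m n n" "\<And>k. poly q k = 0 \<Longrightarrow> k \<in> spectrum x"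
    using annihilating_poly[OF x] by blast
  have r: "\<And>k. poly q k = 0 \<Longrightarrow> k \<in> \<Omega>" using q(3) assms by blast
  obtain p where p: "\<And>n x. x \<in> carrier_mat n n \<Longrightarrow> poly_mat q x = 0\<^sub>m n n \<Longrightarrow> fun_calc h x = poly_mat p x"
    "\<And>z. poly q z = 0 \<Longrightarrow> poly p z = h z"
    using fun_calc_common_poly[OF assms(2,3) q(1) r] by blast
  show thesis by (rule that[OF p(1)[OF x q(2)] p(2)[OF poly_spectrum_eq_0[OF x q(2)]]])
qed

text \<open>The product of annihilating polynomials of \<open>x\<close> and \<open>y\<close>
  annihilates both of them and their direct sum.\<close>

lemma fun_calc_common_poly2:
  assumes x: "x \<in> carrier_mat n n" and y: "y \<in> carrier_mat m m"
    and \<Omega>: "open \<Omega>" "h holomorphic_on \<Omega>" "spectrum x \<subseteq> \<Omega>" "spectrum y \<subseteq> \<Omega>"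
  obtains p where "fun_calc h x = poly_mat p x" "fun_calc h y = poly_mat p y"
    "fun_calc h (mat_dsum x y) = poly_mat p (mat_dsum x y)"
proof -
  obtain q where q: "q \<noteq> 0" "poly_mat q x = 0\<^sub>m n n" "\<And>k. poly q k = 0 \<Longrightarrow> k \<in> spectrum x"
    using annihilating_poly[OF x] by blast
  obtain q' where q': "q' \<noteq> 0" "poly_mat q' y = 0\<^sub>m m m" "\<And>k. poly q' k = 0 \<Longrightarrow> k \<in> spectrum y"
    using annihilating_poly[OF y] by blast
  have nz: "q * q' \<noteq> 0" using q q' by simp
  have r: "\<And>k. poly (q * q') k = 0 \<Longrightarrow> k \<in> \<Omega>" using q(3) q'(3) \<Omega> by auto
  obtain p where p: "\<And>n x. x \<in> carrier_mat n n \<Longrightarrow> poly_mat (q * q') x = 0\<^sub>m n n \<Longrightarrow> fun_calc h x = poly_mat p x"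
    by (rule fun_calc_common_poly[OF \<Omega>(1,2) nz]) (erule r, rule that, simp)
  have 0: "poly_mat (q * q') x = 0\<^sub>m n n" "poly_mat (q * q') y = 0\<^sub>m m m"
    using q q' x y by (auto simp: poly_mat_mult[of _ n] poly_mat_mult[of _ m])
  then have "poly_mat (q * q') (mat_dsum x y) = 0\<^sub>m (n + m) (n + m)"
    using x y by (simp add: poly_mat_dsum mat_dsum_zero)
  then show thesis using that p 0 x y by (metis mat_dsum_carrier)
qed

lemma fun_calc_intertwine:
  assumes "x \<in> carrier_mat n n" "y \<in> carrier_mat m m" "T \<in> carrier_mat n m" "x * T = T * y"
    and "open \<Omega>" "h holomorphic_on \<Omega>" "spectrum x \<subseteq> \<Omega>" "spectrum y \<subseteq> \<Omega>"
  shows "fun_calc h x * T = T * fun_calc h y"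
proof -
  obtain p where "fun_calc h x = poly_mat p x" "fun_calc h y = poly_mat p y"
    using fun_calc_common_poly2[OF assms(1,2,5-8)] by blast
  then show ?thesis using poly_mat_intertwine[OF assms(1-4)] by simp
qed

lemma fun_calc_dsum:
  assumes "x \<in> carrier_mat n n" "y \<in> carrier_mat m m"
    and "open \<Omega>" "h holomorphic_on \<Omega>" "spectrum x \<subseteq> \<Omega>" "spectrum y \<subseteq> \<Omega>"
  shows "fun_calc h (mat_dsum x y) = mat_dsum (fun_calc h x) (fun_calc h y)"
proof -
  obtain p where "fun_calc h x = poly_mat p x" "fun_calc h y = poly_mat p y"
     "fun_calc h (mat_dsum x y) = poly_mat p (mat_dsum x y)"
    using fun_calc_common_poly2[OF assms] by blast
  then show ?thesis using poly_mat_dsum[OF assms(1,2)] by simp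
qed

text \<open>If \<open>p1\<close> and \<open>p2\<close> interpolate \<open>h1\<close> and
  \<open>h2\<close> modulo \<open>q\<close>, then \<open>p1 * p2\<close> interpolates the product
  modulo \<open>q\<close>.\<close>

lemma fun_calc_mult:
  assumes x: "x \<in> carrier_mat n n" and \<Omega>: "open \<Omega>" "spectrum x \<subseteq> \<Omega>"
    and h1: "h1 holomorphic_on \<Omega>" and h2: "h2 holomorphic_on \<Omega>" and h: "\<And>z. z \<in> \<Omega> \<Longrightarrow> h z = h1 z * h2 z"
  shows "fun_calc h x = fun_calc h1 x * fun_calc h2 x"
proof -
  obtain q where q: "q \<noteq> 0" "poly_mat q x = 0\<^sub>m n n" "\<And>k. poly q k = 0 \<Longrightarrow> k \<in> spectrum x"
    using annihilating_poly[OF x] by blast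
  have r: "\<And>k. poly q k = 0 \<Longrightarrow> k \<in> \<Omega>" using q(3) \<Omega> by blast
  obtain p1 g1 where 1: "g1 holomorphic_on \<Omega>" "\<And>z. z \<in> \<Omega> \<Longrightarrow> h1 z = poly p1 z + poly q z * g1 z"
    using holomorphic_interpolation[OF \<Omega>(1) h1 q(1) r] by blast
  obtain p2 g2 where 2: "g2 holomorphic_on \<Omega>" "\<And>z. z \<in> \<Omega> \<Longrightarrow> h2 z = poly p2 z + poly q z * g2 z"
    using holomorphic_interpolation[OF \<Omega>(1) h2 q(1) r] by blast
  have "fun_calc h x = poly_mat (p1 * p2) x"
  proof (rule fun_calc_eq_poly_mat[OF x \<Omega> _ q(2), of "\<lambda>z. poly p1 z * g2 z + g1 z * poly p2 z + poly q z * g1 z * g2 z"])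
    show "(\<lambda>z. poly p1 z * g2 z + g1 z * poly p2 z + poly q z * g1 z * g2 z) holomorphic_on \<Omega>"
      by (intro holomorphic_intros 1 2)
  qed (simp add: h 1 2 algebra_simps)
  then show ?thesis
    by (simp add: fun_calc_eq_poly_mat[OF x \<Omega> 1(1) q(2) 1(2)] fun_calc_eq_poly_mat[OF x \<Omega> 2(1) q(2) 2(2)] poly_mat_mult[OF x])
qed

lemma fun_calc_poly_fun:
  assumes x: "x \<in> carrier_mat n n"
  shows "fun_calc (poly p) x = poly_mat p x"
proof -
  obtain q where q: "poly_mat q x = 0\<^sub>m n n" using annihilating_poly_exists[OF x] by blast
  show ?thesis by (rule fun_calc_eq_poly_mat[OF x open_UNIV _ _ q, of "\<lambda>_. 0"]) auto
qed

lemma fun_calc_id: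
  assumes x: "x \<in> carrier_mat n n"
  shows "fun_calc (\<lambda>z. z) x = x"
proof -
  have "poly [:0, 1:] = (\<lambda>z::complex. z)" by auto
  then show ?thesis using fun_calc_poly_fun[OF x, of "[:0, 1:]"] poly_mat_id[OF x] by simp
qed

lemma fun_calc_eigenvector:
  assumes x: "x \<in> carrier_mat n n" and \<Omega>: "open \<Omega>" "h holomorphic_on \<Omega>" "spectrum x \<subseteq> \<Omega>"
    and v: "v \<in> carrier_vec n" "x *\<^sub>v v = k \<cdot>\<^sub>v v" "v \<noteq> 0\<^sub>v n"
  shows "fun_calc h x *\<^sub>v v = h k \<cdot>\<^sub>v v"
proof -
  obtain p where p: "fun_calc h x = poly_mat p x" "\<And>k. k \<in> spectrum x \<Longrightarrow> poly p k = h k"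
    using fun_calc_poly[OF x \<Omega>] by blast
  then show ?thesis using poly_mat_eigenvector[OF x v(1,2), of p] spectrumI[OF x v(1,3,2)] by simp
qed

section \<open>Bounds for the functional calculus that are uniform in the matrix size\<close>

lemma finite_uniform_radius:
  assumes "finite Z" "\<And>a. a \<in> Z \<Longrightarrow> \<exists>e>0::real. P a e" "\<And>a e e'. P a e \<Longrightarrow> e' \<le> e \<Longrightarrow> P a e'"
  shows "\<exists>e>0. \<forall>a\<in>Z. P a e"
  using assms(1,2)
proof (induction rule: finite_induct)
  case (insert a Z)
  then obtain e1 e2 where "e1 > 0" "\<forall>a\<in>Z. P a e1" "e2 > 0" "P a e2" by blast
  then show ?case using assms(3) by (intro exI[of _ "min e1 e2"]) (auto intro: assms(3))
qed (auto intro: exI[of _ 1])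

text \<open>Room for circles of radius \<rho>: the radius \<open>2 * \<rho>\<close> leaves a margin
  inside \<Omega>, and the distance \<open>4 * \<rho>\<close> keeps each circle farther than \<rho>
  from all other centres.\<close>

lemma finite_separation:
  fixes Z :: "complex set"
  assumes "finite Z" "open \<Omega>" "Z \<subseteq> \<Omega>"
  obtains \<rho> where "\<rho> > 0" "\<And>a. a \<in> Z \<Longrightarrow> ball a (2 * \<rho>) \<subseteq> \<Omega>"
    "\<And>a b. a \<in> Z \<Longrightarrow> b \<in> Z \<Longrightarrow> a \<noteq> b \<Longrightarrow> 4 * \<rho> \<le> cmod (a - b)"
proof -
  have "\<exists>e>0. \<forall>a\<in>Z. ball a e \<subseteq> \<Omega> - (Z - {a})"
  proof (rule finite_uniform_radius[OF assms(1)])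
    fix a assume "a \<in> Z"
    then have "open (\<Omega> - (Z - {a}))" "a \<in> \<Omega> - (Z - {a})"
      using isolated_open_nbhd[of Z \<Omega> a] assms by auto
    then show "\<exists>e>0. ball a e \<subseteq> \<Omega> - (Z - {a})" unfolding open_contains_ball by blast
  next
    fix a and e e' :: real assume "ball a e \<subseteq> \<Omega> - (Z - {a})" "e' \<le> e"
    then show "ball a e' \<subseteq> \<Omega> - (Z - {a})" using subset_ball[of e' e a] by blast
  qed
  then obtain e where e: "e > 0" "\<And>a. a \<in> Z \<Longrightarrow> ball a e \<subseteq> \<Omega> - (Z - {a})" by blast
  show thesis
  proof (rule that[of "e / 4"])
    fix a b assume ab: "a \<in> Z" "b \<in> Z" "a \<noteq> b"
    then have "b \<notin> ball a e" using e(2)[of a] by blast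
    then show "4 * (e / 4) \<le> cmod (a - b)" by (simp add: dist_norm)
  next
    fix a assume "a \<in> Z"
    then show "ball a (2 * (e / 4)) \<subseteq> \<Omega>"
      using e subset_ball[of "2 * (e / 4)" e a] by fastforce
  qed (use e in simp)
qed

text \<open>Away from the zeros each linear factor contributes at least \<rho>, and the leading
  coefficient the rest.\<close>

lemma poly_lower_bound:
  fixes q :: "complex poly"
  assumes "q \<noteq> 0" "\<rho> > 0"
  shows "\<exists>e>0. \<forall>z. (\<forall>a. poly q a = 0 \<longrightarrow> \<rho> \<le> cmod (z - a)) \<longrightarrow> e \<le> cmod (poly q z)"
  using assms(1)
proof (induction "degree q" arbitrary: q)
  case 0
  then obtain c where "q = [:c:]" "c \<noteq> 0" by (metis degree_eq_zeroE pCons_0_0)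
  then show ?case by (intro exI[of _ "cmod c"]) auto
next
  case (Suc d)
  then have "\<not> constant (poly q)" by (simp add: constant_degree)
  then obtain a where a: "poly q a = 0" using fundamental_theorem_of_algebra by blast
  then have "[:- a, 1:] dvd q" using poly_eq_0_iff_dvd by blast
  then obtain q' where q': "q = [:- a, 1:] * q'" by (rule dvdE)
  have q'0: "q' \<noteq> 0" using q' Suc by auto
  have d: "d = degree q'" using Suc(2) q'0 unfolding q' by (subst (asm) degree_mult_eq) auto
  obtain e where e: "e > 0" "\<And>z. (\<And>a. poly q' a = 0 \<Longrightarrow> \<rho> \<le> cmod (z - a)) \<Longrightarrow> e \<le> cmod (poly q' z)"
    using Suc(1)[OF d q'0] by blast
  have "\<rho> * e \<le> cmod (poly q z)" if z: "\<And>a. poly q a = 0 \<Longrightarrow> \<rho> \<le> cmod (z - a)" for z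
  proof -
    have "e \<le> cmod (poly q' z)" by (rule e(2)) (use z in \<open>auto simp: q'\<close>)
    then have "\<rho> * e \<le> cmod (z - a) * cmod (poly q' z)" using z[OF a] assms e by (intro mult_mono) auto
    also have "\<dots> = cmod (poly q z)" by (simp add: q' norm_mult[symmetric] algebra_simps)
    finally show ?thesis .
  qed
  then show ?case using e assms by (intro exI[of _ "\<rho> * e"]) auto
qed

text \<open>The residues are collected by \<open>card Z\<close> fixed circles instead of being
  estimated one by one. The number of points of \<open>S\<close>, later the spectrum of a matrix of
  arbitrary size, does not enter.\<close>

lemma sum_residues_bound:
  assumes Z: "finite Z" and \<rho>: "0 < \<rho>" and ball: "\<And>a. a \<in> Z \<Longrightarrow> ball a (2 * \<rho>) \<subseteq> \<Omega>"
    and sep: "\<And>a b. a \<in> Z \<Longrightarrow> b \<in> Z \<Longrightarrow> a \<noteq> b \<Longrightarrow> 4 * \<rho> \<le> cmod (a - b)"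
    and \<Omega>: "open \<Omega>" and S: "finite S" "S \<subseteq> (\<Union>a\<in>Z. ball a \<rho>)" and f: "f holomorphic_on \<Omega> - S"
    and B: "0 \<le> B" "\<And>a z. a \<in> Z \<Longrightarrow> cmod (z - a) = \<rho> \<Longrightarrow> cmod (f z) \<le> B"
  shows "cmod (\<Sum>\<mu>\<in>S. residue f \<mu>) \<le> real (card Z) * (\<rho> * B)"
proof -
  have ne: "cmod (z - a) \<noteq> \<rho>" if z: "z \<in> S" and a: "a \<in> Z" for z a
  proof
    assume eq: "cmod (z - a) = \<rho>"
    obtain b where b: "b \<in> Z" "cmod (z - b) < \<rho>" using S(2) z by (auto simp: dist_norm norm_minus_commute)
    then have "a \<noteq> b" using eq by auto
    then have "4 * \<rho> \<le> cmod (a - b)" using sep a b by blast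
    also have "\<dots> \<le> cmod (z - a) + cmod (z - b)" by (metis norm_minus_commute norm_triangle_sub norm_diff_triangle_ineq add.commute diff_add_cancel dist_norm dist_triangle2)
    finally show False using eq b \<rho> by linarith
  qed
  have "S = (\<Union>a\<in>Z. S \<inter> ball a \<rho>)" using S by blast
  then have "(\<Sum>\<mu>\<in>S. residue f \<mu>) = (\<Sum>\<mu>\<in>(\<Union>a\<in>Z. S \<inter> ball a \<rho>). residue f \<mu>)" by simp
  also have "\<dots> = (\<Sum>a\<in>Z. \<Sum>\<mu>\<in>S \<inter> ball a \<rho>. residue f \<mu>)"
  proof (rule sum.UNION_disjoint)
    show "\<forall>a\<in>Z. \<forall>b\<in>Z. a \<noteq> b \<longrightarrow> S \<inter> ball a \<rho> \<inter> (S \<inter> ball b \<rho>) = {}"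
    proof (intro ballI impI)
      fix a b assume ab: "a \<in> Z" "b \<in> Z" "a \<noteq> b"
      have "ball a \<rho> \<inter> ball b \<rho> = {}"
        using sep[OF ab] \<rho> by (intro disjoint_ballI) (simp add: dist_norm)
      then show "S \<inter> ball a \<rho> \<inter> (S \<inter> ball b \<rho>) = {}" by blast
    qed
  qed (use Z S in auto)
  finally have eq: "(\<Sum>\<mu>\<in>S. residue f \<mu>) = (\<Sum>a\<in>Z. \<Sum>\<mu>\<in>S \<inter> ball a \<rho>. residue f \<mu>)" .
  have le: "cmod (\<Sum>\<mu>\<in>S \<inter> ball a \<rho>. residue f \<mu>) \<le> \<rho> * B" if a: "a \<in> Z" for a
  proof -
    have ci: "contour_integral (circlepath a \<rho>) f = 2 * pi * \<i> * (\<Sum>\<mu>\<in>S \<inter> ball a \<rho>. residue f \<mu>)"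
      using ne a ball[OF a] \<rho> by (intro sum_residues_circle[OF S(1) \<Omega> f, of _ "2 * \<rho>"]) auto
    have "f contour_integrable_on circlepath a \<rho>"
    proof (rule contour_integrable_holomorphic_simple[OF f])
      show "open (\<Omega> - S)" using \<Omega> S by (intro open_Diff finite_imp_closed)
      show "path_image (circlepath a \<rho>) \<subseteq> \<Omega> - S"
        using ball[OF a] ne[OF _ a] \<rho> by (auto simp: dist_norm norm_minus_commute)
    qed simp
    from has_contour_integral_bound_circlepath[OF has_contour_integral_integral[OF this] B(1) \<rho>]
    have "cmod (contour_integral (circlepath a \<rho>) f) \<le> B * (2 * pi * \<rho>)" using B(2)[OF a] by blast
    then have "(2 * pi) * cmod (\<Sum>\<mu>\<in>S \<inter> ball a \<rho>. residue f \<mu>) \<le> (2 * pi) * (\<rho> * B)"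
      unfolding ci by (simp add: norm_mult mult_ac)
    then show ?thesis by (rule mult_left_le_imp_le) simp
  qed
  have "cmod (\<Sum>\<mu>\<in>S. residue f \<mu>) \<le> (\<Sum>a\<in>Z. \<rho> * B)"
    unfolding eq by (intro order_trans[OF norm_sum] sum_mono le)
  then show ?thesis by simp
qed

lemma cmod_poly_spectrum_le:
  assumes x: "x \<in> carrier_mat n n" and k: "k \<in> spectrum x"
  shows "cmod (poly q k) \<le> op_norm (poly_mat q x)"
proof -
  obtain v where v: "v \<in> carrier_vec n" "v \<noteq> 0\<^sub>v n" "x *\<^sub>v v = k \<cdot>\<^sub>v v" using k x by (rule spectrumE)
  show ?thesis
    by (rule cmod_spectrum_le_op_norm[OF poly_mat_carrier[OF x]])
       (rule spectrumI[OF poly_mat_carrier[OF x] v(1,2) poly_mat_eigenvector[OF x v(1,3)]])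
qed

text \<open>With the resolvent R one has \<open>Q = q(z) R - R q(x)\<close>. Where
  \<open>q(z)\<close> dominates \<open>q(x)\<close>, this bounds R by \<open>Q\<close>, whose norm
  is controlled independently of the size.\<close>

lemma op_norm_resolvent_le:
  assumes x: "x \<in> carrier_mat n n" and z: "z \<notin> spectrum x" and Q: "Q \<in> carrier_mat n n"
    and eq: "(z \<cdot>\<^sub>m 1\<^sub>m n - x) * Q = poly q z \<cdot>\<^sub>m 1\<^sub>m n - poly_mat q x"
  shows "op_norm (mat_inv (z \<cdot>\<^sub>m 1\<^sub>m n - x)) * (cmod (poly q z) - op_norm (poly_mat q x)) \<le> op_norm Q"
proof -
  let ?R = "mat_inv (z \<cdot>\<^sub>m 1\<^sub>m n - x)"
  note r = resolvent(1)[OF x z]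
  have qx: "poly_mat q x \<in> carrier_mat n n" using x by simp
  have "Q = ?R * (poly q z \<cdot>\<^sub>m 1\<^sub>m n - poly_mat q x)" by (rule resolvent_eq[OF x z Q eq])
  also have "\<dots> = poly q z \<cdot>\<^sub>m ?R - ?R * poly_mat q x"
    using r qx by (subst mult_minus_distrib_mat[of _ n n _ n]) (auto simp: mult_smult_distrib[of _ n n _ n])
  finally have "poly q z \<cdot>\<^sub>m ?R = Q + ?R * poly_mat q x"
    using r qx by (intro eq_matI) auto
  then have "cmod (poly q z) * op_norm ?R = op_norm (Q + ?R * poly_mat q x)" by (simp add: op_norm_smult[symmetric])
  also have "\<dots> \<le> op_norm Q + op_norm (?R * poly_mat q x)" using Q r qx by (intro op_norm_add[of _ n n]) auto
  also have "op_norm (?R * poly_mat q x) \<le> op_norm ?R * op_norm (poly_mat q x)" using r qx by (intro op_norm_mult[of _ n n _ n]) auto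
  finally show ?thesis by (simp add: algebra_simps)
qed

text \<open>A scalar estimate suffices. For a vector \<open>w\<close>, put
  \<open>y = h(x) w\<close>; then \<open>G(z) = h(z) <R(z) w, y>\<close>, with the resolvent R, has
  residue sum \<open>(vnorm y)^2\<close>, while on \<Gamma> it is at most
  \<open>H * L * vnorm w * vnorm y\<close>. Dividing by \<open>vnorm y\<close> gives the operator
  norm without a factor from summing over entries.\<close>

lemma op_norm_fun_calc_le:
  assumes x: "x \<in> carrier_mat n n" and K: "0 \<le> K" and h: "open \<Omega>" "h holomorphic_on \<Omega>" "spectrum x \<subseteq> \<Omega>"
    and K: "\<And>G B. G holomorphic_on \<Omega> - spectrum x \<Longrightarrow> 0 \<le> B \<Longrightarrow>
      (\<And>z. z \<in> \<Gamma> \<Longrightarrow> cmod (G z) \<le> B) \<Longrightarrow> cmod (\<Sum>\<mu>\<in>spectrum x. residue G \<mu>) \<le> K * B"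
    and \<Gamma>: "\<Gamma> \<subseteq> \<Omega> - spectrum x" and H: "\<And>z. z \<in> \<Gamma> \<Longrightarrow> cmod (h z) \<le> H" "0 \<le> H"
    and L: "\<And>z. z \<in> \<Gamma> \<Longrightarrow> op_norm (mat_inv (z \<cdot>\<^sub>m 1\<^sub>m n - x)) \<le> L" "0 \<le> L"
  shows "op_norm (fun_calc h x) \<le> K * (H * L)"
proof (rule op_norm_leI)
  let ?F = "fun_calc h x"
  let ?R = "\<lambda>z. mat_inv (z \<cdot>\<^sub>m 1\<^sub>m n - x)"
  fix w :: "complex vec" assume "w \<in> carrier_vec (dim_col ?F)"
  then have w: "w \<in> carrier_vec n" using x by auto
  define y where "y = ?F *\<^sub>v w"
  have y: "y \<in> carrier_vec n" using x by (simp add: y_def)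
  let ?I = "{..<n} \<times> {..<n}"
  define G where "G z = (\<Sum>p\<in>?I. (cnj (y $ fst p) * w $ snd p) * (h z * ?R z $$ p))" for z
  have hR: "(\<lambda>z. h z * ?R z $$ p) holomorphic_on \<Omega> - spectrum x" if "p \<in> ?I" for p
  proof -
    obtain i j where p: "p = (i,j)" "i < n" "j < n" using \<open>p \<in> ?I\<close> by auto
    show ?thesis unfolding p(1)
      by (intro holomorphic_intros holomorphic_on_subset[OF resolvent_holomorphic[OF x p(2,3)]] holomorphic_on_subset[OF h(2)]) auto
  qed
  have Gh: "G holomorphic_on \<Omega> - spectrum x"
    unfolding G_def by (intro holomorphic_on_sum holomorphic_on_mult[OF holomorphic_on_const] hR)
  have "(\<Sum>\<mu>\<in>spectrum x. residue G \<mu>) = (\<Sum>\<mu>\<in>spectrum x. \<Sum>p\<in>?I. (cnj (y $ fst p) * w $ snd p) * residue (\<lambda>z. h z * ?R z $$ p) \<mu>)"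
  proof (intro sum.cong refl)
    fix \<mu> assume \<mu>: "\<mu> \<in> spectrum x"
    define s where "s = \<Omega> - (spectrum x - {\<mu>})"
    have s: "open s" "\<mu> \<in> s" "s - {\<mu>} \<subseteq> \<Omega> - spectrum x"
      using isolated_open_nbhd[of "spectrum x" \<Omega> \<mu>] x h \<mu> unfolding s_def by auto
    show "residue G \<mu> = (\<Sum>p\<in>?I. (cnj (y $ fst p) * w $ snd p) * residue (\<lambda>z. h z * ?R z $$ p) \<mu>)"
      unfolding G_def by (rule residue_sum_lmul[OF s(1,2)]) (auto intro!: holomorphic_on_subset[OF hR s(3)])
  qed
  also have "\<dots> = (\<Sum>p\<in>?I. (cnj (y $ fst p) * w $ snd p) * ?F $$ p)"
    by (subst sum.swap) (auto simp: sum_distrib_left[symmetric] fun_calc_index[OF x] intro!: sum.cong)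
  also have "\<dots> = (\<Sum>i<n. \<Sum>j<n. (cnj (y $ i) * w $ j) * ?F $$ (i,j))"
    by (simp add: sum.cartesian_product case_prod_unfold)
  also have "\<dots> = (\<Sum>i<n. cnj (y $ i) * y $ i)"
  proof (intro sum.cong refl)
    fix i assume i: "i \<in> {..<n}"
    then have "y $ i = (\<Sum>j<n. ?F $$ (i,j) * w $ j)"
      using w x by (simp add: y_def scalar_prod_def atLeast0LessThan)
    moreover have "(\<Sum>j<n. (cnj (y $ i) * w $ j) * ?F $$ (i,j)) = cnj (y $ i) * (\<Sum>j<n. ?F $$ (i,j) * w $ j)"
      by (simp add: sum_distrib_left mult_ac)
    ultimately show "(\<Sum>j<n. (cnj (y $ i) * w $ j) * ?F $$ (i,j)) = cnj (y $ i) * y $ i" by simp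
  qed
  also have "\<dots> = of_real ((vnorm y)\<^sup>2)"
    using y by (simp add: vnorm_def sum_nonneg complex_norm_square[symmetric] mult.commute)
  finally have sum: "cmod (\<Sum>\<mu>\<in>spectrum x. residue G \<mu>) = (vnorm y)\<^sup>2" by (simp add: norm_power)
  have Gb: "cmod (G z) \<le> H * (vnorm y * (L * vnorm w))" if z: "z \<in> \<Gamma>" for z
  proof -
    have r: "?R z \<in> carrier_mat n n" using resolvent(1)[OF x] \<Gamma> z by blast
    have "G z = h z * (\<Sum>i<n. \<Sum>j<n. cnj (y $ i) * (?R z $$ (i,j) * w $ j))"
      by (simp add: G_def sum.cartesian_product case_prod_unfold sum_distrib_left mult_ac)
    also have "\<dots> = h z * (\<Sum>i<n. cnj (y $ i) * (?R z *\<^sub>v w) $ i)"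
      using r w by (simp add: scalar_prod_def atLeast0LessThan sum_distrib_left)
    also have "cmod \<dots> \<le> H * (vnorm y * vnorm (?R z *\<^sub>v w))"
      unfolding norm_mult
    proof (intro mult_mono H z)
      have "cmod (\<Sum>i<n. cnj (y $ i) * (?R z *\<^sub>v w) $ i) \<le> (\<Sum>i<n. \<bar>cmod (y $ i)\<bar> * \<bar>cmod ((?R z *\<^sub>v w) $ i)\<bar>)"
        by (intro order_trans[OF norm_sum]) (simp add: norm_mult)
      also have "\<dots> \<le> vnorm y * vnorm (?R z *\<^sub>v w)"
        using L2_set_mult_ineq[of "\<lambda>i. cmod (y $ i)" "\<lambda>i. cmod ((?R z *\<^sub>v w) $ i)" "{..<n}"] y r
        by (simp add: vnorm_L2_set)
      finally show "cmod (\<Sum>i<n. cnj (y $ i) * (?R z *\<^sub>v w) $ i) \<le> vnorm y * vnorm (?R z *\<^sub>v w)" .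
    qed auto
    also have "\<dots> \<le> H * (vnorm y * (L * vnorm w))"
      using vnorm_mult_mat_vec[of w "?R z"] r w L(1)[OF z] H(2)
      by (intro mult_left_mono order_trans[OF vnorm_mult_mat_vec] mult_right_mono) auto
    finally show ?thesis .
  qed
  have "(vnorm y)\<^sup>2 \<le> K * (H * (vnorm y * (L * vnorm w)))"
    unfolding sum[symmetric] by (rule K[OF Gh _ Gb]) (use H L in auto)
  then have "vnorm y * vnorm y \<le> vnorm y * (K * (H * L) * vnorm w)" by (simp add: power2_eq_square mult_ac)
  then have "vnorm y \<le> K * (H * L) * vnorm w" if "vnorm y > 0" using that by (simp add: mult_le_cancel_left_pos)
  moreover have "0 \<le> K * (H * L) * vnorm w" using \<open>0 \<le> K\<close> H L by simp
  ultimately show "vnorm (?F *\<^sub>v w) \<le> K * (H * L) * vnorm w"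
    unfolding y_def[symmetric] using vnorm_nonneg[of y] by linarith
qed (use assms in auto)

text \<open>\<Gamma> consists of circles around the zeros of \<open>q\<close>, and \<open>e\<close>
  bounds \<open>q\<close> from below on the circles and outside of them. If \<open>q(x)\<close> has
  norm at most \<open>e / 2\<close>, the spectrum lies inside the circles, and on them the resolvent
  is bounded in terms of \<open>q\<close> and \<open>R\<close> only.\<close>

lemma fun_calc_bounded:
  assumes \<Omega>: "open \<Omega>" and h: "h holomorphic_on \<Omega>" and q: "q \<noteq> 0" "\<And>z. poly q z = 0 \<Longrightarrow> z \<in> \<Omega>"
  obtains \<epsilon> where "\<epsilon> > 0"
    "\<And>n x. x \<in> carrier_mat n n \<Longrightarrow> op_norm (poly_mat q x) \<le> \<epsilon> \<Longrightarrow> spectrum x \<subseteq> \<Omega>"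
    "\<And>R. \<exists>C\<ge>0. \<forall>n x. x \<in> carrier_mat n n \<longrightarrow> op_norm x \<le> R \<longrightarrow> op_norm (poly_mat q x) \<le> \<epsilon> \<longrightarrow> op_norm (fun_calc h x) \<le> C"
proof -
  define Z where "Z = {a. poly q a = 0}"
  have Z: "finite Z" "Z \<subseteq> \<Omega>" using q poly_roots_finite[of q] by (auto simp: Z_def)
  obtain \<rho> where \<rho>: "\<rho> > 0" "\<And>a. a \<in> Z \<Longrightarrow> ball a (2 * \<rho>) \<subseteq> \<Omega>"
    "\<And>a b. a \<in> Z \<Longrightarrow> b \<in> Z \<Longrightarrow> a \<noteq> b \<Longrightarrow> 4 * \<rho> \<le> cmod (a - b)"
    using finite_separation[OF Z(1) \<Omega> Z(2)] by blast
  obtain e where e: "e > 0" "\<And>z. (\<And>a. a \<in> Z \<Longrightarrow> \<rho> \<le> cmod (z - a)) \<Longrightarrow> e \<le> cmod (poly q z)"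
    using poly_lower_bound[OF q(1) \<rho>(1)] unfolding Z_def by blast
  have sp: "spectrum x \<subseteq> (\<Union>a\<in>Z. ball a \<rho>)" if x: "x \<in> carrier_mat n n" "op_norm (poly_mat q x) \<le> e / 2" for n x
  proof
    fix k assume "k \<in> spectrum x"
    then have "cmod (poly q k) \<le> e / 2" using order_trans[OF cmod_poly_spectrum_le[OF x(1)] x(2)] by simp
    then have "\<not> (\<forall>a\<in>Z. \<rho> \<le> cmod (k - a))" using e(2)[of k] e(1) by force
    then show "k \<in> (\<Union>a\<in>Z. ball a \<rho>)" by (auto simp: dist_norm norm_minus_commute not_le)
  qed
  have sub: "(\<Union>a\<in>Z. ball a \<rho>) \<subseteq> \<Omega>" using \<rho> subset_ball[of \<rho> "2 * \<rho>"] by fastforce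
  define \<Gamma> where "\<Gamma> = (\<Union>a\<in>Z. sphere a \<rho>)"
  have \<Gamma>\<Omega>: "\<Gamma> \<subseteq> \<Omega>"
  proof
    fix z assume "z \<in> \<Gamma>"
    then obtain a where a: "a \<in> Z" "dist a z = \<rho>" by (auto simp: \<Gamma>_def)
    then have "z \<in> ball a (2 * \<rho>)" using \<rho>(1) by simp
    then show "z \<in> \<Omega>" using \<rho>(2) a by blast
  qed
  have \<Gamma>sep: "\<rho> \<le> cmod (z - a)" if z: "z \<in> \<Gamma>" and a: "a \<in> Z" for z a
  proof -
    obtain b where b: "b \<in> Z" "cmod (z - b) = \<rho>" using z by (auto simp: \<Gamma>_def dist_norm norm_minus_commute)
    show ?thesis
    proof (cases "a = b")
      case False
      then have "4 * \<rho> \<le> cmod (a - b)" using \<rho>(3) a b by blast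
      also have "\<dots> = cmod ((z - b) - (z - a))" by simp
      also have "\<dots> \<le> cmod (z - b) + cmod (z - a)" by (rule norm_triangle_ineq4)
      finally show ?thesis using b \<rho>(1) by linarith
    qed (use b in simp)
  qed
  have \<Gamma>e: "e \<le> cmod (poly q z)" if "z \<in> \<Gamma>" for z using e(2) \<Gamma>sep[OF that] by blast
  have comp: "compact \<Gamma>" unfolding \<Gamma>_def using Z by (intro compact_UN) auto
  have "bounded (h ` \<Gamma>)"
    by (intro compact_imp_bounded compact_continuous_image comp holomorphic_on_imp_continuous_on holomorphic_on_subset[OF h \<Gamma>\<Omega>])
  then obtain H0 where H0: "\<And>z. z \<in> \<Gamma> \<Longrightarrow> cmod (h z) \<le> H0" by (auto simp: bounded_iff)
  define H where "H = max 0 H0"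
  have H: "\<And>z. z \<in> \<Gamma> \<Longrightarrow> cmod (h z) \<le> H" "0 \<le> H" using H0 by (auto simp: H_def intro: max.coboundedI2)
  obtain M0 where M0: "\<And>z. z \<in> \<Gamma> \<Longrightarrow> cmod z \<le> M0"
    using compact_imp_bounded[OF comp] by (auto simp: bounded_iff)
  show thesis
  proof (rule that[of "e / 2"])
    show "spectrum x \<subseteq> \<Omega>" if "x \<in> carrier_mat n n" "op_norm (poly_mat q x) \<le> e / 2" for n x
      using sp[OF that] sub by blast
    fix R :: real
    define M where "M = max 0 (max M0 R)"
    obtain C where C: "C \<ge> 0" "\<And>n x z. x \<in> carrier_mat n n \<Longrightarrow> op_norm x \<le> M \<Longrightarrow> cmod z \<le> M \<Longrightarrow>
      \<exists>Q. Q \<in> carrier_mat n n \<and> (z \<cdot>\<^sub>m 1\<^sub>m n - x) * Q = poly q z \<cdot>\<^sub>m 1\<^sub>m n - poly_mat q x \<and> op_norm Q \<le> C"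
      using poly_divided_difference_bounded[of M q] by (auto simp: M_def)
    have "op_norm (fun_calc h x) \<le> (real (card Z) * \<rho>) * (H * (C / (e / 2)))"
      if x: "x \<in> carrier_mat n n" "op_norm x \<le> R" "op_norm (poly_mat q x) \<le> e / 2" for n x
    proof (rule op_norm_fun_calc_le[OF x(1) _ \<Omega> h])
      have dis: "\<Gamma> \<inter> spectrum x = {}"
      proof -
        have "e \<le> op_norm (poly_mat q x)" if "z \<in> \<Gamma>" "z \<in> spectrum x" for z
          using order_trans[OF \<Gamma>e[OF that(1)] cmod_poly_spectrum_le[OF x(1) that(2)]] .
        then show ?thesis using x(3) e(1) by force
      qed
      show "spectrum x \<subseteq> \<Omega>" using sp[OF x(1,3)] sub by blast
      show "\<Gamma> \<subseteq> \<Omega> - spectrum x" using \<Gamma>\<Omega> dis by blast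
      fix G B assume G: "G holomorphic_on \<Omega> - spectrum x" "0 \<le> B" "\<And>z. z \<in> \<Gamma> \<Longrightarrow> cmod (G z) \<le> B"
      have GB: "cmod (G z) \<le> B" if "a \<in> Z" "cmod (z - a) = \<rho>" for a z
        by (rule G(3)) (use that in \<open>auto simp: \<Gamma>_def dist_norm norm_minus_commute\<close>)
      have "cmod (\<Sum>\<mu>\<in>spectrum x. residue G \<mu>) \<le> real (card Z) * (\<rho> * B)"
        by (rule sum_residues_bound[OF Z(1) \<rho> \<Omega> finite_spectrum[OF x(1)] sp[OF x(1,3)] G(1,2) GB])
      then show "cmod (\<Sum>\<mu>\<in>spectrum x. residue G \<mu>) \<le> real (card Z) * \<rho> * B" by (simp add: mult.assoc)
    next
      fix z assume z: "z \<in> \<Gamma>"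
      have "e \<le> op_norm (poly_mat q x)" if "z \<in> spectrum x"
        using order_trans[OF \<Gamma>e[OF z] cmod_poly_spectrum_le[OF x(1) that]] .
      then have zs: "z \<notin> spectrum x" using x(3) e(1) by force
      have "op_norm x \<le> M" "cmod z \<le> M" using x(2) M0[OF z] by (auto simp: M_def)
      then obtain Q where Q: "Q \<in> carrier_mat n n" "(z \<cdot>\<^sub>m 1\<^sub>m n - x) * Q = poly q z \<cdot>\<^sub>m 1\<^sub>m n - poly_mat q x" "op_norm Q \<le> C"
        using C(2)[OF x(1)] by blast
      let ?r = "op_norm (mat_inv (z \<cdot>\<^sub>m 1\<^sub>m n - x))"
      \<comment> \<open>On \<Gamma> the second factor on the right is at least
        \<open>e - e / 2\<close>.\<close>
      have "?r * (e / 2) \<le> ?r * (cmod (poly q z) - op_norm (poly_mat q x))"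
        using \<Gamma>e[OF z] x(3) by (intro mult_left_mono) auto
      also have "\<dots> \<le> C" using op_norm_resolvent_le[OF x(1) zs Q(1,2)] Q(3) by linarith
      finally show "?r \<le> C / (e / 2)" using e(1) by (simp add: field_simps)
    qed (use H \<rho> C e in auto)
    then show "\<exists>C\<ge>0. \<forall>n x. x \<in> carrier_mat n n \<longrightarrow> op_norm x \<le> R \<longrightarrow> op_norm (poly_mat q x) \<le> e / 2 \<longrightarrow> op_norm (fun_calc h x) \<le> C"
      using \<rho> C e H by (intro exI[of _ "(real (card Z) * \<rho>) * (H * (C / (e / 2)))"]) auto
  qed (use e in simp)
qed

text \<open>Writing \<open>h = p + q g\<close> gives \<open>h(x) - p(x) = q(x) g(x)\<close>, where
  \<open>g(x)\<close> is bounded by \<open>fun_calc_bounded\<close>. So one polynomial approximates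
  \<open>h\<close> at all levels, on bounded matrices with small \<open>q(x)\<close>.\<close>

lemma fun_calc_approx:
  assumes \<Omega>: "open \<Omega>" and h: "h holomorphic_on \<Omega>" and q: "q \<noteq> 0" "\<And>z. poly q z = 0 \<Longrightarrow> z \<in> \<Omega>"
  shows "\<exists>p \<epsilon>. \<epsilon> > 0 \<and>
    (\<forall>n x. x \<in> carrier_mat n n \<longrightarrow> poly_mat q x = 0\<^sub>m n n \<longrightarrow> fun_calc h x = poly_mat p x) \<and>
    (\<forall>n x. x \<in> carrier_mat n n \<longrightarrow> op_norm (poly_mat q x) \<le> \<epsilon> \<longrightarrow> spectrum x \<subseteq> \<Omega>) \<and>
    (\<forall>R. \<exists>C\<ge>0. \<forall>n x. x \<in> carrier_mat n n \<longrightarrow> op_norm x \<le> R \<longrightarrow> op_norm (poly_mat q x) \<le> \<epsilon> \<longrightarrow>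
        op_norm (fun_calc h x - poly_mat p x) \<le> C * op_norm (poly_mat q x))"
proof -
  obtain p g where pg: "g holomorphic_on \<Omega>" "\<And>z. z \<in> \<Omega> \<Longrightarrow> h z = poly p z + poly q z * g z"
    using holomorphic_interpolation[OF \<Omega> h q] by blast
  obtain \<epsilon> where \<epsilon>: "\<epsilon> > 0"
    "\<And>n x. x \<in> carrier_mat n n \<Longrightarrow> op_norm (poly_mat q x) \<le> \<epsilon> \<Longrightarrow> spectrum x \<subseteq> \<Omega>"
    "\<And>R. \<exists>C\<ge>0. \<forall>n x. x \<in> carrier_mat n n \<longrightarrow> op_norm x \<le> R \<longrightarrow> op_norm (poly_mat q x) \<le> \<epsilon> \<longrightarrow> op_norm (fun_calc g x) \<le> C"
    using fun_calc_bounded[OF \<Omega> pg(1) q] by blast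
  \<comment> \<open>Here \<open>q(x)\<close> is not zero in general. A polynomial \<open>q'\<close>
    that annihilates \<open>x\<close> serves to interpolate \<open>g\<close> by \<open>p'\<close>,
    and then \<open>p + q p'\<close> interpolates \<open>h\<close> modulo \<open>q'\<close>.\<close>
  have eq: "fun_calc h x = poly_mat p x + poly_mat q x * fun_calc g x"
    if x: "x \<in> carrier_mat n n" "spectrum x \<subseteq> \<Omega>" for n x
  proof -
    obtain q' where q': "q' \<noteq> 0" "poly_mat q' x = 0\<^sub>m n n" "\<And>k. poly q' k = 0 \<Longrightarrow> k \<in> spectrum x"
      using annihilating_poly[OF x(1)] by blast
    have r: "\<And>k. poly q' k = 0 \<Longrightarrow> k \<in> \<Omega>" using q'(3) x by blast
    obtain p' g' where g': "g' holomorphic_on \<Omega>" "\<And>z. z \<in> \<Omega> \<Longrightarrow> g z = poly p' z + poly q' z * g' z"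
      using holomorphic_interpolation[OF \<Omega> pg(1) q'(1) r] by blast
    have "fun_calc h x = poly_mat (p + q * p') x"
    proof (rule fun_calc_eq_poly_mat[OF x(1) \<Omega> x(2) _ q'(2)])
      show "(\<lambda>z. poly q z * g' z) holomorphic_on \<Omega>" by (intro holomorphic_intros g')
    qed (simp add: pg g' algebra_simps)
    moreover have "fun_calc g x = poly_mat p' x"
      by (rule fun_calc_eq_poly_mat[OF x(1) \<Omega> x(2) g'(1) q'(2) g'(2)])
    ultimately show ?thesis by (simp add: poly_mat_add[OF x(1)] poly_mat_mult[OF x(1)])
  qed
  show ?thesis
  proof (rule exI[of _ p], rule exI[of _ \<epsilon>], intro conjI allI impI \<epsilon>(1))
    fix n x assume x: "x \<in> carrier_mat n n" "poly_mat q x = 0\<^sub>m n n"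
    have "spectrum x \<subseteq> \<Omega>" using poly_spectrum_eq_0[OF x] q(2) by blast
    then show "fun_calc h x = poly_mat p x"
      by (rule fun_calc_eq_poly_mat[OF x(1) \<Omega> _ pg(1) x(2) pg(2)])
  next
    fix n and x :: "complex mat" assume "x \<in> carrier_mat n n" "op_norm (poly_mat q x) \<le> \<epsilon>"
    then show "spectrum x \<subseteq> \<Omega>" by (rule \<epsilon>(2))
  next
    fix R
    obtain C where C: "C \<ge> 0" "\<And>n x. x \<in> carrier_mat n n \<Longrightarrow> op_norm x \<le> R \<Longrightarrow> op_norm (poly_mat q x) \<le> \<epsilon> \<Longrightarrow> op_norm (fun_calc g x) \<le> C"
      using \<epsilon>(3)[of R] by blast
    have "op_norm (fun_calc h x - poly_mat p x) \<le> C * op_norm (poly_mat q x)"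
      if x: "x \<in> carrier_mat n n" "op_norm x \<le> R" "op_norm (poly_mat q x) \<le> \<epsilon>" for n x
    proof -
      have "fun_calc h x - poly_mat p x = poly_mat q x * fun_calc g x"
        unfolding eq[OF x(1) \<epsilon>(2)[OF x(1,3)]] using x(1) by (intro eq_matI) auto
      then have "op_norm (fun_calc h x - poly_mat p x) \<le> op_norm (poly_mat q x) * op_norm (fun_calc g x)"
        using op_norm_mult[of "poly_mat q x" n n "fun_calc g x" n] x by simp
      also have "\<dots> \<le> op_norm (poly_mat q x) * C" by (intro mult_left_mono C(2)[OF x]) simp
      finally show ?thesis by (simp add: mult.commute)
    qed
    then show "\<exists>C\<ge>0. \<forall>n x. x \<in> carrier_mat n n \<longrightarrow> op_norm x \<le> R \<longrightarrow> op_norm (poly_mat q x) \<le> \<epsilon> \<longrightarrow>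
        op_norm (fun_calc h x - poly_mat p x) \<le> C * op_norm (poly_mat q x)"
      using C(1) by blast
  qed
qed

section \<open>Free polynomials and the free topology\<close>

lemma M_level_nth: "x \<in> M_level d n \<Longrightarrow> i < d \<Longrightarrow> x ! i \<in> carrier_mat n n"
  by (auto simp: M_level_def)

lemma lvl_M_level: "x \<in> M_level d n \<Longrightarrow> 0 < d \<Longrightarrow> lvl x = n"
  by (cases x) (auto simp: M_level_def lvl_def)

lemma ME:
  assumes "x \<in> M d"
  obtains n where "1 \<le> n" "x \<in> M_level d n"
  using assms by (auto simp: M_def)

lemma MI: "x \<in> M_level d n \<Longrightarrow> 1 \<le> n \<Longrightarrow> x \<in> M d"
  by (auto simp: M_def)

lemma eval_word_Nil: "eval_word x [] = 1\<^sub>m (lvl x)"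
  and eval_word_Cons: "eval_word x (i # w) = x ! i * eval_word x w"
  by (auto simp: eval_word_def)

lemma eval_word_carrier:
  assumes "x \<in> M_level d n" "0 < d" "w \<in> lists {..<d}"
  shows "eval_word x w \<in> carrier_mat n n"
  using assms(3)
proof (induction w)
  case Nil
  then show ?case using lvl_M_level[OF assms(1,2)] by (simp add: eval_word_Nil)
next
  case (Cons i w)
  then show ?case using M_level_nth[OF assms(1), of i] by (auto simp: eval_word_Cons)
qed

lemma eval_word_append:
  assumes "x \<in> M_level d n" "0 < d" "v \<in> lists {..<d}" "w \<in> lists {..<d}"
  shows "eval_word x (v @ w) = eval_word x v * eval_word x w"
  using assms(3)
proof (induction v)
  case Nil
  then show ?case using lvl_M_level[OF assms(1,2)] eval_word_carrier[OF assms(1,2,4)] by (simp add: eval_word_Nil)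
next
  case (Cons i v)
  then show ?case
    using assoc_mult_mat[of "x ! i" n n "eval_word x v" n "eval_word x w" n]
      M_level_nth[OF assms(1), of i] eval_word_carrier[OF assms(1,2)] assms(4) by (auto simp: eval_word_Cons)
qed

lemma eval_poly_carrier [simp]: "eval_poly p x \<in> carrier_mat (lvl x) (lvl x)"
  and dim_eval_poly [simp]: "dim_row (eval_poly p x) = lvl x" "dim_col (eval_poly p x) = lvl x"
  by (auto simp: eval_poly_def)

lemma eval_poly_index:
  assumes "finite S" "Poly_Mapping.keys p \<subseteq> S" "i < lvl x" "j < lvl x"
  shows "eval_poly p x $$ (i,j) = (\<Sum>w\<in>S. Poly_Mapping.lookup p w * eval_word x w $$ (i,j))"
proof -
  have "eval_poly p x $$ (i,j) = (\<Sum>w\<in>Poly_Mapping.keys p. Poly_Mapping.lookup p w * eval_word x w $$ (i,j))"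
    using assms by (simp add: eval_poly_def)
  also have "\<dots> = (\<Sum>w\<in>S. Poly_Mapping.lookup p w * eval_word x w $$ (i,j))"
    using assms by (intro sum.mono_neutral_left) (auto simp: in_keys_iff)
  finally show ?thesis .
qed

lemma eval_poly_add: "eval_poly (p + q) x = eval_poly p x + eval_poly q x"
proof (rule eq_matI)
  fix i j assume "i < dim_row (eval_poly p x + eval_poly q x)" "j < dim_col (eval_poly p x + eval_poly q x)"
  then have ij: "i < lvl x" "j < lvl x" by auto
  let ?S = "Poly_Mapping.keys p \<union> Poly_Mapping.keys q"
  have S: "finite ?S" "Poly_Mapping.keys p \<subseteq> ?S" "Poly_Mapping.keys q \<subseteq> ?S" "Poly_Mapping.keys (p + q) \<subseteq> ?S"
    using Poly_Mapping.keys_add[of p q] by auto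
  show "eval_poly (p + q) x $$ (i,j) = (eval_poly p x + eval_poly q x) $$ (i,j)"
    unfolding eval_poly_index[OF S(1,4) ij] lookup_add distrib_right sum.distrib
      eval_poly_index[OF S(1,2) ij, symmetric] eval_poly_index[OF S(1,3) ij, symmetric]
    using ij by simp
qed auto

lemma eval_poly_single:
  assumes "eval_word x w \<in> carrier_mat (lvl x) (lvl x)"
  shows "eval_poly (Poly_Mapping.single w c) x = c \<cdot>\<^sub>m eval_word x w"
proof (rule eq_matI)
  fix i j assume "i < dim_row (c \<cdot>\<^sub>m eval_word x w)" "j < dim_col (c \<cdot>\<^sub>m eval_word x w)"
  then have ij: "i < lvl x" "j < lvl x" using assms by auto
  show "eval_poly (Poly_Mapping.single w c) x $$ (i,j) = (c \<cdot>\<^sub>m eval_word x w) $$ (i,j)"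
    using ij assms eval_poly_index[of "{w}" "Poly_Mapping.single w c" i x j] by simp
qed (use assms in auto)

text \<open>The polynomial is hidden by a quantifier so that closure properties can replace
  computations with coefficients.\<close>

definition poly_fun :: "nat \<Rightarrow> (point \<Rightarrow> complex mat) \<Rightarrow> bool" where
  "poly_fun d \<phi> \<longleftrightarrow> (\<exists>p\<in>free_polys d. \<forall>x\<in>M d. eval_poly p x = \<phi> x)"

lemma poly_fun_add:
  assumes "poly_fun d \<phi>" "poly_fun d \<psi>"
  shows "poly_fun d (\<lambda>x. \<phi> x + \<psi> x)"
proof -
  obtain p q where "p \<in> free_polys d" "q \<in> free_polys d" "\<And>x. x \<in> M d \<Longrightarrow> eval_poly p x = \<phi> x" "\<And>x. x \<in> M d \<Longrightarrow> eval_poly q x = \<psi> x"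
    using assms unfolding poly_fun_def by blast
  moreover from this have "Poly_Mapping.keys (p + q) \<subseteq> lists {..<d}"
    using order_trans[OF Poly_Mapping.keys_add[of p q] Un_least] by (simp add: free_polys_def)
  ultimately show ?thesis unfolding poly_fun_def
    by (intro bexI[of _ "p + q"]) (simp_all add: eval_poly_add free_polys_def)
qed

lemma poly_fun_word:
  assumes d: "0 < d" and w: "w \<in> lists {..<d}"
  shows "poly_fun d (\<lambda>x. c \<cdot>\<^sub>m eval_word x w)"
  unfolding poly_fun_def
proof (intro bexI ballI)
  fix x assume "x \<in> M d"
  then obtain n where x: "x \<in> M_level d n" by (rule ME)
  show "eval_poly (Poly_Mapping.single w c) x = c \<cdot>\<^sub>m eval_word x w"
    using eval_word_carrier[OF x d w] lvl_M_level[OF x d] by (intro eval_poly_single) simp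
qed (use w in \<open>auto simp: free_polys_def\<close>)

lemma poly_fun_cong:
  assumes "poly_fun d \<phi>" "\<And>n x. x \<in> M_level d n \<Longrightarrow> 1 \<le> n \<Longrightarrow> \<psi> x = \<phi> x"
  shows "poly_fun d \<psi>"
  using assms unfolding poly_fun_def by (metis ME)

lemma poly_fun_const:
  assumes d: "0 < d"
  shows "poly_fun d (\<lambda>x. c \<cdot>\<^sub>m 1\<^sub>m (lvl x))"
  using poly_fun_word[OF d, of "[]" c] by (simp add: eval_word_Nil)

lemma poly_fun_coord:
  assumes d: "i < d"
  shows "poly_fun d (\<lambda>x. x ! i)"
proof (rule poly_fun_cong[OF poly_fun_word[of d "[i]" 1]])
  fix n x assume x: "x \<in> M_level d n"
  show "x ! i = 1 \<cdot>\<^sub>m eval_word x [i]"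
    using M_level_nth[OF x d] lvl_M_level[OF x] d by (intro eq_matI) (auto simp: eval_word_Cons eval_word_Nil)
qed (use d in auto)

lemma poly_fun_carrier:
  assumes "poly_fun d \<phi>" "x \<in> M_level d n" "1 \<le> n" "0 < d"
  shows "\<phi> x \<in> carrier_mat n n"
proof -
  obtain p where "eval_poly p x = \<phi> x" using assms MI unfolding poly_fun_def by blast
  then show ?thesis using eval_poly_carrier[of p x] lvl_M_level[OF assms(2,4)] by simp
qed

lemma poly_fun_sum:
  assumes d: "0 < d" and S: "finite S" "\<And>s. s \<in> S \<Longrightarrow> poly_fun d (\<phi> s)"
  shows "poly_fun d (\<lambda>x. mat (lvl x) (lvl x) (\<lambda>ij. \<Sum>s\<in>S. \<phi> s x $$ ij))"
  using S
proof (induction rule: finite_induct)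
  case empty
  show ?case
    by (rule poly_fun_cong[OF poly_fun_const[OF d, of 0]]) auto
next
  case (insert s S)
  show ?case
  proof (rule poly_fun_cong[OF poly_fun_add[OF insert(4)[OF insertI1] insert(3)]])
    fix n x assume x: "x \<in> M_level d n" "1 \<le> n"
    show "mat (lvl x) (lvl x) (\<lambda>ij. \<Sum>s\<in>insert s S. \<phi> s x $$ ij) =
      \<phi> s x + mat (lvl x) (lvl x) (\<lambda>ij. \<Sum>s\<in>S. \<phi> s x $$ ij)"
      using poly_fun_carrier[OF insert(4)[OF insertI1] x d] lvl_M_level[OF x(1) d] insert(1,2)
      by (intro eq_matI) auto
  qed (use insert in auto)
qed

text \<open>Words multiply by concatenation, so the product is a sum over pairs of words.\<close>

lemma poly_fun_mult:
  assumes d: "0 < d" and "poly_fun d \<phi>" "poly_fun d \<psi>"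
  shows "poly_fun d (\<lambda>x. \<phi> x * \<psi> x)"
proof -
  obtain p where p: "p \<in> free_polys d" "\<And>x. x \<in> M d \<Longrightarrow> eval_poly p x = \<phi> x"
    using assms unfolding poly_fun_def by blast
  obtain q where q: "q \<in> free_polys d" "\<And>x. x \<in> M d \<Longrightarrow> eval_poly q x = \<psi> x"
    using assms unfolding poly_fun_def by blast
  let ?P = "Poly_Mapping.keys p" and ?Q = "Poly_Mapping.keys q"
  define \<chi> where "\<chi> s x = (case s of (v,w) \<Rightarrow> (Poly_Mapping.lookup p v * Poly_Mapping.lookup q w) \<cdot>\<^sub>m eval_word x (v @ w))" for s x
  have keys: "?P \<subseteq> lists {..<d}" "?Q \<subseteq> lists {..<d}" using p q by (auto simp: free_polys_def)
  have "poly_fun d (\<chi> s)" if "s \<in> ?P \<times> ?Q" for s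
  proof -
    obtain v w where "s = (v,w)" by (cases s)
    then have vw: "s = (v,w)" "v \<in> ?P" "w \<in> ?Q" using that by auto
    then have s: "s = (v,w)" "v @ w \<in> lists {..<d}"
      using subsetD[OF keys(1) vw(2)] subsetD[OF keys(2) vw(3)] by auto
    show ?thesis unfolding s(1) \<chi>_def using poly_fun_word[OF d s(2)] by simp
  qed
  then have "poly_fun d (\<lambda>x. mat (lvl x) (lvl x) (\<lambda>ij. \<Sum>s\<in>?P \<times> ?Q. \<chi> s x $$ ij))"
    by (intro poly_fun_sum d) auto
  then show ?thesis
  proof (rule poly_fun_cong)
    fix n x assume x: "x \<in> M_level d n" "1 \<le> n"
    have l: "lvl x = n" by (rule lvl_M_level[OF x(1) d])
    have ew: "eval_word x w \<in> carrier_mat n n" if "w \<in> lists {..<d}" for w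
      by (rule eval_word_carrier[OF x(1) d that])
    show "\<phi> x * \<psi> x = mat (lvl x) (lvl x) (\<lambda>ij. \<Sum>s\<in>?P \<times> ?Q. \<chi> s x $$ ij)"
    proof (rule eq_matI)
      fix i j assume "i < dim_row (mat (lvl x) (lvl x) (\<lambda>ij. \<Sum>s\<in>?P \<times> ?Q. \<chi> s x $$ ij))"
        "j < dim_col (mat (lvl x) (lvl x) (\<lambda>ij. \<Sum>s\<in>?P \<times> ?Q. \<chi> s x $$ ij))"
      then have ij: "i < n" "j < n" using l by auto
      have c: "\<phi> x = eval_poly p x" "\<psi> x = eval_poly q x" using p q MI[OF x] by auto
      have "(\<phi> x * \<psi> x) $$ (i,j) = (\<Sum>k<n. (\<Sum>v\<in>?P. Poly_Mapping.lookup p v * eval_word x v $$ (i,k)) * (\<Sum>w\<in>?Q. Poly_Mapping.lookup q w * eval_word x w $$ (k,j)))"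
        unfolding c using ij l
        by (simp add: scalar_prod_def atLeast0LessThan eval_poly_index[OF finite_keys order_refl])
      also have "\<dots> = (\<Sum>k<n. \<Sum>v\<in>?P. \<Sum>w\<in>?Q. (Poly_Mapping.lookup p v * Poly_Mapping.lookup q w) * (eval_word x v $$ (i,k) * eval_word x w $$ (k,j)))"
        by (simp add: sum_product mult_ac)
      also have "\<dots> = (\<Sum>v\<in>?P. \<Sum>w\<in>?Q. (Poly_Mapping.lookup p v * Poly_Mapping.lookup q w) * (\<Sum>k<n. eval_word x v $$ (i,k) * eval_word x w $$ (k,j)))"
        by (subst sum.swap, intro sum.cong refl, subst sum.swap) (simp add: sum_distrib_left)
      also have "\<dots> = (\<Sum>v\<in>?P. \<Sum>w\<in>?Q. \<chi> (v,w) x $$ (i,j))"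
      proof (intro sum.cong refl)
        fix v w assume vw: "v \<in> ?P" "w \<in> ?Q"
        then have c: "eval_word x v \<in> carrier_mat n n" "eval_word x w \<in> carrier_mat n n" using ew keys by auto
        have "eval_word x (v @ w) = eval_word x v * eval_word x w"
          by (rule eval_word_append[OF x(1) d]) (use vw keys in auto)
        then show "(Poly_Mapping.lookup p v * Poly_Mapping.lookup q w) * (\<Sum>k<n. eval_word x v $$ (i,k) * eval_word x w $$ (k,j)) = \<chi> (v,w) x $$ (i,j)"
          using c ij by (simp add: \<chi>_def scalar_prod_def atLeast0LessThan)
      qed
      finally show "(\<phi> x * \<psi> x) $$ (i,j) = mat (lvl x) (lvl x) (\<lambda>ij. \<Sum>s\<in>?P \<times> ?Q. \<chi> s x $$ ij) $$ (i,j)"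
        using ij l by (simp add: sum.cartesian_product)
    qed (use l p q MI[OF x] in \<open>auto simp flip: p(2) q(2)\<close>)
  qed
qed

lemma poly_fun_smult:
  assumes d: "0 < d" and "poly_fun d \<phi>"
  shows "poly_fun d (\<lambda>x. c \<cdot>\<^sub>m \<phi> x)"
proof (rule poly_fun_cong[OF poly_fun_mult[OF d poly_fun_const[OF d, of c] assms(2)]])
  fix n x assume x: "x \<in> M_level d n" "1 \<le> n"
  show "c \<cdot>\<^sub>m \<phi> x = c \<cdot>\<^sub>m 1\<^sub>m (lvl x) * \<phi> x"
    using poly_fun_carrier[OF assms(2) x d] lvl_M_level[OF x(1) d] by (simp add: mult_smult_assoc_mat[of _ n n _ n])
qed

lemma poly_fun_diff:
  assumes d: "0 < d" and "poly_fun d \<phi>" "poly_fun d \<psi>"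
  shows "poly_fun d (\<lambda>x. \<phi> x - \<psi> x)"
proof (rule poly_fun_cong[OF poly_fun_add[OF assms(2) poly_fun_smult[OF d assms(3), of "-1"]]])
  fix n x assume x: "x \<in> M_level d n" "1 \<le> n"
  show "\<phi> x - \<psi> x = \<phi> x + -1 \<cdot>\<^sub>m \<psi> x"
    using poly_fun_carrier[OF assms(2) x d] poly_fun_carrier[OF assms(3) x d] by (intro eq_matI) auto
qed

lemma poly_fun_poly_mat:
  assumes d: "0 < d" and \<phi>: "poly_fun d \<phi>"
  shows "poly_fun d (\<lambda>x. poly_mat p (\<phi> x))"
proof (induction p)
  case 0
  show ?case
  proof (rule poly_fun_cong[OF poly_fun_const[OF d, of 0]])
    fix n x assume x: "x \<in> M_level d n" "1 \<le> n"
    show "poly_mat 0 (\<phi> x) = 0 \<cdot>\<^sub>m 1\<^sub>m (lvl x)"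
      using poly_fun_carrier[OF \<phi> x d] lvl_M_level[OF x(1) d] by (intro eq_matI) auto
  qed
next
  case (pCons a p)
  show ?case
  proof (rule poly_fun_cong[OF poly_fun_add[OF poly_fun_const[OF d, of a] poly_fun_mult[OF d \<phi> pCons(2)]]])
    fix n x assume x: "x \<in> M_level d n" "1 \<le> n"
    show "poly_mat (pCons a p) (\<phi> x) = a \<cdot>\<^sub>m 1\<^sub>m (lvl x) + \<phi> x * poly_mat p (\<phi> x)"
      using poly_mat_pCons[OF poly_fun_carrier[OF \<phi> x d]] lvl_M_level[OF x(1) d] by simp
  qed
qed

lemma poly_fun_comp:
  assumes d: "0 < d" and e: "0 < e" and p: "p \<in> free_polys e" and \<phi>: "\<And>i. i < e \<Longrightarrow> poly_fun d (\<phi> i)"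
  shows "poly_fun d (\<lambda>x. eval_poly p (map (\<lambda>i. \<phi> i x) [0..<e]))"
proof -
  let ?\<Phi> = "\<lambda>x. map (\<lambda>i. \<phi> i x) [0..<e]"
  have \<Phi>: "?\<Phi> x \<in> M_level e n" if "x \<in> M_level d n" "1 \<le> n" for x n
    using poly_fun_carrier[OF \<phi> that d] by (auto simp: M_level_def)
  have word: "poly_fun d (\<lambda>x. eval_word (?\<Phi> x) w)" if "w \<in> lists {..<e}" for w
    using that
  proof (induction w)
    case Nil
    show ?case
    proof (rule poly_fun_cong[OF poly_fun_const[OF d, of 1]])
      fix n x assume x: "x \<in> M_level d n" "1 \<le> n"
      show "eval_word (?\<Phi> x) [] = 1 \<cdot>\<^sub>m 1\<^sub>m (lvl x)"
        using lvl_M_level[OF \<Phi>[OF x] e] lvl_M_level[OF x(1) d] by (auto simp: eval_word_Nil)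
    qed
  next
    case (Cons i w)
    then have i: "i < e" by auto
    show ?case
      by (rule poly_fun_cong[OF poly_fun_mult[OF d \<phi>[OF i] Cons.IH]]) (use i in \<open>simp add: eval_word_Cons\<close>)
  qed
  let ?P = "Poly_Mapping.keys p"
  have keys: "?P \<subseteq> lists {..<e}" using p by (auto simp: free_polys_def)
  have "poly_fun d (\<lambda>x. mat (lvl x) (lvl x) (\<lambda>ij. \<Sum>w\<in>?P. (Poly_Mapping.lookup p w \<cdot>\<^sub>m eval_word (?\<Phi> x) w) $$ ij))"
    using keys by (intro poly_fun_sum d poly_fun_smult word) auto
  then show ?thesis
  proof (rule poly_fun_cong)
    fix n x assume x: "x \<in> M_level d n" "1 \<le> n"
    have l: "lvl x = n" "lvl (?\<Phi> x) = n" using lvl_M_level[OF \<Phi>[OF x] e] lvl_M_level[OF x(1) d] by auto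
    have c: "eval_word (?\<Phi> x) w \<in> carrier_mat n n" if "w \<in> ?P" for w
      using eval_word_carrier[OF \<Phi>[OF x] e] keys that by blast
    let ?M = "mat (lvl x) (lvl x) (\<lambda>ij. \<Sum>w\<in>?P. (Poly_Mapping.lookup p w \<cdot>\<^sub>m eval_word (?\<Phi> x) w) $$ ij)"
    show "eval_poly p (?\<Phi> x) = ?M"
    proof (rule eq_matI)
      fix i j assume "i < dim_row ?M" "j < dim_col ?M"
      then have ij: "i < n" "j < n" using l by auto
      have "eval_poly p (?\<Phi> x) $$ (i,j) = (\<Sum>w\<in>?P. Poly_Mapping.lookup p w * eval_word (?\<Phi> x) w $$ (i,j))"
        by (rule eval_poly_index[OF finite_keys order_refl]) (use ij l in auto)
      also have "\<dots> = (\<Sum>w\<in>?P. (Poly_Mapping.lookup p w \<cdot>\<^sub>m eval_word (?\<Phi> x) w) $$ (i,j))"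
        using c ij by (intro sum.cong refl) (metis carrier_matD index_smult_mat(1))
      also have "\<dots> = ?M $$ (i,j)" using ij l by simp
      finally show "eval_poly p (?\<Phi> x) $$ (i,j) = ?M $$ (i,j)" .
    qed (use l in auto)
  qed
qed

section \<open>Lipschitz estimates at all levels and the open sets of the free topology\<close>

definition close :: "nat \<Rightarrow> real \<Rightarrow> real \<Rightarrow> point \<Rightarrow> point \<Rightarrow> bool" where
  "close d R \<eta> x y \<longleftrightarrow> (\<exists>n\<ge>1. x \<in> M_level d n \<and> y \<in> M_level d n) \<and>
     (\<forall>i<d. op_norm (x ! i) \<le> R \<and> op_norm (y ! i) \<le> R \<and> op_norm (x ! i - y ! i) \<le> \<eta>)"

lemma close_sym: "close d R \<eta> x y \<Longrightarrow> close d R \<eta> y x"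
  unfolding close_def by (metis M_level_nth op_norm_minus_commute)

lemma close_nonneg: "close d R \<eta> x y \<Longrightarrow> 0 < d \<Longrightarrow> 0 \<le> \<eta> \<and> 0 \<le> R"
  unfolding close_def using op_norm_nonneg order_trans by blast

text \<open>The induction step is \<open>x A - y A' = x (A - A') + (x - y) A'\<close>. The level is
  quantified inside \<open>close\<close>, so \<open>B\<close> and \<open>L\<close> serve all sizes
  at once.\<close>

lemma eval_word_lipschitz:
  assumes d: "0 < d" and w: "w \<in> lists {..<d}"
  shows "\<exists>B\<ge>0. \<exists>L\<ge>0. \<forall>\<eta> x y. close d R \<eta> x y \<longrightarrow>
    op_norm (eval_word x w) \<le> B \<and> op_norm (eval_word x w - eval_word y w) \<le> L * \<eta>"
  using w
proof (induction w)
  case Nil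
  have "op_norm (eval_word x []) \<le> 1 \<and> op_norm (eval_word x [] - eval_word y []) \<le> 0 * \<eta>"
    if xy: "close d R \<eta> x y" for \<eta> x y
  proof -
    obtain n where "x \<in> M_level d n" "y \<in> M_level d n" using xy unfolding close_def by blast
    then have e: "eval_word x [] = 1\<^sub>m n" "eval_word y [] = 1\<^sub>m n" using lvl_M_level d by (auto simp: eval_word_Nil)
    have z: "1\<^sub>m n - 1\<^sub>m n = (0\<^sub>m n n :: complex mat)" by (intro eq_matI) auto
    show ?thesis unfolding e z using op_norm_one by simp
  qed
  then show ?case by (intro exI[of _ 1] exI[of _ 0] conjI) auto
next
  case (Cons i w)
  then obtain B L where B: "B \<ge> 0" "L \<ge> 0"
    "\<And>\<eta> x y. close d R \<eta> x y \<Longrightarrow> op_norm (eval_word x w) \<le> B"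
    "\<And>\<eta> x y. close d R \<eta> x y \<Longrightarrow> op_norm (eval_word x w - eval_word y w) \<le> L * \<eta>" by blast
  have i: "i < d" "w \<in> lists {..<d}" using Cons by auto
  have "op_norm (eval_word x (i # w)) \<le> \<bar>R\<bar> * B \<and>
      op_norm (eval_word x (i # w) - eval_word y (i # w)) \<le> (\<bar>R\<bar> * L + B) * \<eta>"
    if xy: "close d R \<eta> x y" for \<eta> x y
  proof -
    obtain n where n: "x \<in> M_level d n" "y \<in> M_level d n" using xy unfolding close_def by blast
    let ?A = "eval_word x w" and ?A' = "eval_word y w"
    have A: "?A \<in> carrier_mat n n" "?A' \<in> carrier_mat n n" "x ! i \<in> carrier_mat n n" "y ! i \<in> carrier_mat n n"
      using eval_word_carrier d i n M_level_nth by auto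
    have xi: "op_norm (x ! i) \<le> \<bar>R\<bar>" "op_norm (x ! i - y ! i) \<le> \<eta>" using xy i unfolding close_def by force+
    have "op_norm (x ! i * ?A) \<le> op_norm (x ! i) * op_norm ?A" using A by (intro op_norm_mult[of _ n n _ n])
    also have "\<dots> \<le> \<bar>R\<bar> * B" using xi B(3)[OF xy] B(1) by (intro mult_mono) auto
    finally have 1: "op_norm (x ! i * ?A) \<le> \<bar>R\<bar> * B" .
    have "x ! i * ?A - y ! i * ?A' = x ! i * (?A - ?A') + (x ! i - y ! i) * ?A'"
      using A by (simp add: mult_minus_distrib_mat[of _ n n _ n] minus_mult_distrib_mat[of _ n n _ _ n])
        (intro eq_matI, auto)
    then have "op_norm (x ! i * ?A - y ! i * ?A') \<le> op_norm (x ! i * (?A - ?A')) + op_norm ((x ! i - y ! i) * ?A')"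
      using A by (simp, intro op_norm_add[of _ n n]) auto
    also have "\<dots> \<le> op_norm (x ! i) * op_norm (?A - ?A') + op_norm (x ! i - y ! i) * op_norm ?A'"
      using A by (intro add_mono op_norm_mult[of _ n n _ n]) auto
    also have "\<dots> \<le> \<bar>R\<bar> * (L * \<eta>) + \<eta> * B"
      using xi B(4)[OF xy] B(3)[OF close_sym[OF xy]] B(1) close_nonneg[OF xy d] by (intro add_mono mult_mono) auto
    finally show ?thesis using 1 by (simp add: eval_word_Cons algebra_simps)
  qed
  then show ?case using B(1,2) by (intro exI[of _ "\<bar>R\<bar> * B"] exI[of _ "\<bar>R\<bar> * L + B"] conjI) auto
qed

lemma eval_poly_lipschitz:
  assumes d: "0 < d" and p: "p \<in> free_polys d"
  shows "\<exists>L\<ge>0. \<forall>\<eta> x y. close d R \<eta> x y \<longrightarrow> op_norm (eval_poly p x - eval_poly p y) \<le> L * \<eta>"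
proof -
  define E where "E S x = mat (lvl x) (lvl x) (\<lambda>ij. \<Sum>w\<in>S. Poly_Mapping.lookup p w * eval_word x w $$ ij)" for S x
  have "\<exists>L\<ge>0. \<forall>\<eta> x y. close d R \<eta> x y \<longrightarrow> op_norm (E S x - E S y) \<le> L * \<eta>"
    if "finite S" "S \<subseteq> lists {..<d}" for S
    using that
  proof (induction rule: finite_induct)
    case empty
    have "op_norm (E {} x - E {} y) \<le> 0 * \<eta>" if xy: "close d R \<eta> x y" for \<eta> x y
    proof -
      obtain n where "x \<in> M_level d n" "y \<in> M_level d n" using xy unfolding close_def by blast
      then have "E {} x - E {} y = 0\<^sub>m n n" using lvl_M_level d by (auto simp: E_def)
      then show ?thesis by simp
    qed
    then show ?case by (intro exI[of _ 0]) auto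
  next
    case (insert w S)
    then obtain L where L: "L \<ge> 0" "\<And>\<eta> x y. close d R \<eta> x y \<Longrightarrow> op_norm (E S x - E S y) \<le> L * \<eta>" by auto
    have w: "w \<in> lists {..<d}" using insert by auto
    obtain L' where L': "L' \<ge> 0" "\<And>\<eta> x y. close d R \<eta> x y \<Longrightarrow> op_norm (eval_word x w - eval_word y w) \<le> L' * \<eta>"
      using eval_word_lipschitz[OF d w, of R] by blast
    let ?c = "Poly_Mapping.lookup p w"
    have "op_norm (E (insert w S) x - E (insert w S) y) \<le> (cmod ?c * L' + L) * \<eta>" if xy: "close d R \<eta> x y" for \<eta> x y
    proof -
      obtain n where n: "x \<in> M_level d n" "y \<in> M_level d n" using xy unfolding close_def by blast
      have l: "lvl x = n" "lvl y = n" using n lvl_M_level d by auto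
      have c: "eval_word x w \<in> carrier_mat n n" "eval_word y w \<in> carrier_mat n n" using eval_word_carrier n d w by auto
      have "E (insert w S) x - E (insert w S) y = ?c \<cdot>\<^sub>m (eval_word x w - eval_word y w) + (E S x - E S y)"
        using c insert(1,2) l by (intro eq_matI) (auto simp: E_def algebra_simps)
      then have "op_norm (E (insert w S) x - E (insert w S) y) \<le> op_norm (?c \<cdot>\<^sub>m (eval_word x w - eval_word y w)) + op_norm (E S x - E S y)"
        using c l by (simp, intro op_norm_add[of _ n n]) (auto simp: E_def)
      also have "\<dots> \<le> cmod ?c * (L' * \<eta>) + L * \<eta>"
        unfolding op_norm_smult by (intro add_mono mult_left_mono L(2)[OF xy] L'(2)[OF xy]) auto
      finally show ?thesis by (simp add: algebra_simps)
    qed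
    then show ?case using L(1) L'(1) by (intro exI[of _ "cmod ?c * L' + L"]) auto
  qed
  moreover have "E (Poly_Mapping.keys p) x = eval_poly p x" for x by (simp add: E_def eval_poly_def)
  ultimately show ?thesis using p unfolding free_polys_def by (metis finite_keys mem_Collect_eq)
qed

lemma eval_poly_mat_lipschitz:
  assumes d: "0 < d" and \<delta>: "elements_mat \<delta> \<subseteq> free_polys d"
  shows "\<exists>L\<ge>0. \<forall>\<eta> x y. close d R \<eta> x y \<longrightarrow> op_norm (eval_poly_mat \<delta> x - eval_poly_mat \<delta> y) \<le> L * \<eta>"
proof -
  have "\<exists>L. L \<ge> 0 \<and> (I < dim_row \<delta> \<longrightarrow> J < dim_col \<delta> \<longrightarrow>
      (\<forall>\<eta> x y. close d R \<eta> x y \<longrightarrow> op_norm (eval_poly (\<delta> $$ (I,J)) x - eval_poly (\<delta> $$ (I,J)) y) \<le> L * \<eta>))" for I J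
  proof (cases "I < dim_row \<delta> \<and> J < dim_col \<delta>")
    case True
    then have "\<delta> $$ (I,J) \<in> free_polys d" using \<delta> by (auto intro: elements_matI)
    then show ?thesis using eval_poly_lipschitz[OF d, of "\<delta> $$ (I,J)" R] by blast
  qed auto
  then obtain L where L: "\<And>I J. L I J \<ge> (0::real)" "\<And>I J \<eta> x y. I < dim_row \<delta> \<Longrightarrow> J < dim_col \<delta> \<Longrightarrow> close d R \<eta> x y \<Longrightarrow>
      op_norm (eval_poly (\<delta> $$ (I,J)) x - eval_poly (\<delta> $$ (I,J)) y) \<le> L I J * \<eta>" by metis
  have "op_norm (eval_poly_mat \<delta> x - eval_poly_mat \<delta> y) \<le> (\<Sum>I<dim_row \<delta>. \<Sum>J<dim_col \<delta>. L I J) * \<eta>"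
    if xy: "close d R \<eta> x y" for \<eta> x y
  proof -
    obtain n where n: "x \<in> M_level d n" "y \<in> M_level d n" "1 \<le> n" using xy unfolding close_def by blast
    have l: "lvl x = n" "lvl y = n" using n lvl_M_level d by auto
    define B where "B I J = eval_poly (\<delta> $$ (I,J)) x - eval_poly (\<delta> $$ (I,J)) y" for I J
    have B: "B I J \<in> carrier_mat n n" for I J using l by (simp add: B_def)
    have "eval_poly_mat \<delta> x - eval_poly_mat \<delta> y =
      mat (dim_row \<delta> * n) (dim_col \<delta> * n) (\<lambda>(i,j). B (i div n) (j div n) $$ (i mod n, j mod n))"
      using n(3) by (intro eq_matI) (auto simp: eval_poly_mat_def l B_def)
    then have "op_norm (eval_poly_mat \<delta> x - eval_poly_mat \<delta> y) \<le> (\<Sum>I<dim_row \<delta>. \<Sum>J<dim_col \<delta>. op_norm (B I J))"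
      using op_norm_block_mat_le[of n B, OF _ B] n(3) by simp
    also have "\<dots> \<le> (\<Sum>I<dim_row \<delta>. \<Sum>J<dim_col \<delta>. L I J * \<eta>)"
      unfolding B_def by (intro sum_mono L(2)[OF _ _ xy]) auto
    finally show ?thesis by (simp add: sum_distrib_right)
  qed
  then show ?thesis using L(1) by (intro exI[of _ "\<Sum>I<dim_row \<delta>. \<Sum>J<dim_col \<delta>. L I J"]) (auto intro!: sum_nonneg)
qed

lemma eval_poly_mat_carrier: "eval_poly_mat \<delta> x \<in> carrier_mat (dim_row \<delta> * lvl x) (dim_col \<delta> * lvl x)"
  by (simp add: eval_poly_mat_def)

text \<open>Free open sets are finitely open. In the induction over the generation of the topology
  only the balls need an argument, namely that \<open>eval_poly_mat \<delta>\<close> is Lipschitz on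
  bounded sets.\<close>

lemma free_open_level:
  assumes d: "0 < d" and U: "openin (free_topology d) U" and x: "x \<in> U" "x \<in> M_level d n" "1 \<le> n"
  obtains \<epsilon> where "\<epsilon> > 0" "\<And>y. y \<in> M_level d n \<Longrightarrow> (\<And>i. i < d \<Longrightarrow> op_norm (y ! i - x ! i) < \<epsilon>) \<Longrightarrow> y \<in> U"
proof -
  have "generate_topology_on {free_ball d \<delta> | \<delta>. elements_mat \<delta> \<subseteq> free_polys d} U"
    using U by (simp add: free_topology_def openin_topology_generated_by_iff)
  then have "x \<in> U \<longrightarrow> (\<exists>\<epsilon>>0. \<forall>y\<in>M_level d n. (\<forall>i<d. op_norm (y ! i - x ! i) < \<epsilon>) \<longrightarrow> y \<in> U)"
  proof (induction rule: generate_topology_on.induct)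
    case (Int a b)
    show ?case
    proof
      assume "x \<in> a \<inter> b"
      then obtain e1 e2 where "e1 > 0" "\<forall>y\<in>M_level d n. (\<forall>i<d. op_norm (y ! i - x ! i) < e1) \<longrightarrow> y \<in> a"
        "e2 > 0" "\<forall>y\<in>M_level d n. (\<forall>i<d. op_norm (y ! i - x ! i) < e2) \<longrightarrow> y \<in> b" using Int by auto
      then show "\<exists>\<epsilon>>0. \<forall>y\<in>M_level d n. (\<forall>i<d. op_norm (y ! i - x ! i) < \<epsilon>) \<longrightarrow> y \<in> a \<inter> b"
        by (intro exI[of _ "min e1 e2"]) auto
    qed
  next
    case (UN K)
    then show ?case by (meson UnionE UnionI)
  next
    case (Basis s)
    then obtain \<delta> where \<delta>: "s = free_ball d \<delta>" "elements_mat \<delta> \<subseteq> free_polys d" by blast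
    show ?case
    proof
      assume "x \<in> s"
      then have lt: "op_norm (eval_poly_mat \<delta> x) < 1" by (simp add: \<delta> free_ball_def)
      define R where "R = 1 + (\<Sum>i<d. op_norm (x ! i))"
      obtain L where L: "L \<ge> 0" "\<And>\<eta> y. close d R \<eta> y x \<Longrightarrow> op_norm (eval_poly_mat \<delta> y - eval_poly_mat \<delta> x) \<le> L * \<eta>"
        using eval_poly_mat_lipschitz[OF d \<delta>(2), of R] by blast
      \<comment> \<open>At most 1, so that nearby points obey the bound \<open>R\<close>, and small
        enough for the norm to stay below 1. The summand in \<open>L + 1\<close> avoids a division
        by zero.\<close>
      define \<epsilon> where "\<epsilon> = min 1 ((1 - op_norm (eval_poly_mat \<delta> x)) / (2 * (L + 1)))"
      have \<epsilon>: "\<epsilon> > 0" "\<epsilon> \<le> 1" using lt L by (auto simp: \<epsilon>_def)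
      have Le: "L * \<epsilon> < 1 - op_norm (eval_poly_mat \<delta> x)"
      proof -
        have "L * \<epsilon> \<le> (L + 1) * ((1 - op_norm (eval_poly_mat \<delta> x)) / (2 * (L + 1)))"
          using L \<epsilon> by (intro mult_mono) (auto simp: \<epsilon>_def)
        also have "\<dots> = (1 - op_norm (eval_poly_mat \<delta> x)) / 2" using L by (simp add: field_simps)
        finally show ?thesis using lt by simp
      qed
      have "y \<in> s" if y: "y \<in> M_level d n" "\<And>i. i < d \<Longrightarrow> op_norm (y ! i - x ! i) < \<epsilon>" for y
      proof -
        have c: "close d R \<epsilon> y x"
          unfolding close_def
        proof (intro conjI allI impI)
          fix i assume i: "i < d"
          have c: "x ! i \<in> carrier_mat n n" "y ! i \<in> carrier_mat n n" using M_level_nth x y i by auto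
          have xi: "op_norm (x ! i) \<le> (\<Sum>i<d. op_norm (x ! i))" using i by (intro member_le_sum) auto
          then show "op_norm (x ! i) \<le> R" by (simp add: R_def)
          show "op_norm (y ! i - x ! i) \<le> \<epsilon>" using y(2)[OF i] by simp
          have "op_norm (y ! i) = op_norm (x ! i + (y ! i - x ! i))" using c by (intro arg_cong[of _ _ op_norm] eq_matI) auto
          also have "\<dots> \<le> op_norm (x ! i) + op_norm (y ! i - x ! i)" using c by (intro op_norm_add[of _ n n]) auto
          finally show "op_norm (y ! i) \<le> R" using y(2)[OF i] xi \<epsilon>(2) by (simp add: R_def)
        qed (use x y in auto)
        let ?X = "eval_poly_mat \<delta> x" and ?Y = "eval_poly_mat \<delta> y"
        have l: "lvl x = n" "lvl y = n" using x y lvl_M_level d by auto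
        have XY: "?X \<in> carrier_mat (dim_row \<delta> * n) (dim_col \<delta> * n)" "?Y \<in> carrier_mat (dim_row \<delta> * n) (dim_col \<delta> * n)"
          using eval_poly_mat_carrier[of \<delta> x] eval_poly_mat_carrier[of \<delta> y] l by auto
        have "op_norm ?Y = op_norm (?X + (?Y - ?X))" using XY by (intro arg_cong[of _ _ op_norm] eq_matI) auto
        also have "\<dots> \<le> op_norm ?X + op_norm (?Y - ?X)" using XY by (intro op_norm_add) auto
        also have "\<dots> < 1" using L(2)[OF c] Le by linarith
        finally show ?thesis using MI[OF y(1) x(3)] by (simp add: \<delta> free_ball_def)
      qed
      then show "\<exists>\<epsilon>>0. \<forall>y\<in>M_level d n. (\<forall>i<d. op_norm (y ! i - x ! i) < \<epsilon>) \<longrightarrow> y \<in> s" using \<epsilon> by blast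
    qed
  qed auto
  then show thesis using that x(1) by blast
qed

text \<open>After substitution of the polynomials, dividing the entries by \<open>c\<close> turns
  the radius \<open>c\<close> into the radius 1 of a free ball.\<close>

lemma free_ball_comp_open:
  assumes d: "0 < d" and e: "0 < e" and \<delta>: "elements_mat \<delta> \<subseteq> free_polys e" and \<phi>: "\<And>i. i < e \<Longrightarrow> poly_fun d (\<phi> i)"
    and c: "0 < c"
  shows "openin (free_topology d) {x \<in> M d. op_norm (eval_poly_mat \<delta> (map (\<lambda>i. \<phi> i x) [0..<e])) < c}"
proof -
  let ?\<Phi> = "\<lambda>x. map (\<lambda>i. \<phi> i x) [0..<e]"
  have "\<exists>p. p \<in> free_polys d \<and> (I < dim_row \<delta> \<longrightarrow> J < dim_col \<delta> \<longrightarrow>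
      (\<forall>x\<in>M d. eval_poly p x = of_real (1 / c) \<cdot>\<^sub>m eval_poly (\<delta> $$ (I,J)) (?\<Phi> x)))" for I J
  proof (cases "I < dim_row \<delta> \<and> J < dim_col \<delta>")
    case True
    then have "\<delta> $$ (I,J) \<in> free_polys e" using \<delta> by (auto intro: elements_matI)
    then have "poly_fun d (\<lambda>x. eval_poly (\<delta> $$ (I,J)) (?\<Phi> x))" by (rule poly_fun_comp[OF d e _ \<phi>])
    from poly_fun_smult[OF d this, of "of_real (1 / c)"]
    show ?thesis unfolding poly_fun_def by blast
  next
    case False
    have "0 \<in> free_polys d" by (simp add: free_polys_def)
    then show ?thesis using False by blast
  qed
  then obtain p where p: "\<And>I J. p I J \<in> free_polys d" "\<And>I J x. I < dim_row \<delta> \<Longrightarrow> J < dim_col \<delta> \<Longrightarrow> x \<in> M d \<Longrightarrow>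
      eval_poly (p I J) x = of_real (1 / c) \<cdot>\<^sub>m eval_poly (\<delta> $$ (I,J)) (?\<Phi> x)" by metis
  define \<delta>' where "\<delta>' = mat (dim_row \<delta>) (dim_col \<delta>) (\<lambda>(I,J). p I J)"
  have \<delta>': "elements_mat \<delta>' \<subseteq> free_polys d" using p(1) by (auto simp: \<delta>'_def dest!: elements_matD)
  have eq: "op_norm (eval_poly_mat \<delta>' x) = op_norm (eval_poly_mat \<delta> (?\<Phi> x)) / c" if x: "x \<in> M d" for x
  proof -
    obtain n where n: "1 \<le> n" "x \<in> M_level d n" using x by (rule ME)
    have \<Phi>: "?\<Phi> x \<in> M_level e n" using poly_fun_carrier[OF \<phi> n(2,1) d] by (auto simp: M_level_def)
    have l: "lvl x = n" "lvl (?\<Phi> x) = n" using lvl_M_level[OF n(2) d] lvl_M_level[OF \<Phi> e] by auto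
    have "eval_poly_mat \<delta>' x = of_real (1 / c) \<cdot>\<^sub>m eval_poly_mat \<delta> (?\<Phi> x)"
    proof (rule eq_matI)
      fix i j assume "i < dim_row (of_real (1 / c) \<cdot>\<^sub>m eval_poly_mat \<delta> (?\<Phi> x))"
        "j < dim_col (of_real (1 / c) \<cdot>\<^sub>m eval_poly_mat \<delta> (?\<Phi> x))"
      then have ij: "i < dim_row \<delta> * n" "j < dim_col \<delta> * n" using l by (auto simp: eval_poly_mat_def)
      then have IJ: "i div n < dim_row \<delta>" "j div n < dim_col \<delta>" by (auto simp: less_mult_imp_div_less)
      have "eval_poly (p (i div n) (j div n)) x $$ (i mod n, j mod n) =
         of_real (1 / c) * eval_poly (\<delta> $$ (i div n, j div n)) (?\<Phi> x) $$ (i mod n, j mod n)"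
        unfolding p(2)[OF IJ x] using n(1) l by (subst index_smult_mat) auto
      then show "eval_poly_mat \<delta>' x $$ (i,j) = (of_real (1 / c) \<cdot>\<^sub>m eval_poly_mat \<delta> (?\<Phi> x)) $$ (i,j)"
        using ij IJ l by (simp add: eval_poly_mat_def \<delta>'_def)
    qed (use l in \<open>auto simp: eval_poly_mat_def \<delta>'_def\<close>)
    then show ?thesis using c by (simp add: op_norm_smult norm_divide)
  qed
  have "{x \<in> M d. op_norm (eval_poly_mat \<delta> (?\<Phi> x)) < c} = free_ball d \<delta>'"
    using c eq by (auto simp: free_ball_def)
  then show ?thesis using \<delta>' unfolding free_topology_def by (auto intro!: topology_generated_by_Basis)
qed

lemma eval_poly_mat_11:
  assumes "0 < lvl x"
  shows "eval_poly_mat (mat 1 1 (\<lambda>_. p)) x = eval_poly p x"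
  using assms by (intro eq_matI) (auto simp: eval_poly_mat_def)

lemma poly_fun_ball_open:
  assumes d: "0 < d" and \<phi>: "poly_fun d \<phi>" and c: "0 < c"
  shows "openin (free_topology d) {x \<in> M d. op_norm (\<phi> x) < c}"
proof -
  obtain p where p: "p \<in> free_polys d" "\<And>x. x \<in> M d \<Longrightarrow> eval_poly p x = of_real (1 / c) \<cdot>\<^sub>m \<phi> x"
    using poly_fun_smult[OF d \<phi>, of "of_real (1 / c)"] unfolding poly_fun_def by blast
  have "op_norm (eval_poly_mat (mat 1 1 (\<lambda>_. p)) x) = op_norm (\<phi> x) / c" if xM: "x \<in> M d" for x
  proof -
    obtain n where n: "1 \<le> n" "x \<in> M_level d n" using xM by (rule ME)
    then have "0 < lvl x" using lvl_M_level[OF n(2) d] by simp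
    then show ?thesis unfolding eval_poly_mat_11[OF \<open>0 < lvl x\<close>] using p(2)[OF xM] c by (simp add: op_norm_smult norm_divide)
  qed
  then have "{x \<in> M d. op_norm (\<phi> x) < c} = free_ball d (mat 1 1 (\<lambda>_. p))" using c by (auto simp: free_ball_def)
  moreover have "elements_mat (mat 1 1 (\<lambda>_. p)) \<subseteq> free_polys d" using p(1) by (auto dest!: elements_matD)
  ultimately show ?thesis unfolding free_topology_def by (auto intro!: topology_generated_by_Basis)
qed

lemma openin_free_M:
  assumes d: "0 < d"
  shows "openin (free_topology d) (M d)"
proof -
  have "op_norm ((0 \<cdot>\<^sub>m 1\<^sub>m n) :: complex mat) = 0" for n by (simp add: op_norm_smult)
  then show ?thesis using poly_fun_ball_open[OF d poly_fun_const[OF d, of 0], of 1] by simp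
qed

lemma free_open_subset_M:
  assumes "openin (free_topology d) U"
  shows "U \<subseteq> M d"
proof -
  have "U \<subseteq> topspace (free_topology d)" using assms by (rule openin_subset)
  also have "\<dots> \<subseteq> M d" by (auto simp: free_topology_def topology_generated_by_topspace free_ball_def)
  finally show ?thesis .
qed

text \<open>Near each point, \<open>f\<close> is approximated uniformly over all levels by a
  polynomial map that agrees with it at the point, and for polynomial maps preimages of balls are
  open. The bound \<open>R\<close> has to be fixed before \<eta>, because \<eta> is chosen by means
  of the Lipschitz constant of \<delta> for this \<open>R\<close>.\<close>

lemma free_continuous_at:
  assumes d: "0 < d" and e: "0 < e"
    and loc: "\<And>x. x \<in> D \<Longrightarrow> \<exists>R \<phi>. (\<forall>i<e. poly_fun d (\<phi> i)) \<and> f x = map (\<lambda>i. \<phi> i x) [0..<e] \<and>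
      (\<forall>\<eta>>0. \<exists>N. openin (free_topology d) N \<and> x \<in> N \<and> N \<subseteq> D \<and> (\<forall>y\<in>N. close e R \<eta> (f y) (map (\<lambda>i. \<phi> i y) [0..<e])))"
    and U: "openin (free_topology e) U" and x: "x \<in> D" "f x \<in> U"
  obtains N where "openin (free_topology d) N" "x \<in> N" "N \<subseteq> D" "f ` N \<subseteq> U"
proof -
  have "generate_topology_on {free_ball e \<delta> | \<delta>. elements_mat \<delta> \<subseteq> free_polys e} U"
    using U by (simp add: free_topology_def openin_topology_generated_by_iff)
  then have "f x \<in> U \<longrightarrow> (\<exists>N. openin (free_topology d) N \<and> x \<in> N \<and> N \<subseteq> D \<and> f ` N \<subseteq> U)"
  proof (induction rule: generate_topology_on.induct)
    case (Int a b)
    show ?case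
    proof
      assume "f x \<in> a \<inter> b"
      then obtain N1 N2 where "openin (free_topology d) N1" "x \<in> N1" "N1 \<subseteq> D" "f ` N1 \<subseteq> a"
        "openin (free_topology d) N2" "x \<in> N2" "N2 \<subseteq> D" "f ` N2 \<subseteq> b" using Int by auto
      then show "\<exists>N. openin (free_topology d) N \<and> x \<in> N \<and> N \<subseteq> D \<and> f ` N \<subseteq> a \<inter> b"
        by (intro exI[of _ "N1 \<inter> N2"]) auto
    qed
  next
    case (UN K)
    then show ?case by (meson UnionE Sup_upper order_trans)
  next
    case (Basis s)
    then obtain \<delta> where \<delta>: "s = free_ball e \<delta>" "elements_mat \<delta> \<subseteq> free_polys e" by blast
    show ?case
    proof
      assume "f x \<in> s"
      then have lt: "op_norm (eval_poly_mat \<delta> (f x)) < 1" by (simp add: \<delta> free_ball_def)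
      obtain R \<phi> where \<phi>: "\<And>i. i < e \<Longrightarrow> poly_fun d (\<phi> i)" "f x = map (\<lambda>i. \<phi> i x) [0..<e]"
        and N: "\<And>\<eta>. \<eta> > 0 \<Longrightarrow> \<exists>N. openin (free_topology d) N \<and> x \<in> N \<and> N \<subseteq> D \<and> (\<forall>y\<in>N. close e R \<eta> (f y) (map (\<lambda>i. \<phi> i y) [0..<e]))"
        using loc[OF x(1)] by blast
      let ?\<Phi> = "\<lambda>x. map (\<lambda>i. \<phi> i x) [0..<e]"
      obtain L where L: "L \<ge> 0" "\<And>\<eta> x y. close e R \<eta> x y \<Longrightarrow> op_norm (eval_poly_mat \<delta> x - eval_poly_mat \<delta> y) \<le> L * \<eta>"
        using eval_poly_mat_lipschitz[OF e \<delta>(2), of R] by blast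
      define a where "a = op_norm (eval_poly_mat \<delta> (f x))"
      \<comment> \<open>Midpoint between the norm at \<open>x\<close> and 1: the polynomial map is
        kept below \<open>c\<close>, and the approximation error may use up the rest.\<close>
      define c where "c = (1 + a) / 2"
      have a: "0 \<le> a" "a < 1" using lt by (auto simp: a_def)
      define \<eta> where "\<eta> = (1 - a) / (2 * (L + 1))"
      have \<eta>: "\<eta> > 0" using a L by (auto simp: \<eta>_def)
      have L\<eta>: "L * \<eta> \<le> (1 - a) / 2"
      proof -
        have "L * \<eta> \<le> (L + 1) * \<eta>" using \<eta> by simp
        also have "\<dots> = (1 - a) / 2" using L by (simp add: \<eta>_def field_simps)
        finally show ?thesis .
      qed
      obtain N where N: "openin (free_topology d) N" "x \<in> N" "N \<subseteq> D" "\<And>y. y \<in> N \<Longrightarrow> close e R \<eta> (f y) (?\<Phi> y)"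
        using N[OF \<eta>] by blast
      let ?N = "N \<inter> {y \<in> M d. op_norm (eval_poly_mat \<delta> (?\<Phi> y)) < c}"
      have "openin (free_topology d) ?N"
        using a by (intro openin_Int N free_ball_comp_open d e \<delta> \<phi>(1)) (auto simp: c_def)
      moreover have "op_norm (eval_poly_mat \<delta> (?\<Phi> x)) = a" unfolding a_def \<phi>(2) ..
      then have "x \<in> ?N" using N free_open_subset_M[OF N(1)] a by (auto simp: c_def)
      moreover have "f ` ?N \<subseteq> s"
      proof
        fix v assume "v \<in> f ` ?N"
        then obtain y where y: "v = f y" "y \<in> N" "op_norm (eval_poly_mat \<delta> (?\<Phi> y)) < c" by blast
        obtain n where n: "1 \<le> n" "f y \<in> M_level e n" "?\<Phi> y \<in> M_level e n" using N(4)[OF y(2)] unfolding close_def by blast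
        let ?X = "eval_poly_mat \<delta> (?\<Phi> y)" and ?Y = "eval_poly_mat \<delta> (f y)"
        have XY: "?X \<in> carrier_mat (dim_row \<delta> * n) (dim_col \<delta> * n)" "?Y \<in> carrier_mat (dim_row \<delta> * n) (dim_col \<delta> * n)"
          using eval_poly_mat_carrier[of \<delta> "?\<Phi> y"] eval_poly_mat_carrier[of \<delta> "f y"] lvl_M_level[OF n(2) e] lvl_M_level[OF n(3) e] by auto
        have "op_norm ?Y = op_norm (?X + (?Y - ?X))" using XY by (intro arg_cong[of _ _ op_norm] eq_matI) auto
        also have "\<dots> \<le> op_norm ?X + op_norm (?Y - ?X)" using XY by (intro op_norm_add) auto
        also have "\<dots> < c + (1 - a) / 2" using L(2)[OF N(4)[OF y(2)]] y(3) L\<eta> by linarith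
        also have "\<dots> = 1" by (simp add: c_def field_simps)
        finally show "v \<in> s" using MI[OF n(2,1)] y(1) by (simp add: \<delta> free_ball_def)
      qed
      ultimately show "\<exists>N. openin (free_topology d) N \<and> x \<in> N \<and> N \<subseteq> D \<and> f ` N \<subseteq> s" using N(3) by (intro exI[of _ ?N]) auto
    qed
  qed auto
  then show thesis using that x(2) by blast
qed

lemma zariski_open_of_free_open:
  assumes "openin (free_topology d) U"
  shows "openin (zariski_free_topology d) U"
proof -
  have "U - \<Union>{} \<in> {D - \<Union>\<V> | D \<V>. openin (free_topology d) D \<and> finite \<V> \<and> (\<forall>V\<in>\<V>. free_variety d D V)}"
    using assms by blast
  from topology_generated_by_Basis[OF this] show ?thesis unfolding zariski_free_topology_def by simp
qed

section \<open>Regularity of nc-functions\<close>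

lemma op_norm_diff_self [simp]: "op_norm (A - A) = 0"
proof -
  have "A - A = 0\<^sub>m (dim_row A) (dim_col A)" by (intro eq_matI) auto
  then show ?thesis by (metis op_norm_zero)
qed

lemma length_dsum [simp]: "length (dsum x y) = min (length x) (length y)"
  by (simp add: dsum_def)

lemma dsum_nth: "i < length x \<Longrightarrow> i < length y \<Longrightarrow> dsum x y ! i = mat_dsum (x ! i) (y ! i)"
  by (simp add: dsum_def)

lemma M_levelI: "length x = d \<Longrightarrow> (\<And>i. i < d \<Longrightarrow> x ! i \<in> carrier_mat n n) \<Longrightarrow> x \<in> M_level d n"
  by (auto simp: M_level_def in_set_conv_nth)

lemma dsum_M_level:
  "x \<in> M_level d n \<Longrightarrow> y \<in> M_level d m \<Longrightarrow> dsum x y \<in> M_level d (n + m)"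
  using M_level_nth[of x d n] M_level_nth[of y d m]
  by (intro M_levelI) (auto simp: M_level_def dsum_nth intro!: mat_dsum_carrier)

lemma conjugate_by_nth: "i < length x \<Longrightarrow> conjugate_by s x ! i = mat_inv s * x ! i * s"
  by (simp add: conjugate_by_def)

lemma length_conjugate_by [simp]: "length (conjugate_by s x) = length x"
  by (simp add: conjugate_by_def)

lemma conjugate_by_M_level:
  assumes "x \<in> M_level d n" "s \<in> carrier_mat n n" "invertible_mat s"
  shows "conjugate_by s x \<in> M_level d n"
proof (rule M_levelI)
  fix i assume "i < d"
  then show "conjugate_by s x ! i \<in> carrier_mat n n"
    using M_level_nth[OF assms(1)] assms invertible_mat_inv(1)[OF assms(2,3)]
    by (simp add: conjugate_by_nth M_level_def)
qed (use assms in \<open>simp add: M_level_def\<close>)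

section \<open>Shears and block triangular points\<close>

definition shear :: "complex mat \<Rightarrow> complex mat" where
  "shear T = four_block_mat (1\<^sub>m (dim_row T)) T (0\<^sub>m (dim_col T) (dim_row T)) (1\<^sub>m (dim_col T))"

lemma shear_carrier: "T \<in> carrier_mat n m \<Longrightarrow> shear T \<in> carrier_mat (n + m) (n + m)"
  by (auto simp: shear_def)

lemma mat_inv_shear:
  assumes T: "T \<in> carrier_mat n m"
  shows "mat_inv (shear T) = shear (- T)" "invertible_mat (shear T)"
proof -
  have mult: "shear A * shear B = shear (A + B)" if "A \<in> carrier_mat n m" "B \<in> carrier_mat n m" for A B
    unfolding shear_def using that
    by (subst mult_four_block_mat[of _ n n _ m _ m]) (auto simp: comm_add_mat[of A n m])
  have "shear (0\<^sub>m n m) = 1\<^sub>m (n + m)" by (simp add: shear_def)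
  moreover have "T + - T = 0\<^sub>m n m" "- T + T = 0\<^sub>m n m" using T by (auto intro!: eq_matI)
  ultimately have 1: "shear T * shear (- T) = 1\<^sub>m (n + m)" "shear (- T) * shear T = 1\<^sub>m (n + m)"
    using mult[of T "- T"] mult[of "- T" T] T by auto
  have c: "shear T \<in> carrier_mat (n + m) (n + m)" "shear (- T) \<in> carrier_mat (n + m) (n + m)"
    using T by (auto intro: shear_carrier)
  show "mat_inv (shear T) = shear (- T)" by (rule mat_inv_eqI[OF c 1(1)])
  show "invertible_mat (shear T)" by (rule invertible_matI[OF c 1])
qed

lemma shear_conj:
  assumes T: "T \<in> carrier_mat n m" and A: "A \<in> carrier_mat n n" and B: "B \<in> carrier_mat m m"
  shows "mat_inv (shear T) * mat_dsum A B * shear T = four_block_mat A (A * T - T * B) (0\<^sub>m m n) B"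
proof -
  have "shear (- T) * mat_dsum A B = four_block_mat A (- T * B) (0\<^sub>m m n) B"
    unfolding shear_def mat_dsum_def using assms
    by (subst mult_four_block_mat[of _ n n _ m _ m]) auto
  moreover have "four_block_mat A (- T * B) (0\<^sub>m m n) B * shear T = four_block_mat A (A * T + - T * B) (0\<^sub>m m n) B"
    unfolding shear_def using assms
    by (subst mult_four_block_mat[of _ n n _ m _ m]) auto
  moreover have "A * T + - T * B = A * T - T * B" using assms by (intro eq_matI) auto
  ultimately show ?thesis by (simp add: mat_inv_shear[OF T])
qed

definition upper :: "point \<Rightarrow> point \<Rightarrow> point \<Rightarrow> point" where
  "upper x h y = map (\<lambda>i. four_block_mat (x ! i) (h ! i) (0\<^sub>m (dim_row (y ! i)) (dim_col (x ! i))) (y ! i)) [0..<length x]"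

lemma upper_M_level:
  assumes "x \<in> M_level d n" "y \<in> M_level d m"
  shows "upper x h y \<in> M_level d (n + m)"
  using M_level_nth[OF assms(1)] M_level_nth[OF assms(2)] assms
  by (auto simp: upper_def M_level_def intro!: four_block_carrier_mat)

text \<open>Direct sums are considered only where they stay in \<open>D\<close>. The set
  \<open>branched\<close>, to which this is applied, is not closed under direct sums, since the two
  summands may contribute opposite eigenvalues.\<close>

definition nc_on :: "nat \<Rightarrow> point set \<Rightarrow> (point \<Rightarrow> complex mat) \<Rightarrow> bool" where
  "nc_on d D f \<longleftrightarrow> D \<subseteq> M d \<and> graded D f \<and> respects_similarities D f \<and>
    (\<forall>x\<in>D. \<forall>y\<in>D. dsum x y \<in> D \<longrightarrow> f (dsum x y) = mat_dsum (f x) (f y))"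

lemma nc_on_carrier:
  "nc_on d D f \<Longrightarrow> 0 < d \<Longrightarrow> x \<in> D \<Longrightarrow> x \<in> M_level d n \<Longrightarrow> f x \<in> carrier_mat n n"
  unfolding nc_on_def graded_def using lvl_M_level by blast

lemma nc_on_similar:
  assumes "nc_on d D f" "0 < d" "x \<in> D" "x \<in> M_level d n" "s \<in> carrier_mat n n" "invertible_mat s"
    "conjugate_by s x \<in> D"
  shows "f (conjugate_by s x) = mat_inv s * f x * s"
  using assms lvl_M_level[OF assms(4,2)] unfolding nc_on_def respects_similarities_def by blast

text \<open>By \<open>shear_conj\<close>, \<open>upper x h y\<close> is \<open>x \<oplus> y\<close>
  conjugated by the shear with corner \<open>T\<close>; similarity turns the corner
  \<open>x T - T y\<close> of the argument into the corner \<open>f(x) T - T f(y)\<close> of the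
  value.\<close>

lemma nc_on_upper:
  assumes f: "nc_on d D f" and d: "0 < d" and xy: "x \<in> D" "y \<in> D" "dsum x y \<in> D"
    and l: "x \<in> M_level d n" "y \<in> M_level d m" and T: "T \<in> carrier_mat n m"
    and h: "\<And>i. i < d \<Longrightarrow> h ! i = x ! i * T - T * y ! i" and z: "upper x h y \<in> D"
  shows "f (upper x h y) = four_block_mat (f x) (f x * T - T * f y) (0\<^sub>m m n) (f y)"
proof -
  have len: "length x = d" "length y = d" using l by (auto simp: M_level_def)
  have "conjugate_by (shear T) (dsum x y) = upper x h y"
  proof (rule nth_equalityI)
    fix i assume "i < length (conjugate_by (shear T) (dsum x y))"
    then have i: "i < d" using len by simp
    then show "conjugate_by (shear T) (dsum x y) ! i = upper x h y ! i"
      using shear_conj[OF T M_level_nth[OF l(1) i] M_level_nth[OF l(2) i]] carrier_matD[OF M_level_nth[OF l(1) i]]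
        carrier_matD[OF M_level_nth[OF l(2) i]] len h
      by (simp add: conjugate_by_nth dsum_nth upper_def)
  qed (use len in \<open>simp add: upper_def\<close>)
  then have "f (upper x h y) = mat_inv (shear T) * f (dsum x y) * shear T"
    using nc_on_similar[OF f d xy(3) dsum_M_level[OF l] shear_carrier[OF T] mat_inv_shear(2)[OF T]] z by simp
  also have "f (dsum x y) = mat_dsum (f x) (f y)" using f xy unfolding nc_on_def by blast
  finally show ?thesis
    using shear_conj[OF T] nc_on_carrier[OF f d xy(1) l(1)] nc_on_carrier[OF f d xy(2) l(2)] by simp
qed

text \<open>The case of corner zero: the shear then fixes \<open>x \<oplus> y\<close>, so the corner
  of the value must vanish as well.\<close>

lemma nc_on_intertwine:
  assumes f: "nc_on d D f" and d: "0 < d" and xy: "x \<in> D" "y \<in> D" "dsum x y \<in> D"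
    and l: "x \<in> M_level d n" "y \<in> M_level d m" and T: "T \<in> carrier_mat n m"
    and xT: "\<And>i. i < d \<Longrightarrow> x ! i * T = T * y ! i"
  shows "f x * T = T * f y"
proof -
  have len: "length x = d" "length y = d" using l by (auto simp: M_level_def)
  note fc = nc_on_carrier[OF f d xy(1) l(1)] nc_on_carrier[OF f d xy(2) l(2)]
  define h where "h = replicate d (0\<^sub>m n m :: complex mat)"
  have h: "h ! i = x ! i * T - T * y ! i" if "i < d" for i
    using xT[OF that] T M_level_nth[OF l(2) that] that unfolding h_def by (intro eq_matI) auto
  have "upper x h y = dsum x y"
  proof (rule nth_equalityI)
    fix i assume "i < length (upper x h y)"
    then have i: "i < d" using len by (simp add: upper_def)
    then show "upper x h y ! i = dsum x y ! i"
      using M_level_nth[OF l(1) i] M_level_nth[OF l(2) i] len by (simp add: upper_def dsum_nth mat_dsum_def h_def)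
  qed (use len in \<open>simp add: upper_def\<close>)
  then have "mat_dsum (f x) (f y) = four_block_mat (f x) (f x * T - T * f y) (0\<^sub>m m n) (f y)"
    using nc_on_upper[OF f d xy l T h] f xy unfolding nc_on_def by metis
  then have "0\<^sub>m n m = f x * T - T * f y"
    using four_block_mat_inject[of "f x" n n "0\<^sub>m n m" m "0\<^sub>m m n" m "f y" "f x" "f x * T - T * f y" "0\<^sub>m m n" "f y"] fc T
    by (auto simp: mat_dsum_def)
  moreover have "f x * T = (f x * T - T * f y) + T * f y" using fc T by (intro eq_matI) auto
  ultimately show ?thesis using fc T by (metis left_add_zero_mat mult_carrier_mat)
qed

section \<open>From local boundedness to holomorphy along lines\<close>

definition near :: "nat \<Rightarrow> nat \<Rightarrow> real \<Rightarrow> point \<Rightarrow> point \<Rightarrow> bool" where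
  "near d n \<epsilon> x y \<longleftrightarrow> y \<in> M_level d n \<and> (\<forall>i<d. op_norm (y ! i - x ! i) < \<epsilon>)"

text \<open>Closure under \<open>x \<oplus> x\<close> is the part of closure under direct sums that
  the arguments call for, as the block triangular points they use lie near such a sum. The bounds
  may depend on the level, unlike those in the free topology.\<close>

definition locally_bounded_nc :: "nat \<Rightarrow> point set \<Rightarrow> (point \<Rightarrow> complex mat) \<Rightarrow> bool" where
  "locally_bounded_nc d D f \<longleftrightarrow> nc_on d D f \<and> (\<forall>x\<in>D. dsum x x \<in> D) \<and>
    (\<forall>n. \<forall>x\<in>D \<inter> M_level d n. \<exists>\<epsilon>>0. \<exists>C. \<forall>y. near d n \<epsilon> x y \<longrightarrow> y \<in> D \<and> op_norm (f y) \<le> C)"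

lemma op_norm_eq_0D:
  assumes "A \<in> carrier_mat m n" "op_norm A = 0"
  shows "A = 0\<^sub>m m n"
proof (rule eq_matI)
  fix i j assume "i < dim_row (0\<^sub>m m n :: complex mat)" "j < dim_col (0\<^sub>m m n :: complex mat)"
  then show "A $$ (i,j) = 0\<^sub>m m n $$ (i,j)" using cmod_index_le_op_norm[of i A j] assms by auto
qed (use assms in auto)

lemma op_norm_upper_diff:
  assumes c: "A \<in> carrier_mat n n" "B \<in> carrier_mat n n" "H \<in> carrier_mat n n" "K \<in> carrier_mat n n"
  shows "op_norm (four_block_mat A H (0\<^sub>m n n) B - four_block_mat A K (0\<^sub>m n n) A)
    \<le> op_norm (H - K) + op_norm (B - A)"
proof -
  have "four_block_mat A H (0\<^sub>m n n) B - four_block_mat A K (0\<^sub>m n n) A =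
    four_block_mat (0\<^sub>m n n) (H - K) (0\<^sub>m n n) (B - A)"
    using c by (intro eq_matI) auto
  then show ?thesis
    using op_norm_four_block_le[of "0\<^sub>m n n" n n "H - K" n "0\<^sub>m n n" n "B - A"] c by simp
qed

lemma locally_bounded_nc_near:
  assumes f: "locally_bounded_nc d D f" and x: "x \<in> D" "x \<in> M_level d n"
  obtains \<epsilon> C where "\<epsilon> > 0" "C \<ge> 0" "\<And>y. near d n \<epsilon> x y \<Longrightarrow> y \<in> D \<and> op_norm (f y) \<le> C"
proof -
  obtain \<epsilon> C where "\<epsilon> > 0" "\<And>y. near d n \<epsilon> x y \<Longrightarrow> y \<in> D \<and> op_norm (f y) \<le> C"
    using f x unfolding locally_bounded_nc_def by blast
  then show thesis by (intro that[of \<epsilon> "max 0 C"]) (auto intro: max.coboundedI2)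
qed

lemma near_mono: "near d n \<epsilon> x y \<Longrightarrow> \<epsilon> \<le> \<epsilon>' \<Longrightarrow> near d n \<epsilon>' x y"
  unfolding near_def by fastforce

lemma near_upper:
  assumes x: "x \<in> M_level d n" and y: "near d n (\<epsilon> / 2) x y" and k: "k \<in> M_level d n"
    and h: "h \<in> M_level d n" "\<And>i. i < d \<Longrightarrow> op_norm (h ! i - k ! i) \<le> \<epsilon> / 2"
  shows "near d (n + n) \<epsilon> (upper x k x) (upper x h y)"
  unfolding near_def
proof (intro conjI allI impI)
  have yl: "y \<in> M_level d n" using y by (simp add: near_def)
  show "upper x h y \<in> M_level d (n + n)" by (rule upper_M_level[OF x yl])
  fix i assume i: "i < d"
  note c = M_level_nth[OF x i] M_level_nth[OF yl i] M_level_nth[OF h(1) i] M_level_nth[OF k i]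
  have "length x = d" using x by (simp add: M_level_def)
  then have "upper x h y ! i - upper x k x ! i = four_block_mat (x ! i) (h ! i) (0\<^sub>m n n) (y ! i) - four_block_mat (x ! i) (k ! i) (0\<^sub>m n n) (x ! i)"
    using i c by (simp add: upper_def)
  then have "op_norm (upper x h y ! i - upper x k x ! i) \<le> op_norm (h ! i - k ! i) + op_norm (y ! i - x ! i)"
    using op_norm_upper_diff[OF c] by simp
  also have "\<dots> < \<epsilon> / 2 + \<epsilon> / 2" using h(2)[OF i] y i by (intro add_le_less_mono) (auto simp: near_def)
  finally show "op_norm (upper x h y ! i - upper x k x ! i) < \<epsilon>" by simp
qed

lemma dsum_eq_upper:
  assumes "x \<in> M_level d n" "y \<in> M_level d m"
  shows "dsum x y = upper x (replicate d (0\<^sub>m n m)) y"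
proof (rule nth_equalityI)
  have len: "length x = d" "length y = d" using assms by (auto simp: M_level_def)
  then show "length (dsum x y) = length (upper x (replicate d (0\<^sub>m n m)) y)" by (simp add: upper_def)
  fix i assume "i < length (dsum x y)"
  then have i: "i < d" using len by simp
  then show "dsum x y ! i = upper x (replicate d (0\<^sub>m n m)) y ! i"
    using M_level_nth[OF assms(1) i] M_level_nth[OF assms(2) i] len by (simp add: upper_def dsum_nth mat_dsum_def)
qed

text \<open>Conjugating \<open>x \<oplus> y\<close> by a shear puts the difference quotient of \<open>f\<close> in the upper right corner
  of a value of \<open>f\<close> at a point near \<open>x \<oplus> x\<close>; local boundedness there gives a Lipschitz estimate,
  and then continuity one level up gives complex differentiability along lines.\<close>

lemma nc_lipschitz:
  assumes f: "locally_bounded_nc d D f" and d: "0 < d" and x: "x \<in> D" "x \<in> M_level d n"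
  obtains \<epsilon> L where "\<epsilon> > 0" "L \<ge> 0"
    "\<And>y. near d n \<epsilon> x y \<Longrightarrow> y \<in> D \<and> op_norm (f y - f x) \<le> L * (\<Sum>i<d. op_norm (y ! i - x ! i))"
proof -
  have nc: "nc_on d D f" using f by (simp add: locally_bounded_nc_def)
  have xx: "dsum x x \<in> D" using f x unfolding locally_bounded_nc_def by blast
  let ?Z0 = "replicate d (0\<^sub>m n n :: complex mat)"
  have 0: "?Z0 \<in> M_level d n" by (auto simp: M_level_def)
  have xx': "upper x ?Z0 x = dsum x x" using dsum_eq_upper[OF x(2,2)] by simp
  obtain \<epsilon>1 C1 where 1: "\<epsilon>1 > 0" "\<And>y. near d n \<epsilon>1 x y \<Longrightarrow> y \<in> D \<and> op_norm (f y) \<le> C1"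
    using locally_bounded_nc_near[OF f x] by blast
  obtain \<epsilon>2 C2 where 2: "\<epsilon>2 > 0" "C2 \<ge> 0" "\<And>z. near d (n + n) \<epsilon>2 (dsum x x) z \<Longrightarrow> z \<in> D \<and> op_norm (f z) \<le> C2"
    using locally_bounded_nc_near[OF f xx dsum_M_level[OF x(2,2)]] by blast
  define \<epsilon> where "\<epsilon> = min \<epsilon>1 (\<epsilon>2 / 2)"
  have "y \<in> D \<and> op_norm (f y - f x) \<le> (2 * C2 / \<epsilon>2) * (\<Sum>i<d. op_norm (y ! i - x ! i))" if y: "near d n \<epsilon> x y" for y
  proof
    have y1: "near d n \<epsilon>1 x y" and y2: "near d n (\<epsilon>2 / 2) x y"
      using near_mono[OF y] by (auto simp: \<epsilon>_def)
    show yD: "y \<in> D" using 1(2)[OF y1] by blast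
    have yl: "y \<in> M_level d n" using y by (simp add: near_def)
    note fc = nc_on_carrier[OF nc d x] nc_on_carrier[OF nc d yD yl]
    define \<delta> where "\<delta> = (\<Sum>i<d. op_norm (y ! i - x ! i))"
    have \<delta>i: "op_norm (y ! i - x ! i) \<le> \<delta>" if "i < d" for i
      unfolding \<delta>_def using that by (intro member_le_sum) auto
    have \<delta>0: "0 \<le> \<delta>" unfolding \<delta>_def by (intro sum_nonneg) simp
    show "op_norm (f y - f x) \<le> (2 * C2 / \<epsilon>2) * (\<Sum>i<d. op_norm (y ! i - x ! i))"
    proof (cases "\<delta> = 0")
      case True
      have "y = x"
      proof (rule nth_equalityI)
        show len: "length y = length x" using x yl by (simp add: M_level_def)
        fix i assume "i < length y"
        then have i: "i < d" using yl by (simp add: M_level_def)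
        have "op_norm (y ! i - x ! i) = 0" using \<delta>i[OF i] True by (simp add: antisym)
        then have "y ! i - x ! i = 0\<^sub>m n n"
          using M_level_nth[OF x(2) i] M_level_nth[OF yl i] by (intro op_norm_eq_0D) auto
        moreover have "y ! i = (y ! i - x ! i) + x ! i"
          using M_level_nth[OF x(2) i] M_level_nth[OF yl i] by (intro eq_matI) auto
        ultimately show "y ! i = x ! i" using M_level_nth[OF x(2) i] by simp
      qed
      moreover have "f x - f x = 0\<^sub>m n n" using fc by (intro eq_matI) auto
      ultimately show ?thesis using 2 by (simp add: sum_nonneg)
    next
      case False
      then have \<delta>p: "\<delta> > 0" using \<delta>0 by simp
      \<comment> \<open>With the scalar matrix \<open>T = c 1\<close> the corner of the argument is
        \<open>c (x - y)\<close>, which this \<open>c\<close> scales to norm at most half of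
        \<open>\<epsilon>2\<close>. The corner of the value is \<open>c (f x - f y)\<close> and has
        norm at most \<open>C2\<close>.\<close>
      define c where "c = \<epsilon>2 / (2 * \<delta>)"
      have c: "c > 0" using 2 \<delta>p by (simp add: c_def)
      define T where "T = complex_of_real c \<cdot>\<^sub>m 1\<^sub>m n"
      have T: "T \<in> carrier_mat n n" by (simp add: T_def)
      have Tm: "A * T = of_real c \<cdot>\<^sub>m A" "T * A = of_real c \<cdot>\<^sub>m A" if "A \<in> carrier_mat n n" for A
        using that by (auto simp: T_def mult_smult_distrib[of _ n n _ n] mult_smult_assoc_mat[of _ n n _ n])
      define h where "h = map (\<lambda>i. x ! i * T - T * y ! i) [0..<d]"
      have hi: "h ! i = of_real c \<cdot>\<^sub>m (x ! i - y ! i)" if "i < d" for i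
        using that M_level_nth[OF x(2) that] M_level_nth[OF yl that]
        by (simp add: h_def Tm) (intro eq_matI, auto simp: algebra_simps)
      have hl: "h \<in> M_level d n"
      proof (rule M_levelI)
        fix i assume i: "i < d"
        then show "h ! i \<in> carrier_mat n n" using hi[OF i] M_level_nth[OF x(2) i] M_level_nth[OF yl i] by simp
      qed (simp add: h_def)
      have "near d (n + n) \<epsilon>2 (upper x ?Z0 x) (upper x h y)"
      proof (rule near_upper[OF x(2) y2 0 hl])
        fix i assume i: "i < d"
        have xy: "x ! i - y ! i \<in> carrier_mat n n" using M_level_nth[OF yl i] by auto
        have "h ! i - ?Z0 ! i = of_real c \<cdot>\<^sub>m (x ! i - y ! i)"
          unfolding hi[OF i] using i xy by (intro eq_matI) auto
        then have "op_norm (h ! i - ?Z0 ! i) = c * op_norm (y ! i - x ! i)"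
          using c M_level_nth[OF x(2) i] M_level_nth[OF yl i] by (simp add: op_norm_smult op_norm_minus_commute[of "x ! i" n n])
        also have "\<dots> \<le> c * \<delta>" using \<delta>i[OF i] c by simp
        also have "\<dots> = \<epsilon>2 / 2" using \<delta>p by (simp add: c_def)
        finally show "op_norm (h ! i - ?Z0 ! i) \<le> \<epsilon>2 / 2" .
      qed
      then have z: "upper x h y \<in> D" "op_norm (f (upper x h y)) \<le> C2" using 2(3) xx' by auto
      have "near d (n + n) \<epsilon>2 (upper x ?Z0 x) (upper x ?Z0 y)"
      proof (rule near_upper[OF x(2) y2 0 0])
        fix i assume i: "i < d"
        show "op_norm (?Z0 ! i - ?Z0 ! i) \<le> \<epsilon>2 / 2" using 2(1) i by simp
      qed
      then have xyD: "dsum x y \<in> D" using 2(3) xx' dsum_eq_upper[OF x(2) yl] by auto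
      have hT: "h ! i = x ! i * T - T * y ! i" if "i < d" for i using that by (simp add: h_def)
      have fz: "f (upper x h y) = four_block_mat (f x) (f x * T - T * f y) (0\<^sub>m n n) (f y)"
        by (rule nc_on_upper[OF nc d x(1) yD xyD x(2) yl T hT z(1)])
      have "f x * T - T * f y = of_real c \<cdot>\<^sub>m (f x - f y)"
        unfolding Tm[OF fc(1)] Tm[OF fc(2)] using fc by (intro eq_matI) (auto simp: algebra_simps)
      then have "c * op_norm (f x - f y) \<le> C2"
        using op_norm_four_block_ge(2)[of "f x" n n "f x * T - T * f y" n "0\<^sub>m n n" n "f y"] fc T z(2) fz c
        by (simp add: op_norm_smult)
      then have "op_norm (f x - f y) \<le> C2 / c" using c by (simp add: field_simps)
      also have "C2 / c = (2 * C2 / \<epsilon>2) * \<delta>" using \<delta>p 2 by (simp add: c_def)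
      finally show ?thesis unfolding \<delta>_def using op_norm_minus_commute[OF fc] by simp
    qed
  qed
  then show thesis using 1 2 by (intro that[of \<epsilon> "2 * C2 / \<epsilon>2"]) (auto simp: \<epsilon>_def)
qed

definition line :: "point \<Rightarrow> point \<Rightarrow> complex \<Rightarrow> point" where
  "line x h t = map (\<lambda>i. x ! i + t \<cdot>\<^sub>m h ! i) [0..<length x]"

lemma line_M_level:
  assumes "x \<in> M_level d n" "h \<in> M_level d n"
  shows "line x h t \<in> M_level d n"
proof (rule M_levelI)
  fix i assume i: "i < d"
  then show "line x h t ! i \<in> carrier_mat n n"
    using M_level_nth[OF assms(1) i] M_level_nth[OF assms(2) i] assms by (simp add: line_def M_level_def)
qed (use assms in \<open>simp add: line_def M_level_def\<close>)

lemma line_nth: "i < length x \<Longrightarrow> line x h t ! i = x ! i + t \<cdot>\<^sub>m h ! i"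
  by (simp add: line_def)

lemma line_add:
  assumes "x \<in> M_level d n" "h \<in> M_level d n"
  shows "line x h (s + t) = line (line x h s) h t"
proof (rule nth_equalityI)
  have len: "length x = d" using assms by (simp add: M_level_def)
  fix i assume "i < length (line x h (s + t))"
  then have i: "i < d" using len by (simp add: line_def)
  then show "line x h (s + t) ! i = line (line x h s) h t ! i"
    using M_level_nth[OF assms(1) i] M_level_nth[OF assms(2) i] len
    by (simp add: line_def) (intro eq_matI, auto simp: algebra_simps)
qed (simp add: line_def)

lemma line_0:
  assumes "x \<in> M_level d n" "h \<in> M_level d n"
  shows "line x h 0 = x"
proof (rule nth_equalityI)
  have len: "length x = d" using assms by (simp add: M_level_def)
  fix i assume "i < length (line x h 0)"
  then have i: "i < d" using len by (simp add: line_def)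
  then show "line x h 0 ! i = x ! i"
    using M_level_nth[OF assms(1) i] M_level_nth[OF assms(2) i] len
    by (simp add: line_def) (intro eq_matI, auto simp: algebra_simps)
qed (simp add: line_def)

lemma op_norm_line_diff:
  assumes "x \<in> M_level d n" "h \<in> M_level d n" "i < d"
  shows "op_norm (line x h t ! i - x ! i) = cmod t * op_norm (h ! i)"
proof -
  have len: "length x = d" using assms by (simp add: M_level_def)
  have "line x h t ! i - x ! i = t \<cdot>\<^sub>m h ! i"
    using M_level_nth[OF assms(1,3)] M_level_nth[OF assms(2,3)] len assms(3)
    by (simp add: line_nth) (intro eq_matI, auto)
  then show ?thesis by (simp add: op_norm_smult)
qed

lemma eventually_near_line:
  assumes "x \<in> M_level d n" "h \<in> M_level d n" "\<epsilon> > 0"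
  shows "eventually (\<lambda>t. near d n \<epsilon> x (line x h t)) (nhds 0)"
proof -
  define K where "K = 1 + (\<Sum>i<d. op_norm (h ! i))"
  have K: "K > 0" unfolding K_def by (intro add_pos_nonneg sum_nonneg) auto
  have "eventually (\<lambda>t. t \<in> ball 0 (\<epsilon> / K)) (nhds (0::complex))"
    using K assms by (intro eventually_nhds_in_open) auto
  then show ?thesis
  proof eventually_elim
    case (elim t)
    show ?case unfolding near_def
    proof (intro conjI allI impI line_M_level assms)
      fix i assume i: "i < d"
      have "op_norm (h ! i) \<le> (\<Sum>i<d. op_norm (h ! i))" using i by (intro member_le_sum) auto
      then have "op_norm (h ! i) \<le> K" by (simp add: K_def)
      then have "cmod t * op_norm (h ! i) \<le> cmod t * K" by (rule mult_left_mono) simp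
      also have "\<dots> < \<epsilon>" using elim K by (simp add: pos_less_divide_eq)
      finally show "op_norm (line x h t ! i - x ! i) < \<epsilon>" using op_norm_line_diff[OF assms(1,2) i] by simp
    qed
  qed
qed

lemma nc_tendsto_line:
  assumes f: "locally_bounded_nc d D f" and d: "0 < d" and x: "x \<in> D" "x \<in> M_level d n" and h: "h \<in> M_level d n"
    and ij: "i < n" "j < n"
  shows "((\<lambda>t. f (line x h t) $$ (i,j)) \<longlongrightarrow> f x $$ (i,j)) (at 0)"
proof -
  have nc: "nc_on d D f" using f by (simp add: locally_bounded_nc_def)
  obtain \<epsilon> L where L: "\<epsilon> > 0" "L \<ge> 0"
    "\<And>y. near d n \<epsilon> x y \<Longrightarrow> y \<in> D \<and> op_norm (f y - f x) \<le> L * (\<Sum>i<d. op_norm (y ! i - x ! i))"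
    using nc_lipschitz[OF f d x] by blast
  show ?thesis
  proof (rule LIM_zero_cancel, rule Lim_null_comparison)
    have "eventually (\<lambda>t. near d n \<epsilon> x (line x h t)) (at 0)"
      using eventually_near_line[OF x(2) h L(1)] by (simp add: eventually_at_filter eventually_mono)
    then show "eventually (\<lambda>t. cmod (f (line x h t) $$ (i,j) - f x $$ (i,j)) \<le> cmod t * (L * (\<Sum>i<d. op_norm (h ! i)))) (at 0)"
    proof eventually_elim
      case (elim t)
      have D: "line x h t \<in> D" using L(3)[OF elim] by blast
      have fc: "f (line x h t) \<in> carrier_mat n n" "f x \<in> carrier_mat n n"
        using nc_on_carrier[OF nc d] x D line_M_level[OF x(2) h] by auto
      have "cmod ((f (line x h t) - f x) $$ (i,j)) \<le> op_norm (f (line x h t) - f x)"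
        using fc ij by (intro cmod_index_le_op_norm) auto
      also have "\<dots> \<le> L * (\<Sum>i<d. op_norm (line x h t ! i - x ! i))" using L(3)[OF elim] by blast
      also have "\<dots> = cmod t * (L * (\<Sum>i<d. op_norm (h ! i)))"
        using op_norm_line_diff[OF x(2) h] by (simp add: sum_distrib_left mult_ac)
      finally show ?case using fc ij by simp
    qed
    show "((\<lambda>t. cmod t * (L * (\<Sum>i<d. op_norm (h ! i)))) \<longlongrightarrow> 0) (at 0)"
      by (auto intro!: tendsto_eq_intros)
  qed
qed

text \<open>The corner is held fixed at \<open>k = a h\<close> while \<open>y = x + t h\<close>
  moves, by taking the scalar \<open>T = - a / t\<close>. The corner of the value is then
  \<open>a\<close> times the difference quotient, and it converges because \<open>f\<close> is
  continuous along lines at the point \<open>upper x k x\<close> of twice the level.\<close>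

lemma nc_has_derivative_line:
  assumes f: "locally_bounded_nc d D f" and d: "0 < d" and x: "x \<in> D" "x \<in> M_level d n" and h: "h \<in> M_level d n"
    and ij: "i < n" "j < n"
  shows "(\<lambda>t. f (line x h t) $$ (i,j)) field_differentiable (at 0)"
proof -
  have nc: "nc_on d D f" using f by (simp add: locally_bounded_nc_def)
  have xx: "dsum x x \<in> D" using f x unfolding locally_bounded_nc_def by blast
  let ?Z0 = "replicate d (0\<^sub>m n n :: complex mat)"
  have 0: "?Z0 \<in> M_level d n" by (auto simp: M_level_def)
  have xx': "upper x ?Z0 x = dsum x x" using dsum_eq_upper[OF x(2,2)] by simp
  obtain \<epsilon> C where eC: "\<epsilon> > 0" "\<And>z. near d (n + n) \<epsilon> (dsum x x) z \<Longrightarrow> z \<in> D \<and> op_norm (f z) \<le> C"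
    using locally_bounded_nc_near[OF f xx dsum_M_level[OF x(2,2)]] by blast
  obtain \<epsilon>1 C1 where eC1: "\<epsilon>1 > 0" "\<And>z. near d n \<epsilon>1 x z \<Longrightarrow> z \<in> D \<and> op_norm (f z) \<le> C1"
    using locally_bounded_nc_near[OF f x] by blast
  have e: "\<epsilon> > 0" "\<And>z. near d (n + n) \<epsilon> (dsum x x) z \<Longrightarrow> z \<in> D" using eC by auto
  have e1: "\<epsilon>1 > 0" "\<And>z. near d n \<epsilon>1 x z \<Longrightarrow> z \<in> D" using eC1 by auto
  define K where "K = 1 + (\<Sum>i<d. op_norm (h ! i))"
  have K: "K > 0" unfolding K_def by (intro add_pos_nonneg sum_nonneg) auto
  \<comment> \<open>Scales the direction so that the corner \<open>k\<close> has norm at most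
    \<open>\<epsilon> / 2\<close> and \<open>upper x k x\<close> stays in the domain.\<close>
  define a where "a = \<epsilon> / (2 * K)"
  have a: "a > 0" using e K by (simp add: a_def)
  define k where "k = map (\<lambda>i. of_real a \<cdot>\<^sub>m h ! i) [0..<d]"
  have kl: "k \<in> M_level d n" using M_level_nth[OF h] by (auto simp: k_def M_level_def)
  have k0: "op_norm (k ! i - ?Z0 ! i) \<le> \<epsilon> / 2" if i: "i < d" for i
  proof -
    have "k ! i - ?Z0 ! i = of_real a \<cdot>\<^sub>m h ! i" using M_level_nth[OF h i] i by (simp add: k_def) (intro eq_matI, auto)
    then have "op_norm (k ! i - ?Z0 ! i) = a * op_norm (h ! i)" using a by (simp add: op_norm_smult)
    also have "op_norm (h ! i) \<le> (\<Sum>i<d. op_norm (h ! i))" using i by (intro member_le_sum) auto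
    then have "a * op_norm (h ! i) \<le> a * K" using a by (intro mult_left_mono) (auto simp: K_def)
    also have "\<dots> = \<epsilon> / 2" using K by (simp add: a_def)
    finally show ?thesis .
  qed
  have up: "upper x k y \<in> D" "dsum x y \<in> D" if y: "near d n (\<epsilon> / 2) x y" for y
  proof -
    show "upper x k y \<in> D" using near_upper[OF x(2) y 0 kl k0] e(2) xx' by simp
    have "op_norm (?Z0 ! i - ?Z0 ! i) \<le> \<epsilon> / 2" if "i < d" for i using that e(1) by simp
    then show "dsum x y \<in> D"
      using near_upper[OF x(2) y 0 0] e(2) xx' dsum_eq_upper[OF x(2), of y n] y by (auto simp: near_def)
  qed
  define z where "z = upper x k x"
  have xn: "near d n (\<epsilon> / 2) x x"
  proof -
    show ?thesis using x e by (auto simp: near_def)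
  qed
  have z: "z \<in> D" "z \<in> M_level d (n + n)" using up(1)[OF xn] upper_M_level[OF x(2,2)] by (auto simp: z_def)
  \<comment> \<open>Moves the lower right block along \<open>h\<close> and nothing else, so the line
    through \<open>z\<close> in this direction consists of the points
    \<open>upper x k (line x h t)\<close>.\<close>
  define g where "g = map (\<lambda>i. four_block_mat (0\<^sub>m n n) (0\<^sub>m n n) (0\<^sub>m n n) (h ! i)) [0..<d]"
  have gl: "g \<in> M_level d (n + n)" using M_level_nth[OF h] by (auto simp: g_def M_level_def intro!: four_block_carrier_mat)
  have len: "length x = d" "length h = d" "length g = d" using x h by (auto simp: M_level_def g_def)
  have zt: "line z g t = upper x k (line x h t)" for t
  proof (rule nth_equalityI)
    fix i assume "i < length (line z g t)"
    then have i: "i < d" using len by (simp add: line_def z_def upper_def)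
    show "line z g t ! i = upper x k (line x h t) ! i"
      using M_level_nth[OF x(2) i] M_level_nth[OF h i] M_level_nth[OF kl i] len i
      by (simp add: line_def z_def upper_def g_def) (intro eq_matI, auto)
  qed (simp add: line_def z_def upper_def)
  \<comment> \<open>Entry \<open>(i, j)\<close> of the upper right block, hence the column shift by
    \<open>n\<close>; this is \<open>a\<close> times the derivative.\<close>
  define e0 where "e0 = f z $$ (i, n + j)"
  have lim: "((\<lambda>t. f (line z g t) $$ (i, n + j)) \<longlongrightarrow> e0) (at 0)"
    unfolding e0_def using ij by (intro nc_tendsto_line[OF f d z gl]) auto
  have "eventually (\<lambda>t. near d n (min \<epsilon>1 (\<epsilon> / 2)) x (line x h t)) (at 0)"
    using eventually_near_line[OF x(2) h, of "min \<epsilon>1 (\<epsilon> / 2)"] e e1 by (simp add: eventually_at_filter eventually_mono)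
  then have ev: "eventually (\<lambda>t. f (line z g t) $$ (i, n + j) / of_real a = (f (line x h t) $$ (i,j) - f (line x h 0) $$ (i,j)) / (t - 0)) (at 0)"
    using eventually_neq_at_within[of 0 0]
  proof eventually_elim
    case (elim t)
    let ?y = "line x h t"
    have y1: "near d n \<epsilon>1 x ?y" and y2: "near d n (\<epsilon> / 2) x ?y" using near_mono[OF elim(1)] by auto
    have yD: "?y \<in> D" using e1 y1 by blast
    have yl: "?y \<in> M_level d n" by (rule line_M_level[OF x(2) h])
    note fc = nc_on_carrier[OF nc d x] nc_on_carrier[OF nc d yD yl]
    define T where "T = (- of_real a / t) \<cdot>\<^sub>m 1\<^sub>m n"
    have T: "T \<in> carrier_mat n n" by (simp add: T_def)
    have Tm: "A * T = (- of_real a / t) \<cdot>\<^sub>m A" "T * A = (- of_real a / t) \<cdot>\<^sub>m A" if "A \<in> carrier_mat n n" for A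
      using that by (auto simp: T_def mult_smult_distrib[of _ n n _ n] mult_smult_assoc_mat[of _ n n _ n])
    have kT: "k ! i = x ! i * T - T * ?y ! i" if i: "i < d" for i
      unfolding Tm[OF M_level_nth[OF x(2) i]] Tm[OF M_level_nth[OF yl i]]
      using M_level_nth[OF x(2) i] M_level_nth[OF h i] i elim(2) len
      by (simp add: line_nth k_def) (intro eq_matI, auto simp: field_simps)
    have "f (upper x k ?y) = four_block_mat (f x) (f x * T - T * f ?y) (0\<^sub>m n n) (f ?y)"
      by (rule nc_on_upper[OF nc d x(1) yD up(2)[OF y2] x(2) yl T kT up(1)[OF y2]])
    then have "f (line z g t) $$ (i, n + j) = (f x * T - T * f ?y) $$ (i,j)"
      unfolding zt using fc ij T by simp
    also have "\<dots> = (of_real a / t) * (f ?y $$ (i,j) - f x $$ (i,j))"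
      unfolding Tm[OF fc(1)] Tm[OF fc(2)] using fc ij by (simp add: algebra_simps)
    finally show ?case using a elim(2) by (simp add: line_0[OF x(2) h])
  qed
  have "((\<lambda>t. f (line z g t) $$ (i, n + j) / of_real a) \<longlongrightarrow> e0 / of_real a) (at 0)"
    using a by (intro tendsto_intros lim) auto
  then have "((\<lambda>t. (f (line x h t) $$ (i,j) - f (line x h 0) $$ (i,j)) / (t - 0)) \<longlongrightarrow> e0 / of_real a) (at 0)"
    by (rule Lim_transform_eventually[OF _ ev])
  then show ?thesis unfolding field_differentiable_def has_field_derivative_iff by blast
qed

text \<open>By \<open>line_add\<close> the line can be recentred at each of its points, so
  differentiability at parameter 0 suffices.\<close>

lemma nc_holomorphic_line:
  assumes f: "locally_bounded_nc d D f" and d: "0 < d" and x: "x \<in> M_level d n" and h: "h \<in> M_level d n"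
    and A: "\<And>t. t \<in> A \<Longrightarrow> line x h t \<in> D" and ij: "i < n" "j < n"
  shows "(\<lambda>t. f (line x h t) $$ (i,j)) holomorphic_on A"
  unfolding holomorphic_on_def
proof
  fix t assume "t \<in> A"
  then have t: "line x h t \<in> D" by (rule A)
  have "(\<lambda>s. f (line (line x h t) h s) $$ (i,j)) field_differentiable (at (t - t))"
    using nc_has_derivative_line[OF f d t line_M_level[OF x h] h ij] by simp
  then have "(\<lambda>s. f (line (line x h t) h s) $$ (i,j)) \<circ> (\<lambda>w. w - t) field_differentiable (at t)"
    by (intro field_differentiable_compose) (auto intro!: derivative_intros field_differentiable_diff)
  moreover have "(\<lambda>s. f (line (line x h t) h s) $$ (i,j)) \<circ> (\<lambda>w. w - t) = (\<lambda>w. f (line x h w) $$ (i,j))"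
    using line_add[OF x h, of t] by (auto simp: fun_eq_iff) (metis add_diff_cancel_left' diff_add_cancel add.commute)
  ultimately show "(\<lambda>t. f (line x h t) $$ (i,j)) field_differentiable (at t within A)"
    by (simp add: field_differentiable_at_within)
qed

section \<open>Square roots of matrices\<close>

lemma poly_mat_pcompose:
  assumes A: "A \<in> carrier_mat n n"
  shows "poly_mat (pcompose p q) A = poly_mat p (poly_mat q A)"
proof (induction p)
  case (pCons a p)
  have "poly_mat (pcompose (pCons a p) q) A = a \<cdot>\<^sub>m 1\<^sub>m n + poly_mat q A * poly_mat (pcompose p q) A"
    by (simp add: pcompose_pCons poly_mat_add[OF A] poly_mat_mult[OF A] poly_mat_const[OF A])
  then show ?case using pCons by (simp add: poly_mat_pCons[OF poly_mat_carrier[OF A]])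
qed (use A in simp)

text \<open>Peel off linear factors of \<open>p\<close>: either the remaining product already kills
  \<open>w\<close>, or it maps \<open>w\<close> to a nonzero vector that the split factor kills, and
  this is an eigenvector.\<close>

lemma poly_mat_singular:
  assumes A: "A \<in> carrier_mat n n" and w: "w \<in> carrier_vec n" "w \<noteq> 0\<^sub>v n" "poly_mat p A *\<^sub>v w = 0\<^sub>v n"
  shows "\<exists>k\<in>spectrum A. poly p k = 0"
  using w
proof (induction "degree p" arbitrary: p)
  case 0
  then obtain c where c: "p = [:c:]" by (metis degree_eq_zeroE)
  have "0 < n" using w(1,2) by (cases n) auto
  then obtain k where k: "k \<in> spectrum A" using spectrum_non_empty[OF A] by blast
  have "(c \<cdot>\<^sub>m 1\<^sub>m n) *\<^sub>v w = c \<cdot>\<^sub>v w" using w(1) by (intro eq_vecI) auto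
  then have "c \<cdot>\<^sub>v w = 0\<^sub>v n" using 0(4) by (simp add: c poly_mat_const[OF A])
  then have "c = 0" using w(1,2)
    by (metis (no_types, lifting) carrier_vecD mult_eq_0_iff eq_vecI index_smult_vec(1) index_zero_vec)
  then show ?case using k c by auto
next
  case (Suc m)
  then have "\<not> constant (poly p)" by (simp add: constant_degree)
  then obtain a where a: "poly p a = 0" using fundamental_theorem_of_algebra by blast
  then have "[:- a, 1:] dvd p" using poly_eq_0_iff_dvd by blast
  then obtain q where q: "p = [:- a, 1:] * q" by (rule dvdE)
  have q0: "q \<noteq> 0" using q Suc by auto
  have d: "m = degree q" using Suc(2) q0 unfolding q by (subst (asm) degree_mult_eq) auto
  let ?v = "poly_mat q A *\<^sub>v w"
  have v: "?v \<in> carrier_vec n" using A by simp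
  show ?case
  proof (cases "?v = 0\<^sub>v n")
    case True
    then show ?thesis using Suc(1)[OF d w(1,2)] q by auto
  next
    case False
    have "poly_mat p A = (- a \<cdot>\<^sub>m 1\<^sub>m n + A) * poly_mat q A"
      unfolding q poly_mat_mult[OF A] poly_mat_linear[OF A] ..
    then have "(- a \<cdot>\<^sub>m 1\<^sub>m n + A) *\<^sub>v ?v = 0\<^sub>v n"
      using Suc(5) A w(1) assoc_mult_mat_vec[of "- a \<cdot>\<^sub>m 1\<^sub>m n + A" n n "poly_mat q A" n w] by simp
    moreover have "(- a \<cdot>\<^sub>m 1\<^sub>m n + A) *\<^sub>v ?v = (- a \<cdot>\<^sub>m 1\<^sub>m n) *\<^sub>v ?v + A *\<^sub>v ?v"
      by (rule add_mult_distrib_mat_vec[OF _ A v]) simp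
    moreover have "(- a \<cdot>\<^sub>m 1\<^sub>m n) *\<^sub>v ?v = - a \<cdot>\<^sub>v ?v" using v by (intro eq_vecI) auto
    ultimately have eq: "- a \<cdot>\<^sub>v ?v + A *\<^sub>v ?v = 0\<^sub>v n" by simp
    have "A *\<^sub>v ?v = a \<cdot>\<^sub>v ?v"
    proof (rule eq_vecI)
      fix i assume i: "i < dim_vec (a \<cdot>\<^sub>v ?v)"
      then have i: "i < n" using A by simp
      have "(- a \<cdot>\<^sub>v ?v + A *\<^sub>v ?v) $ i = 0" unfolding eq using i by simp
      moreover have "(- a \<cdot>\<^sub>v ?v + A *\<^sub>v ?v) $ i = - (a * ?v $ i) + (A *\<^sub>v ?v) $ i"
        using i A carrier_vecD[OF v] by (simp del: index_mult_mat_vec)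
      ultimately have "(A *\<^sub>v ?v) $ i = a * ?v $ i" by (simp del: index_mult_mat_vec)
      then show "(A *\<^sub>v ?v) $ i = (a \<cdot>\<^sub>v ?v) $ i" using i carrier_vecD[OF v] by (simp del: index_mult_mat_vec)
    qed (use A in simp)
    then have "a \<in> spectrum A" by (rule spectrumI[OF A v False])
    then show ?thesis using a by blast
  qed
qed

lemma poly_mat_square: "A \<in> carrier_mat n n \<Longrightarrow> poly_mat [:0, 0, 1:] A = A * A"
proof -
  assume A: "A \<in> carrier_mat n n"
  have "[:0, 0, 1:] = [:0, 1:] * ([:0, 1:] :: complex poly)" by simp
  then show ?thesis by (simp only: poly_mat_mult[OF A] poly_mat_id[OF A])
qed

text \<open>An eigenvector of the square for \<open>k\<close> is killed by the polynomial
  \<open>z^2 - k\<close> of \<open>A\<close>, so this polynomial has a zero in the spectrum of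
  \<open>A\<close>.\<close>

lemma spectrum_square:
  fixes A :: "complex mat"
  assumes A: "A \<in> carrier_mat n n" and k: "k \<in> spectrum (A * A)"
  shows "\<exists>l\<in>spectrum A. k = l\<^sup>2"
proof -
  have AA: "A * A \<in> carrier_mat n n" using A by simp
  obtain w where w: "w \<in> carrier_vec n" "w \<noteq> 0\<^sub>v n" "(A * A) *\<^sub>v w = k \<cdot>\<^sub>v w" using k AA by (rule spectrumE)
  have "poly_mat [:- k, 1:] (A * A) *\<^sub>v w = poly [:- k, 1:] k \<cdot>\<^sub>v w"
    by (rule poly_mat_eigenvector[OF AA w(1,3)])
  also have "\<dots> = 0\<^sub>v n" using w(1) by (intro eq_vecI) auto
  finally have "poly_mat (pcompose [:- k, 1:] [:0, 0, 1:]) A *\<^sub>v w = 0\<^sub>v n"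
    by (simp only: poly_mat_pcompose[OF A] poly_mat_square[OF A])
  from poly_mat_singular[OF A w(1,2) this] show ?thesis
    by (auto simp: poly_pcompose power2_eq_square)
qed

text \<open>Of the two factors in \<open>(S - v) (S + v) = 0\<close> the second is a polynomial of \<open>v\<close> without zeros
  on the spectrum of \<open>v\<close>.\<close>

lemma fun_calc_sqrt_of_square:
  assumes v: "v \<in> carrier_mat n n" and \<Omega>: "open \<Omega>" "h holomorphic_on \<Omega>" "0 \<notin> \<Omega>" "\<And>z. z \<in> \<Omega> \<Longrightarrow> (h z)\<^sup>2 = z"
    and sp: "\<And>l. l \<in> spectrum v \<Longrightarrow> l\<^sup>2 \<in> \<Omega> \<and> h (l\<^sup>2) = l"
  shows "fun_calc h (v * v) = v"
proof -
  let ?x = "v * v"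
  have x: "?x \<in> carrier_mat n n" using v by simp
  have sx: "spectrum ?x \<subseteq> \<Omega>" using spectrum_square[OF v] sp by blast
  obtain p where p: "fun_calc h ?x = poly_mat p ?x" "\<And>k. k \<in> spectrum ?x \<Longrightarrow> poly p k = h k"
    using fun_calc_poly[OF x \<Omega>(1,2) sx] by blast
  \<comment> \<open>Substituting \<open>z^2\<close> presents \<open>h\<close> of the square as a
    polynomial of \<open>v\<close>, so everything commutes.\<close>
  define q where "q = pcompose p [:0, 0, 1:]"
  have S: "fun_calc h ?x = poly_mat q v"
    by (simp only: p(1) q_def poly_mat_pcompose[OF v] poly_mat_square[OF v])
  have "fun_calc (\<lambda>z. z) ?x = fun_calc h ?x * fun_calc h ?x"
    by (rule fun_calc_mult[OF x \<Omega>(1) sx \<Omega>(2,2)]) (use \<Omega>(4) in \<open>simp add: power2_eq_square\<close>)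
  then have SS: "poly_mat q v * poly_mat q v = ?x" using fun_calc_id[OF x] S by simp
  have prod: "poly_mat (q + [:0, 1:]) v * poly_mat (q - [:0, 1:]) v = 0\<^sub>m n n"
  proof -
    have "poly_mat (q + [:0, 1:]) v * poly_mat (q - [:0, 1:]) v = poly_mat (q * q + Polynomial.smult (- 1) ([:0, 1:] * [:0, 1:])) v"
      unfolding poly_mat_mult[OF v, symmetric] by (intro arg_cong[of _ _ "\<lambda>p. poly_mat p v"]) (simp add: algebra_simps)
    also have "\<dots> = poly_mat q v * poly_mat q v + (- 1) \<cdot>\<^sub>m ?x"
      by (simp only: poly_mat_add[OF v] poly_mat_mult[OF v] poly_mat_smult[OF v] poly_mat_id[OF v])
    also have "\<dots> = 0\<^sub>m n n" unfolding SS using v by (intro eq_matI) auto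
    finally show ?thesis .
  qed
  have "poly_mat q v - v = poly_mat (q - [:0, 1:]) v"
  proof -
    have "q - [:0, 1:] = q + Polynomial.smult (- 1) [:0, 1:]" by simp
    then have "poly_mat (q - [:0, 1:]) v = poly_mat (q + Polynomial.smult (- 1) [:0, 1:]) v" by (simp only:)
    also have "\<dots> = poly_mat q v + (- 1) \<cdot>\<^sub>m v"
      by (simp only: poly_mat_add[OF v] poly_mat_smult[OF v] poly_mat_id[OF v])
    also have "\<dots> = poly_mat q v - v" using v by (intro eq_matI) auto
    finally show ?thesis ..
  qed
  also have "\<dots> = 0\<^sub>m n n"
  proof (rule ccontr)
    let ?D = "poly_mat (q - [:0, 1:]) v"
    assume D: "?D \<noteq> 0\<^sub>m n n"
    have "\<exists>i j. i < n \<and> j < n \<and> ?D $$ (i,j) \<noteq> 0"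
    proof (rule ccontr)
      assume "\<not> (\<exists>i j. i < n \<and> j < n \<and> ?D $$ (i,j) \<noteq> 0)"
      then have "?D = 0\<^sub>m n n" using dim_poly_mat[OF v] by (intro eq_matI) auto
      then show False using D by simp
    qed
    then obtain i j where ij: "i < n" "j < n" "?D $$ (i,j) \<noteq> 0" by blast
    define w where "w = ?D *\<^sub>v unit_vec n j"
    have w: "w \<in> carrier_vec n" using v by (simp add: w_def)
    have "w $ i = ?D $$ (i,j)" using ij v by (simp add: w_def)
    then have w0: "w \<noteq> 0\<^sub>v n" using ij by auto
    have "poly_mat (q + [:0, 1:]) v *\<^sub>v w = (poly_mat (q + [:0, 1:]) v * ?D) *\<^sub>v unit_vec n j"
      unfolding w_def using v by (subst assoc_mult_mat_vec[of _ n n _ n]) auto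
    also have "\<dots> = 0\<^sub>v n" unfolding prod using ij by (intro eq_vecI) auto
    finally obtain l where l: "l \<in> spectrum v" "poly (q + [:0, 1:]) l = 0"
      using poly_mat_singular[OF v w w0] by blast
    obtain e where e: "e \<in> carrier_vec n" "e \<noteq> 0\<^sub>v n" "v *\<^sub>v e = l \<cdot>\<^sub>v e" using l(1) v by (rule spectrumE)
    have "?x *\<^sub>v e = (l * l) \<cdot>\<^sub>v e" using v e by (simp add: mult_mat_vec_smult smult_smult_assoc)
    then have "l\<^sup>2 \<in> spectrum ?x" using spectrumI[OF x e(1,2)] by (simp add: power2_eq_square)
    \<comment> \<open>So \<open>q(l) = l\<close>, and the second factor has the value
      \<open>2 l\<close> at \<open>l\<close>. It would vanish only for \<open>l = 0\<close>, which
      \<open>0 \<notin> \<Omega>\<close> excludes.\<close>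
    then have "poly p (l\<^sup>2) = l" using p(2) sp[OF l(1)] by simp
    then have "l + l = 0" using l(2) by (simp add: q_def poly_pcompose power2_eq_square)
    then have "l = 0" by simp
    then show False using sp[OF l(1)] \<Omega>(3) by simp
  qed
  finally have D0: "poly_mat q v - v = 0\<^sub>m n n" .
  have "poly_mat q v = (poly_mat q v - v) + v" using v by (intro eq_matI) auto
  then show ?thesis unfolding S D0 using v by simp
qed

section \<open>The charts of the manifold\<close>

lemma pair_M_level: "[a, b] \<in> M_level 2 n \<longleftrightarrow> a \<in> carrier_mat n n \<and> b \<in> carrier_mat n n"
  by (auto simp: M_level_def)

lemma triple_M_level: "[a, b, c] \<in> M_level 3 n \<longleftrightarrow> a \<in> carrier_mat n n \<and> b \<in> carrier_mat n n \<and> c \<in> carrier_mat n n"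
  by (auto simp: M_level_def)

lemma M_level_pairE:
  assumes "w \<in> M_level 2 n"
  obtains a b where "w = [a, b]" "a \<in> carrier_mat n n" "b \<in> carrier_mat n n"
  using assms by (auto simp: M_level_def numeral_2_eq_2 length_Suc_conv)

lemma M_level_tripleE:
  assumes "w \<in> M_level 3 n"
  obtains a b c where "w = [a, b, c]" "a \<in> carrier_mat n n" "b \<in> carrier_mat n n" "c \<in> carrier_mat n n"
  using assms by (auto simp: M_level_def numeral_3_eq_3 length_Suc_conv)

definition pm :: "complex mat \<Rightarrow> complex mat \<Rightarrow> point" where
  "pm u v = [u + v, u - v]"

lemma pm_M_level: "u \<in> carrier_mat n n \<Longrightarrow> v \<in> carrier_mat n n \<Longrightarrow> pm u v \<in> M_level 2 n"
  by (simp add: pm_def pair_M_level)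

lemma M_level_pmE:
  assumes "w \<in> M_level 2 n"
  obtains u v where "w = pm u v" "u \<in> carrier_mat n n" "v \<in> carrier_mat n n"
proof -
  obtain a b where w: "w = [a, b]" "a \<in> carrier_mat n n" "b \<in> carrier_mat n n"
    using assms by (rule M_level_pairE)
  have "w = pm ((1/2) \<cdot>\<^sub>m (a + b)) ((1/2) \<cdot>\<^sub>m (a - b))"
    using w by (auto simp: pm_def field_simps intro!: eq_matI)
  then show thesis by (rule that) (use w in auto)
qed

lemma pi_map_pm:
  assumes "u \<in> carrier_mat n n" "v \<in> carrier_mat n n"
  shows "pi_map (pm u v) = [u, v * v, v * u * v]"
proof -
  have p: "(u + v) + (u - v) = 2 \<cdot>\<^sub>m u" using assms by (intro eq_matI) auto
  have m: "(u + v) - (u - v) = 2 \<cdot>\<^sub>m v" using assms by (intro eq_matI) auto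
  have "(1/2) \<cdot>\<^sub>m (2 \<cdot>\<^sub>m u) = u" by (intro eq_matI) auto
  moreover have "(1/4) \<cdot>\<^sub>m ((2 \<cdot>\<^sub>m v) * (2 \<cdot>\<^sub>m v)) = v * v"
    using assms by (simp add: mult_smult_assoc_mat[of _ n n _ n] mult_smult_distrib[of _ n n _ n]) (intro eq_matI, auto)
  moreover have "(1/8) \<cdot>\<^sub>m ((2 \<cdot>\<^sub>m v) * (2 \<cdot>\<^sub>m u) * (2 \<cdot>\<^sub>m v)) = v * u * v"
    using assms by (simp add: mult_smult_assoc_mat[of _ n n _ n] mult_smult_distrib[of _ n n _ n]) (intro eq_matI, auto)
  ultimately show ?thesis by (simp add: pi_map_def pm_def p m Let_def)
qed

lemma dsum_pm:
  assumes "u \<in> carrier_mat n n" "v \<in> carrier_mat n n" "u' \<in> carrier_mat m m" "v' \<in> carrier_mat m m"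
  shows "dsum (pm u v) (pm u' v') = pm (mat_dsum u u') (mat_dsum v v')"
  using assms by (simp add: pm_def dsum_def mat_dsum_add[of _ n _ m] mat_dsum_diff[of _ n _ m])

lemma conj_mult:
  assumes s: "s \<in> carrier_mat n n" "invertible_mat s" and "A \<in> carrier_mat n n" "B \<in> carrier_mat n n"
  shows "(mat_inv s * A * s) * (mat_inv s * B * s) = mat_inv s * (A * B) * s"
proof -
  note i = invertible_mat_inv[OF s]
  have "(mat_inv s * A * s) * (mat_inv s * B * s) = mat_inv s * A * (s * (mat_inv s * (B * s)))"
    using assms i by (simp add: assoc_mult_mat[of _ n n _ n _ n])
  also have "s * (mat_inv s * (B * s)) = B * s"
    using assms i assoc_mult_mat[OF s(1) i(1), of "B * s" n] by simp
  finally show ?thesis using assms i by (simp add: assoc_mult_mat[of _ n n _ n _ n])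
qed

lemma conj_add:
  assumes "s \<in> carrier_mat n n" "invertible_mat s" "A \<in> carrier_mat n n" "B \<in> carrier_mat n n"
  shows "mat_inv s * (A + B) * s = mat_inv s * A * s + mat_inv s * B * s"
    "mat_inv s * (A - B) * s = mat_inv s * A * s - mat_inv s * B * s"
  using assms invertible_mat_inv[OF assms(1,2)]
  by (auto simp: mult_add_distrib_mat[of _ n n _ n] add_mult_distrib_mat[of _ n n _ _ n]
      mult_minus_distrib_mat[of _ n n _ n] minus_mult_distrib_mat[of _ n n _ _ n] simp del: assoc_mult_mat)

lemma conjugate_by_pm:
  assumes "s \<in> carrier_mat n n" "invertible_mat s" "u \<in> carrier_mat n n" "v \<in> carrier_mat n n"
  shows "conjugate_by s (pm u v) = pm (mat_inv s * u * s) (mat_inv s * v * s)"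
  unfolding pm_def conjugate_by_def using conj_add[OF assms] by simp

text \<open>The matrix \<open>s\<close> intertwines \<open>x\<close> with its conjugate
  \<open>y\<close>, that is \<open>x s = s y\<close>.\<close>

lemma fun_calc_similar:
  assumes s: "s \<in> carrier_mat n n" "invertible_mat s" and x: "x \<in> carrier_mat n n"
    and \<Omega>: "open \<Omega>" "h holomorphic_on \<Omega>" "spectrum x \<subseteq> \<Omega>"
  shows "fun_calc h (mat_inv s * x * s) = mat_inv s * fun_calc h x * s"
proof -
  note i = invertible_mat_inv[OF s]
  have y: "mat_inv s * x * s \<in> carrier_mat n n" using i x s by simp
  have sp: "spectrum (mat_inv s * x * s) \<subseteq> \<Omega>" using spectrum_similar_subset[OF x s(1) i(1,2)] \<Omega> by blast
  have "s * (mat_inv s * x * s) = x * s"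
    using i x s assoc_mult_mat[OF s(1) i(1), of "x * s" n] by (simp add: assoc_mult_mat[of _ n n _ n _ n])
  then have "fun_calc h x * s = s * fun_calc h (mat_inv s * x * s)"
    using fun_calc_intertwine[OF x y s(1) _ \<Omega> sp] by simp
  then have "mat_inv s * (fun_calc h x * s) = mat_inv s * (s * fun_calc h (mat_inv s * x * s))" by simp
  also have "\<dots> = (mat_inv s * s) * fun_calc h (mat_inv s * x * s)"
    using i s fun_calc_carrier[OF y] by (intro assoc_mult_mat[symmetric]) auto
  also have "\<dots> = fun_calc h (mat_inv s * x * s)" using i fun_calc_carrier[OF y] by simp
  finally show ?thesis using i s x assoc_mult_mat[OF i(1) fun_calc_carrier[OF x] s(1)] by simp
qed

locale sqrt_branches =
  fixes r :: "complex set \<Rightarrow> real" and s :: "complex set \<Rightarrow> complex \<Rightarrow> complex"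
  assumes sqrt_data: "sqrt_data r s"
begin

definition root :: "complex set \<Rightarrow> (complex \<Rightarrow> complex) \<Rightarrow> complex \<Rightarrow> complex" where
  "root \<gamma> \<tau> z = s \<gamma> z * iota r \<gamma> \<tau> z"

abbreviation "S \<equiv> S_op r s"

lemma S_eq: "S \<gamma> \<tau> = fun_calc (root \<gamma> \<tau>)"
  by (simp add: S_op_def root_def[abs_def])

lemma I_eq: "I_op r \<gamma> \<tau> = fun_calc (iota r \<gamma> \<tau>)"
  by (simp add: I_op_def)

lemma open_Disks: "open (Disks r \<gamma>)"
  by (auto simp: Disks_def)

context
  fixes \<gamma> assumes \<gamma>: "\<gamma> \<in> Gam"
begin

lemma radius: "0 < r \<gamma>" "c \<in> \<gamma> \<Longrightarrow> r \<gamma> < cmod c" "c \<in> \<gamma> \<Longrightarrow> d \<in> \<gamma> \<Longrightarrow> c \<noteq> d \<Longrightarrow> 4 * r \<gamma> < cmod (c - d)"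
  using sqrt_data \<gamma> unfolding sqrt_data_def by fastforce+

text \<open>The centres are more than four radii apart, so the definite description in
  \<open>iota\<close> is unique on each disc.\<close>

lemma iota_eq:
  assumes "c \<in> \<gamma>" "cmod (z - c) < r \<gamma>"
  shows "iota r \<gamma> \<tau> z = \<tau> c"
proof -
  have "(THE c. c \<in> \<gamma> \<and> cmod (z - c) < r \<gamma>) = c"
  proof (rule the_equality)
    fix d assume d: "d \<in> \<gamma> \<and> cmod (z - d) < r \<gamma>"
    show "d = c"
    proof (rule ccontr)
      assume "d \<noteq> c"
      then have "4 * r \<gamma> < cmod (c - d)" using radius(3)[of c d] assms d by auto
      also have "\<dots> = cmod ((z - d) - (z - c))" by simp
      also have "\<dots> \<le> cmod (z - d) + cmod (z - c)" by (rule norm_triangle_ineq4)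
      finally show False using d assms radius(1) by linarith
    qed
  qed (use assms in simp)
  then show ?thesis by (simp add: iota_def)
qed

lemma DisksE:
  assumes "z \<in> Disks r \<gamma>"
  obtains c where "c \<in> \<gamma>" "cmod (z - c) < r \<gamma>"
  using assms by (auto simp: Disks_def dist_norm norm_minus_commute)

lemma center_in_Disks: "c \<in> \<gamma> \<Longrightarrow> c \<in> Disks r \<gamma>"
  using radius(1) by (auto simp: Disks_def intro!: bexI[of _ c])

lemma zero_notin_Disks: "0 \<notin> Disks r \<gamma>"
  using radius(2) by (force elim: DisksE)

lemma iota_holomorphic: "iota r \<gamma> \<tau> holomorphic_on Disks r \<gamma>"
  unfolding Disks_def
proof (rule holomorphic_on_UN_open)
  fix c assume c: "c \<in> \<gamma>"
  show "iota r \<gamma> \<tau> holomorphic_on ball c (r \<gamma>)"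
    by (rule holomorphic_transform[of "\<lambda>_. \<tau> c"])
      (use iota_eq[OF c] in \<open>auto simp: dist_norm norm_minus_commute\<close>)
qed auto

lemma root_holomorphic: "root \<gamma> \<tau> holomorphic_on Disks r \<gamma>"
  unfolding root_def using iota_holomorphic sqrt_data \<gamma> unfolding sqrt_data_def
  by (intro holomorphic_intros) auto

lemma iota_square:
  assumes "\<tau> \<in> signs \<gamma>" "z \<in> Disks r \<gamma>"
  shows "iota r \<gamma> \<tau> z * iota r \<gamma> \<tau> z = 1"
proof -
  obtain c where "c \<in> \<gamma>" "cmod (z - c) < r \<gamma>" using assms(2) by (rule DisksE)
  then show ?thesis using iota_eq assms(1) by (auto simp: signs_def PiE_def Pi_def)
qed

lemma root_square:
  assumes "\<tau> \<in> signs \<gamma>" "z \<in> Disks r \<gamma>"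
  shows "(root \<gamma> \<tau> z)\<^sup>2 = z"
proof -
  have "(s \<gamma> z)\<^sup>2 = z" using sqrt_data \<gamma> assms(2) unfolding sqrt_data_def by blast
  moreover have "(iota r \<gamma> \<tau> z)\<^sup>2 = 1" using iota_square[OF assms] by (simp add: power2_eq_square)
  ultimately show ?thesis by (simp add: root_def power_mult_distrib)
qed

context
  fixes n and x :: "complex mat" assumes x: "x \<in> carrier_mat n n" "spectrum x \<subseteq> Disks r \<gamma>"
begin

lemma S_carrier: "S \<gamma> \<tau> x \<in> carrier_mat n n" and I_carrier: "I_op r \<gamma> \<tau> x \<in> carrier_mat n n"
  using x by (auto simp: S_eq I_eq)

lemma S_square: "\<tau> \<in> signs \<gamma> \<Longrightarrow> S \<gamma> \<tau> x * S \<gamma> \<tau> x = x"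
  unfolding S_eq
  using fun_calc_mult[OF x(1) open_Disks x(2) root_holomorphic root_holomorphic, of "\<lambda>z. z" \<tau> \<tau>]
    root_square by (simp add: fun_calc_id[OF x(1)] power2_eq_square)

lemma S_poly: obtains p where "S \<gamma> \<tau> x = poly_mat p x"
  unfolding S_eq using fun_calc_poly[OF x(1) open_Disks root_holomorphic x(2)] by blast

text \<open>An eigenvector of \<open>S\<close> for \<open>l\<close> is one of \<open>x = S S\<close>
  for \<open>l^2\<close>, and on it the functional calculus acts as
  \<open>root \<gamma> \<tau> (l^2)\<close>.\<close>

lemma S_spectrum:
  assumes \<tau>: "\<tau> \<in> signs \<gamma>" and l: "l \<in> spectrum (S \<gamma> \<tau> x)"
  shows "l\<^sup>2 \<in> Disks r \<gamma> \<and> root \<gamma> \<tau> (l\<^sup>2) = l"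
proof -
  obtain v where v: "v \<in> carrier_vec n" "v \<noteq> 0\<^sub>v n" "S \<gamma> \<tau> x *\<^sub>v v = l \<cdot>\<^sub>v v"
    using l S_carrier by (rule spectrumE)
  have "(S \<gamma> \<tau> x * S \<gamma> \<tau> x) *\<^sub>v v = (l * l) \<cdot>\<^sub>v v"
    using v carrier_matD[OF S_carrier] assoc_mult_mat_vec[OF S_carrier S_carrier v(1), of \<tau> \<tau>]
    by (simp add: mult_mat_vec_smult smult_smult_assoc)
  then have xv: "x *\<^sub>v v = l\<^sup>2 \<cdot>\<^sub>v v" by (simp add: S_square[OF \<tau>] power2_eq_square)
  have "S \<gamma> \<tau> x *\<^sub>v v = root \<gamma> \<tau> (l\<^sup>2) \<cdot>\<^sub>v v"
    unfolding S_eq by (rule fun_calc_eigenvector[OF x(1) open_Disks root_holomorphic x(2) v(1) xv v(2)])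
  then have "(l - root \<gamma> \<tau> (l\<^sup>2)) \<cdot>\<^sub>v v = 0\<^sub>v n" using v by (auto simp: algebra_simps vec_eq_iff)
  then have "l - root \<gamma> \<tau> (l\<^sup>2) = 0" using v(1,2)
    by (metis (no_types, lifting) carrier_vecD mult_eq_0_iff eq_vecI index_smult_vec(1) index_zero_vec)
  moreover have "l\<^sup>2 \<in> spectrum x" by (rule spectrumI[OF x(1) v(1,2) xv])
  ultimately show ?thesis using x(2) by auto
qed

end

lemma S_dsum:
  assumes "x \<in> carrier_mat n n" "spectrum x \<subseteq> Disks r \<gamma>" "y \<in> carrier_mat m m" "spectrum y \<subseteq> Disks r \<gamma>"
  shows "S \<gamma> \<tau> (mat_dsum x y) = mat_dsum (S \<gamma> \<tau> x) (S \<gamma> \<tau> y)"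
    "I_op r \<gamma> \<tau> (mat_dsum x y) = mat_dsum (I_op r \<gamma> \<tau> x) (I_op r \<gamma> \<tau> y)"
  unfolding S_eq I_eq using assms
  by (auto intro!: fun_calc_dsum[OF _ _ open_Disks] root_holomorphic iota_holomorphic)

lemma S_similar:
  assumes "x \<in> carrier_mat n n" "spectrum x \<subseteq> Disks r \<gamma>" "t \<in> carrier_mat n n" "invertible_mat t"
  shows "S \<gamma> \<tau> (mat_inv t * x * t) = mat_inv t * S \<gamma> \<tau> x * t"
    "I_op r \<gamma> \<tau> (mat_inv t * x * t) = mat_inv t * I_op r \<gamma> \<tau> x * t"
  unfolding S_eq I_eq using assms
  by (auto intro!: fun_calc_similar[OF _ _ _ open_Disks] root_holomorphic iota_holomorphic)

lemma S_of_square: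
  assumes "\<tau> \<in> signs \<gamma>" "v \<in> carrier_mat n n"
    "\<And>l. l \<in> spectrum v \<Longrightarrow> l\<^sup>2 \<in> Disks r \<gamma> \<and> root \<gamma> \<tau> (l\<^sup>2) = l"
  shows "S \<gamma> \<tau> (v * v) = v"
  unfolding S_eq
  by (rule fun_calc_sqrt_of_square[OF assms(2) open_Disks root_holomorphic zero_notin_Disks root_square[OF assms(1)] assms(3)])

end

lemma finite_signs: "\<gamma> \<in> Gam \<Longrightarrow> finite (signs \<gamma>)"
  unfolding signs_def Gam_def by (intro finite_PiE) auto

definition nonconst :: "complex set \<Rightarrow> (complex \<Rightarrow> complex) \<Rightarrow> bool" where
  "nonconst \<gamma> \<tau> \<longleftrightarrow> (\<exists>c\<in>\<gamma>. \<exists>d\<in>\<gamma>. \<tau> c \<noteq> \<tau> d)"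

lemma U_setI:
  assumes "1 \<le> n" "u \<in> carrier_mat n n" "x \<in> carrier_mat n n" "spectrum x \<subseteq> Disks r \<gamma>"
    "\<And>\<tau>. \<tau> \<in> signs \<gamma> \<Longrightarrow> nonconst \<gamma> \<tau> \<Longrightarrow> u * I_op r \<gamma> \<tau> x \<noteq> I_op r \<gamma> \<tau> x * u"
  shows "[u, x] \<in> U_set r \<gamma>"
  using assms MI[of "[u, x]" 2 n] unfolding U_set_def Dom_def nonconst_def by (auto simp: pair_M_level)

lemma U_setE:
  assumes "p \<in> U_set r \<gamma>"
  obtains n u x where "p = [u, x]" "1 \<le> n" "u \<in> carrier_mat n n" "x \<in> carrier_mat n n" "spectrum x \<subseteq> Disks r \<gamma>"
    "\<And>\<tau>. \<tau> \<in> signs \<gamma> \<Longrightarrow> nonconst \<gamma> \<tau> \<Longrightarrow> u * I_op r \<gamma> \<tau> x \<noteq> I_op r \<gamma> \<tau> x * u"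
proof -
  obtain u x where ux: "p = [u, x]" "[u, x] \<in> M 2" "x \<in> Dom r \<gamma>"
    "\<And>\<tau>. \<tau> \<in> signs \<gamma> \<Longrightarrow> nonconst \<gamma> \<tau> \<Longrightarrow> u * I_op r \<gamma> \<tau> x \<noteq> I_op r \<gamma> \<tau> x * u"
    using assms unfolding U_set_def nonconst_def by blast
  obtain n where n: "1 \<le> n" "[u, x] \<in> M_level 2 n" using ux(2) by (rule ME)
  have "u \<in> carrier_mat n n" "x \<in> carrier_mat n n" using n(2) by (auto simp: pair_M_level)
  moreover have "spectrum x \<subseteq> Disks r \<gamma>" using ux(3) by (auto simp: Dom_def)
  ultimately show thesis using that[OF ux(1) n(1) _ _ _ ux(4)] by blast
qed

lemma U_set_level: "[u, x] \<in> U_set r \<gamma> \<Longrightarrow> u \<in> carrier_mat n n \<Longrightarrow> 1 \<le> n \<and> x \<in> carrier_mat n n \<and> spectrum x \<subseteq> Disks r \<gamma>"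
  by (elim U_setE) auto

text \<open>Products of direct sums are formed blockwise, so a noncommuting first block suffices and
  only a spectral condition is imposed on the second. This is what allows branched points with
  commuting coordinates to be absorbed later.\<close>

lemma U_set_dsum:
  assumes \<gamma>: "\<gamma> \<in> Gam" and p: "[u, x] \<in> U_set r \<gamma>" "u \<in> carrier_mat n n"
    and q: "u' \<in> carrier_mat m m" "x' \<in> carrier_mat m m" "spectrum x' \<subseteq> Disks r \<gamma>"
  shows "[mat_dsum u u', mat_dsum x x'] \<in> U_set r \<gamma>"
proof -
  have x: "1 \<le> n" "x \<in> carrier_mat n n" "spectrum x \<subseteq> Disks r \<gamma>" using U_set_level[OF p] by auto
  have ne: "u * I_op r \<gamma> \<tau> x \<noteq> I_op r \<gamma> \<tau> x * u" if "\<tau> \<in> signs \<gamma>" "nonconst \<gamma> \<tau>" for \<tau>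
    using p(1) by (rule U_setE) (use that in auto)
  show ?thesis
  proof (rule U_setI[of "n + m"])
    fix \<tau> assume \<tau>: "\<tau> \<in> signs \<gamma>" "nonconst \<gamma> \<tau>"
    note I = I_carrier[OF \<gamma> x(2,3), of \<tau>] I_carrier[OF \<gamma> q(2,3), of \<tau>]
    show "mat_dsum u u' * I_op r \<gamma> \<tau> (mat_dsum x x') \<noteq> I_op r \<gamma> \<tau> (mat_dsum x x') * mat_dsum u u'"
      unfolding S_dsum(2)[OF \<gamma> x(2,3) q(2,3)] mat_dsum_mult[OF p(2) q(1) I] mat_dsum_mult[OF I p(2) q(1)]
      using mat_dsum_inject[of "u * I_op r \<gamma> \<tau> x" n "u' * I_op r \<gamma> \<tau> x'" m "I_op r \<gamma> \<tau> x * u" "I_op r \<gamma> \<tau> x' * u'"]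
        I p q ne[OF \<tau>] by auto
  qed (use x p q in \<open>auto simp: spectrum_mat_dsum[of _ n _ m]\<close>)
qed

lemma omega_map_eq: "omega_map r s \<gamma> \<tau> [u, x] = pm u (S \<gamma> \<tau> x)"
  by (simp add: omega_map_def pm_def Let_def)

lemma Phi_map_eq: "Phi_map r s \<gamma> \<tau> [u, x] = [u, x, S \<gamma> \<tau> x * u * S \<gamma> \<tau> x]"
  by (simp add: Phi_map_def Let_def)

lemma pi_omega:
  assumes \<gamma>: "\<gamma> \<in> Gam" "\<tau> \<in> signs \<gamma>" and p: "p \<in> U_set r \<gamma>"
  shows "pi_map (omega_map r s \<gamma> \<tau> p) = Phi_map r s \<gamma> \<tau> p"
proof -
  obtain n u x where ux: "p = [u, x]" "1 \<le> n" "u \<in> carrier_mat n n" "x \<in> carrier_mat n n" "spectrum x \<subseteq> Disks r \<gamma>"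
    using p by (rule U_setE)
  show ?thesis
    unfolding ux(1) omega_map_eq Phi_map_eq pi_map_pm[OF ux(3) S_carrier[OF \<gamma>(1) ux(4,5)]]
      S_square[OF \<gamma>(1) ux(4,5) \<gamma>(2)] ..
qed

lemma G_manE:
  assumes "y \<in> G_man r s"
  obtains \<gamma> \<tau> p where "\<gamma> \<in> Gam" "\<tau> \<in> signs \<gamma>" "p \<in> U_set r \<gamma>" "y = Phi_map r s \<gamma> \<tau> p"
  using assms unfolding G_man_def by blast

lemma G_manI: "\<gamma> \<in> Gam \<Longrightarrow> \<tau> \<in> signs \<gamma> \<Longrightarrow> p \<in> U_set r \<gamma> \<Longrightarrow> Phi_map r s \<gamma> \<tau> p \<in> G_man r s"
  unfolding G_man_def by blast

end

section \<open>From symmetric functions to functions on the manifold\<close>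

lemma M_dsum: "x \<in> M d \<Longrightarrow> y \<in> M d \<Longrightarrow> dsum x y \<in> M d"
  by (elim ME) (rule MI[OF dsum_M_level], auto)

lemma nc_set_M: "nc_set d (M d)"
  by (simp add: nc_set_def M_dsum)

lemma pm_in_M: "u \<in> carrier_mat n n \<Longrightarrow> v \<in> carrier_mat n n \<Longrightarrow> 1 \<le> n \<Longrightarrow> pm u v \<in> M 2"
  by (rule MI[OF pm_M_level])

lemma symmetric_pm:
  assumes f: "symmetric f" and uv: "u \<in> carrier_mat n n" "v \<in> carrier_mat n n" "1 \<le> n"
  shows "f (pm u (- v)) = f (pm u v)"
proof -
  have "u + - v = u - v" "u - - v = u + v" using uv by (auto intro!: eq_matI)
  then show ?thesis using f MI[of "[u + v, u - v]" 2 n] uv by (auto simp: pm_def symmetric_def pair_M_level)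
qed

text \<open>With \<open>J = v\<inverse> v'\<close>, the idempotents \<open>(1 \<plusminus> J) / 2\<close> intertwine \<open>(u + v, u - v)\<close> with
  \<open>(u + v', u - v')\<close> and with its flip, respectively.\<close>

lemma symmetric_nc_pm_eq:
  assumes f: "nc_on 2 (M 2) f" "symmetric f" and n: "1 \<le> n"
    and c: "u \<in> carrier_mat n n" "v \<in> carrier_mat n n" "v' \<in> carrier_mat n n" "vi \<in> carrier_mat n n"
    and inv: "v * vi = 1\<^sub>m n" "vi * v = 1\<^sub>m n" and comm: "v * v' = v' * v"
    and sq: "v * v = v' * v'" and uv: "v * u * v = v' * u * v'"
  shows "f (pm u v) = f (pm u v')"
proof -
  note a = assoc_mult_mat[of _ n n _ n _ n]
  define J where "J = vi * v'"
  have J: "J \<in> carrier_mat n n" using c by (simp add: J_def)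
  have vJ: "v * J = v'" unfolding J_def using c inv by (simp add: assoc_mult_mat[of v n n vi n v' n, symmetric])
  have Jv: "J * v = v'" 
  proof -
    have "J * v = vi * (v * v')" unfolding J_def comm using c by (simp add: a)
    also have "\<dots> = v'" using c inv by (simp add: assoc_mult_mat[of vi n n v n v' n, symmetric])
    finally show ?thesis .
  qed
  have Jv': "J * v' = v"
  proof -
    have "J * v' = vi * (v * v)" unfolding sq J_def using c by (simp add: a)
    also have "\<dots> = v" using c inv by (simp add: assoc_mult_mat[of vi n n v n v n, symmetric])
    finally show ?thesis .
  qed
  have cancel: "A = B" if "A \<in> carrier_mat n n" "B \<in> carrier_mat n n" "v * A * v = v * B * v" for A B
  proof -
    have e: "vi * (v * A * v) * vi = A" if A: "A \<in> carrier_mat n n" for A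
    proof -
      have "vi * (v * A * v) * vi = (vi * v) * A * (v * vi)" using A c by (simp add: a)
      then show ?thesis using A inv by simp
    qed
    show ?thesis using e[OF that(1)] e[OF that(2)] that(3) by metis
  qed
  have JJ: "J * J = 1\<^sub>m n"
  proof (rule cancel)
    have "v * (J * J) * v = (v * J) * (J * v)" using c J by (simp add: a)
    also have "\<dots> = v * 1\<^sub>m n * v" unfolding vJ Jv using sq c by simp
    finally show "v * (J * J) * v = v * 1\<^sub>m n * v" .
  qed (use J in auto)
  \<comment> \<open>This comes from \<open>v J = J v = v'\<close> and \<open>v u v = v' u v'\<close>
    by cancelling \<open>v\<close>. Together with \<open>J J = 1\<close> it shows that
    \<open>J\<close> commutes with \<open>u\<close>.\<close>
  have "u = J * u * J"
  proof (rule cancel)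
    have "v * (J * u * J) * v = (v * J) * u * (J * v)" using c J by (simp add: a)
    then show "v * u * v = v * (J * u * J) * v" unfolding vJ Jv uv by simp
  qed (use c J in auto)
  then have "J * u = J * (J * u * J)" by simp
  also have "\<dots> = (J * J) * (u * J)" using c J by (simp add: a)
  finally have Ju: "J * u = u * J" using c J by (simp add: JJ)
  define P where "P e = (1/2) \<cdot>\<^sub>m (1\<^sub>m n + e \<cdot>\<^sub>m J)" for e :: complex
  have P: "P e \<in> carrier_mat n n" for e using J by (simp add: P_def)
  have Pl: "A * P e = (1/2) \<cdot>\<^sub>m (A + e \<cdot>\<^sub>m (A * J))" and Pr: "P e * A = (1/2) \<cdot>\<^sub>m (A + e \<cdot>\<^sub>m (J * A))"
    if "A \<in> carrier_mat n n" for A e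
    using that J by (auto simp: P_def mult_smult_distrib[of _ n n _ n] mult_smult_assoc_mat[of _ n n _ n]
        mult_add_distrib_mat[of _ n n _ n] add_mult_distrib_mat[of _ n n _ _ n])
  have M: "pm u v \<in> M 2" "pm u v' \<in> M 2" "pm u (- v') \<in> M 2" using c n by (auto intro: pm_in_M)
  have L: "pm u v \<in> M_level 2 n" "pm u v' \<in> M_level 2 n" "pm u (- v') \<in> M_level 2 n" using c by (auto intro: pm_M_level)
  have i2: "i = 0 \<or> i = 1" if "i < 2" for i :: nat using that by auto
  note d = mult_add_distrib_mat[of _ n n _ n] add_mult_distrib_mat[of _ n n _ _ n]
     mult_minus_distrib_mat[of _ n n _ n] minus_mult_distrib_mat[of _ n n _ _ n]
  have uP: "u * P e = P e * u" for e unfolding Pl[OF c(1)] Pr[OF c(1)] Ju ..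
  \<comment> \<open>On the range of \<open>P 1\<close> the roots \<open>v\<close> and
    \<open>v'\<close> agree, and on that of \<open>P (-1)\<close> they are opposite; the symmetry of
    \<open>f\<close> compensates for the sign.\<close>
  have vP1: "v * P 1 = P 1 * v'" unfolding Pl[OF c(2)] Pr[OF c(3)] vJ Jv'
    using c by (intro eq_matI) auto
  have vP2: "v * P (-1) = - (P (-1) * v')" unfolding Pl[OF c(2)] Pr[OF c(3)] vJ Jv'
    using c by (intro eq_matI) (auto simp: field_simps)
  have 1: "f (pm u v) * P 1 = P 1 * f (pm u v')"
  proof (rule nc_on_intertwine[OF f(1) _ M(1,2) M_dsum[OF M(1,2)] L(1,2) P])
    fix i :: nat assume "i < 2"
    then show "pm u v ! i * P 1 = P 1 * pm u v' ! i"
      using i2[of i] c P[of 1] uP[of 1] vP1 by (auto simp: pm_def d)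
  qed simp
  have 2: "f (pm u v) * P (-1) = P (-1) * f (pm u (- v'))"
  proof (rule nc_on_intertwine[OF f(1) _ M(1,3) M_dsum[OF M(1,3)] L(1,3) P])
    fix i :: nat assume "i < 2"
    moreover have "u + - v' = u - v'" "u - - v' = u + v'" using c by (auto intro!: eq_matI)
    moreover have "A + - B = A - B" "A - - B = A + B" if "A \<in> carrier_mat n n" "B \<in> carrier_mat n n" for A B :: "complex mat"
      using that by (auto intro!: eq_matI)
    ultimately show "pm u v ! i * P (-1) = P (-1) * pm u (- v') ! i"
      using i2[of i] c P[of "-1"] uP[of "-1"] vP2 by (auto simp: pm_def d)
  qed simp
  have fc: "f (pm u v) \<in> carrier_mat n n" "f (pm u v') \<in> carrier_mat n n"
    using nc_on_carrier[OF f(1)] M L by auto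
  have sum: "P 1 + P (-1) = 1\<^sub>m n" using J by (intro eq_matI) (auto simp: P_def field_simps)
  have "f (pm u v) = f (pm u v) * (P 1 + P (-1))" using fc sum by simp
  also have "\<dots> = f (pm u v) * P 1 + f (pm u v) * P (-1)" using fc P by (simp add: d)
  also have "\<dots> = P 1 * f (pm u v') + P (-1) * f (pm u v')"
    unfolding 1 2 symmetric_pm[OF f(2) c(1,3) n] ..
  also have "\<dots> = (P 1 + P (-1)) * f (pm u v')" using fc P by (simp add: d)
  also have "\<dots> = f (pm u v')" using fc sum by simp
  finally show ?thesis .
qed

text \<open>The value at some preimage under \<pi>. It is defined off the manifold as well, because
  the same function also serves as \<open>fhat\<close> in \<open>conditionally_nc\<close>.\<close>

definition via_pi :: "(point \<Rightarrow> complex mat) \<Rightarrow> point \<Rightarrow> complex mat" where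
  "via_pi f y = f (SOME w. w \<in> M 2 \<and> pi_map w = y)"

lemma dsum_triple: "dsum [a, b, c] [a', b', c'] = [mat_dsum a a', mat_dsum b b', mat_dsum c c']"
  by (simp add: dsum_def)

lemma dsum_pair: "dsum [a, b] [a', b'] = [mat_dsum a a', mat_dsum b b']"
  by (simp add: dsum_def)

lemma lvl_Cons: "lvl (a # w) = dim_row a"
  by (simp add: lvl_def)

context sqrt_branches
begin

definition Dom2 :: "complex set \<Rightarrow> point set" where
  "Dom2 \<gamma> = {p \<in> M 2. p ! 1 \<in> Dom r \<gamma>}"

lemma Dom2E:
  assumes "p \<in> Dom2 \<gamma>"
  obtains n u x where "p = [u, x]" "1 \<le> n" "u \<in> carrier_mat n n" "x \<in> carrier_mat n n" "spectrum x \<subseteq> Disks r \<gamma>"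
proof -
  obtain n where n: "1 \<le> n" "p \<in> M_level 2 n" using assms by (auto simp: Dom2_def elim: ME)
  obtain u x where ux: "p = [u, x]" "u \<in> carrier_mat n n" "x \<in> carrier_mat n n" using n(2) by (rule M_level_pairE)
  show thesis using assms by (intro that[OF ux(1) n(1) ux(2,3)]) (auto simp: Dom2_def Dom_def ux(1))
qed

lemma Dom2I:
  assumes "1 \<le> n" "u \<in> carrier_mat n n" "x \<in> carrier_mat n n" "spectrum x \<subseteq> Disks r \<gamma>"
  shows "[u, x] \<in> Dom2 \<gamma>"
  using assms MI[of "[u, x]" 2 n] by (auto simp: Dom2_def Dom_def pair_M_level)

lemma U_set_subset_Dom2: "U_set r \<gamma> \<subseteq> Dom2 \<gamma>"
  by (auto elim!: U_setE intro: Dom2I)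

lemma S_inverse:
  assumes \<gamma>: "\<gamma> \<in> Gam" "\<tau> \<in> signs \<gamma>" and x: "x \<in> carrier_mat n n" "spectrum x \<subseteq> Disks r \<gamma>"
  obtains vi where "vi \<in> carrier_mat n n" "S \<gamma> \<tau> x * vi = 1\<^sub>m n" "vi * S \<gamma> \<tau> x = 1\<^sub>m n"
proof -
  note Sc = S_carrier[OF \<gamma>(1) x, of \<tau>]
  have inj: "v = 0\<^sub>v n" if v: "v \<in> carrier_vec n" "S \<gamma> \<tau> x *\<^sub>v v = 0\<^sub>v n" for v
  proof (rule ccontr)
    assume "v \<noteq> 0\<^sub>v n"
    moreover have "x *\<^sub>v v = S \<gamma> \<tau> x *\<^sub>v (S \<gamma> \<tau> x *\<^sub>v v)"
      using assoc_mult_mat_vec[OF Sc Sc v(1)] S_square[OF \<gamma>(1) x \<gamma>(2)] by simp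
    then have "x *\<^sub>v v = 0 \<cdot>\<^sub>v v" using v mult_mat_zero_vec[OF Sc] by (auto intro!: eq_vecI)
    ultimately have "0 \<in> spectrum x" using spectrumI[OF x(1) v(1)] by blast
    then show False using x(2) zero_notin_Disks[OF \<gamma>(1)] by blast
  qed
  show thesis using mat_inv[OF Sc inj] that by blast
qed

text \<open>Every preimage has the form \<open>pm u v\<close> with \<open>v v = x\<close>. Such a
  \<open>v\<close> commutes with \<open>x\<close> and hence with \<open>S\<close>, a polynomial of
  \<open>x\<close>, so \<open>symmetric_nc_pm_eq\<close> applies. The claim extends to second
  summands, whose \<open>(u, x)\<close> may violate the noncommutation conditions.\<close>

lemma symmetric_nc_S_eq:
  assumes f: "nc_on 2 (M 2) f" "symmetric f" and \<gamma>: "\<gamma> \<in> Gam" "\<tau> \<in> signs \<gamma>"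
    and n: "1 \<le> n" and u: "u \<in> carrier_mat n n" and x: "x \<in> carrier_mat n n" "spectrum x \<subseteq> Disks r \<gamma>"
    and w: "w \<in> M 2" "pi_map w = [u, x, S \<gamma> \<tau> x * u * S \<gamma> \<tau> x]"
  shows "f w = f (pm u (S \<gamma> \<tau> x))"
proof -
  obtain m where m: "1 \<le> m" "w \<in> M_level 2 m" using w(1) by (rule ME)
  obtain u' v where uv: "w = pm u' v" "u' \<in> carrier_mat m m" "v \<in> carrier_mat m m" using m(2) by (rule M_level_pmE)
  have eq: "u' = u" "v * v = x" "v * u' * v = S \<gamma> \<tau> x * u * S \<gamma> \<tau> x"
    using w(2) pi_map_pm[OF uv(2,3)] by (auto simp: uv(1))
  have mn: "m = n" using uv(2) u eq(1) by auto
  note Sc = S_carrier[OF \<gamma>(1) x, of \<tau>]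
  have v: "v \<in> carrier_mat n n" using uv(3) mn by simp
  obtain p where p: "S \<gamma> \<tau> x = poly_mat p x" using S_poly[OF \<gamma>(1) x] by blast
  have "x * v = v * x" unfolding eq(2)[symmetric] using v by simp
  then have comm: "S \<gamma> \<tau> x * v = v * S \<gamma> \<tau> x" unfolding p by (rule poly_mat_intertwine[OF x(1) x(1) v])
  obtain vi where vi: "vi \<in> carrier_mat n n" "S \<gamma> \<tau> x * vi = 1\<^sub>m n" "vi * S \<gamma> \<tau> x = 1\<^sub>m n"
    using S_inverse[OF \<gamma> x] by blast
  have "f (pm u (S \<gamma> \<tau> x)) = f (pm u v)"
    by (rule symmetric_nc_pm_eq[OF f n u Sc v vi comm]) (use eq S_square[OF \<gamma>(1) x \<gamma>(2)] in auto)
  then show ?thesis by (simp add: uv(1) eq(1))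
qed

lemma via_pi_S:
  assumes f: "nc_on 2 (M 2) f" "symmetric f" and \<gamma>: "\<gamma> \<in> Gam" "\<tau> \<in> signs \<gamma>"
    and n: "1 \<le> n" and u: "u \<in> carrier_mat n n" and x: "x \<in> carrier_mat n n" "spectrum x \<subseteq> Disks r \<gamma>"
  shows "via_pi f [u, x, S \<gamma> \<tau> x * u * S \<gamma> \<tau> x] = f (pm u (S \<gamma> \<tau> x))"
proof -
  let ?P = "\<lambda>w. w \<in> M 2 \<and> pi_map w = [u, x, S \<gamma> \<tau> x * u * S \<gamma> \<tau> x]"
  note Sc = S_carrier[OF \<gamma>(1) x, of \<tau>]
  have "?P (pm u (S \<gamma> \<tau> x))"
    using pm_in_M[OF u Sc n] pi_map_pm[OF u Sc] S_square[OF \<gamma>(1) x \<gamma>(2)] by simp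
  then have "?P (SOME w. ?P w)" by (rule someI)
  then show ?thesis unfolding via_pi_def by (intro symmetric_nc_S_eq[OF f \<gamma> n u x]) auto
qed

lemma G_man_tripleE:
  assumes "y \<in> G_man r s"
  obtains \<gamma> \<tau> n u x where "\<gamma> \<in> Gam" "\<tau> \<in> signs \<gamma>" "1 \<le> n" "u \<in> carrier_mat n n" "x \<in> carrier_mat n n"
    "spectrum x \<subseteq> Disks r \<gamma>" "[u, x] \<in> U_set r \<gamma>" "y = [u, x, S \<gamma> \<tau> x * u * S \<gamma> \<tau> x]"
proof -
  obtain \<gamma> \<tau> p where 1: "\<gamma> \<in> Gam" "\<tau> \<in> signs \<gamma>" "p \<in> U_set r \<gamma>" "y = Phi_map r s \<gamma> \<tau> p"
    using assms by (rule G_manE)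
  obtain n u x where 2: "p = [u, x]" "1 \<le> n" "u \<in> carrier_mat n n" "x \<in> carrier_mat n n" "spectrum x \<subseteq> Disks r \<gamma>"
    using 1(3) by (rule U_setE)
  show thesis using that[OF 1(1,2) 2(2-5)] 1(3,4) by (simp add: 2(1) Phi_map_eq)
qed

lemma S_u_S_carrier:
  assumes "\<gamma> \<in> Gam" "u \<in> carrier_mat n n" "x \<in> carrier_mat n n" "spectrum x \<subseteq> Disks r \<gamma>"
  shows "S \<gamma> \<tau> x * u * S \<gamma> \<tau> x \<in> carrier_mat n n"
  using S_carrier[OF assms(1,3,4), of \<tau>] assms by simp

lemma G_man_subset_M: "G_man r s \<subseteq> M 3"
proof
  fix y assume "y \<in> G_man r s"
  then obtain \<gamma> \<tau> n u x where y: "\<gamma> \<in> Gam" "\<tau> \<in> signs \<gamma>" "1 \<le> n" "u \<in> carrier_mat n n" "x \<in> carrier_mat n n"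
    "spectrum x \<subseteq> Disks r \<gamma>" "[u, x] \<in> U_set r \<gamma>" "y = [u, x, S \<gamma> \<tau> x * u * S \<gamma> \<tau> x]" by (rule G_man_tripleE)
  show "y \<in> M 3" unfolding y(8)
    by (rule MI[OF _ y(3)]) (use y S_u_S_carrier[OF y(1,4-6)] in \<open>simp add: triple_M_level\<close>)
qed

text \<open>The spectrum of the sum contains those of the summands, and \<open>S\<close> splits, so
  both summands have the chart form with \<gamma> and \<tau> of the sum. Noncommutation may fail in
  the second one, which therefore need not belong to the manifold.\<close>

lemma G_man_dsumE:
  assumes "x \<in> G_man r s" "y \<in> M 3" "dsum x y \<in> G_man r s"
  obtains \<gamma> \<tau> n u a m u' a' where "\<gamma> \<in> Gam" "\<tau> \<in> signs \<gamma>"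
    "1 \<le> n" "u \<in> carrier_mat n n" "a \<in> carrier_mat n n" "spectrum a \<subseteq> Disks r \<gamma>" "x = [u, a, S \<gamma> \<tau> a * u * S \<gamma> \<tau> a]"
    "1 \<le> m" "u' \<in> carrier_mat m m" "a' \<in> carrier_mat m m" "spectrum a' \<subseteq> Disks r \<gamma>" "y = [u', a', S \<gamma> \<tau> a' * u' * S \<gamma> \<tau> a']"
proof -
  obtain n where n: "1 \<le> n" "x \<in> M_level 3 n" using subsetD[OF G_man_subset_M assms(1)] by (rule ME)
  obtain u a b where x: "x = [u, a, b]" "u \<in> carrier_mat n n" "a \<in> carrier_mat n n" "b \<in> carrier_mat n n"
    using n(2) by (rule M_level_tripleE)
  obtain m where m: "1 \<le> m" "y \<in> M_level 3 m" using assms(2) by (rule ME)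
  obtain u' a' b' where y: "y = [u', a', b']" "u' \<in> carrier_mat m m" "a' \<in> carrier_mat m m" "b' \<in> carrier_mat m m"
    using m(2) by (rule M_level_tripleE)
  obtain \<gamma> \<tau> k U X where z: "\<gamma> \<in> Gam" "\<tau> \<in> signs \<gamma>" "1 \<le> k" "U \<in> carrier_mat k k" "X \<in> carrier_mat k k"
    "spectrum X \<subseteq> Disks r \<gamma>" "[U, X] \<in> U_set r \<gamma>" "dsum x y = [U, X, S \<gamma> \<tau> X * U * S \<gamma> \<tau> X]"
    using assms(3) by (rule G_man_tripleE)
  have e: "U = mat_dsum u u'" "X = mat_dsum a a'" "mat_dsum b b' = S \<gamma> \<tau> X * U * S \<gamma> \<tau> X"
    using z(8) by (auto simp: x(1) y(1) dsum_triple)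
  have sp: "spectrum a \<subseteq> Disks r \<gamma>" "spectrum a' \<subseteq> Disks r \<gamma>"
    using z(6) spectrum_mat_dsum[OF x(3) y(3)] by (auto simp: e(2))
  note Sc = S_carrier[OF z(1) x(3) sp(1), of \<tau>] S_carrier[OF z(1) y(3) sp(2), of \<tau>]
  have "mat_dsum b b' = mat_dsum (S \<gamma> \<tau> a * u * S \<gamma> \<tau> a) (S \<gamma> \<tau> a' * u' * S \<gamma> \<tau> a')"
    unfolding e S_dsum(1)[OF z(1) x(3) sp(1) y(3) sp(2)] using Sc x y
    by (simp add: mat_dsum_mult[of _ n _ m] del: assoc_mult_mat)
  then have "b = S \<gamma> \<tau> a * u * S \<gamma> \<tau> a \<and> b' = S \<gamma> \<tau> a' * u' * S \<gamma> \<tau> a'"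
    using x y Sc by (intro mat_dsum_inject[of _ n _ m]) (simp_all del: assoc_mult_mat)
  then show thesis using that[OF z(1,2) n(1) x(2,3) sp(1) _ m(1) y(2,3) sp(2)] x(1) y(1) by blast
qed

lemma conjugate_by_S:
  assumes \<gamma>: "\<gamma> \<in> Gam" and u: "u \<in> carrier_mat n n" and x: "x \<in> carrier_mat n n" "spectrum x \<subseteq> Disks r \<gamma>"
    and t: "t \<in> carrier_mat n n" "invertible_mat t"
  shows "conjugate_by t [u, x, S \<gamma> \<tau> x * u * S \<gamma> \<tau> x] =
    (let u' = mat_inv t * u * t; x' = mat_inv t * x * t in [u', x', S \<gamma> \<tau> x' * u' * S \<gamma> \<tau> x'])"
proof -
  note Sc = S_carrier[OF \<gamma> x, of \<tau>]
  have "(mat_inv t * S \<gamma> \<tau> x * t) * (mat_inv t * u * t) * (mat_inv t * S \<gamma> \<tau> x * t) = mat_inv t * (S \<gamma> \<tau> x * u * S \<gamma> \<tau> x) * t"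
    using conj_mult[OF t Sc u] conj_mult[OF t _ Sc, of "S \<gamma> \<tau> x * u"] Sc u by (simp del: assoc_mult_mat)
  then show ?thesis by (simp add: conjugate_by_def Let_def S_similar(1)[OF \<gamma> x t] del: assoc_mult_mat)
qed

lemma via_pi_conditionally_nc:
  assumes f: "nc_on 2 (M 2) f" "symmetric f"
  shows "conditionally_nc 3 (G_man r s) (restrict (via_pi f) (G_man r s))"
proof -
  let ?G = "G_man r s"
  let ?F = "restrict (via_pi f) ?G"
  have gr: "f (pm u (S \<gamma> \<tau> x)) \<in> carrier_mat n n"
    if "\<gamma> \<in> Gam" "1 \<le> n" "u \<in> carrier_mat n n" "x \<in> carrier_mat n n" "spectrum x \<subseteq> Disks r \<gamma>" for \<gamma> \<tau> n u x
    using nc_on_carrier[OF f(1) _ pm_in_M pm_M_level] S_carrier[OF that(1,4,5)] that by auto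
  have "graded ?G ?F"
    unfolding graded_def
  proof
    fix y assume y: "y \<in> ?G"
    then obtain \<gamma> \<tau> n u x where 1: "\<gamma> \<in> Gam" "\<tau> \<in> signs \<gamma>" "1 \<le> n" "u \<in> carrier_mat n n" "x \<in> carrier_mat n n"
      "spectrum x \<subseteq> Disks r \<gamma>" "[u, x] \<in> U_set r \<gamma>" "y = [u, x, S \<gamma> \<tau> x * u * S \<gamma> \<tau> x]" by (rule G_man_tripleE)
    show "?F y \<in> carrier_mat (lvl y) (lvl y)"
      using y gr[OF 1(1,3-6)] via_pi_S[OF f 1(1-6)] 1(4) unfolding 1(8) by (simp add: lvl_Cons)
  qed
  moreover have "respects_similarities ?G ?F"
    unfolding respects_similarities_def
  proof (intro ballI impI)
    fix y t assume y: "y \<in> ?G" and t: "t \<in> carrier_mat (lvl y) (lvl y)" "invertible_mat t" and cG: "conjugate_by t y \<in> ?G"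
    obtain \<gamma> \<tau> n u x where 1: "\<gamma> \<in> Gam" "\<tau> \<in> signs \<gamma>" "1 \<le> n" "u \<in> carrier_mat n n" "x \<in> carrier_mat n n"
      "spectrum x \<subseteq> Disks r \<gamma>" "[u, x] \<in> U_set r \<gamma>" "y = [u, x, S \<gamma> \<tau> x * u * S \<gamma> \<tau> x]" using y by (rule G_man_tripleE)
    have t: "t \<in> carrier_mat n n" "invertible_mat t" using t 1(4) by (auto simp: 1(8) lvl_Cons)
    note i = invertible_mat_inv[OF t]
    note Sc = S_carrier[OF 1(1,5,6), of \<tau>]
    let ?u = "mat_inv t * u * t" and ?x = "mat_inv t * x * t"
    have c: "?u \<in> carrier_mat n n" "?x \<in> carrier_mat n n" using i t 1 by auto
    have sp: "spectrum ?x \<subseteq> Disks r \<gamma>" using spectrum_similar_subset[OF 1(5) t(1) i(1,2)] 1(6) by blast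
    have "?F (conjugate_by t y) = via_pi f (conjugate_by t y)" using cG by simp
    also have "\<dots> = f (pm ?u (S \<gamma> \<tau> ?x))"
      using via_pi_S[OF f 1(1-3) c sp] conjugate_by_S[OF 1(1,4-6) t] by (simp add: 1(8) Let_def)
    also have "\<dots> = f (conjugate_by t (pm u (S \<gamma> \<tau> x)))"
      unfolding conjugate_by_pm[OF t 1(4) Sc] S_similar(1)[OF 1(1,5,6) t] ..
    also have "\<dots> = mat_inv t * f (pm u (S \<gamma> \<tau> x)) * t"
      using MI[OF conjugate_by_M_level[OF pm_M_level[OF 1(4) Sc] t] 1(3)]
      by (intro nc_on_similar[OF f(1) _ pm_in_M[OF 1(4) Sc 1(3)] pm_M_level[OF 1(4) Sc] t]) auto
    also have "f (pm u (S \<gamma> \<tau> x)) = ?F y" using via_pi_S[OF f 1(1-6)] y by (simp add: 1(8))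
    finally show "?F (conjugate_by t y) = mat_inv t * ?F y * t" .
  qed
  moreover have "graded {y \<in> M 3. \<exists>x\<in>?G. dsum x y \<in> ?G} (via_pi f)"
    unfolding graded_def
  proof
    fix y assume "y \<in> {y \<in> M 3. \<exists>x\<in>?G. dsum x y \<in> ?G}"
    then obtain x where "x \<in> ?G" "y \<in> M 3" "dsum x y \<in> ?G" by blast
    then obtain \<gamma> \<tau> n u a m u' a' where 1: "\<gamma> \<in> Gam" "\<tau> \<in> signs \<gamma>"
      "1 \<le> n" "u \<in> carrier_mat n n" "a \<in> carrier_mat n n" "spectrum a \<subseteq> Disks r \<gamma>" "x = [u, a, S \<gamma> \<tau> a * u * S \<gamma> \<tau> a]"
      "1 \<le> m" "u' \<in> carrier_mat m m" "a' \<in> carrier_mat m m" "spectrum a' \<subseteq> Disks r \<gamma>" "y = [u', a', S \<gamma> \<tau> a' * u' * S \<gamma> \<tau> a']"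
      by (rule G_man_dsumE)
    show "via_pi f y \<in> carrier_mat (lvl y) (lvl y)"
      using gr[OF 1(1,8-11)] via_pi_S[OF f 1(1,2,8-11)] 1(9) unfolding 1(12) by (simp add: lvl_Cons)
  qed
  moreover have "?F (dsum x y) = mat_dsum (?F x) (via_pi f y)"
    if xy: "x \<in> ?G" "y \<in> M 3" "dsum x y \<in> ?G" for x y
  proof -
    obtain \<gamma> \<tau> n u a m u' a' where 1: "\<gamma> \<in> Gam" "\<tau> \<in> signs \<gamma>"
      "1 \<le> n" "u \<in> carrier_mat n n" "a \<in> carrier_mat n n" "spectrum a \<subseteq> Disks r \<gamma>" "x = [u, a, S \<gamma> \<tau> a * u * S \<gamma> \<tau> a]"
      "1 \<le> m" "u' \<in> carrier_mat m m" "a' \<in> carrier_mat m m" "spectrum a' \<subseteq> Disks r \<gamma>" "y = [u', a', S \<gamma> \<tau> a' * u' * S \<gamma> \<tau> a']"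
      using xy by (rule G_man_dsumE)
    note Sc = S_carrier[OF 1(1,5,6), of \<tau>] S_carrier[OF 1(1,10,11), of \<tau>]
    have c: "mat_dsum u u' \<in> carrier_mat (n + m) (n + m)" "mat_dsum a a' \<in> carrier_mat (n + m) (n + m)"
      "spectrum (mat_dsum a a') \<subseteq> Disks r \<gamma>" "1 \<le> n + m"
      using 1 by (auto simp: spectrum_mat_dsum[OF 1(5,10)])
    have d: "dsum x y = [mat_dsum u u', mat_dsum a a', S \<gamma> \<tau> (mat_dsum a a') * mat_dsum u u' * S \<gamma> \<tau> (mat_dsum a a')]"
      unfolding 1(7,12) dsum_triple S_dsum(1)[OF 1(1,5,6,10,11)] using Sc 1(4,9)
      by (simp add: mat_dsum_mult[of _ n _ m] del: assoc_mult_mat)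
    have "?F (dsum x y) = f (pm (mat_dsum u u') (S \<gamma> \<tau> (mat_dsum a a')))"
      using xy(3) via_pi_S[OF f 1(1,2) c(4,1-3)] by (simp add: d)
    also have "\<dots> = f (dsum (pm u (S \<gamma> \<tau> a)) (pm u' (S \<gamma> \<tau> a')))"
      unfolding S_dsum(1)[OF 1(1,5,6,10,11)] dsum_pm[OF 1(4) Sc(1) 1(9) Sc(2)] ..
    also have "\<dots> = mat_dsum (f (pm u (S \<gamma> \<tau> a))) (f (pm u' (S \<gamma> \<tau> a')))"
      using f(1) pm_in_M[OF 1(4) Sc(1) 1(3)] pm_in_M[OF 1(9) Sc(2) 1(8)] M_dsum unfolding nc_on_def by blast
    also have "\<dots> = mat_dsum (?F x) (via_pi f y)"
      using xy(1) via_pi_S[OF f 1(1-6)] via_pi_S[OF f 1(1,2,8-11)] by (simp add: 1(7,12))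
    finally show ?thesis .
  qed
  ultimately show ?thesis using G_man_subset_M unfolding conditionally_nc_def by blast
qed

section \<open>Free neighbourhoods on which the functional calculus is almost polynomial\<close>

definition approx_on :: "complex set \<Rightarrow> (complex \<Rightarrow> complex) \<Rightarrow> real \<Rightarrow> complex poly \<Rightarrow> real \<Rightarrow> point set \<Rightarrow> bool" where
  "approx_on \<gamma> h R p \<eta> N \<longleftrightarrow> openin (free_topology 2) N \<and> N \<subseteq> Dom2 \<gamma> \<and>
    (\<forall>n u x. [u, x] \<in> N \<longrightarrow> x \<in> carrier_mat n n \<longrightarrow> op_norm u \<le> R \<and> op_norm (poly_mat p x) \<le> R \<and>
       op_norm (fun_calc h x) \<le> R \<and> op_norm (fun_calc h x - poly_mat p x) \<le> \<eta>)"

lemma approx_onD: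
  assumes "approx_on \<gamma> h R p \<eta> N" "[u, x] \<in> N" "x \<in> carrier_mat n n"
  shows "op_norm u \<le> R" "op_norm (poly_mat p x) \<le> R" "op_norm (fun_calc h x) \<le> R" "op_norm (fun_calc h x - poly_mat p x) \<le> \<eta>"
  using assms unfolding approx_on_def by auto

text \<open>With \<open>q\<close> annihilating \<open>x\<close>, \<open>fun_calc_approx\<close>
  gives a polynomial \<open>p\<close> that is exact at \<open>x\<close> and has an error of the
  order of \<open>q(x')\<close> at nearby \<open>x'\<close>; that \<open>q(x')\<close> is small is a
  free open condition. \<open>R\<close> and \<open>p\<close> precede \<eta>, as
  \<open>free_continuous_at\<close> demands.\<close>

lemma Dom2_approx:
  assumes h: "h holomorphic_on Disks r \<gamma>" and ux: "[u, x] \<in> Dom2 \<gamma>"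
  shows "\<exists>R p. fun_calc h x = poly_mat p x \<and> (\<forall>\<eta>>0. \<exists>N. [u, x] \<in> N \<and> approx_on \<gamma> h R p \<eta> N)"
proof -
  obtain n where n: "1 \<le> n" "u \<in> carrier_mat n n" "x \<in> carrier_mat n n" "spectrum x \<subseteq> Disks r \<gamma>"
    using ux by (rule Dom2E) auto
  obtain q where q: "q \<noteq> 0" "poly_mat q x = 0\<^sub>m n n" "\<And>k. poly q k = 0 \<Longrightarrow> k \<in> spectrum x"
    using annihilating_poly[OF n(3)] by blast
  have q\<Omega>: "\<And>k. poly q k = 0 \<Longrightarrow> k \<in> Disks r \<gamma>" using q(3) n(4) by blast
  obtain p \<epsilon> where p0: "\<epsilon> > 0" "\<forall>n x. x \<in> carrier_mat n n \<longrightarrow> poly_mat q x = 0\<^sub>m n n \<longrightarrow> fun_calc h x = poly_mat p x"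
    "\<forall>n x. x \<in> carrier_mat n n \<longrightarrow> op_norm (poly_mat q x) \<le> \<epsilon> \<longrightarrow> spectrum x \<subseteq> Disks r \<gamma>"
    "\<forall>R. \<exists>C\<ge>0. \<forall>n x. x \<in> carrier_mat n n \<longrightarrow> op_norm x \<le> R \<longrightarrow> op_norm (poly_mat q x) \<le> \<epsilon> \<longrightarrow>
        op_norm (fun_calc h x - poly_mat p x) \<le> C * op_norm (poly_mat q x)"
    apply (insert fun_calc_approx[OF open_Disks h q(1)])
    apply (drule meta_mp)
     apply (erule q\<Omega>)
    apply (elim exE conjE)
    apply (rule that)
    apply assumption+
    done
  note p = p0(1) p0(2,3)[rule_format] p0(4)[THEN spec]
  define R1 where "R1 = op_norm u + op_norm x + 1"
  have R1: "op_norm u < R1" "op_norm x < R1" "0 < R1"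
    using op_norm_nonneg[of u] op_norm_nonneg[of x] by (auto simp: R1_def simp del: op_norm_nonneg)
  obtain C where C: "C \<ge> 0" "\<And>n x. x \<in> carrier_mat n n \<Longrightarrow> op_norm x \<le> R1 \<Longrightarrow> op_norm (poly_mat q x) \<le> \<epsilon> \<Longrightarrow>
        op_norm (fun_calc h x - poly_mat p x) \<le> C * op_norm (poly_mat q x)"
    using p(4)[of R1] by blast
  obtain B where B: "B \<ge> 0" "\<And>n x. x \<in> carrier_mat n n \<Longrightarrow> op_norm x \<le> R1 \<Longrightarrow> op_norm (poly_mat p x) \<le> B"
    using poly_mat_bounded[of R1 p] by blast
  have "\<exists>N. [u, x] \<in> N \<and> approx_on \<gamma> h (R1 + B + C * \<epsilon>) p \<eta> N" if \<eta>: "\<eta> > 0" for \<eta>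
  proof -
    \<comment> \<open>The denominator is \<open>C + 1\<close> because \<open>C\<close> may be
      zero.\<close>
    define \<epsilon>' where "\<epsilon>' = min \<epsilon> (\<eta> / (C + 1))"
    have e': "\<epsilon>' > 0" "\<epsilon>' \<le> \<epsilon>" using p(1) \<eta> C(1) by (auto simp: \<epsilon>'_def)
    have "C * \<epsilon>' \<le> (C + 1) * (\<eta> / (C + 1))" using C(1) \<eta> e' by (intro mult_mono) (auto simp: \<epsilon>'_def)
    then have Ce: "C * \<epsilon>' \<le> \<eta>" using C(1) by simp
    define N where "N = {p \<in> M 2. op_norm (p ! 0) < R1} \<inter> {p \<in> M 2. op_norm (p ! 1) < R1} \<inter> {p \<in> M 2. op_norm (poly_mat q (p ! 1)) < \<epsilon>'}"
    have "openin (free_topology 2) N"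
      unfolding N_def using R1 e' by (intro openin_Int poly_fun_ball_open poly_fun_coord poly_fun_poly_mat) auto
    moreover have "[u, x] \<in> N" using ux R1 q(2) e' by (auto simp: N_def Dom2_def)
    moreover have "N \<subseteq> Dom2 \<gamma>"
    proof
      fix w assume w: "w \<in> N"
      then obtain m where m: "1 \<le> m" "w \<in> M_level 2 m" by (auto simp: N_def elim: ME)
      obtain a b where ab: "w = [a, b]" "a \<in> carrier_mat m m" "b \<in> carrier_mat m m" using m(2) by (rule M_level_pairE)
      have "spectrum b \<subseteq> Disks r \<gamma>" using p(3)[OF ab(3)] w e' by (simp add: N_def ab(1))
      then show "w \<in> Dom2 \<gamma>" unfolding ab(1) by (rule Dom2I[OF m(1) ab(2,3)])
    qed
    moreover have "op_norm u' \<le> R1 + B + C * \<epsilon> \<and> op_norm (poly_mat p x') \<le> R1 + B + C * \<epsilon> \<and>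
       op_norm (fun_calc h x') \<le> R1 + B + C * \<epsilon> \<and> op_norm (fun_calc h x' - poly_mat p x') \<le> \<eta>"
      if w: "[u', x'] \<in> N" "x' \<in> carrier_mat m m" for m u' x'
    proof -
      have b: "op_norm u' \<le> R1" "op_norm x' \<le> R1" "op_norm (poly_mat q x') \<le> \<epsilon>'" using w(1) by (auto simp: N_def)
      have c: "fun_calc h x' \<in> carrier_mat m m" "poly_mat p x' \<in> carrier_mat m m" using w by auto
      have 1: "op_norm (fun_calc h x' - poly_mat p x') \<le> C * \<epsilon>'"
        using C(2)[OF w(2) b(2)] b(3) e' C(1) mult_left_mono[OF b(3) C(1)] by linarith
      have 2: "op_norm (poly_mat p x') \<le> B" by (rule B(2)[OF w(2) b(2)])
      have "op_norm (fun_calc h x') = op_norm (poly_mat p x' + (fun_calc h x' - poly_mat p x'))"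
        using c by (intro arg_cong[of _ _ op_norm] eq_matI) auto
      also have "\<dots> \<le> op_norm (poly_mat p x') + op_norm (fun_calc h x' - poly_mat p x')"
        using c by (intro op_norm_add[of _ m m]) auto
      finally have 3: "op_norm (fun_calc h x') \<le> B + C * \<epsilon>" using 1 2 mult_left_mono[OF e'(2) C(1)] by linarith
      have "0 \<le> C * \<epsilon>" using C(1) p(1) by simp
      then show ?thesis using 1 2 3 b R1(3) B(1) Ce by linarith
    qed
    ultimately show ?thesis unfolding approx_on_def by blast
  qed
  then show ?thesis using p(2)[OF n(3) q(2)] by blast
qed

lemma Dom2_nbhd:
  assumes "h holomorphic_on Disks r \<gamma>" "[u, x] \<in> Dom2 \<gamma>"
  obtains R p N where "[u, x] \<in> N" "approx_on \<gamma> h R p 1 N"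
proof -
  obtain R p where "\<forall>\<eta>>0. \<exists>N. [u, x] \<in> N \<and> approx_on \<gamma> h R p \<eta> N"
    using Dom2_approx[OF assms] by (elim exE conjE) (rule that)
  from this[THEN spec, of 1] obtain N where "[u, x] \<in> N" "approx_on \<gamma> h R p 1 N" by auto
  then show thesis by (rule that)
qed

lemma Dom2_open: "openin (free_topology 2) (Dom2 \<gamma>)"
proof (subst openin_subopen, intro ballI)
  fix w assume w: "w \<in> Dom2 \<gamma>"
  then obtain u x where ux: "w = [u, x]" by (rule Dom2E)
  have c: "(\<lambda>_. 0) holomorphic_on Disks r \<gamma>" by simp
  obtain R p N where "[u, x] \<in> N" "approx_on \<gamma> (\<lambda>_. 0) R p 1 N"
    by (rule Dom2_nbhd[OF c w[unfolded ux]])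
  then show "\<exists>N. openin (free_topology 2) N \<and> w \<in> N \<and> N \<subseteq> Dom2 \<gamma>"
    unfolding ux approx_on_def by (intro exI[of _ N]) simp
qed

text \<open>Locally, \<open>omega_map\<close> is approximated by the polynomial map with coordinates
  \<open>u + p(x)\<close> and \<open>u - p(x)\<close>; each coordinate has two terms of norm at most
  \<open>R\<close>, hence the bound \<open>2 * R\<close>. The lemma carries local bounds of
  \<open>f\<close> over to the charts.\<close>

lemma omega_free_continuous:
  assumes \<gamma>: "\<gamma> \<in> Gam" and U: "openin (free_topology 2) U" and p: "p \<in> Dom2 \<gamma>" "omega_map r s \<gamma> \<tau> p \<in> U"
  obtains N where "openin (free_topology 2) N" "p \<in> N" "N \<subseteq> Dom2 \<gamma>" "omega_map r s \<gamma> \<tau> ` N \<subseteq> U"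
proof (rule free_continuous_at[where f = "omega_map r s \<gamma> \<tau>" and D = "Dom2 \<gamma>" and d = 2 and e = 2 and U = U and x = p])
  fix w assume w: "w \<in> Dom2 \<gamma>"
  then obtain n u x where ux: "w = [u, x]" "1 \<le> n" "u \<in> carrier_mat n n" "x \<in> carrier_mat n n" "spectrum x \<subseteq> Disks r \<gamma>"
    by (rule Dom2E)
  obtain R p where Rp: "fun_calc (root \<gamma> \<tau>) x = poly_mat p x"
    "\<forall>\<eta>>0. \<exists>N. [u, x] \<in> N \<and> approx_on \<gamma> (root \<gamma> \<tau>) R p \<eta> N"
    using Dom2_approx[OF root_holomorphic[OF \<gamma>, of \<tau>] w[unfolded ux(1)]] by (elim exE conjE) (rule that)
  define \<phi> where "\<phi> i q = (if i = 0 then q ! 0 + poly_mat p (q ! 1) else q ! 0 - poly_mat p (q ! 1))" for i :: nat and q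
  have up: "map (\<lambda>i. \<phi> i q) [0..<2] = [q ! 0 + poly_mat p (q ! 1), q ! 0 - poly_mat p (q ! 1)]" for q
    by (simp add: \<phi>_def numeral_2_eq_2)
  have "poly_fun 2 (\<phi> i)" for i
    unfolding \<phi>_def by (cases "i = 0") (auto intro!: poly_fun_add poly_fun_diff poly_fun_poly_mat poly_fun_coord)
  moreover have "omega_map r s \<gamma> \<tau> w = map (\<lambda>i. \<phi> i w) [0..<2]"
    unfolding up by (simp add: ux(1) omega_map_eq pm_def S_eq Rp(1))
  moreover have "\<exists>N. openin (free_topology 2) N \<and> w \<in> N \<and> N \<subseteq> Dom2 \<gamma> \<and>
      (\<forall>y\<in>N. close 2 (2 * R) \<eta> (omega_map r s \<gamma> \<tau> y) (map (\<lambda>i. \<phi> i y) [0..<2]))" if \<eta>: "\<eta> > 0" for \<eta>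
  proof -
    obtain N where N: "[u, x] \<in> N" "approx_on \<gamma> (root \<gamma> \<tau>) R p \<eta> N" using Rp(2)[rule_format, OF \<eta>] by (elim exE conjE) (rule that)
    have N': "openin (free_topology 2) N" "w \<in> N" "N \<subseteq> Dom2 \<gamma>" using N ux(1) by (auto simp: approx_on_def)
    have "close 2 (2 * R) \<eta> (omega_map r s \<gamma> \<tau> y) (map (\<lambda>i. \<phi> i y) [0..<2])" if y: "y \<in> N" for y
    proof -
      obtain m a b where ab: "y = [a, b]" "1 \<le> m" "a \<in> carrier_mat m m" "b \<in> carrier_mat m m" "spectrum b \<subseteq> Disks r \<gamma>"
        using subsetD[OF N'(3) y] by (rule Dom2E)
      let ?S = "S \<gamma> \<tau> b" and ?P = "poly_mat p b"
      have c: "?S \<in> carrier_mat m m" "?P \<in> carrier_mat m m" using S_carrier[OF \<gamma> ab(4,5)] ab(4) by auto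
      have b: "op_norm a \<le> R" "op_norm ?P \<le> R" "op_norm ?S \<le> R" "op_norm (?S - ?P) \<le> \<eta>"
        using approx_onD[OF N(2) _ ab(4), of a] y ab(1) by (auto simp: S_eq)
      have d: "(a + ?S) - (a + ?P) = ?S - ?P" "(a - ?S) - (a - ?P) = - (?S - ?P)"
        using ab(3) c by (auto intro!: eq_matI)
      have le: "op_norm (a + A) \<le> 2 * R" "op_norm (a - A) \<le> 2 * R" if "A \<in> carrier_mat m m" "op_norm A \<le> R" for A
        using op_norm_add[OF ab(3) that(1)] op_norm_diff[OF ab(3) that(1)] that(2) b(1) by auto
      show ?thesis
        unfolding close_def up ab(1) omega_map_eq pm_def
      proof (intro conjI allI impI)
        fix i :: nat assume "i < 2"
        then have i: "i = 0 \<or> i = 1" by auto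
        show "op_norm ([a + ?S, a - ?S] ! i) \<le> 2 * R" using i le[OF c(1) b(3)] by auto
        show "op_norm ([[a, b] ! 0 + poly_mat p ([a, b] ! 1), [a, b] ! 0 - poly_mat p ([a, b] ! 1)] ! i) \<le> 2 * R"
          using i le[OF c(2) b(2)] by auto
        show "op_norm ([a + ?S, a - ?S] ! i - [[a, b] ! 0 + poly_mat p ([a, b] ! 1), [a, b] ! 0 - poly_mat p ([a, b] ! 1)] ! i) \<le> \<eta>"
          using i d b(4) by (auto simp: op_norm_uminus)
      next
        show "\<exists>n\<ge>1. [a + ?S, a - ?S] \<in> M_level 2 n \<and> [[a, b] ! 0 + poly_mat p ([a, b] ! 1), [a, b] ! 0 - poly_mat p ([a, b] ! 1)] \<in> M_level 2 n"
          using ab(2,3) c by (intro exI[of _ m]) (simp add: pair_M_level)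
      qed
    qed
    then show ?thesis using N' by blast
  qed
  ultimately show "\<exists>R \<phi>. (\<forall>i<2. poly_fun 2 (\<phi> i)) \<and> omega_map r s \<gamma> \<tau> w = map (\<lambda>i. \<phi> i w) [0..<2] \<and>
      (\<forall>\<eta>>0. \<exists>N. openin (free_topology 2) N \<and> w \<in> N \<and> N \<subseteq> Dom2 \<gamma> \<and> (\<forall>y\<in>N. close 2 R \<eta> (omega_map r s \<gamma> \<tau> y) (map (\<lambda>i. \<phi> i y) [0..<2])))"
    by blast
qed (use assms that in auto)

lemma nc_set_Dom2: "nc_set 2 (Dom2 \<gamma>)"
  unfolding nc_set_def
proof (intro conjI ballI)
  fix w w' assume w: "w \<in> Dom2 \<gamma>" "w' \<in> Dom2 \<gamma>"
  obtain n u x where w1: "w = [u, x]" "1 \<le> n" "u \<in> carrier_mat n n" "x \<in> carrier_mat n n" "spectrum x \<subseteq> Disks r \<gamma>"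
    using w(1) by (rule Dom2E)
  obtain m u' x' where w2: "w' = [u', x']" "1 \<le> m" "u' \<in> carrier_mat m m" "x' \<in> carrier_mat m m" "spectrum x' \<subseteq> Disks r \<gamma>"
    using w(2) by (rule Dom2E)
  note 1 = w1 w2
  show "dsum w w' \<in> Dom2 \<gamma>"
    unfolding 1(1,6) dsum_pair by (rule Dom2I[of "n + m"]) (use 1 in \<open>auto simp: spectrum_mat_dsum[OF 1(4,9)]\<close>)
qed (auto simp: Dom2_def)

text \<open>The zero set of this function is the variety that a chart domain must omit for a
  nonconstant \<tau>. Its local bounds, valid at all levels, come from \<open>Dom2_nbhd\<close> for
  \<open>iota\<close>.\<close>

lemma commutator_nc_holomorphic:
  assumes \<gamma>: "\<gamma> \<in> Gam"
  shows "nc_holomorphic 2 (free_topology 2) (Dom2 \<gamma>) (\<lambda>p. p ! 0 * I_op r \<gamma> \<tau> (p ! 1) - I_op r \<gamma> \<tau> (p ! 1) * p ! 0)"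
    (is "nc_holomorphic 2 _ _ ?g")
proof -
  have gr: "graded (Dom2 \<gamma>) ?g"
    unfolding graded_def
  proof
    fix p assume "p \<in> Dom2 \<gamma>"
    then obtain n u x where ux: "p = [u, x]" "1 \<le> n" "u \<in> carrier_mat n n" "x \<in> carrier_mat n n" "spectrum x \<subseteq> Disks r \<gamma>"
      by (rule Dom2E)
    show "?g p \<in> carrier_mat (lvl p) (lvl p)"
      using ux I_carrier[OF \<gamma> ux(4,5), of \<tau>] by (simp add: lvl_Cons)
  qed
  have ds: "?g (dsum w w') = mat_dsum (?g w) (?g w')" if w: "w \<in> Dom2 \<gamma>" "w' \<in> Dom2 \<gamma>" for w w'
  proof -
    obtain n u x where w1: "w = [u, x]" "1 \<le> n" "u \<in> carrier_mat n n" "x \<in> carrier_mat n n" "spectrum x \<subseteq> Disks r \<gamma>"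
      using w(1) by (rule Dom2E)
    obtain m u' x' where w2: "w' = [u', x']" "1 \<le> m" "u' \<in> carrier_mat m m" "x' \<in> carrier_mat m m" "spectrum x' \<subseteq> Disks r \<gamma>"
      using w(2) by (rule Dom2E)
    note 1 = w1 w2
    note I = I_carrier[OF \<gamma> 1(4,5), of \<tau>] I_carrier[OF \<gamma> 1(9,10), of \<tau>]
    show ?thesis
      unfolding 1(1,6) dsum_pair using I 1(3,8)
      by (simp add: S_dsum(2)[OF \<gamma> 1(4,5,9,10)] mat_dsum_mult[of _ n _ m] mat_dsum_diff[of _ n _ m])
  qed
  have si: "respects_similarities (Dom2 \<gamma>) ?g"
    unfolding respects_similarities_def
  proof (intro ballI impI)
    fix w and t :: "complex mat" assume w: "w \<in> Dom2 \<gamma>" and t: "t \<in> carrier_mat (lvl w) (lvl w)" "invertible_mat t"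
    obtain n u x where ux: "w = [u, x]" "1 \<le> n" "u \<in> carrier_mat n n" "x \<in> carrier_mat n n" "spectrum x \<subseteq> Disks r \<gamma>"
      using w by (rule Dom2E)
    have t: "t \<in> carrier_mat n n" "invertible_mat t" using t ux by (auto simp: lvl_Cons)
    note I = I_carrier[OF \<gamma> ux(4,5), of \<tau>]
    show "?g (conjugate_by t w) = mat_inv t * ?g w * t"
      using conj_mult[OF t ux(3) I] conj_mult[OF t I ux(3)] conj_add(2)[OF t, of "u * I_op r \<gamma> \<tau> x" "I_op r \<gamma> \<tau> x * u"] I ux(3)
      by (simp add: ux(1) conjugate_by_def S_similar(2)[OF \<gamma> ux(4,5) t] del: assoc_mult_mat)
  qed
  have nc: "nc_function 2 (Dom2 \<gamma>) ?g" unfolding nc_function_def using nc_set_Dom2 gr ds si by blast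
  have "\<exists>N. openin (free_topology 2) N \<and> w \<in> N \<and> N \<subseteq> Dom2 \<gamma> \<and> bounded_fun_on N ?g" if w: "w \<in> Dom2 \<gamma>" for w
  proof -
    obtain n u x where ux: "w = [u, x]" "1 \<le> n" "u \<in> carrier_mat n n" "x \<in> carrier_mat n n" "spectrum x \<subseteq> Disks r \<gamma>"
      using w by (rule Dom2E)
    obtain R p N where N: "[u, x] \<in> N" "approx_on \<gamma> (iota r \<gamma> \<tau>) R p 1 N"
      by (rule Dom2_nbhd[OF iota_holomorphic[OF \<gamma>, of \<tau>] w[unfolded ux(1)]])
    have N': "openin (free_topology 2) N" "w \<in> N" "N \<subseteq> Dom2 \<gamma>" using N ux(1) by (auto simp: approx_on_def)
    have "op_norm (?g y) \<le> R * R + R * R" if y: "y \<in> N" for y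
    proof -
      obtain m a b where ab: "y = [a, b]" "1 \<le> m" "a \<in> carrier_mat m m" "b \<in> carrier_mat m m" "spectrum b \<subseteq> Disks r \<gamma>"
        using subsetD[OF N'(3) y] by (rule Dom2E)
      let ?I = "I_op r \<gamma> \<tau> b"
      have I: "?I \<in> carrier_mat m m" by (rule I_carrier[OF \<gamma> ab(4,5)])
      have b: "op_norm a \<le> R" "op_norm ?I \<le> R" using approx_onD[OF N(2) _ ab(4), of a] y ab(1) by (auto simp: I_eq)
      have R: "0 \<le> R" using b op_norm_nonneg order_trans by blast
      have "op_norm (a * ?I - ?I * a) \<le> op_norm (a * ?I) + op_norm (?I * a)" using I ab by (intro op_norm_diff[of _ m m]) auto
      also have "\<dots> \<le> op_norm a * op_norm ?I + op_norm ?I * op_norm a"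
        using I ab by (intro add_mono op_norm_mult[of _ m m _ m]) auto
      also have "\<dots> \<le> R * R + R * R" using b R by (intro add_mono mult_mono) auto
      finally show ?thesis by (simp add: ab(1))
    qed
    then show ?thesis using N' unfolding bounded_fun_on_def by blast
  qed
  then show ?thesis unfolding nc_holomorphic_def using Dom2_open gr nc by blast
qed

text \<open>The set is the free domain \<open>Dom2 \<gamma>\<close> minus one free variety for each
  nonconstant sign choice, and there are finitely many of these.\<close>

lemma U_set_zariski_open:
  assumes \<gamma>: "\<gamma> \<in> Gam"
  shows "openin (zariski_free_topology 2) (U_set r \<gamma>)"
proof -
  define g where "g \<tau> p = p ! 0 * I_op r \<gamma> \<tau> (p ! 1) - I_op r \<gamma> \<tau> (p ! 1) * p ! 0" for \<tau> and p :: point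
  define V where "V \<tau> = {p \<in> Dom2 \<gamma>. \<forall>h\<in>{g \<tau>}. h p = 0\<^sub>m (lvl p) (lvl p)}" for \<tau>
  define \<V> where "\<V> = V ` {\<tau> \<in> signs \<gamma>. nonconst \<gamma> \<tau>}"
  have gholo: "nc_holomorphic 2 (free_topology 2) (Dom2 \<gamma>) (g \<tau>)" for \<tau>
    unfolding g_def by (rule commutator_nc_holomorphic[OF \<gamma>])
  then have "free_variety 2 (Dom2 \<gamma>) (V \<tau>)" for \<tau>
    unfolding free_variety_def V_def by blast
  then have "\<forall>V\<in>\<V>. free_variety 2 (Dom2 \<gamma>) V" unfolding \<V>_def by blast
  moreover have "finite \<V>" unfolding \<V>_def using finite_signs[OF \<gamma>] by simp
  ultimately have "openin (zariski_free_topology 2) (Dom2 \<gamma> - \<Union>\<V>)"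
    unfolding zariski_free_topology_def using Dom2_open by (intro topology_generated_by_Basis) blast
  moreover have "Dom2 \<gamma> - \<Union>\<V> = U_set r \<gamma>"
  proof -
    have iff: "p \<in> V \<tau> \<longleftrightarrow> u * I_op r \<gamma> \<tau> x = I_op r \<gamma> \<tau> x * u"
      if p: "p = [u, x]" "u \<in> carrier_mat n n" "x \<in> carrier_mat n n" "spectrum x \<subseteq> Disks r \<gamma>" "p \<in> Dom2 \<gamma>" for p u x n \<tau>
    proof -
      note I = I_carrier[OF \<gamma> p(3,4), of \<tau>]
      have "u * I_op r \<gamma> \<tau> x - I_op r \<gamma> \<tau> x * u = 0\<^sub>m n n \<longleftrightarrow> u * I_op r \<gamma> \<tau> x = I_op r \<gamma> \<tau> x * u"
      proof
        assume e: "u * I_op r \<gamma> \<tau> x - I_op r \<gamma> \<tau> x * u = 0\<^sub>m n n"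
        have "u * I_op r \<gamma> \<tau> x = (u * I_op r \<gamma> \<tau> x - I_op r \<gamma> \<tau> x * u) + I_op r \<gamma> \<tau> x * u"
          using I p by (intro eq_matI) auto
        then show "u * I_op r \<gamma> \<tau> x = I_op r \<gamma> \<tau> x * u" unfolding e using I p by simp
      next
        assume e: "u * I_op r \<gamma> \<tau> x = I_op r \<gamma> \<tau> x * u"
        show "u * I_op r \<gamma> \<tau> x - I_op r \<gamma> \<tau> x * u = 0\<^sub>m n n" unfolding e using I p by (intro eq_matI) auto
      qed
      then show ?thesis using p by (auto simp: V_def g_def lvl_Cons)
    qed
    show ?thesis
    proof
      show "Dom2 \<gamma> - \<Union>\<V> \<subseteq> U_set r \<gamma>"
      proof
        fix p assume p: "p \<in> Dom2 \<gamma> - \<Union>\<V>"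
        then obtain n u x where ux: "p = [u, x]" "1 \<le> n" "u \<in> carrier_mat n n" "x \<in> carrier_mat n n" "spectrum x \<subseteq> Disks r \<gamma>"
          by (auto elim: Dom2E)
        show "p \<in> U_set r \<gamma>" unfolding ux(1)
        proof (rule U_setI[OF ux(2-5)])
          fix \<tau> assume "\<tau> \<in> signs \<gamma>" "nonconst \<gamma> \<tau>"
          then have "p \<notin> V \<tau>" using p by (auto simp: \<V>_def)
          then show "u * I_op r \<gamma> \<tau> x \<noteq> I_op r \<gamma> \<tau> x * u" using iff[OF ux(1,3-5)] p by auto
        qed
      qed
      show "U_set r \<gamma> \<subseteq> Dom2 \<gamma> - \<Union>\<V>"
      proof
        fix p assume p: "p \<in> U_set r \<gamma>"
        then obtain n u x where ux: "p = [u, x]" "1 \<le> n" "u \<in> carrier_mat n n" "x \<in> carrier_mat n n" "spectrum x \<subseteq> Disks r \<gamma>"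
          "\<And>\<tau>. \<tau> \<in> signs \<gamma> \<Longrightarrow> nonconst \<gamma> \<tau> \<Longrightarrow> u * I_op r \<gamma> \<tau> x \<noteq> I_op r \<gamma> \<tau> x * u" by (rule U_setE) auto
        have "p \<in> Dom2 \<gamma>" using p U_set_subset_Dom2 by blast
        then show "p \<in> Dom2 \<gamma> - \<Union>\<V>" using iff[OF ux(1,3-5)] ux(6) by (auto simp: \<V>_def)
      qed
    qed
  qed
  ultimately show ?thesis by simp
qed

end

lemma nc_function_imp_nc_on: "nc_function d D f \<Longrightarrow> nc_on d D f"
  unfolding nc_function_def nc_on_def nc_set_def by blast

lemma symmetric_free_functionsD:
  assumes "f \<in> symmetric_free_functions"
  shows "nc_on 2 (M 2) f" "symmetric f"
    "\<And>w. w \<in> M 2 \<Longrightarrow> \<exists>U. openin (free_topology 2) U \<and> w \<in> U \<and> bounded_fun_on U f"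
  using assms nc_function_imp_nc_on unfolding symmetric_free_functions_def nc_holomorphic_def by blast+

context sqrt_branches
begin

lemma via_pi_Phi:
  assumes f: "nc_on 2 (M 2) f" "symmetric f" and \<gamma>: "\<gamma> \<in> Gam" "\<tau> \<in> signs \<gamma>" and p: "p \<in> U_set r \<gamma>"
  shows "restrict (via_pi f) (G_man r s) (Phi_map r s \<gamma> \<tau> p) = f (omega_map r s \<gamma> \<tau> p)"
proof -
  obtain n u x where ux: "p = [u, x]" "1 \<le> n" "u \<in> carrier_mat n n" "x \<in> carrier_mat n n" "spectrum x \<subseteq> Disks r \<gamma>"
    using p by (rule U_setE)
  show ?thesis
    using G_manI[OF \<gamma> p] via_pi_S[OF f \<gamma> ux(2-5)] unfolding ux(1) by (simp add: Phi_map_eq omega_map_eq)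
qed

lemma omega_in_M:
  assumes "\<gamma> \<in> Gam" "p \<in> Dom2 \<gamma>"
  shows "omega_map r s \<gamma> \<tau> p \<in> M 2"
proof -
  obtain n u x where ux: "p = [u, x]" "1 \<le> n" "u \<in> carrier_mat n n" "x \<in> carrier_mat n n" "spectrum x \<subseteq> Disks r \<gamma>"
    using assms(2) by (rule Dom2E)
  show ?thesis unfolding ux(1) omega_map_eq by (rule pm_in_M[OF ux(3) S_carrier[OF assms(1) ux(4,5)] ux(2)])
qed

text \<open>In a chart the descended function is \<open>f\<close> composed with
  \<open>omega_map\<close>, which is compatible with direct sums and similarities.\<close>

lemma via_pi_nc_function:
  assumes f: "nc_on 2 (M 2) f" "symmetric f" and \<gamma>: "\<gamma> \<in> Gam" "\<tau> \<in> signs \<gamma>"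
  shows "nc_function 2 (U_set r \<gamma>) (restrict (via_pi f) (G_man r s) \<circ> Phi_map r s \<gamma> \<tau>)" (is "nc_function 2 ?U ?g")
proof -
  have g: "?g p = f (omega_map r s \<gamma> \<tau> p)" if "p \<in> ?U" for p using via_pi_Phi[OF f \<gamma> that] by simp
  have dU: "dsum p q \<in> ?U" if p: "p \<in> ?U" and q: "q \<in> ?U" for p q
  proof -
    obtain n u x where 1: "p = [u, x]" "1 \<le> n" "u \<in> carrier_mat n n" "x \<in> carrier_mat n n" "spectrum x \<subseteq> Disks r \<gamma>"
      using p by (rule U_setE)
    obtain m u' x' where 2: "q = [u', x']" "1 \<le> m" "u' \<in> carrier_mat m m" "x' \<in> carrier_mat m m" "spectrum x' \<subseteq> Disks r \<gamma>"
      using q by (rule U_setE)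
    show ?thesis using U_set_dsum[OF \<gamma>(1) p[unfolded 1(1)] 1(3) 2(3-5)] by (simp add: 1(1) 2(1) dsum_pair)
  qed
  have "nc_set 2 ?U" unfolding nc_set_def using dU U_set_subset_Dom2 by (auto simp: Dom2_def)
  moreover have "graded ?U ?g"
    unfolding graded_def
  proof
    fix p assume p: "p \<in> ?U"
    then obtain n u x where ux: "p = [u, x]" "1 \<le> n" "u \<in> carrier_mat n n" "x \<in> carrier_mat n n" "spectrum x \<subseteq> Disks r \<gamma>"
      by (rule U_setE)
    note Sc = S_carrier[OF \<gamma>(1) ux(4,5), of \<tau>]
    show "?g p \<in> carrier_mat (lvl p) (lvl p)"
      unfolding g[OF p] using nc_on_carrier[OF f(1) _ pm_in_M[OF ux(3) Sc ux(2)] pm_M_level[OF ux(3) Sc]] ux(3)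
      by (simp add: ux(1) omega_map_eq lvl_Cons)
  qed
  moreover have "?g (dsum p q) = mat_dsum (?g p) (?g q)" if p: "p \<in> ?U" and q: "q \<in> ?U" for p q
  proof -
    obtain n u x where 1: "p = [u, x]" "1 \<le> n" "u \<in> carrier_mat n n" "x \<in> carrier_mat n n" "spectrum x \<subseteq> Disks r \<gamma>"
      using p by (rule U_setE)
    obtain m u' x' where 2: "q = [u', x']" "1 \<le> m" "u' \<in> carrier_mat m m" "x' \<in> carrier_mat m m" "spectrum x' \<subseteq> Disks r \<gamma>"
      using q by (rule U_setE)
    note Sc = S_carrier[OF \<gamma>(1) 1(4,5), of \<tau>] S_carrier[OF \<gamma>(1) 2(4,5), of \<tau>]
    have "omega_map r s \<gamma> \<tau> (dsum p q) = dsum (omega_map r s \<gamma> \<tau> p) (omega_map r s \<gamma> \<tau> q)"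
      unfolding 1(1) 2(1) dsum_pair omega_map_eq S_dsum(1)[OF \<gamma>(1) 1(4,5) 2(4,5)] dsum_pm[OF 1(3) Sc(1) 2(3) Sc(2)] ..
    moreover have "omega_map r s \<gamma> \<tau> p \<in> M 2" "omega_map r s \<gamma> \<tau> q \<in> M 2"
      using omega_in_M[OF \<gamma>(1)] p q U_set_subset_Dom2 by blast+
    ultimately show ?thesis unfolding g[OF p] g[OF q] g[OF dU[OF p q]] using f(1) M_dsum unfolding nc_on_def by metis
  qed
  moreover have "respects_similarities ?U ?g"
    unfolding respects_similarities_def
  proof (intro ballI impI)
    fix p and t :: "complex mat"
    assume p: "p \<in> ?U" and t: "t \<in> carrier_mat (lvl p) (lvl p)" "invertible_mat t" and cU: "conjugate_by t p \<in> ?U"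
    obtain n u x where ux: "p = [u, x]" "1 \<le> n" "u \<in> carrier_mat n n" "x \<in> carrier_mat n n" "spectrum x \<subseteq> Disks r \<gamma>"
      using p by (rule U_setE)
    have t: "t \<in> carrier_mat n n" "invertible_mat t" using t ux by (auto simp: lvl_Cons)
    note Sc = S_carrier[OF \<gamma>(1) ux(4,5), of \<tau>]
    have "omega_map r s \<gamma> \<tau> (conjugate_by t p) = conjugate_by t (omega_map r s \<gamma> \<tau> p)"
      unfolding ux(1) omega_map_eq conjugate_by_pm[OF t ux(3) Sc]
      by (simp add: conjugate_by_def omega_map_eq S_similar(1)[OF \<gamma>(1) ux(4,5) t])
    moreover have "f (conjugate_by t (pm u (S \<gamma> \<tau> x))) = mat_inv t * f (pm u (S \<gamma> \<tau> x)) * t"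
      using MI[OF conjugate_by_M_level[OF pm_M_level[OF ux(3) Sc] t] ux(2)]
      by (intro nc_on_similar[OF f(1) _ pm_in_M[OF ux(3) Sc ux(2)] pm_M_level[OF ux(3) Sc] t]) auto
    ultimately show "?g (conjugate_by t p) = mat_inv t * ?g p * t"
      unfolding g[OF p] g[OF cU] by (simp add: ux(1) omega_map_eq)
  qed
  ultimately show ?thesis unfolding nc_function_def by blast
qed

lemma via_pi_in_G_functions:
  assumes f: "f \<in> symmetric_free_functions"
  shows "restrict (via_pi f) (G_man r s) \<in> G_functions r s"
proof -
  let ?F = "restrict (via_pi f) (G_man r s)"
  note nc = symmetric_free_functionsD(1,2)[OF f]
  note bd = symmetric_free_functionsD(3)[OF f]
  have "holomorphic_on_G r s ?F"
    unfolding holomorphic_on_G_def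
  proof (intro ballI)
    fix \<gamma> \<tau> assume \<gamma>: "\<gamma> \<in> Gam" "\<tau> \<in> signs \<gamma>"
    let ?U = "U_set r \<gamma>" and ?g = "?F \<circ> Phi_map r s \<gamma> \<tau>"
    note ncf = via_pi_nc_function[OF nc \<gamma>]
    note op = U_set_zariski_open[OF \<gamma>(1)]
    have "\<exists>N. openin (zariski_free_topology 2) N \<and> p \<in> N \<and> N \<subseteq> ?U \<and> bounded_fun_on N ?g" if p: "p \<in> ?U" for p
    proof -
      have pD: "p \<in> Dom2 \<gamma>" using p U_set_subset_Dom2 by blast
      obtain B where B: "openin (free_topology 2) B" "omega_map r s \<gamma> \<tau> p \<in> B" "bounded_fun_on B f"
        using bd[OF omega_in_M[OF \<gamma>(1) pD]] by blast
      obtain N where N: "openin (free_topology 2) N" "p \<in> N" "N \<subseteq> Dom2 \<gamma>" "omega_map r s \<gamma> \<tau> ` N \<subseteq> B"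
        by (rule omega_free_continuous[OF \<gamma>(1) B(1) pD B(2)])
      obtain C where C: "\<And>w. w \<in> B \<Longrightarrow> op_norm (f w) \<le> C" using B(3) unfolding bounded_fun_on_def by blast
      have "bounded_fun_on (N \<inter> ?U) ?g"
        unfolding bounded_fun_on_def
      proof (intro exI[of _ C] ballI)
        fix q assume q: "q \<in> N \<inter> ?U"
        then have "?g q = f (omega_map r s \<gamma> \<tau> q)" using via_pi_Phi[OF nc \<gamma>, of q] by simp
        then show "op_norm (?g q) \<le> C" using C N(4) q by auto
      qed
      moreover have "openin (zariski_free_topology 2) (N \<inter> ?U)"
        by (intro openin_Int zariski_open_of_free_open N op)
      ultimately show ?thesis using N(2) p by blast
    qed
    then show "nc_holomorphic 2 (zariski_free_topology 2) ?U ?g"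
      unfolding nc_holomorphic_def using op ncf unfolding nc_function_def by blast
  qed
  moreover have "\<exists>U. openin (free_topology 2) U \<and> w \<in> U \<and> bounded_fun_on (pi_map ` U \<inter> G_man r s) ?F" if w: "w \<in> M 2" for w
  proof -
    obtain U where U: "openin (free_topology 2) U" "w \<in> U" "bounded_fun_on U f" using bd[OF w] by blast
    obtain C where C: "\<And>w. w \<in> U \<Longrightarrow> op_norm (f w) \<le> C" using U(3) unfolding bounded_fun_on_def by blast
    \<comment> \<open>All preimages of a point of the manifold yield the same value, in particular
      the one in \<open>U\<close>, where \<open>f\<close> is bounded by \<open>C\<close>.\<close>
    have "op_norm (?F y) \<le> C" if y: "y \<in> pi_map ` U \<inter> G_man r s" for y
    proof -
      obtain w' where w': "w' \<in> U" "y = pi_map w'" using y by blast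
      have wM: "w' \<in> M 2" using w'(1) free_open_subset_M[OF U(1)] by blast
      have yG: "y \<in> G_man r s" using y by blast
      then obtain \<gamma> \<tau> n u x where 1: "\<gamma> \<in> Gam" "\<tau> \<in> signs \<gamma>" "1 \<le> n" "u \<in> carrier_mat n n" "x \<in> carrier_mat n n"
        "spectrum x \<subseteq> Disks r \<gamma>" "[u, x] \<in> U_set r \<gamma>" "y = [u, x, S \<gamma> \<tau> x * u * S \<gamma> \<tau> x]" by (rule G_man_tripleE)
      have "?F y = f (pm u (S \<gamma> \<tau> x))" using via_pi_S[OF nc 1(1-6)] yG by (simp add: 1(8))
      also have "\<dots> = f w'" using symmetric_nc_S_eq[OF nc 1(1-6) wM] w'(2) 1(8) by simp
      finally show ?thesis using C[OF w'(1)] by simp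
    qed
    then show ?thesis using U(1,2) unfolding bounded_fun_on_def by blast
  qed
  ultimately show ?thesis unfolding G_functions_def using via_pi_conditionally_nc[OF nc] by simp
qed

section \<open>Generic points\<close>

text \<open>The first column of \<open>k\<close> is the sum of one eigenvector \<open>e c\<close>
  for each \<open>c\<close> in \<gamma>, the others are zero. If \<open>k\<close> commuted with the
  sign operator of a nonconstant \<tau>, that sum would be an eigenvector of it, against the
  independence of the \<open>e c\<close>. For fixed \<open>u\<close> the commutator with
  \<open>u + t k\<close> is then affine and not constant in \<open>t\<close>, so each \<tau>
  excludes at most one \<open>t\<close>.\<close>

lemma generic_direction:
  assumes \<gamma>: "\<gamma> \<in> Gam" and n: "1 \<le> n" and x: "x \<in> carrier_mat n n" "spectrum x = \<gamma>"
  shows "\<exists>k\<in>carrier_mat n n. \<forall>u\<in>carrier_mat n n. \<exists>T. finite T \<and> (\<forall>t. t \<notin> T \<longrightarrow> [u + t \<cdot>\<^sub>m k, x] \<in> U_set r \<gamma>)"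
proof -
  have sp: "spectrum x \<subseteq> Disks r \<gamma>" using center_in_Disks[OF \<gamma>] x(2) by blast
  have fin: "finite \<gamma>" using \<gamma> by (simp add: Gam_def)
  have "\<exists>v. v \<in> carrier_vec n \<and> v \<noteq> 0\<^sub>v n \<and> x *\<^sub>v v = c \<cdot>\<^sub>v v" if "c \<in> \<gamma>" for c
    using that x by (auto elim: spectrumE)
  then obtain e where e: "\<And>c. c \<in> \<gamma> \<Longrightarrow> e c \<in> carrier_vec n" "\<And>c. c \<in> \<gamma> \<Longrightarrow> e c \<noteq> 0\<^sub>v n"
    "\<And>c. c \<in> \<gamma> \<Longrightarrow> x *\<^sub>v e c = c \<cdot>\<^sub>v e c" by metis
  define comb where "comb \<beta> = vec n (\<lambda>i. \<Sum>c\<in>\<gamma>. \<beta> c * e c $ i)" for \<beta> :: "complex \<Rightarrow> complex"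
  have comb: "comb \<beta> \<in> carrier_vec n" for \<beta> by (simp add: comb_def)
  let ?I = "\<lambda>\<tau>. I_op r \<gamma> \<tau> x"
  note Ic = I_carrier[OF \<gamma> x(1) sp]
  have Ie: "?I \<tau> *\<^sub>v e c = \<tau> c \<cdot>\<^sub>v e c" if c: "c \<in> \<gamma>" for \<tau> c
    unfolding I_eq fun_calc_eigenvector[OF x(1) open_Disks iota_holomorphic[OF \<gamma>] sp e(1)[OF c] e(3)[OF c] e(2)[OF c]]
    using iota_eq[OF \<gamma> c, of c] radius(1)[OF \<gamma>] by simp
  have Icomb: "?I \<tau> *\<^sub>v comb \<beta> = comb (\<lambda>c. \<beta> c * \<tau> c)" for \<tau> \<beta>
  proof (rule eq_vecI)
    fix i assume "i < dim_vec (comb (\<lambda>c. \<beta> c * \<tau> c))"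
    then have i: "i < n" by (simp add: comb_def)
    have "(?I \<tau> *\<^sub>v comb \<beta>) $ i = (\<Sum>j<n. ?I \<tau> $$ (i,j) * (\<Sum>c\<in>\<gamma>. \<beta> c * e c $ j))"
      using i carrier_matD[OF Ic, of \<tau>] by (simp add: scalar_prod_def atLeast0LessThan comb_def)
    also have "\<dots> = (\<Sum>c\<in>\<gamma>. \<beta> c * (\<Sum>j<n. ?I \<tau> $$ (i,j) * e c $ j))"
      by (simp add: sum_distrib_left mult_ac) (rule sum.swap)
    also have "\<dots> = (\<Sum>c\<in>\<gamma>. \<beta> c * (\<tau> c * e c $ i))"
    proof (intro sum.cong refl)
      fix c assume c: "c \<in> \<gamma>"
      have "(\<Sum>j<n. ?I \<tau> $$ (i,j) * e c $ j) = (?I \<tau> *\<^sub>v e c) $ i"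
        using i carrier_matD[OF Ic, of \<tau>] e(1)[OF c] by (simp add: scalar_prod_def atLeast0LessThan)
      also have "\<dots> = \<tau> c * e c $ i" unfolding Ie[OF c] using i e(1)[OF c] by simp
      finally show "\<beta> c * (\<Sum>j<n. ?I \<tau> $$ (i,j) * e c $ j) = \<beta> c * (\<tau> c * e c $ i)" by simp
    qed
    also have "\<dots> = comb (\<lambda>c. \<beta> c * \<tau> c) $ i" using i by (simp add: comb_def mult_ac)
    finally show "(?I \<tau> *\<^sub>v comb \<beta>) $ i = comb (\<lambda>c. \<beta> c * \<tau> c) $ i" .
  qed (use carrier_matD[OF Ic] in \<open>simp add: comb_def\<close>)
  have indep: "\<beta> c = 0" if c: "c \<in> \<gamma>" and 0: "comb \<beta> = 0\<^sub>v n" for \<beta> c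
  proof -
    \<comment> \<open>The sign operator for this function flips only the component at
      \<open>c\<close>; subtracting its effect isolates
      \<open>2 \<beta>(c) e(c) = 0\<close>.\<close>
    define \<tau> where "\<tau> d = (if d = c then -1 else 1 :: complex)" for d
    have c0: "comb (\<lambda>c. \<beta> c * \<tau> c) = 0\<^sub>v n" unfolding Icomb[symmetric] 0 by (rule mult_mat_zero_vec[OF Ic])
    have z: "(\<Sum>d\<in>\<gamma>. \<beta> d * \<tau> d * e d $ i) = 0" "(\<Sum>d\<in>\<gamma>. \<beta> d * e d $ i) = 0" if i: "i < n" for i
    proof -
      have "vec_index (comb (\<lambda>c. \<beta> c * \<tau> c)) i = 0" "vec_index (comb \<beta>) i = 0" unfolding c0 0 using i by simp_all
      then show "(\<Sum>d\<in>\<gamma>. \<beta> d * \<tau> d * e d $ i) = 0" "(\<Sum>d\<in>\<gamma>. \<beta> d * e d $ i) = 0"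
        using i by (simp_all add: comb_def)
    qed
    have "\<beta> c * e c $ i = 0" if i: "i < n" for i
    proof -
      have "0 = (\<Sum>d\<in>\<gamma>. \<beta> d * e d $ i - \<beta> d * \<tau> d * e d $ i)" using z[OF i] by (simp add: sum_subtractf)
      also have "\<dots> = (\<Sum>d\<in>\<gamma>. if d = c then 2 * (\<beta> d * e d $ i) else 0)" by (intro sum.cong) (auto simp: \<tau>_def)
      also have "\<dots> = 2 * (\<beta> c * e c $ i)" using c fin by simp
      finally show ?thesis by simp
    qed
    moreover obtain i where "i < n" "e c $ i \<noteq> 0"
      using e(1,2)[OF c] by (metis carrier_vecD eq_vecI index_zero_vec)
    ultimately show ?thesis by auto
  qed
  define k where "k = mat n n (\<lambda>(i,j). if j = 0 then comb (\<lambda>_. 1) $ i else 0)"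
  have k: "k \<in> carrier_mat n n" by (simp add: k_def)
  have nc: "k * ?I \<tau> \<noteq> ?I \<tau> * k" if \<tau>: "nonconst \<gamma> \<tau>" for \<tau>
  proof
    assume eq: "k * ?I \<tau> = ?I \<tau> * k"
    \<comment> \<open>The first column of the commutation relation says that the sign operator maps
      the sum of the eigenvectors to \<kappa> times itself.\<close>
    define \<kappa> where "\<kappa> = ?I \<tau> $$ (0,0)"
    have "comb (\<lambda>c. \<tau> c - \<kappa>) = 0\<^sub>v n"
    proof (rule eq_vecI)
      fix i assume "i < dim_vec (0\<^sub>v n :: complex vec)"
      then have i: "i < n" by simp
      have "(\<Sum>c\<in>\<gamma>. \<tau> c * e c $ i) = (?I \<tau> *\<^sub>v comb (\<lambda>_. 1)) $ i" unfolding Icomb using i by (simp add: comb_def)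
      also have "\<dots> = (?I \<tau> * k) $$ (i,0)"
        using i n carrier_matD[OF Ic, of \<tau>] carrier_vecD[OF comb] by (simp add: scalar_prod_def k_def)
      also have "\<dots> = (k * ?I \<tau>) $$ (i,0)" unfolding eq ..
      also have "\<dots> = (\<Sum>j<n. k $$ (i,j) * ?I \<tau> $$ (j,0))"
        using i n k carrier_matD[OF Ic, of \<tau>] by (simp add: scalar_prod_def atLeast0LessThan)
      also have "\<dots> = (\<Sum>j<n. if j = 0 then comb (\<lambda>_. 1) $ i * ?I \<tau> $$ (j,0) else 0)"
        using i by (intro sum.cong) (auto simp: k_def)
      also have "\<dots> = (\<Sum>c\<in>\<gamma>. e c $ i) * \<kappa>" using n i by (simp add: \<kappa>_def comb_def)
      finally show "comb (\<lambda>c. \<tau> c - \<kappa>) $ i = 0\<^sub>v n $ i"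
        using i by (simp add: comb_def left_diff_distrib sum_subtractf sum_distrib_left[symmetric] mult.commute)
    qed (simp add: comb_def)
    then have "\<tau> c = \<kappa>" if "c \<in> \<gamma>" for c using indep[OF that, of "\<lambda>c. \<tau> c - \<kappa>"] by simp
    then show False using \<tau> unfolding nonconst_def by auto
  qed
  have "\<exists>T. finite T \<and> (\<forall>t. t \<notin> T \<longrightarrow> [u + t \<cdot>\<^sub>m k, x] \<in> U_set r \<gamma>)" if u: "u \<in> carrier_mat n n" for u
  proof -
    have one: "\<exists>t0. \<forall>t. t \<noteq> t0 \<longrightarrow> (u + t \<cdot>\<^sub>m k) * ?I \<tau> \<noteq> ?I \<tau> * (u + t \<cdot>\<^sub>m k)" if \<tau>: "nonconst \<gamma> \<tau>" for \<tau>
    proof -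
      have "\<exists>i j. i < n \<and> j < n \<and> (k * ?I \<tau>) $$ (i,j) \<noteq> (?I \<tau> * k) $$ (i,j)"
      proof (rule ccontr)
        assume "\<not> ?thesis"
        then have "k * ?I \<tau> = ?I \<tau> * k" using k carrier_matD[OF Ic, of \<tau>] by (intro eq_matI) auto
        then show False using nc[OF \<tau>] by simp
      qed
      then obtain i j where ij: "i < n" "j < n" "(k * ?I \<tau>) $$ (i,j) \<noteq> (?I \<tau> * k) $$ (i,j)" by blast
      \<comment> \<open>At an entry where \<open>k\<close> and the sign operator fail to commute,
        the commutator with \<open>u + t k\<close> is \<open>b + t * a\<close> with
        \<open>a \<noteq> 0\<close>.\<close>
      define a where "a = (k * ?I \<tau>) $$ (i,j) - (?I \<tau> * k) $$ (i,j)"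
      define b where "b = (u * ?I \<tau>) $$ (i,j) - (?I \<tau> * u) $$ (i,j)"
      have "t = - b / a" if "(u + t \<cdot>\<^sub>m k) * ?I \<tau> = ?I \<tau> * (u + t \<cdot>\<^sub>m k)" for t
      proof -
        have "u * ?I \<tau> + t \<cdot>\<^sub>m (k * ?I \<tau>) = ?I \<tau> * u + t \<cdot>\<^sub>m (?I \<tau> * k)"
          using that u k Ic[of \<tau>]
          by (simp add: add_mult_distrib_mat[of _ n n _ _ n] mult_add_distrib_mat[of _ n n _ n]
              mult_smult_assoc_mat[of _ n n _ n] mult_smult_distrib[of _ n n _ n])
        from arg_cong[OF this, of "\<lambda>A. A $$ (i,j)"]
        have "(u * ?I \<tau>) $$ (i,j) + t * (k * ?I \<tau>) $$ (i,j) = (?I \<tau> * u) $$ (i,j) + t * (?I \<tau> * k) $$ (i,j)"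
          using ij u k carrier_matD[OF Ic, of \<tau>] by (simp del: index_mult_mat(1))
        then have "b + t * a = 0" by (simp add: a_def b_def algebra_simps)
        moreover have "a \<noteq> 0" using ij(3) by (simp add: a_def)
        ultimately show ?thesis by (simp add: field_simps add_eq_0_iff)
      qed
      then show ?thesis by blast
    qed
    then obtain t0 where t0: "\<And>\<tau> t. nonconst \<gamma> \<tau> \<Longrightarrow> t \<noteq> t0 \<tau> \<Longrightarrow> (u + t \<cdot>\<^sub>m k) * ?I \<tau> \<noteq> ?I \<tau> * (u + t \<cdot>\<^sub>m k)" by metis
    have "[u + t \<cdot>\<^sub>m k, x] \<in> U_set r \<gamma>" if t: "t \<notin> t0 ` signs \<gamma>" for t
    proof (rule U_setI[OF n _ x(1) sp])
      fix \<tau> assume \<tau>: "\<tau> \<in> signs \<gamma>" "nonconst \<gamma> \<tau>"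
      then have "t \<noteq> t0 \<tau>" using t by blast
      then show "(u + t \<cdot>\<^sub>m k) * ?I \<tau> \<noteq> ?I \<tau> * (u + t \<cdot>\<^sub>m k)" by (rule t0[OF \<tau>(2)])
    qed (use u k in simp)
    then show ?thesis using finite_signs[OF \<gamma>] by (intro exI[of _ "t0 ` signs \<gamma>"]) auto
  qed
  then show ?thesis using k by blast
qed

text \<open>A diagonal matrix, built as a direct sum of 1 by 1 blocks.\<close>

lemma spectrum_diag_exists:
  assumes "finite \<gamma>" "\<gamma> \<noteq> {}"
  shows "\<exists>n\<ge>1. \<exists>x::complex mat. x \<in> carrier_mat n n \<and> spectrum x = \<gamma>"
  using assms
proof (induction rule: finite_ne_induct)
  have 1: "spectrum (mat 1 1 (\<lambda>_. c)) = {c}" for c :: complex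
  proof -
    let ?A = "mat 1 1 (\<lambda>_. c) :: complex mat"
    have A: "?A \<in> carrier_mat 1 1" by simp
    have eq: "?A *\<^sub>v v = c \<cdot>\<^sub>v v" if "v \<in> carrier_vec 1" for v using that by (intro eq_vecI) (auto simp: scalar_prod_def)
    have "unit_vec 1 0 \<noteq> (0\<^sub>v 1 :: complex vec)"
      by (metis index_unit_vec(1) index_zero_vec(1) less_one zero_neq_one)
    then have "c \<in> spectrum ?A" using eq by (intro spectrumI[OF A, of "unit_vec 1 0"]) auto
    moreover have "k = c" if k: "k \<in> spectrum ?A" for k
    proof -
      obtain v where v: "v \<in> carrier_vec 1" "v \<noteq> 0\<^sub>v 1" "?A *\<^sub>v v = k \<cdot>\<^sub>v v" using k A by (rule spectrumE)
      have "v $ 0 \<noteq> 0" using v(1,2) by (auto intro!: eq_vecI)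
      moreover have "c * v $ 0 = k * v $ 0" using v(3) eq[OF v(1)] v(1) by (metis carrier_vecD index_smult_vec(1) less_one)
      ultimately show ?thesis by simp
    qed
    ultimately show ?thesis by blast
  qed
  {
    case (singleton c)
    show ?case using 1[of c] by (intro exI[of _ 1] conjI exI[of _ "mat 1 1 (\<lambda>_. c)"]) auto
  next
    case (insert c \<gamma>)
    then obtain n and x :: "complex mat" where x: "n \<ge> 1" "x \<in> carrier_mat n n" "spectrum x = \<gamma>" by blast
    have A: "mat 1 1 (\<lambda>_. c) \<in> carrier_mat 1 1" by simp
    have "spectrum (mat_dsum (mat 1 1 (\<lambda>_. c)) x) = insert c \<gamma>"
      unfolding spectrum_mat_dsum[OF A x(2)] 1 x(3) by simp
    then show ?case using mat_dsum_carrier[OF A x(2)] by (intro exI[of _ "1 + n"] conjI exI[of _ "mat_dsum (mat 1 1 (\<lambda>_. c)) x"]) auto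
  }
qed

text \<open>Supplies the auxiliary first summand in each chart. The empty \<gamma> has no points,
  since a matrix of positive size has an eigenvalue.\<close>

lemma U_set_nonempty:
  assumes \<gamma>: "\<gamma> \<in> Gam" "\<gamma> \<noteq> {}"
  shows "U_set r \<gamma> \<noteq> {}"
proof -
  obtain n x where x: "1 \<le> n" "x \<in> carrier_mat n n" "spectrum x = \<gamma>"
    using spectrum_diag_exists[of \<gamma>] \<gamma> by (auto simp: Gam_def)
  obtain k T where T: "finite T" "\<forall>t. t \<notin> T \<longrightarrow> [x + t \<cdot>\<^sub>m k, x] \<in> U_set r \<gamma>"
    using generic_direction[OF \<gamma>(1) x] x(2) by blast
  obtain t :: complex where "t \<notin> T" using ex_new_if_finite[OF infinite_UNIV_char_0 T(1)] by blast
  then show ?thesis using T(2) by blast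
qed

text \<open>If \<open>v * v\<close> has its spectrum in the discs, this is equivalent to
  \<open>v = S \<gamma> \<tau> (v * v)\<close>, by \<open>S_spectrum\<close> and
  \<open>S_of_square\<close>. Stated for eigenvalues it passes at once to direct sums, summands and
  similar matrices, and it describes a free open set.\<close>

definition in_branch :: "complex set \<Rightarrow> (complex \<Rightarrow> complex) \<Rightarrow> complex mat \<Rightarrow> bool" where
  "in_branch \<gamma> \<tau> v \<longleftrightarrow> (\<forall>l\<in>spectrum v. l\<^sup>2 \<in> Disks r \<gamma> \<and> root \<gamma> \<tau> (l\<^sup>2) = l)"

text \<open>Take \<gamma> to be the spectrum of \<open>v * v\<close>. Without opposite eigenvalues,
  squaring is injective on the spectrum of \<open>v\<close> and 0 is no eigenvalue. So each
  \<open>c\<close> in \<gamma> has exactly one root \<open>\<mu> c\<close> in the spectrum, and the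
  sign at \<open>c\<close> compares it with \<open>s \<gamma> c\<close>.\<close>

lemma in_branch_exists:
  assumes v: "v \<in> carrier_mat n n" and sp: "\<And>l m. l \<in> spectrum v \<Longrightarrow> m \<in> spectrum v \<Longrightarrow> l \<noteq> - m"
  obtains \<tau> where "spectrum (v * v) \<in> Gam" "\<tau> \<in> signs (spectrum (v * v))" "in_branch (spectrum (v * v)) \<tau> v"
proof -
  define \<gamma> where "\<gamma> = spectrum (v * v)"
  have vv: "v * v \<in> carrier_mat n n" using v by simp
  have sq: "\<exists>l\<in>spectrum v. c = l\<^sup>2" if "c \<in> \<gamma>" for c using spectrum_square[OF v] that unfolding \<gamma>_def by blast
  have "0 \<notin> \<gamma>" using sq[of 0] sp[of 0 0] by auto
  then have \<gamma>: "\<gamma> \<in> Gam" unfolding Gam_def using finite_spectrum[OF vv] by (simp add: \<gamma>_def)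
  have in\<gamma>: "l\<^sup>2 \<in> \<gamma>" if l: "l \<in> spectrum v" for l
  proof -
    obtain e where e: "e \<in> carrier_vec n" "e \<noteq> 0\<^sub>v n" "v *\<^sub>v e = l \<cdot>\<^sub>v e" using l v by (rule spectrumE)
    have "(v * v) *\<^sub>v e = (l * l) \<cdot>\<^sub>v e" using v e by (simp add: mult_mat_vec_smult smult_smult_assoc)
    then show ?thesis unfolding \<gamma>_def using spectrumI[OF vv e(1,2)] by (simp add: power2_eq_square)
  qed
  define \<mu> where "\<mu> c = (SOME l. l \<in> spectrum v \<and> c = l\<^sup>2)" for c
  have \<mu>: "\<mu> c \<in> spectrum v" "(\<mu> c)\<^sup>2 = c" if "c \<in> \<gamma>" for c
  proof -
    have "\<exists>l. l \<in> spectrum v \<and> c = l\<^sup>2" using sq[OF that] by blast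
    from someI_ex[OF this] show "\<mu> c \<in> spectrum v" "(\<mu> c)\<^sup>2 = c" unfolding \<mu>_def by (blast, metis)
  qed
  have \<mu>l: "\<mu> (l\<^sup>2) = l" if l: "l \<in> spectrum v" for l
    using \<mu>[OF in\<gamma>[OF l]] sp[OF \<mu>(1)[OF in\<gamma>[OF l]] l] power2_eq_iff[of "\<mu> (l\<^sup>2)" l] by auto
  define \<tau> where "\<tau> = restrict (\<lambda>c. \<mu> c / s \<gamma> c) \<gamma>"
  have s2: "(s \<gamma> c)\<^sup>2 = c" "s \<gamma> c \<noteq> 0" if c: "c \<in> \<gamma>" for c
  proof -
    show "(s \<gamma> c)\<^sup>2 = c" using sqrt_data \<gamma> center_in_Disks[OF \<gamma> c] unfolding sqrt_data_def by blast
    then show "s \<gamma> c \<noteq> 0" using c \<open>0 \<notin> \<gamma>\<close> by auto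
  qed
  have \<tau>: "\<tau> \<in> signs \<gamma>"
    unfolding signs_def
  proof (rule PiE_I)
    fix c assume c: "c \<in> \<gamma>"
    have "(\<mu> c)\<^sup>2 = (s \<gamma> c)\<^sup>2" using \<mu>(2)[OF c] s2[OF c] by simp
    then have "\<mu> c = s \<gamma> c \<or> \<mu> c = - s \<gamma> c" by (simp add: power2_eq_iff)
    then show "\<tau> c \<in> {- 1, 1}" using c s2[OF c] by (auto simp: \<tau>_def)
  qed (simp add: \<tau>_def)
  have "in_branch \<gamma> \<tau> v"
    unfolding in_branch_def
  proof
    fix l assume l: "l \<in> spectrum v"
    note c = in\<gamma>[OF l]
    have "root \<gamma> \<tau> (l\<^sup>2) = s \<gamma> (l\<^sup>2) * \<tau> (l\<^sup>2)"
      using iota_eq[OF \<gamma> c, of "l\<^sup>2"] radius(1)[OF \<gamma>] by (simp add: root_def)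
    also have "\<dots> = l" using s2[OF c] c \<mu>l[OF l] by (simp add: \<tau>_def)
    finally show "l\<^sup>2 \<in> Disks r \<gamma> \<and> root \<gamma> \<tau> (l\<^sup>2) = l" using center_in_Disks[OF \<gamma> c] by simp
  qed
  then show thesis using that \<gamma> \<tau> unfolding \<gamma>_def by blast
qed

text \<open>Opposite eigenvalues have the same square, hence the same branch value; both would be 0,
  which no disc contains.\<close>

lemma in_branch_no_opposite:
  assumes "\<gamma> \<in> Gam" "in_branch \<gamma> \<tau> v" "l \<in> spectrum v" "m \<in> spectrum v"
  shows "l \<noteq> - m"
proof
  assume "l = - m"
  then have "l\<^sup>2 = m\<^sup>2" by simp
  then have "l = m" using assms(2-4) unfolding in_branch_def by metis
  then have "l\<^sup>2 = 0" using \<open>l = - m\<close> by simp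
  then show False using assms zero_notin_Disks[OF assms(1)] unfolding in_branch_def by metis
qed

lemma in_branch_S:
  assumes "\<gamma> \<in> Gam" "\<tau> \<in> signs \<gamma>" "v \<in> carrier_mat n n" "in_branch \<gamma> \<tau> v"
  shows "S \<gamma> \<tau> (v * v) = v" "spectrum (v * v) \<subseteq> Disks r \<gamma>"
  using S_of_square[OF assms(1-3)] spectrum_square[OF assms(3)] assms(4) unfolding in_branch_def by blast+

lemma in_branch_dsum:
  assumes "v \<in> carrier_mat n n" "v' \<in> carrier_mat m m"
  shows "in_branch \<gamma> \<tau> (mat_dsum v v') \<longleftrightarrow> in_branch \<gamma> \<tau> v \<and> in_branch \<gamma> \<tau> v'"
  unfolding in_branch_def spectrum_mat_dsum[OF assms] by blast

lemma in_branch_similar: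
  assumes "v \<in> carrier_mat n n" "t \<in> carrier_mat n n" "invertible_mat t" "in_branch \<gamma> \<tau> v"
  shows "in_branch \<gamma> \<tau> (mat_inv t * v * t)"
  using assms(4) spectrum_similar_subset[OF assms(1,2) invertible_mat_inv(1,2)[OF assms(2,3)]]
  unfolding in_branch_def by blast

definition vpart :: "point \<Rightarrow> complex mat" where
  "vpart w = (1/2) \<cdot>\<^sub>m (w ! 0 - w ! 1)"

lemma vpart_pm:
  assumes "u \<in> carrier_mat n n" "v \<in> carrier_mat n n"
  shows "vpart (pm u v) = v"
  using assms unfolding vpart_def pm_def by (intro eq_matI) auto

definition branch_set :: "complex set \<Rightarrow> (complex \<Rightarrow> complex) \<Rightarrow> point set" where
  "branch_set \<gamma> \<tau> = {w \<in> M 2. in_branch \<gamma> \<tau> (vpart w)}"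

lemma branch_setE:
  assumes "w \<in> branch_set \<gamma> \<tau>"
  obtains n u v where "1 \<le> n" "w = pm u v" "u \<in> carrier_mat n n" "v \<in> carrier_mat n n" "in_branch \<gamma> \<tau> v"
proof -
  obtain n where n: "1 \<le> n" "w \<in> M_level 2 n" using assms by (auto simp: branch_set_def elim: ME)
  obtain u v where uv: "w = pm u v" "u \<in> carrier_mat n n" "v \<in> carrier_mat n n" using n(2) by (rule M_level_pmE)
  show thesis using assms vpart_pm[OF uv(2,3)] by (intro that[OF n(1) uv]) (simp add: branch_set_def uv(1))
qed

lemma pm_in_branch_set:
  assumes "1 \<le> n" "u \<in> carrier_mat n n" "v \<in> carrier_mat n n"
  shows "pm u v \<in> branch_set \<gamma> \<tau> \<longleftrightarrow> in_branch \<gamma> \<tau> v"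
  using pm_in_M[OF assms(2,3,1)] vpart_pm[OF assms(2,3)] by (simp add: branch_set_def)

text \<open>As \<open>root \<gamma> \<tau> (z^2)\<close> is \<open>z\<close> or \<open>-z\<close>,
  it equals \<open>z\<close> exactly where \<open>root \<gamma> \<tau> (z^2) + z\<close> does not
  vanish, an open condition. An annihilating polynomial of \<open>v\<close>, kept small, confines
  the eigenvalues of nearby matrices to that open set.\<close>

lemma branch_set_open:
  assumes \<gamma>: "\<gamma> \<in> Gam" "\<tau> \<in> signs \<gamma>"
  shows "openin (free_topology 2) (branch_set \<gamma> \<tau>)"
proof (subst openin_subopen, intro ballI)
  fix w assume "w \<in> branch_set \<gamma> \<tau>"
  then obtain n u v where w: "1 \<le> n" "w = pm u v" "u \<in> carrier_mat n n" "v \<in> carrier_mat n n" "in_branch \<gamma> \<tau> v"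
    by (rule branch_setE)
  define \<Omega> where "\<Omega> = {z. z\<^sup>2 \<in> Disks r \<gamma> \<and> root \<gamma> \<tau> (z\<^sup>2) = z}"
  have cont: "continuous_on {z. z\<^sup>2 \<in> Disks r \<gamma>} (\<lambda>z. root \<gamma> \<tau> (z\<^sup>2) + z)"
    by (intro continuous_intros continuous_on_compose2[OF holomorphic_on_imp_continuous_on[OF root_holomorphic[OF \<gamma>(1)]]]) auto
  have op: "open {z. z\<^sup>2 \<in> Disks r \<gamma>}"
    using continuous_open_vimage[OF open_Disks, of "\<lambda>z. z\<^sup>2" \<gamma>] by (simp add: vimage_def continuous_intros)
  have "\<Omega> = {z \<in> {z. z\<^sup>2 \<in> Disks r \<gamma>}. root \<gamma> \<tau> (z\<^sup>2) + z \<in> - {0}}"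
  proof -
    have "root \<gamma> \<tau> (z\<^sup>2) = z \<longleftrightarrow> root \<gamma> \<tau> (z\<^sup>2) + z \<noteq> 0" if z: "z\<^sup>2 \<in> Disks r \<gamma>" for z
    proof -
      have "z \<noteq> 0" using z zero_notin_Disks[OF \<gamma>(1)] by auto
      moreover have "root \<gamma> \<tau> (z\<^sup>2) = z \<or> root \<gamma> \<tau> (z\<^sup>2) = - z"
        using root_square[OF \<gamma> z] by (simp add: power2_eq_iff)
      ultimately show ?thesis by auto
    qed
    then show ?thesis by (auto simp: \<Omega>_def)
  qed
  moreover have "open {z \<in> {z. z\<^sup>2 \<in> Disks r \<gamma>}. root \<gamma> \<tau> (z\<^sup>2) + z \<in> - {0}}"
    using continuous_open_preimage[OF cont op open_Compl[OF closed_singleton[of 0]]] by (simp add: vimage_def Int_def)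
  ultimately have \<Omega>: "open \<Omega>" by simp
  obtain q where q: "q \<noteq> 0" "poly_mat q v = 0\<^sub>m n n" "\<And>k. poly q k = 0 \<Longrightarrow> k \<in> spectrum v"
    using annihilating_poly[OF w(4)] by blast
  have q\<Omega>: "\<And>k. poly q k = 0 \<Longrightarrow> k \<in> \<Omega>" using q(3) w(5) by (auto simp: \<Omega>_def in_branch_def)
  \<comment> \<open>\<open>fun_calc_bounded\<close> is applied to the zero function for the sake of
    its inclusion of spectra.\<close>
  have hol: "(\<lambda>_. 0) holomorphic_on \<Omega>" by simp
  have "\<exists>\<epsilon>>0. \<forall>n x. x \<in> carrier_mat n n \<longrightarrow> op_norm (poly_mat q x) \<le> \<epsilon> \<longrightarrow> spectrum x \<subseteq> \<Omega>"
    by (rule fun_calc_bounded[OF \<Omega> hol q(1)]) (erule q\<Omega>, blast)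
  then obtain \<epsilon> where e: "\<epsilon> > 0" "\<And>n x. x \<in> carrier_mat n n \<Longrightarrow> op_norm (poly_mat q x) \<le> \<epsilon> \<Longrightarrow> spectrum x \<subseteq> \<Omega>"
    by blast
  define N where "N = {w \<in> M 2. op_norm (poly_mat q (vpart w)) < \<epsilon>}"
  have "openin (free_topology 2) N"
    unfolding N_def vpart_def using e(1)
    by (intro poly_fun_ball_open poly_fun_poly_mat poly_fun_smult poly_fun_diff poly_fun_coord) auto
  moreover have "w \<in> N" using pm_in_M[OF w(3,4,1)] q(2) e(1) vpart_pm[OF w(3,4)] by (simp add: N_def w(2))
  moreover have "N \<subseteq> branch_set \<gamma> \<tau>"
  proof
    fix y assume y: "y \<in> N"
    then obtain m where m: "1 \<le> m" "y \<in> M_level 2 m" by (auto simp: N_def elim: ME)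
    obtain a b where ab: "y = pm a b" "a \<in> carrier_mat m m" "b \<in> carrier_mat m m" using m(2) by (rule M_level_pmE)
    have "spectrum b \<subseteq> \<Omega>" using e(2)[OF ab(3)] y vpart_pm[OF ab(2,3)] by (simp add: N_def ab(1))
    then show "y \<in> branch_set \<gamma> \<tau>" unfolding ab(1) pm_in_branch_set[OF m(1) ab(2,3)] by (auto simp: in_branch_def \<Omega>_def)
  qed
  ultimately show "\<exists>T. openin (free_topology 2) T \<and> w \<in> T \<and> T \<subseteq> branch_set \<gamma> \<tau>" by blast
qed

end

section \<open>From functions on the manifold to symmetric functions\<close>

lemma mat_dsum_assoc:
  assumes "A \<in> carrier_mat n n" "B \<in> carrier_mat m m" "C \<in> carrier_mat k k"
  shows "mat_dsum (mat_dsum A B) C = mat_dsum A (mat_dsum B C)"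
  using assms unfolding mat_dsum_def by (intro eq_matI) auto

lemma dsum_pm_assoc:
  assumes "a \<in> M_level 2 n" "b \<in> M_level 2 m" "c \<in> M_level 2 k"
  shows "dsum (dsum a b) c = dsum a (dsum b c)"
proof -
  obtain a0 a1 where a: "a = [a0, a1]" "a0 \<in> carrier_mat n n" "a1 \<in> carrier_mat n n" using assms(1) by (rule M_level_pairE)
  obtain b0 b1 where b: "b = [b0, b1]" "b0 \<in> carrier_mat m m" "b1 \<in> carrier_mat m m" using assms(2) by (rule M_level_pairE)
  obtain c0 c1 where c: "c = [c0, c1]" "c0 \<in> carrier_mat k k" "c1 \<in> carrier_mat k k" using assms(3) by (rule M_level_pairE)
  show ?thesis using a b c by (simp add: dsum_pair mat_dsum_assoc[of _ n _ m _ k])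
qed

lemma pi_map_M_level:
  assumes "w \<in> M_level 2 n"
  shows "pi_map w \<in> M_level 3 n"
proof -
  obtain u v where "w = pm u v" "u \<in> carrier_mat n n" "v \<in> carrier_mat n n" using assms by (rule M_level_pmE)
  then show ?thesis by (simp add: pi_map_pm[of _ n] triple_M_level del: assoc_mult_mat)
qed

lemma pi_map_dsum:
  assumes "w \<in> M_level 2 n" "w' \<in> M_level 2 m"
  shows "pi_map (dsum w w') = dsum (pi_map w) (pi_map w')"
proof -
  obtain u v where 1: "w = pm u v" "u \<in> carrier_mat n n" "v \<in> carrier_mat n n" using assms(1) by (rule M_level_pmE)
  obtain u' v' where 2: "w' = pm u' v'" "u' \<in> carrier_mat m m" "v' \<in> carrier_mat m m" using assms(2) by (rule M_level_pmE)
  show ?thesis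
    unfolding 1(1) 2(1) dsum_pm[OF 1(2,3) 2(2,3)] pi_map_pm[OF mat_dsum_carrier[OF 1(2) 2(2)] mat_dsum_carrier[OF 1(3) 2(3)]]
      pi_map_pm[OF 1(2,3)] pi_map_pm[OF 2(2,3)] dsum_triple
    using 1 2 by (simp add: mat_dsum_mult[of _ n _ m] del: assoc_mult_mat)
qed

lemma pi_map_conjugate:
  assumes w: "w \<in> M_level 2 n" and t: "t \<in> carrier_mat n n" "invertible_mat t"
  shows "pi_map (conjugate_by t w) = conjugate_by t (pi_map w)"
proof -
  obtain u v where 1: "w = pm u v" "u \<in> carrier_mat n n" "v \<in> carrier_mat n n" using w by (rule M_level_pmE)
  have c: "mat_inv t * u * t \<in> carrier_mat n n" "mat_inv t * v * t \<in> carrier_mat n n"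
    using invertible_mat_inv(1)[OF t] t 1 by auto
  have "(mat_inv t * v * t) * (mat_inv t * u * t) * (mat_inv t * v * t) = mat_inv t * (v * u * v) * t"
    using conj_mult[OF t 1(3,2)] conj_mult[OF t _ 1(3), of "v * u"] 1 by (simp del: assoc_mult_mat)
  then show ?thesis
    unfolding 1(1) conjugate_by_pm[OF t 1(2,3)] pi_map_pm[OF c] pi_map_pm[OF 1(2,3)]
    using conj_mult[OF t 1(3,3)] by (simp add: conjugate_by_def del: assoc_mult_mat)
qed

lemma mat_dsum_one_invertible:
  assumes t: "t \<in> carrier_mat m m" "invertible_mat t"
  shows "mat_inv (mat_dsum (1\<^sub>m n) t) = mat_dsum (1\<^sub>m n) (mat_inv t)" "invertible_mat (mat_dsum (1\<^sub>m n) t)"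
proof -
  note i = invertible_mat_inv[OF t]
  have c: "mat_dsum (1\<^sub>m n) t \<in> carrier_mat (n + m) (n + m)" "mat_dsum (1\<^sub>m n) (mat_inv t) \<in> carrier_mat (n + m) (n + m)"
    using t i by auto
  have 1: "mat_dsum (1\<^sub>m n) t * mat_dsum (1\<^sub>m n) (mat_inv t) = 1\<^sub>m (n + m)"
    "mat_dsum (1\<^sub>m n) (mat_inv t) * mat_dsum (1\<^sub>m n) t = 1\<^sub>m (n + m)"
    using t i by (simp_all add: mat_dsum_mult[of _ n _ m] mat_dsum_one)
  show "mat_inv (mat_dsum (1\<^sub>m n) t) = mat_dsum (1\<^sub>m n) (mat_inv t)" by (rule mat_inv_eqI[OF c 1(1)])
  show "invertible_mat (mat_dsum (1\<^sub>m n) t)" by (rule invertible_matI[OF c 1])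
qed

text \<open>A similarity of the second summand is a similarity of the whole sum; in this way the
  similarity rule for \<open>F\<close> reaches the second block of its values.\<close>

lemma conjugate_by_dsum_right:
  assumes y: "y \<in> M_level d n" "z \<in> M_level d m" and t: "t \<in> carrier_mat m m" "invertible_mat t"
  shows "conjugate_by (mat_dsum (1\<^sub>m n) t) (dsum y z) = dsum y (conjugate_by t z)"
proof (rule nth_equalityI)
  have len: "length y = d" "length z = d" using y by (auto simp: M_level_def)
  then show "length (conjugate_by (mat_dsum (1\<^sub>m n) t) (dsum y z)) = length (dsum y (conjugate_by t z))" by simp
  fix i assume "i < length (conjugate_by (mat_dsum (1\<^sub>m n) t) (dsum y z))"
  then have i: "i < d" using len by simp
  show "conjugate_by (mat_dsum (1\<^sub>m n) t) (dsum y z) ! i = dsum y (conjugate_by t z) ! i"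
    using M_level_nth[OF y(1) i] M_level_nth[OF y(2) i] t invertible_mat_inv(1)[OF t] i len
    by (simp add: conjugate_by_nth dsum_nth mat_dsum_one_invertible(1)[OF t] mat_dsum_mult[of _ n _ m])
qed

lemma free_open_near:
  assumes d: "0 < d" and U: "openin (free_topology d) U" and x: "x \<in> U" "x \<in> M_level d n" "1 \<le> n"
  shows "\<exists>\<epsilon>>0. \<forall>y. near d n \<epsilon> x y \<longrightarrow> y \<in> U"
proof (rule free_open_level[OF assms])
  fix \<epsilon> :: real
  assume e: "0 < \<epsilon>" "\<And>y. y \<in> M_level d n \<Longrightarrow> (\<And>i. i < d \<Longrightarrow> op_norm (y ! i - x ! i) < \<epsilon>) \<Longrightarrow> y \<in> U"
  have "y \<in> U" if "near d n \<epsilon> x y" for y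
    by (rule e(2)) (use that in \<open>auto simp: near_def\<close>)
  then show ?thesis using e(1) by blast
qed

lemma eventually_line_in_open:
  assumes d: "0 < d" and U: "openin (free_topology d) U" "w \<in> U" and w: "w \<in> M_level d n" "1 \<le> n" and h: "h \<in> M_level d n"
  shows "eventually (\<lambda>t. line w h t \<in> U) (at 0)"
proof -
  obtain \<epsilon> where e: "\<epsilon> > 0" "\<forall>y. near d n \<epsilon> w y \<longrightarrow> y \<in> U"
    using free_open_near[OF d U w] by blast
  have "eventually (\<lambda>t. near d n \<epsilon> w (line w h t)) (at 0)"
    using eventually_near_line[OF w(1) h e(1)] by (simp add: eventually_at_filter eventually_mono)
  then show ?thesis by eventually_elim (use e(2) in blast)
qed

text \<open>\<open>op_norm A\<close> is at most \<open>C\<close> plus the sum of all entry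
  differences, and this sum tends to 0 at a fixed size. So \<open>C\<close> survives the entrywise
  limit without a factor depending on \<open>n\<close>.\<close>

lemma op_norm_le_limit:
  assumes lim: "\<And>i j. i < n \<Longrightarrow> j < n \<Longrightarrow> ((\<lambda>t. g t $$ (i,j)) \<longlongrightarrow> A $$ (i,j)) Fl"
    and ev: "eventually (\<lambda>t. g t \<in> carrier_mat n n \<and> op_norm (g t) \<le> C) Fl" and Fl: "Fl \<noteq> bot" and A: "A \<in> carrier_mat n n"
  shows "op_norm A \<le> C"
proof (rule tendsto_lowerbound[OF _ _ Fl])
  let ?e = "\<lambda>t. C + (\<Sum>i<n. \<Sum>j<n. cmod (A $$ (i,j) - g t $$ (i,j)))"
  have "(?e \<longlongrightarrow> C + (\<Sum>i<n. \<Sum>j<n. cmod (A $$ (i,j) - A $$ (i,j)))) Fl"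
    by (intro tendsto_intros lim) auto
  then show "(?e \<longlongrightarrow> C) Fl" by simp
  show "eventually (\<lambda>t. op_norm A \<le> ?e t) Fl"
    using ev
  proof eventually_elim
    case (elim t)
    have "op_norm A = op_norm (g t + (A - g t))" using elim A by (intro arg_cong[of _ _ op_norm] eq_matI) auto
    also have "\<dots> \<le> op_norm (g t) + op_norm (A - g t)" using elim A by (intro op_norm_add[of _ n n]) auto
    also have "op_norm (A - g t) \<le> (\<Sum>i<n. \<Sum>j<n. cmod (A $$ (i,j) - g t $$ (i,j)))"
      using op_norm_le_sum[of "A - g t"] elim A by auto
    finally show ?case using elim by linarith
  qed
qed

definition v_dir :: "nat \<Rightarrow> point" where
  "v_dir n = [1\<^sub>m n, - 1\<^sub>m n]"

lemma v_dir_M_level: "v_dir n \<in> M_level 2 n"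
  by (simp add: v_dir_def pair_M_level)

lemma line_v_dir:
  assumes "u \<in> carrier_mat n n" "v \<in> carrier_mat n n"
  shows "line (pm u v) (v_dir n) t = pm u (v + t \<cdot>\<^sub>m 1\<^sub>m n)"
proof -
  have "line (pm u v) (v_dir n) t = [(u + v) + t \<cdot>\<^sub>m 1\<^sub>m n, (u - v) + t \<cdot>\<^sub>m (- 1\<^sub>m n)]"
    by (simp add: line_def pm_def v_dir_def numeral_2_eq_2)
  also have "\<dots> = pm u (v + t \<cdot>\<^sub>m 1\<^sub>m n)"
    using assms unfolding pm_def by (auto intro!: eq_matI)
  finally show ?thesis .
qed

lemma line_u_dir:
  assumes "u \<in> carrier_mat n n" "v \<in> carrier_mat n n" "k \<in> carrier_mat n n"
  shows "line (pm u v) [k, k] t = pm (u + t \<cdot>\<^sub>m k) v"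
proof -
  have "line (pm u v) [k, k] t = [(u + v) + t \<cdot>\<^sub>m k, (u - v) + t \<cdot>\<^sub>m k]"
    by (simp add: line_def pm_def numeral_2_eq_2)
  also have "\<dots> = pm (u + t \<cdot>\<^sub>m k) v"
    using assms unfolding pm_def by (auto intro!: eq_matI)
  finally show ?thesis .
qed

lemma spectrum_shift:
  assumes v: "v \<in> carrier_mat n n" and k: "k \<in> spectrum (v + t \<cdot>\<^sub>m 1\<^sub>m n)"
  shows "k - t \<in> spectrum (v :: complex mat)"
proof -
  obtain e where e: "e \<in> carrier_vec n" "e \<noteq> 0\<^sub>v n" "(v + t \<cdot>\<^sub>m 1\<^sub>m n) *\<^sub>v e = k \<cdot>\<^sub>v e"
    using k by (rule spectrumE) (use v in simp)
  have "(v + t \<cdot>\<^sub>m 1\<^sub>m n) *\<^sub>v e = v *\<^sub>v e + (t \<cdot>\<^sub>m 1\<^sub>m n) *\<^sub>v e"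
    by (rule add_mult_distrib_mat_vec[OF v _ e(1)]) simp
  moreover have "(t \<cdot>\<^sub>m 1\<^sub>m n) *\<^sub>v e = t \<cdot>\<^sub>v e" using e(1) by (intro eq_vecI) auto
  ultimately have eq: "v *\<^sub>v e + t \<cdot>\<^sub>v e = k \<cdot>\<^sub>v e" using e(3) by simp
  have "v *\<^sub>v e = (k - t) \<cdot>\<^sub>v e"
  proof (rule eq_vecI)
    fix i assume "i < dim_vec ((k - t) \<cdot>\<^sub>v e)"
    then have i: "i < n" using e(1) by simp
    have "vec_index (v *\<^sub>v e + t \<cdot>\<^sub>v e) i = vec_index (k \<cdot>\<^sub>v e) i" unfolding eq ..
    then have "vec_index (v *\<^sub>v e) i + t * vec_index e i = k * vec_index e i"
      using i e(1) v by (simp del: index_mult_mat_vec)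
    then show "vec_index (v *\<^sub>v e) i = vec_index ((k - t) \<cdot>\<^sub>v e) i"
      using i e(1) by (simp add: left_diff_distrib eq_diff_eq del: index_mult_mat_vec)
  qed (use e v in auto)
  then show ?thesis by (rule spectrumI[OF v e(1,2)])
qed

context sqrt_branches
begin

section \<open>Branched points, images of the charts, and lines that run into them\<close>

definition branched :: "point set" where
  "branched = (\<Union>\<gamma>\<in>Gam. \<Union>\<tau>\<in>signs \<gamma>. branch_set \<gamma> \<tau>)"

definition image_omega :: "point set" where
  "image_omega = (\<Union>\<gamma>\<in>Gam. \<Union>\<tau>\<in>signs \<gamma>. omega_map r s \<gamma> \<tau> ` U_set r \<gamma>)"

lemma branchedE:
  assumes "w \<in> branched"
  obtains \<gamma> \<tau> where "\<gamma> \<in> Gam" "\<tau> \<in> signs \<gamma>" "w \<in> branch_set \<gamma> \<tau>"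
  using assms unfolding branched_def by blast

lemma branchedI: "\<gamma> \<in> Gam \<Longrightarrow> \<tau> \<in> signs \<gamma> \<Longrightarrow> w \<in> branch_set \<gamma> \<tau> \<Longrightarrow> w \<in> branched"
  unfolding branched_def by blast

lemma branched_subset_M: "branched \<subseteq> M 2"
  by (auto simp: branched_def branch_set_def)

lemma omega_in_branch_set:
  assumes \<gamma>: "\<gamma> \<in> Gam" "\<tau> \<in> signs \<gamma>" and p: "p \<in> U_set r \<gamma>"
  shows "omega_map r s \<gamma> \<tau> p \<in> branch_set \<gamma> \<tau>"
proof -
  obtain n u x where ux: "p = [u, x]" "1 \<le> n" "u \<in> carrier_mat n n" "x \<in> carrier_mat n n" "spectrum x \<subseteq> Disks r \<gamma>"
    using p by (rule U_setE)
  show ?thesis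
    unfolding ux(1) omega_map_eq pm_in_branch_set[OF ux(2,3) S_carrier[OF \<gamma>(1) ux(4,5)]] in_branch_def
    using S_spectrum[OF \<gamma>(1) ux(4,5) \<gamma>(2)] by blast
qed

text \<open>For \<open>p = [u, x]\<close> and \<open>w = pm a v\<close> the witness is
  \<open>[mat_dsum u a, mat_dsum x (v * v)]\<close>; the branch condition gives
  \<open>S \<gamma> \<tau> (v * v) = v\<close>.\<close>

lemma dsum_omega:
  assumes \<gamma>: "\<gamma> \<in> Gam" "\<tau> \<in> signs \<gamma>" and p: "p \<in> U_set r \<gamma>" and w: "w \<in> branch_set \<gamma> \<tau>"
  shows "\<exists>q\<in>U_set r \<gamma>. omega_map r s \<gamma> \<tau> q = dsum (omega_map r s \<gamma> \<tau> p) w"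
proof -
  obtain n u x where ux: "p = [u, x]" "1 \<le> n" "u \<in> carrier_mat n n" "x \<in> carrier_mat n n" "spectrum x \<subseteq> Disks r \<gamma>"
    using p by (rule U_setE)
  obtain m a v where w': "1 \<le> m" "w = pm a v" "a \<in> carrier_mat m m" "v \<in> carrier_mat m m" "in_branch \<gamma> \<tau> v"
    using w by (rule branch_setE)
  have vv: "v * v \<in> carrier_mat m m" using w' by simp
  note Sv = in_branch_S[OF \<gamma> w'(4,5)]
  have "[mat_dsum u a, mat_dsum x (v * v)] \<in> U_set r \<gamma>"
    by (rule U_set_dsum[OF \<gamma>(1) p[unfolded ux(1)] ux(3) w'(3) vv Sv(2)])
  moreover have "omega_map r s \<gamma> \<tau> [mat_dsum u a, mat_dsum x (v * v)] = dsum (omega_map r s \<gamma> \<tau> p) w"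
    unfolding ux(1) w'(2) omega_map_eq S_dsum(1)[OF \<gamma>(1) ux(4,5) vv Sv(2)] Sv(1)
      dsum_pm[OF ux(3) S_carrier[OF \<gamma>(1) ux(4,5)] w'(3,4)] ..
  ultimately show ?thesis by blast
qed

text \<open>The line shifts all eigenvalues of \<open>v\<close> by \<open>t\<close>, so two shifted
  eigenvalues add up to zero only if \<open>t = - (l + m) / 2\<close> for eigenvalues
  \<open>l\<close> and \<open>m\<close> of \<open>v\<close>.\<close>

lemma line_eventually_branched:
  assumes w: "w \<in> M_level 2 n" and n: "1 \<le> n"
  shows "\<exists>T. finite T \<and> (\<forall>t. t \<notin> T \<longrightarrow> line w (v_dir n) t \<in> branched)"
proof -
  obtain u v where uv: "w = pm u v" "u \<in> carrier_mat n n" "v \<in> carrier_mat n n" using w by (rule M_level_pmE)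
  let ?T = "(\<lambda>(l,m). - (l + m) / 2) ` (spectrum v \<times> spectrum v)"
  have "line w (v_dir n) t \<in> branched" if t: "t \<notin> ?T" for t
  proof -
    let ?v = "v + t \<cdot>\<^sub>m 1\<^sub>m n"
    have v: "?v \<in> carrier_mat n n" using uv by simp
    have "l \<noteq> - m" if lm: "l \<in> spectrum ?v" "m \<in> spectrum ?v" for l m
    proof
      assume "l = - m"
      then have "t = - ((l - t) + (m - t)) / 2" by (simp add: field_simps)
      then have "t \<in> ?T" using spectrum_shift[OF uv(3) lm(1)] spectrum_shift[OF uv(3) lm(2)]
        by (intro image_eqI[of _ _ "(l - t, m - t)"]) auto
      then show False using t by blast
    qed
    then obtain \<tau> where \<tau>: "spectrum (?v * ?v) \<in> Gam" "\<tau> \<in> signs (spectrum (?v * ?v))" "in_branch (spectrum (?v * ?v)) \<tau> ?v"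
      using in_branch_exists[OF v] by blast
    show ?thesis
      unfolding uv(1) line_v_dir[OF uv(2,3)]
      by (rule branchedI[OF \<tau>(1,2)]) (use \<tau>(3) pm_in_branch_set[OF n uv(2) v] in blast)
  qed
  moreover have "finite ?T" using finite_spectrum[OF uv(3)] by simp
  ultimately show ?thesis by blast
qed

lemma line_eventually_branched_at:
  assumes "w \<in> M_level 2 n" "1 \<le> n"
  shows "eventually (\<lambda>t. line w (v_dir n) t \<in> branched) (at 0)"
proof -
  obtain T where T: "finite T" "\<And>t. t \<notin> T \<Longrightarrow> line w (v_dir n) t \<in> branched"
    using line_eventually_branched[OF assms] by blast
  have "open (- (T - {0}))" using T(1) by (intro open_Compl finite_imp_closed) auto
  then have "eventually (\<lambda>t. t \<in> - (T - {0}) - {0}) (at 0)" by (intro eventually_at_in_open) auto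
  then show ?thesis by eventually_elim (use T(2) in auto)
qed

text \<open>The \<gamma> by which \<open>w\<close> is known to be branched may contain points that
  are no eigenvalues. It is replaced by the spectrum of \<open>v * v\<close>, as
  \<open>generic_direction\<close> requires. The line moves \<open>u\<close> and keeps
  \<open>v\<close>.\<close>

lemma line_eventually_image_omega:
  assumes w: "w \<in> branched" "w \<in> M_level 2 n"
  shows "\<exists>h\<in>M_level 2 n. eventually (\<lambda>t. line w h t \<in> image_omega) (at 0)"
proof -
  obtain \<gamma>0 \<tau>0 where \<gamma>0: "\<gamma>0 \<in> Gam" "\<tau>0 \<in> signs \<gamma>0" "w \<in> branch_set \<gamma>0 \<tau>0" using w(1) by (rule branchedE)
  obtain m u v where uv: "1 \<le> m" "w = pm u v" "u \<in> carrier_mat m m" "v \<in> carrier_mat m m" "in_branch \<gamma>0 \<tau>0 v"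
    using \<gamma>0(3) by (rule branch_setE)
  have mn: "m = n" using lvl_M_level[OF w(2)] lvl_M_level[OF pm_M_level[OF uv(3,4)]] by (simp add: uv(2))
  let ?\<gamma> = "spectrum (v * v)"
  have vv: "v * v \<in> carrier_mat m m" using uv by simp
  obtain \<tau> where \<tau>: "?\<gamma> \<in> Gam" "\<tau> \<in> signs ?\<gamma>" "in_branch ?\<gamma> \<tau> v"
    using in_branch_exists[OF uv(4) in_branch_no_opposite[OF \<gamma>0(1) uv(5)]] by blast
  obtain k T where k: "k \<in> carrier_mat m m" and T: "finite T" "\<forall>t. t \<notin> T \<longrightarrow> [u + t \<cdot>\<^sub>m k, v * v] \<in> U_set r ?\<gamma>"
    using generic_direction[OF \<tau>(1) uv(1) vv refl] uv(3) by blast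
  have *: "line w [k, k] t \<in> image_omega" if "t \<notin> T" for t
  proof -
    have "line w [k, k] t = omega_map r s ?\<gamma> \<tau> [u + t \<cdot>\<^sub>m k, v * v]"
      unfolding omega_map_eq in_branch_S(1)[OF \<tau>(1,2) uv(4) \<tau>(3)] uv(2) by (rule line_u_dir[OF uv(3,4) k])
    then show ?thesis unfolding image_omega_def using \<tau> T(2) that by blast
  qed
  have "open (- (T - {0}))" using T(1) by (intro open_Compl finite_imp_closed) auto
  then have "eventually (\<lambda>t. t \<in> - (T - {0}) - {0}) (at 0)" by (intro eventually_at_in_open) auto
  then have "eventually (\<lambda>t. line w [k, k] t \<in> image_omega) (at 0)"
    by eventually_elim (use * in auto)
  then show ?thesis using k mn by (intro bexI[of _ "[k, k]"]) (auto simp: pair_M_level)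
qed

end

section \<open>The nc-function on the branched points\<close>

locale manifold_function = sqrt_branches +
  fixes F Fh :: "point \<Rightarrow> complex mat"
  assumes F_graded: "graded (G_man r s) F"
    and F_similar: "respects_similarities (G_man r s) F"
    and Fh_graded: "graded {y \<in> M 3. \<exists>x\<in>G_man r s. dsum x y \<in> G_man r s} Fh"
    and F_dsum: "\<And>x y. x \<in> G_man r s \<Longrightarrow> y \<in> M 3 \<Longrightarrow> dsum x y \<in> G_man r s \<Longrightarrow> F (dsum x y) = mat_dsum (F x) (Fh y)"
    and F_bounded: "\<And>w. w \<in> M 2 \<Longrightarrow> \<exists>U. openin (free_topology 2) U \<and> w \<in> U \<and> bounded_fun_on (pi_map ` U \<inter> G_man r s) F"
begin

text \<open>\<open>Fh\<close> instead of \<open>F\<close>: for a branched \<open>w\<close> the point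
  \<open>pi_map w\<close> may lie outside the manifold, where nothing is known about
  \<open>F\<close>. On the images of the charts both give the same value, by
  \<open>f0_omega\<close>.\<close>

definition f0 :: "point \<Rightarrow> complex mat" where
  "f0 w = Fh (pi_map w)"

lemma manifold_function_dsum_omega:
  assumes \<gamma>: "\<gamma> \<in> Gam" "\<tau> \<in> signs \<gamma>" and p: "p \<in> U_set r \<gamma>" and w: "w \<in> branch_set \<gamma> \<tau>"
    and l: "omega_map r s \<gamma> \<tau> p \<in> M_level 2 n" "w \<in> M_level 2 m"
  shows "pi_map (dsum (omega_map r s \<gamma> \<tau> p) w) \<in> G_man r s"
    "F (pi_map (dsum (omega_map r s \<gamma> \<tau> p) w)) = mat_dsum (F (Phi_map r s \<gamma> \<tau> p)) (f0 w)"
    "F (Phi_map r s \<gamma> \<tau> p) \<in> carrier_mat n n" "f0 w \<in> carrier_mat m m"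
proof -
  obtain q where q: "q \<in> U_set r \<gamma>" "omega_map r s \<gamma> \<tau> q = dsum (omega_map r s \<gamma> \<tau> p) w"
    using dsum_omega[OF \<gamma> p w] by blast
  show G: "pi_map (dsum (omega_map r s \<gamma> \<tau> p) w) \<in> G_man r s"
    unfolding q(2)[symmetric] pi_omega[OF \<gamma> q(1)] by (rule G_manI[OF \<gamma> q(1)])
  have P: "Phi_map r s \<gamma> \<tau> p \<in> G_man r s" by (rule G_manI[OF \<gamma> p])
  have eq: "pi_map (dsum (omega_map r s \<gamma> \<tau> p) w) = dsum (Phi_map r s \<gamma> \<tau> p) (pi_map w)"
    unfolding pi_map_dsum[OF l] pi_omega[OF \<gamma> p] ..
  have wM: "w \<in> M 2" using w by (simp add: branch_set_def)
  then have m: "1 \<le> m" using lvl_M_level[OF l(2)] by (elim ME) (metis lvl_M_level pos2)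
  have pM: "pi_map w \<in> M 3" by (rule MI[OF pi_map_M_level[OF l(2)] m])
  show "F (pi_map (dsum (omega_map r s \<gamma> \<tau> p) w)) = mat_dsum (F (Phi_map r s \<gamma> \<tau> p)) (f0 w)"
    unfolding eq f0_def by (rule F_dsum[OF P pM]) (use G eq in simp)
  have "Phi_map r s \<gamma> \<tau> p \<in> M_level 3 n" using pi_map_M_level[OF l(1)] by (simp add: pi_omega[OF \<gamma> p])
  then show "F (Phi_map r s \<gamma> \<tau> p) \<in> carrier_mat n n"
    using F_graded P lvl_M_level[of "Phi_map r s \<gamma> \<tau> p" 3 n] unfolding graded_def by auto
  have "pi_map w \<in> {y \<in> M 3. \<exists>x\<in>G_man r s. dsum x y \<in> G_man r s}" using pM P G eq by auto
  then show "f0 w \<in> carrier_mat m m"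
    using Fh_graded lvl_M_level[OF pi_map_M_level[OF l(2)]] unfolding graded_def f0_def by auto
qed

lemma branch_set_omega_exists:
  assumes \<gamma>: "\<gamma> \<in> Gam" "\<tau> \<in> signs \<gamma>" and w: "w \<in> branch_set \<gamma> \<tau>"
  obtains p n where "p \<in> U_set r \<gamma>" "omega_map r s \<gamma> \<tau> p \<in> M_level 2 n" "1 \<le> n"
proof -
  obtain m u v where uv: "1 \<le> m" "w = pm u v" "u \<in> carrier_mat m m" "v \<in> carrier_mat m m" "in_branch \<gamma> \<tau> v"
    using w by (rule branch_setE)
  obtain l where "l \<in> spectrum v" using spectrum_non_empty[OF uv(4)] uv(1) by auto
  then have "\<gamma> \<noteq> {}" using uv(5) by (auto simp: in_branch_def Disks_def)
  then obtain p where p: "p \<in> U_set r \<gamma>" using U_set_nonempty[OF \<gamma>(1)] by blast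
  have "omega_map r s \<gamma> \<tau> p \<in> M 2" using omega_in_M[OF \<gamma>(1)] p U_set_subset_Dom2 by blast
  then show thesis using that[OF p] by (elim ME) auto
qed

text \<open>Each rule is read off in the second block of \<open>F\<close> at
  \<open>a \<oplus> w\<close>, with \<open>a\<close> in the image of a chart. For direct sums,
  \<open>a \<oplus> w\<close> is in that image too, so the value of \<open>F\<close> at
  \<open>(a \<oplus> w) \<oplus> w' = a \<oplus> (w \<oplus> w')\<close> splits in two ways.\<close>

lemma f0_nc: "nc_on 2 branched f0"
  unfolding nc_on_def
proof (intro conjI ballI impI)
  show "branched \<subseteq> M 2" by (rule branched_subset_M)
  show "graded branched f0"
    unfolding graded_def
  proof
    fix w assume "w \<in> branched"
    then obtain \<gamma> \<tau> where \<gamma>: "\<gamma> \<in> Gam" "\<tau> \<in> signs \<gamma>" "w \<in> branch_set \<gamma> \<tau>" by (rule branchedE)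
    obtain p n where p: "p \<in> U_set r \<gamma>" "omega_map r s \<gamma> \<tau> p \<in> M_level 2 n" using branch_set_omega_exists[OF \<gamma>] by blast
    obtain m where m: "w \<in> M_level 2 m" using \<gamma>(3) by (auto simp: branch_set_def elim: ME)
    show "f0 w \<in> carrier_mat (lvl w) (lvl w)"
      using manifold_function_dsum_omega(4)[OF \<gamma>(1,2) p(1) \<gamma>(3) p(2) m] lvl_M_level[OF m] by simp
  qed
  show "respects_similarities branched f0"
    unfolding respects_similarities_def
  proof (intro ballI impI)
    fix w and t :: "complex mat"
    assume w: "w \<in> branched" and t: "t \<in> carrier_mat (lvl w) (lvl w)" "invertible_mat t"
    obtain \<gamma> \<tau> where \<gamma>: "\<gamma> \<in> Gam" "\<tau> \<in> signs \<gamma>" "w \<in> branch_set \<gamma> \<tau>" using w by (rule branchedE)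
    obtain p n where p: "p \<in> U_set r \<gamma>" "omega_map r s \<gamma> \<tau> p \<in> M_level 2 n" using branch_set_omega_exists[OF \<gamma>] by blast
    obtain m u v where uv: "1 \<le> m" "w = pm u v" "u \<in> carrier_mat m m" "v \<in> carrier_mat m m" "in_branch \<gamma> \<tau> v"
      using \<gamma>(3) by (rule branch_setE)
    have m: "w \<in> M_level 2 m" unfolding uv(2) by (rule pm_M_level[OF uv(3,4)])
    have t: "t \<in> carrier_mat m m" "invertible_mat t" using t lvl_M_level[OF m] by auto
    note ti = invertible_mat_inv[OF t]
    have tc: "mat_inv t * u * t \<in> carrier_mat m m" "mat_inv t * v * t \<in> carrier_mat m m" using ti t uv by auto
    have cw: "conjugate_by t w \<in> branch_set \<gamma> \<tau>"
      unfolding uv(2) conjugate_by_pm[OF t uv(3,4)] pm_in_branch_set[OF uv(1) tc]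
      by (rule in_branch_similar[OF uv(4) t uv(5)])
    note cm = conjugate_by_M_level[OF m t]
    let ?a = "omega_map r s \<gamma> \<tau> p" and ?T = "mat_dsum (1\<^sub>m n) t"
    note ab = manifold_function_dsum_omega[OF \<gamma>(1,2) p(1) \<gamma>(3) p(2) m]
    note ab' = manifold_function_dsum_omega[OF \<gamma>(1,2) p(1) cw p(2) cm]
    have Tc: "?T \<in> carrier_mat (n + m) (n + m)" using t by simp
    note Ti = mat_dsum_one_invertible[OF t, of n]
    have eq: "pi_map (dsum ?a (conjugate_by t w)) = conjugate_by ?T (pi_map (dsum ?a w))"
      unfolding conjugate_by_dsum_right[OF p(2) m t, symmetric]
      by (rule pi_map_conjugate[OF dsum_M_level[OF p(2) m] Tc Ti(2)])
    have lv: "lvl (pi_map (dsum ?a w)) = n + m"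
      by (rule lvl_M_level[OF pi_map_M_level[OF dsum_M_level[OF p(2) m]]]) simp
    have "F (pi_map (dsum ?a (conjugate_by t w))) = mat_inv ?T * F (pi_map (dsum ?a w)) * ?T"
      using F_similar ab(1) ab'(1) Tc Ti(2) unfolding respects_similarities_def eq lv[symmetric] by blast
    then have "mat_dsum (F (Phi_map r s \<gamma> \<tau> p)) (f0 (conjugate_by t w)) =
        mat_dsum (1\<^sub>m n) (mat_inv t) * mat_dsum (F (Phi_map r s \<gamma> \<tau> p)) (f0 w) * mat_dsum (1\<^sub>m n) t"
      unfolding ab(2) ab'(2) Ti(1) .
    also have "\<dots> = mat_dsum (F (Phi_map r s \<gamma> \<tau> p)) (mat_inv t * f0 w * t)"
      using ab(3,4) ti t by (simp add: mat_dsum_mult[of _ n _ m] del: assoc_mult_mat)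
    finally have "mat_dsum (F (Phi_map r s \<gamma> \<tau> p)) (f0 (conjugate_by t w)) = mat_dsum (F (Phi_map r s \<gamma> \<tau> p)) (mat_inv t * f0 w * t)" .
    then show "f0 (conjugate_by t w) = mat_inv t * f0 w * t"
      using mat_dsum_inject[OF ab'(3,4) ab(3), of "mat_inv t * f0 w * t"] ti t ab(4) by simp
  qed
  fix w w' assume w: "w \<in> branched" "w' \<in> branched" "dsum w w' \<in> branched"
  obtain \<gamma> \<tau> where \<gamma>: "\<gamma> \<in> Gam" "\<tau> \<in> signs \<gamma>" "dsum w w' \<in> branch_set \<gamma> \<tau>" using w(3) by (rule branchedE)
  obtain n where n: "1 \<le> n" "w \<in> M_level 2 n" using subsetD[OF branched_subset_M w(1)] by (rule ME)
  obtain u v where uv: "w = pm u v" "u \<in> carrier_mat n n" "v \<in> carrier_mat n n" using n(2) by (rule M_level_pmE)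
  obtain m where m: "1 \<le> m" "w' \<in> M_level 2 m" using subsetD[OF branched_subset_M w(2)] by (rule ME)
  obtain u' v' where uv': "w' = pm u' v'" "u' \<in> carrier_mat m m" "v' \<in> carrier_mat m m" using m(2) by (rule M_level_pmE)
  \<comment> \<open>The branch of the sum serves both summands, whatever branches they were given
    by.\<close>
  have "in_branch \<gamma> \<tau> (mat_dsum v v')"
    using \<gamma>(3) pm_in_branch_set[of "n + m" "mat_dsum u u'" "mat_dsum v v'"] uv uv' n m
    by (simp add: dsum_pm[of _ n _ _ m])
  then have ib: "w \<in> branch_set \<gamma> \<tau>" "w' \<in> branch_set \<gamma> \<tau>"
    using in_branch_dsum[OF uv(3) uv'(3)] pm_in_branch_set[OF n(1) uv(2,3)] pm_in_branch_set[OF m(1) uv'(2,3)]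
    by (auto simp: uv(1) uv'(1))
  obtain p k where p: "p \<in> U_set r \<gamma>" "omega_map r s \<gamma> \<tau> p \<in> M_level 2 k" using branch_set_omega_exists[OF \<gamma>] by blast
  let ?a = "omega_map r s \<gamma> \<tau> p" and ?A = "F (Phi_map r s \<gamma> \<tau> p)"
  obtain q where q: "q \<in> U_set r \<gamma>" "omega_map r s \<gamma> \<tau> q = dsum ?a w" using dsum_omega[OF \<gamma>(1,2) p(1) ib(1)] by blast
  have ql: "omega_map r s \<gamma> \<tau> q \<in> M_level 2 (k + n)" unfolding q(2) by (rule dsum_M_level[OF p(2) n(2)])
  note ab1 = manifold_function_dsum_omega[OF \<gamma>(1,2) p(1) ib(1) p(2) n(2)]
  note ab2 = manifold_function_dsum_omega[OF \<gamma>(1,2) q(1) ib(2) ql m(2)]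
  note ab3 = manifold_function_dsum_omega[OF \<gamma>(1,2) p(1) \<gamma>(3) p(2) dsum_M_level[OF n(2) m(2)]]
  have Fq: "F (Phi_map r s \<gamma> \<tau> q) = mat_dsum ?A (f0 w)"
    unfolding pi_omega[OF \<gamma>(1,2) q(1), symmetric] q(2) by (rule ab1(2))
  have "mat_dsum ?A (mat_dsum (f0 w) (f0 w')) = mat_dsum (mat_dsum ?A (f0 w)) (f0 w')"
    by (rule mat_dsum_assoc[OF ab1(3,4) ab2(4), symmetric])
  also have "\<dots> = F (pi_map (dsum (dsum ?a w) w'))" using ab2(2) Fq q(2) by simp
  also have "\<dots> = mat_dsum ?A (f0 (dsum w w'))" unfolding dsum_pm_assoc[OF p(2) n(2) m(2)] by (rule ab3(2))
  finally show "f0 (dsum w w') = mat_dsum (f0 w) (f0 w')"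
    using mat_dsum_inject[OF ab1(3) mat_dsum_carrier[OF ab1(4) ab2(4)] ab3(3,4)] by simp
qed

text \<open>The shear with corner 1 fixes \<open>y \<oplus> y\<close>, so conjugating
  \<open>F(y \<oplus> y) = F(y) \<oplus> f0(w)\<close> by it changes nothing, and the corner
  \<open>F(y) - f0(w)\<close> of the conjugate must vanish.\<close>

lemma f0_omega:
  assumes \<gamma>: "\<gamma> \<in> Gam" "\<tau> \<in> signs \<gamma>" and p: "p \<in> U_set r \<gamma>"
  shows "f0 (omega_map r s \<gamma> \<tau> p) = F (pi_map (omega_map r s \<gamma> \<tau> p))"
proof -
  let ?w = "omega_map r s \<gamma> \<tau> p" and ?y = "Phi_map r s \<gamma> \<tau> p"
  have "?w \<in> M 2" using omega_in_M[OF \<gamma>(1)] p U_set_subset_Dom2 by blast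
  then obtain n where n: "1 \<le> n" "?w \<in> M_level 2 n" by (rule ME)
  note ab = manifold_function_dsum_omega[OF \<gamma> p omega_in_branch_set[OF \<gamma> p] n(2,2)]
  have pw: "pi_map ?w = ?y" by (rule pi_omega[OF \<gamma> p])
  have yl: "?y \<in> M_level 3 n" using pi_map_M_level[OF n(2)] by (simp add: pw)
  have eq: "pi_map (dsum ?w ?w) = dsum ?y ?y" unfolding pi_map_dsum[OF n(2,2)] pw ..
  let ?T = "shear (1\<^sub>m n)"
  have T: "1\<^sub>m n \<in> carrier_mat n n" by simp
  note Tc = shear_carrier[OF T] and Ti = mat_inv_shear(2)[OF T]
  have len: "length ?y = 3" using yl by (simp add: M_level_def)
  have cy: "conjugate_by ?T (dsum ?y ?y) = dsum ?y ?y"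
  proof (rule nth_equalityI)
    fix i assume "i < length (conjugate_by ?T (dsum ?y ?y))"
    then have i: "i < 3" using len by simp
    have yi: "?y ! i \<in> carrier_mat n n" by (rule M_level_nth[OF yl i])
    have "?y ! i * 1\<^sub>m n - 1\<^sub>m n * ?y ! i = 0\<^sub>m n n" using yi by (intro eq_matI) auto
    then show "conjugate_by ?T (dsum ?y ?y) ! i = dsum ?y ?y ! i"
      using shear_conj[OF T yi yi] i len yi by (simp add: conjugate_by_nth dsum_nth mat_dsum_def)
  qed simp
  have lv: "lvl (dsum ?y ?y) = n + n" by (rule lvl_M_level[OF dsum_M_level[OF yl yl]]) simp
  have yyG: "dsum ?y ?y \<in> G_man r s" using ab(1) eq by simp
  have "F (conjugate_by ?T (dsum ?y ?y)) = mat_inv ?T * F (dsum ?y ?y) * ?T"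
    using F_similar yyG Tc Ti cy unfolding respects_similarities_def lv[symmetric] by metis
  then have "mat_dsum (F ?y) (f0 ?w) = mat_inv ?T * mat_dsum (F ?y) (f0 ?w) * ?T"
    using ab(2) eq cy by simp
  also have "\<dots> = four_block_mat (F ?y) (F ?y * 1\<^sub>m n - 1\<^sub>m n * f0 ?w) (0\<^sub>m n n) (f0 ?w)"
    by (rule shear_conj[OF T ab(3,4)])
  finally have "0\<^sub>m n n = F ?y * 1\<^sub>m n - 1\<^sub>m n * f0 ?w"
    using four_block_mat_inject[of "F ?y" n n "0\<^sub>m n n" n "0\<^sub>m n n" n "f0 ?w" "F ?y" "F ?y * 1\<^sub>m n - 1\<^sub>m n * f0 ?w" "0\<^sub>m n n" "f0 ?w"] ab(3,4)
    by (simp add: mat_dsum_def)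
  then have z: "F ?y - f0 ?w = 0\<^sub>m n n" using ab(3,4) by simp
  have "F ?y = (F ?y - f0 ?w) + f0 ?w" using ab(3,4) by (intro eq_matI) auto
  then show ?thesis using ab(4) unfolding z pw by simp
qed

lemma f0_image_omega: "w \<in> image_omega \<Longrightarrow> f0 w = F (pi_map w) \<and> pi_map w \<in> G_man r s \<and> w \<in> branched"
  unfolding image_omega_def using f0_omega pi_omega G_manI omega_in_branch_set branchedI by auto

text \<open>\<open>f0 y\<close> is the lower right block of \<open>F\<close> at
  \<open>a \<oplus> y\<close>, and \<open>a \<oplus> y\<close> is near \<open>a \<oplus> w\<close>
  when \<open>y\<close> is near \<open>w\<close>.\<close>

lemma f0_locally_bounded: "locally_bounded_nc 2 branched f0"
  unfolding locally_bounded_nc_def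
proof (intro conjI ballI allI f0_nc)
  fix w assume "w \<in> branched"
  then obtain \<gamma> \<tau> where \<gamma>: "\<gamma> \<in> Gam" "\<tau> \<in> signs \<gamma>" "w \<in> branch_set \<gamma> \<tau>" by (rule branchedE)
  obtain m u v where uv: "1 \<le> m" "w = pm u v" "u \<in> carrier_mat m m" "v \<in> carrier_mat m m" "in_branch \<gamma> \<tau> v"
    using \<gamma>(3) by (rule branch_setE)
  show "dsum w w \<in> branched"
    unfolding uv(2) dsum_pm[OF uv(3,4,3,4)]
    by (rule branchedI[OF \<gamma>(1,2)])
      (use uv in_branch_dsum[OF uv(4,4)] pm_in_branch_set[of "m + m" "mat_dsum u u" "mat_dsum v v"] in simp)
next
  fix n w assume "w \<in> branched \<inter> M_level 2 n"
  then have w: "w \<in> branched" "w \<in> M_level 2 n" by auto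
  obtain \<gamma> \<tau> where \<gamma>: "\<gamma> \<in> Gam" "\<tau> \<in> signs \<gamma>" "w \<in> branch_set \<gamma> \<tau>" using w(1) by (rule branchedE)
  have n: "1 \<le> n" using subsetD[OF branched_subset_M w(1)] lvl_M_level[OF w(2)] by (elim ME) (metis lvl_M_level pos2)
  obtain p m where p: "p \<in> U_set r \<gamma>" "omega_map r s \<gamma> \<tau> p \<in> M_level 2 m" using branch_set_omega_exists[OF \<gamma>] by blast
  let ?a = "omega_map r s \<gamma> \<tau> p"
  have z: "dsum ?a w \<in> M_level 2 (m + n)" by (rule dsum_M_level[OF p(2) w(2)])
  have mn: "1 \<le> m + n" using n by simp
  obtain U where U: "openin (free_topology 2) U" "dsum ?a w \<in> U" "bounded_fun_on (pi_map ` U \<inter> G_man r s) F"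
    using F_bounded[OF MI[OF z mn]] by blast
  obtain C where C: "\<And>y. y \<in> pi_map ` U \<inter> G_man r s \<Longrightarrow> op_norm (F y) \<le> C" using U(3) unfolding bounded_fun_on_def by blast
  obtain \<epsilon>1 where e1: "\<epsilon>1 > 0" "\<forall>y. near 2 (m + n) \<epsilon>1 (dsum ?a w) y \<longrightarrow> y \<in> U"
    using free_open_near[OF pos2 U(1,2) z mn] by blast
  obtain \<epsilon>2 where e2: "\<epsilon>2 > 0" "\<forall>y. near 2 n \<epsilon>2 w y \<longrightarrow> y \<in> branch_set \<gamma> \<tau>"
    using free_open_near[OF pos2 branch_set_open[OF \<gamma>(1,2)] \<gamma>(3) w(2) n] by blast
  have "y \<in> branched \<and> op_norm (f0 y) \<le> C" if y: "near 2 n (min \<epsilon>1 \<epsilon>2) w y" for y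
  proof -
    have yl: "y \<in> M_level 2 n" using y by (simp add: near_def)
    have yb: "y \<in> branch_set \<gamma> \<tau>" using y e2(2) by (simp add: near_def)
    have "near 2 (m + n) \<epsilon>1 (dsum ?a w) (dsum ?a y)"
      unfolding near_def
    proof (intro conjI allI impI dsum_M_level[OF p(2) yl])
      fix i :: nat assume i: "i < 2"
      note c = M_level_nth[OF p(2) i] M_level_nth[OF w(2) i] M_level_nth[OF yl i]
      have len: "length ?a = 2" "length w = 2" "length y = 2" using p(2) w(2) yl by (auto simp: M_level_def)
      have "dsum ?a y ! i - dsum ?a w ! i = four_block_mat (0\<^sub>m m m) (0\<^sub>m m n) (0\<^sub>m n m) (y ! i - w ! i)"
        using c i len by (simp add: dsum_nth mat_dsum_def) (intro eq_matI, auto)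
      then have "op_norm (dsum ?a y ! i - dsum ?a w ! i) \<le> op_norm (y ! i - w ! i)"
        using op_norm_four_block_le[of "0\<^sub>m m m" m m "0\<^sub>m m n" n "0\<^sub>m n m" n "y ! i - w ! i"] c by simp
      also have "\<dots> < \<epsilon>1" using y i by (simp add: near_def)
      finally show "op_norm (dsum ?a y ! i - dsum ?a w ! i) < \<epsilon>1" .
    qed
    then have "dsum ?a y \<in> U" using e1(2) by blast
    note ab = manifold_function_dsum_omega[OF \<gamma>(1,2) p(1) yb p(2) yl]
    have "op_norm (f0 y) \<le> op_norm (mat_dsum (F (Phi_map r s \<gamma> \<tau> p)) (f0 y))"
      unfolding mat_dsum_def using ab(3,4) by (intro op_norm_four_block_ge(3)[of _ m m _ n _ n]) auto
    also have "\<dots> \<le> C" unfolding ab(2)[symmetric] by (rule C) (use \<open>dsum ?a y \<in> U\<close> ab(1) in blast)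
    finally show ?thesis using branchedI[OF \<gamma>(1,2) yb] by simp
  qed
  then show "\<exists>\<epsilon>>0. \<exists>C. \<forall>y. near 2 n \<epsilon> w y \<longrightarrow> y \<in> branched \<and> op_norm (f0 y) \<le> C"
    using e1(1) e2(1) by (intro exI[of _ "min \<epsilon>1 \<epsilon>2"]) auto
qed

text \<open>Local bounds from \<open>f0_locally_bounded\<close> belong to one level. Here the
  constant of \<open>F\<close> itself persists at all levels: it holds on the images of the charts,
  where \<open>f0\<close> is \<open>F\<close> composed with \<pi>, and passes to all branched points
  along lines.\<close>

lemma f0_bounded:
  assumes U: "openin (free_topology 2) U" and C: "\<And>y. y \<in> pi_map ` U \<inter> G_man r s \<Longrightarrow> op_norm (F y) \<le> C"
    and w: "w \<in> U" "w \<in> branched"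
  shows "op_norm (f0 w) \<le> C"
proof -
  obtain n where n: "1 \<le> n" "w \<in> M_level 2 n" using subsetD[OF branched_subset_M w(2)] by (rule ME)
  obtain h where h: "h \<in> M_level 2 n" "eventually (\<lambda>t. line w h t \<in> image_omega) (at 0)"
    using line_eventually_image_omega[OF w(2) n(2)] by blast
  show ?thesis
  proof (rule op_norm_le_limit[where Fl = "at 0" and g = "\<lambda>t. f0 (line w h t)" and n = n])
    fix i j assume "i < n" "j < n"
    then show "((\<lambda>t. f0 (line w h t) $$ (i,j)) \<longlongrightarrow> f0 w $$ (i,j)) (at 0)"
      by (intro nc_tendsto_line[OF f0_locally_bounded _ w(2) n(2) h(1)]) auto
  next
    show "eventually (\<lambda>t. f0 (line w h t) \<in> carrier_mat n n \<and> op_norm (f0 (line w h t)) \<le> C) (at 0)"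
      using h(2) eventually_line_in_open[OF pos2 U w(1) n(2,1) h(1)]
    proof eventually_elim
      case (elim t)
      note io = f0_image_omega[OF elim(1)]
      have "pi_map (line w h t) \<in> pi_map ` U \<inter> G_man r s" using elim io by blast
      then have "op_norm (f0 (line w h t)) \<le> C" using C io by simp
      moreover have "f0 (line w h t) \<in> carrier_mat n n"
        by (rule nc_on_carrier[OF f0_nc _ _ line_M_level[OF n(2) h(1)]]) (use io in auto)
      ultimately show ?case by blast
    qed
  qed (use nc_on_carrier[OF f0_nc _ w(2) n(2)] in auto)
qed

section \<open>Extension over the points that are not branched\<close>

definition extension :: "point \<Rightarrow> complex mat" where
  "extension w = mat (lvl w) (lvl w) (\<lambda>ij. Lim (at 0) (\<lambda>t. f0 (line w (v_dir (lvl w)) t) $$ ij))"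

lemma extension_carrier: "w \<in> M_level 2 n \<Longrightarrow> extension w \<in> carrier_mat n n"
  using lvl_M_level[of w 2 n] by (simp add: extension_def)

lemma extension_limit:
  assumes w: "w \<in> M_level 2 n" "1 \<le> n" and ij: "i < n" "j < n"
  shows "((\<lambda>t. f0 (line w (v_dir n) t) $$ (i,j)) \<longlongrightarrow> extension w $$ (i,j)) (at 0)"
proof -
  let ?g = "\<lambda>t. f0 (line w (v_dir n) t) $$ (i,j)"
  obtain T where T: "finite T" "\<And>t. t \<notin> T \<Longrightarrow> line w (v_dir n) t \<in> branched"
    using line_eventually_branched[OF w] by blast
  \<comment> \<open>All exceptional parameters except 0 are removed, so 0 is the only possible
    singularity in \<open>?A\<close>, whether or not \<open>w\<close> itself is branched.\<close>
  let ?A = "- (T - {0})"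
  have A: "open ?A" using T(1) by (intro open_Compl finite_imp_closed) auto
  have hol: "?g holomorphic_on ?A - {0}"
    using T(2) by (intro nc_holomorphic_line[OF f0_locally_bounded _ w(1) v_dir_M_level _ ij]) auto
  have int: "0 \<in> interior ?A" using A by (simp add: interior_open)
  obtain U where U: "openin (free_topology 2) U" "w \<in> U" "bounded_fun_on (pi_map ` U \<inter> G_man r s) F"
    using F_bounded[OF MI[OF w]] by blast
  obtain C where C: "\<And>y. y \<in> pi_map ` U \<inter> G_man r s \<Longrightarrow> op_norm (F y) \<le> C" using U(3) unfolding bounded_fun_on_def by blast
  have "eventually (\<lambda>t. norm (?g t) \<le> C) (at 0)"
    using line_eventually_branched_at[OF w] eventually_line_in_open[OF pos2 U(1,2) w v_dir_M_level]
  proof eventually_elim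
    case (elim t)
    have "f0 (line w (v_dir n) t) \<in> carrier_mat n n"
      using nc_on_carrier[OF f0_nc _ elim(1) line_M_level[OF w(1) v_dir_M_level]] by simp
    then have "norm (?g t) \<le> op_norm (f0 (line w (v_dir n) t))" using ij by (intro cmod_index_le_op_norm) auto
    also have "\<dots> \<le> C" by (rule f0_bounded[OF U(1) C elim(2,1)])
    finally show ?case .
  qed
  then obtain g' where g': "g' holomorphic_on ?A" "\<And>z. z \<in> ?A - {0} \<Longrightarrow> g' z = ?g z"
    using holomorphic_on_extend_bounded[OF hol int] by blast
  have "isCont g' 0"
    using continuous_on_eq_continuous_at[OF A] holomorphic_on_imp_continuous_on[OF g'(1)] by auto
  then have lim: "(g' \<longlongrightarrow> g' 0) (at 0)" by (simp add: isCont_def)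
  have "eventually (\<lambda>t. t \<in> ?A - {0}) (at 0)" using A by (intro eventually_at_in_open) auto
  then have "eventually (\<lambda>t. g' t = ?g t) (at 0)" by eventually_elim (rule g'(2))
  with lim have "(?g \<longlongrightarrow> g' 0) (at 0)" by (rule Lim_transform_eventually)
  moreover from this have "Lim (at 0) ?g = g' 0" by (intro tendsto_Lim) auto
  ultimately show ?thesis using ij lvl_M_level[OF w(1)] by (simp add: extension_def)
qed

lemma extension_eqI:
  assumes w: "w \<in> M_level 2 n" "1 \<le> n" and A: "A \<in> carrier_mat n n"
    and lim: "\<And>i j. i < n \<Longrightarrow> j < n \<Longrightarrow> ((\<lambda>t. f0 (line w (v_dir n) t) $$ (i,j)) \<longlongrightarrow> A $$ (i,j)) (at 0)"
  shows "extension w = A"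
proof (rule eq_matI)
  fix i j assume "i < dim_row A" "j < dim_col A"
  then have ij: "i < n" "j < n" using A by auto
  show "extension w $$ (i,j) = A $$ (i,j)"
    by (rule tendsto_unique[OF _ extension_limit[OF w ij] lim[OF ij]]) simp
qed (use A extension_carrier[OF w(1)] in auto)

lemma extension_branched:
  assumes "w \<in> branched"
  shows "extension w = f0 w"
proof -
  obtain n where n: "1 \<le> n" "w \<in> M_level 2 n" using subsetD[OF branched_subset_M assms] by (rule ME)
  show ?thesis
    by (rule extension_eqI[OF n(2,1)])
      (use nc_on_carrier[OF f0_nc _ assms n(2)] nc_tendsto_line[OF f0_locally_bounded _ assms n(2) v_dir_M_level] in auto)
qed

text \<open>\<pi> does not see the exchange of the coordinates, and the exchange turns parameter
  \<open>t\<close> on the line into \<open>-t\<close>, which does not affect a limit at 0.\<close>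

lemma extension_symmetric: "symmetric extension"
  unfolding symmetric_def
proof (intro allI impI)
  fix w1 w2 assume "[w1, w2] \<in> M 2"
  then obtain n where n: "1 \<le> n" "[w1, w2] \<in> M_level 2 n" by (rule ME)
  then have c: "w1 \<in> carrier_mat n n" "w2 \<in> carrier_mat n n" "[w2, w1] \<in> M_level 2 n" by (auto simp: pair_M_level)
  have pi_flip: "pi_map [a, b] = pi_map [b, a]" if "a \<in> carrier_mat n n" "b \<in> carrier_mat n n" for a b
  proof -
    have "b + a = a + b" "b - a = - (a - b)" using that by (auto intro!: eq_matI)
    moreover have "(a - b) \<in> carrier_mat n n" "(a + b) \<in> carrier_mat n n" using that by auto
    ultimately show ?thesis by (simp add: pi_map_def Let_def)
  qed
  have flip: "f0 (line [w2, w1] (v_dir n) t) = f0 (line [w1, w2] (v_dir n) (- t))" for t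
  proof -
    have 1: "line [w2, w1] (v_dir n) t = [w2 + t \<cdot>\<^sub>m 1\<^sub>m n, w1 - t \<cdot>\<^sub>m 1\<^sub>m n]"
      using c by (auto simp: line_def v_dir_def numeral_2_eq_2 intro!: eq_matI)
    have 2: "line [w1, w2] (v_dir n) (- t) = [w1 - t \<cdot>\<^sub>m 1\<^sub>m n, w2 + t \<cdot>\<^sub>m 1\<^sub>m n]"
      using c by (auto simp: line_def v_dir_def numeral_2_eq_2 intro!: eq_matI)
    show ?thesis unfolding f0_def 1 2 using c by (subst pi_flip) auto
  qed
  show "extension [w1, w2] = extension [w2, w1]"
  proof (rule sym, rule extension_eqI[OF c(3) n(1) extension_carrier[OF n(2)]])
    fix i j assume ij: "i < n" "j < n"
    have "((\<lambda>t. f0 (line [w1, w2] (v_dir n) (- t)) $$ (i,j)) \<longlongrightarrow> extension [w1, w2] $$ (i,j)) (at 0)"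
      by (rule filterlim_compose[OF extension_limit[OF n(2,1) ij]])
        (auto simp: filterlim_at eventually_at_filter intro!: tendsto_eq_intros)
    then show "((\<lambda>t. f0 (line [w2, w1] (v_dir n) t) $$ (i,j)) \<longlongrightarrow> extension [w1, w2] $$ (i,j)) (at 0)"
      by (simp add: flip)
  qed
qed

text \<open>The direction \<open>v_dir\<close> shifts \<open>v\<close> by a scalar, so these lines
  are compatible with direct sums and similarities. The identities of \<open>f0\<close> hold along
  them for small nonzero parameters and pass to the limit entry by entry.\<close>

lemma extension_nc: "nc_function 2 (M 2) extension"
  unfolding nc_function_def
proof (intro conjI ballI)
  show "nc_set 2 (M 2)" by (rule nc_set_M)
  show "graded (M 2) extension" by (simp add: graded_def extension_def)
  fix w w' assume w: "w \<in> M 2" "w' \<in> M 2"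
  obtain n where n: "1 \<le> n" "w \<in> M_level 2 n" using w(1) by (rule ME)
  obtain m where m: "1 \<le> m" "w' \<in> M_level 2 m" using w(2) by (rule ME)
  obtain u v where uv: "w = pm u v" "u \<in> carrier_mat n n" "v \<in> carrier_mat n n" using n(2) by (rule M_level_pmE)
  obtain u' v' where uv': "w' = pm u' v'" "u' \<in> carrier_mat m m" "v' \<in> carrier_mat m m" using m(2) by (rule M_level_pmE)
  note d = dsum_M_level[OF n(2) m(2)]
  have nm: "1 \<le> n + m" using n by simp
  note E = extension_carrier[OF n(2)] extension_carrier[OF m(2)]
  have ld: "line (dsum w w') (v_dir (n + m)) t = dsum (line w (v_dir n) t) (line w' (v_dir m) t)" for t
  proof -
    have c: "v + t \<cdot>\<^sub>m 1\<^sub>m n \<in> carrier_mat n n" "v' + t \<cdot>\<^sub>m 1\<^sub>m m \<in> carrier_mat m m" using uv uv' by auto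
    have "mat_dsum v v' + t \<cdot>\<^sub>m 1\<^sub>m (n + m) = mat_dsum (v + t \<cdot>\<^sub>m 1\<^sub>m n) (v' + t \<cdot>\<^sub>m 1\<^sub>m m)"
      using uv uv' by (simp add: mat_dsum_one[symmetric] mat_dsum_smult[of _ n _ m] mat_dsum_add[of _ n _ m])
    then show ?thesis
      unfolding uv(1) uv'(1) dsum_pm[OF uv(2,3) uv'(2,3)] line_v_dir[OF uv(2,3)] line_v_dir[OF uv'(2,3)]
        line_v_dir[OF mat_dsum_carrier[OF uv(2) uv'(2)] mat_dsum_carrier[OF uv(3) uv'(3)]] dsum_pm[OF uv(2) c(1) uv'(2) c(2)]
      by simp
  qed
  show "extension (dsum w w') = mat_dsum (extension w) (extension w')"
  proof (rule extension_eqI[OF d nm mat_dsum_carrier[OF E]])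
    fix i j assume ij: "i < n + m" "j < n + m"
    have ev: "eventually (\<lambda>t. mat_dsum (f0 (line w (v_dir n) t)) (f0 (line w' (v_dir m) t)) $$ (i,j) = f0 (line (dsum w w') (v_dir (n + m)) t) $$ (i,j)
        \<and> f0 (line w (v_dir n) t) \<in> carrier_mat n n \<and> f0 (line w' (v_dir m) t) \<in> carrier_mat m m) (at 0)"
      using line_eventually_branched_at[OF n(2,1)] line_eventually_branched_at[OF m(2,1)] line_eventually_branched_at[OF d nm]
    proof eventually_elim
      case (elim t)
      have "f0 (line (dsum w w') (v_dir (n + m)) t) = mat_dsum (f0 (line w (v_dir n) t)) (f0 (line w' (v_dir m) t))"
        using f0_nc elim unfolding nc_on_def ld by blast
      then show ?case
        using nc_on_carrier[OF f0_nc _ elim(1) line_M_level[OF n(2) v_dir_M_level]]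
          nc_on_carrier[OF f0_nc _ elim(2) line_M_level[OF m(2) v_dir_M_level]] by simp
    qed
    let ?lhs = "\<lambda>t. if i < n then if j < n then f0 (line w (v_dir n) t) $$ (i,j) else 0
      else if j < n then 0 else f0 (line w' (v_dir m) t) $$ (i - n, j - n)"
    have ix: "mat_dsum A B $$ (i,j) = (if i < n then if j < n then A $$ (i,j) else 0 else if j < n then 0 else B $$ (i - n, j - n))"
      if "A \<in> carrier_mat n n" "B \<in> carrier_mat m m" for A B
      using that ij by (auto simp: mat_dsum_def)
    have "(?lhs \<longlongrightarrow> mat_dsum (extension w) (extension w') $$ (i,j)) (at 0)"
      unfolding ix[OF E] using extension_limit[OF n(2,1), of i j] extension_limit[OF m(2,1), of "i - n" "j - n"] ij by auto
    moreover have "eventually (\<lambda>t. ?lhs t = f0 (line (dsum w w') (v_dir (n + m)) t) $$ (i,j)) (at 0)"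
      using ev by eventually_elim (use ix in metis)
    ultimately show "((\<lambda>t. f0 (line (dsum w w') (v_dir (n + m)) t) $$ (i,j)) \<longlongrightarrow> mat_dsum (extension w) (extension w') $$ (i,j)) (at 0)"
      by (rule Lim_transform_eventually)
  qed
next
  show "respects_similarities (M 2) extension"
    unfolding respects_similarities_def
  proof (intro ballI impI)
    fix w and t :: "complex mat"
    assume w: "w \<in> M 2" and t: "t \<in> carrier_mat (lvl w) (lvl w)" "invertible_mat t"
    obtain n where n: "1 \<le> n" "w \<in> M_level 2 n" using w by (rule ME)
    have t: "t \<in> carrier_mat n n" "invertible_mat t" using t lvl_M_level[OF n(2)] by auto
    note ti = invertible_mat_inv[OF t]
    obtain u v where uv: "w = pm u v" "u \<in> carrier_mat n n" "v \<in> carrier_mat n n" using n(2) by (rule M_level_pmE)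
    have tc: "mat_inv t * u * t \<in> carrier_mat n n" "mat_inv t * v * t \<in> carrier_mat n n" using ti t uv by auto
    note cm = conjugate_by_M_level[OF n(2) t]
    note E = extension_carrier[OF n(2)]
    have lc: "line (conjugate_by t w) (v_dir n) z = conjugate_by t (line w (v_dir n) z)" for z
    proof -
      have c: "v + z \<cdot>\<^sub>m 1\<^sub>m n \<in> carrier_mat n n" using uv by simp
      have "mat_inv t * (z \<cdot>\<^sub>m 1\<^sub>m n) * t = z \<cdot>\<^sub>m 1\<^sub>m n"
        using ti t by (simp add: mult_smult_distrib[of _ n n _ n] mult_smult_assoc_mat[of _ n n _ n])
      then have "mat_inv t * (v + z \<cdot>\<^sub>m 1\<^sub>m n) * t = mat_inv t * v * t + z \<cdot>\<^sub>m 1\<^sub>m n"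
        using conj_add(1)[OF t uv(3), of "z \<cdot>\<^sub>m 1\<^sub>m n"] by simp
      then show ?thesis
        unfolding uv(1) conjugate_by_pm[OF t uv(2,3)] line_v_dir[OF uv(2,3)] line_v_dir[OF tc] conjugate_by_pm[OF t uv(2) c] by simp
    qed
    show "extension (conjugate_by t w) = mat_inv t * extension w * t"
    proof (rule extension_eqI[OF cm n(1)])
      show "mat_inv t * extension w * t \<in> carrier_mat n n" using ti t E by simp
      fix i j assume ij: "i < n" "j < n"
      have ix: "(mat_inv t * A * t) $$ (i,j) = (\<Sum>l<n. (\<Sum>k<n. mat_inv t $$ (i,k) * A $$ (k,l)) * t $$ (l,j))"
        if "A \<in> carrier_mat n n" for A
      proof -
        have "(mat_inv t * A * t) $$ (i,j) = (\<Sum>l<n. (mat_inv t * A) $$ (i,l) * t $$ (l,j))"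
          using that ij ti t by (simp add: scalar_prod_def atLeast0LessThan del: assoc_mult_mat)
        also have "\<dots> = (\<Sum>l<n. (\<Sum>k<n. mat_inv t $$ (i,k) * A $$ (k,l)) * t $$ (l,j))"
          using that ij ti(1) by (intro sum.cong refl) (simp add: scalar_prod_def atLeast0LessThan)
        finally show ?thesis .
      qed
      let ?lhs = "\<lambda>z. \<Sum>l<n. (\<Sum>k<n. mat_inv t $$ (i,k) * f0 (line w (v_dir n) z) $$ (k,l)) * t $$ (l,j)"
      have "(?lhs \<longlongrightarrow> (mat_inv t * extension w * t) $$ (i,j)) (at 0)"
        unfolding ix[OF E] by (intro tendsto_intros extension_limit[OF n(2,1)]) auto
      moreover have "eventually (\<lambda>z. ?lhs z = f0 (line (conjugate_by t w) (v_dir n) z) $$ (i,j)) (at 0)"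
        using line_eventually_branched_at[OF n(2,1)] line_eventually_branched_at[OF cm n(1)]
      proof eventually_elim
        case (elim z)
        have l: "line w (v_dir n) z \<in> M_level 2 n" by (rule line_M_level[OF n(2) v_dir_M_level])
        have "f0 (line (conjugate_by t w) (v_dir n) z) = mat_inv t * f0 (line w (v_dir n) z) * t"
          using nc_on_similar[OF f0_nc _ elim(1) l t] elim(2) by (simp add: lc)
        then show ?case using ix nc_on_carrier[OF f0_nc _ elim(1) l] by simp
      qed
      ultimately show "((\<lambda>z. f0 (line (conjugate_by t w) (v_dir n) z) $$ (i,j)) \<longlongrightarrow> (mat_inv t * extension w * t) $$ (i,j)) (at 0)"
        by (rule Lim_transform_eventually)
    qed
  qed
qed

text \<open>The neighbourhood on which \<open>F\<close> is controlled works with the same constant,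
  since each of its points is a limit of branched points in it.\<close>

lemma extension_locally_bounded:
  assumes w: "w \<in> M 2"
  shows "\<exists>U. openin (free_topology 2) U \<and> w \<in> U \<and> bounded_fun_on U extension"
proof -
  obtain U where U: "openin (free_topology 2) U" "w \<in> U" "bounded_fun_on (pi_map ` U \<inter> G_man r s) F"
    using F_bounded[OF w] by blast
  obtain C where C: "\<And>y. y \<in> pi_map ` U \<inter> G_man r s \<Longrightarrow> op_norm (F y) \<le> C" using U(3) unfolding bounded_fun_on_def by blast
  have "op_norm (extension y) \<le> C" if y: "y \<in> U" for y
  proof -
    obtain n where n: "1 \<le> n" "y \<in> M_level 2 n" using subsetD[OF free_open_subset_M[OF U(1)] y] by (rule ME)
    show ?thesis
    proof (rule op_norm_le_limit[where Fl = "at 0" and g = "\<lambda>t. f0 (line y (v_dir n) t)" and n = n])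
      show "eventually (\<lambda>t. f0 (line y (v_dir n) t) \<in> carrier_mat n n \<and> op_norm (f0 (line y (v_dir n) t)) \<le> C) (at 0)"
        using line_eventually_branched_at[OF n(2,1)] eventually_line_in_open[OF pos2 U(1) y n(2,1) v_dir_M_level]
      proof eventually_elim
        case (elim t)
        show ?case
          using nc_on_carrier[OF f0_nc _ elim(1) line_M_level[OF n(2) v_dir_M_level]] f0_bounded[OF U(1) C elim(2,1)] by simp
      qed
    qed (use extension_limit[OF n(2,1)] extension_carrier[OF n(2)] in auto)
  qed
  then show ?thesis using U(1,2) unfolding bounded_fun_on_def by blast
qed

end

section \<open>The bijection\<close>

lemma symmetric_free_functions_locally_bounded:
  assumes f: "f \<in> symmetric_free_functions"
  shows "locally_bounded_nc 2 (M 2) f"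
  unfolding locally_bounded_nc_def
proof (intro conjI ballI allI symmetric_free_functionsD(1)[OF f] M_dsum)
  fix n w assume "w \<in> M 2 \<inter> M_level 2 n"
  then have w: "w \<in> M 2" "w \<in> M_level 2 n" by auto
  have n: "1 \<le> n" using w(1) lvl_M_level[OF w(2)] by (elim ME) (metis lvl_M_level pos2)
  obtain U where U: "openin (free_topology 2) U" "w \<in> U" "bounded_fun_on U f"
    using symmetric_free_functionsD(3)[OF f w(1)] by blast
  obtain C where "\<forall>y\<in>U. op_norm (f y) \<le> C" using U(3) unfolding bounded_fun_on_def by blast
  moreover obtain \<epsilon> where "\<epsilon> > 0" "\<forall>y. near 2 n \<epsilon> w y \<longrightarrow> y \<in> U"
    using free_open_near[OF pos2 U(1,2) w(2) n] by blast
  ultimately show "\<exists>\<epsilon>>0. \<exists>C. \<forall>y. near 2 n \<epsilon> w y \<longrightarrow> y \<in> M 2 \<and> op_norm (f y) \<le> C"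
    using free_open_subset_M[OF U(1)] by blast
qed

lemma eq_of_eventually_eq_on_line:
  assumes fg: "locally_bounded_nc d D f" "locally_bounded_nc d D g" and d: "0 < d"
    and w: "w \<in> D" "w \<in> M_level d n" and h: "h \<in> M_level d n"
    and ev: "eventually (\<lambda>t. f (line w h t) = g (line w h t)) (at 0)"
  shows "f w = g w"
proof (rule eq_matI)
  have nc: "nc_on d D f" "nc_on d D g" using fg by (simp_all add: locally_bounded_nc_def)
  note c = nc_on_carrier[OF nc(1) d w] nc_on_carrier[OF nc(2) d w]
  show "dim_row (f w) = dim_row (g w)" "dim_col (f w) = dim_col (g w)" using c by auto
  fix i j assume "i < dim_row (g w)" "j < dim_col (g w)"
  then have ij: "i < n" "j < n" using c by auto
  have "eventually (\<lambda>t. f (line w h t) $$ (i,j) = g (line w h t) $$ (i,j)) (at 0)"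
    using ev by eventually_elim simp
  from tendsto_unique[OF _ Lim_transform_eventually[OF nc_tendsto_line[OF fg(1) d w h ij] this] nc_tendsto_line[OF fg(2) d w h ij]]
  show "f w $$ (i,j) = g w $$ (i,j)" by simp
qed

context sqrt_branches
begin

text \<open>Continuity along lines is used twice: moving \<open>u\<close>, from the images of the
  charts to the branched points, and moving \<open>v\<close>, from these to all points.\<close>

lemma image_omega_determines:
  assumes f: "f \<in> symmetric_free_functions" and g: "g \<in> symmetric_free_functions"
    and eq: "\<And>w. w \<in> image_omega \<Longrightarrow> f w = g w"
  shows "f = g"
proof -
  note fg = symmetric_free_functions_locally_bounded[OF f] symmetric_free_functions_locally_bounded[OF g]
  have br: "f w = g w" if w: "w \<in> branched" for w
  proof -
    have wM: "w \<in> M 2" using w branched_subset_M by blast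
    obtain n where n: "1 \<le> n" "w \<in> M_level 2 n" using wM by (rule ME)
    obtain h where h: "h \<in> M_level 2 n" "eventually (\<lambda>t. line w h t \<in> image_omega) (at 0)"
      using line_eventually_image_omega[OF w n(2)] by blast
    show ?thesis
      by (rule eq_of_eventually_eq_on_line[OF fg pos2 wM n(2) h(1)])
        (use h(2) in \<open>rule eventually_mono, use eq in blast\<close>)
  qed
  have "f w = g w" if w: "w \<in> M 2" for w
  proof -
    obtain n where n: "1 \<le> n" "w \<in> M_level 2 n" using w by (rule ME)
    show ?thesis
      by (rule eq_of_eventually_eq_on_line[OF fg pos2 w n(2) v_dir_M_level])
        (use line_eventually_branched_at[OF n(2,1)] in \<open>rule eventually_mono, use br in blast\<close>)
  qed
  then show ?thesis
    using f g by (intro extensionalityI[of f "M 2" g]) (auto simp: symmetric_free_functions_def)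
qed

lemma image_omegaE:
  assumes "w \<in> image_omega"
  obtains \<gamma> \<tau> p where "\<gamma> \<in> Gam" "\<tau> \<in> signs \<gamma>" "p \<in> U_set r \<gamma>" "w = omega_map r s \<gamma> \<tau> p"
  using assms unfolding image_omega_def by blast

lemma restrict_via_pi_pi_map:
  assumes f: "f \<in> symmetric_free_functions" and w: "w \<in> image_omega"
  shows "restrict (via_pi f) (G_man r s) (pi_map w) = f w"
proof -
  obtain \<gamma> \<tau> p where p: "\<gamma> \<in> Gam" "\<tau> \<in> signs \<gamma>" "p \<in> U_set r \<gamma>" "w = omega_map r s \<gamma> \<tau> p"
    using w by (rule image_omegaE)
  show ?thesis
    using via_pi_Phi[OF symmetric_free_functionsD(1,2)[OF f] p(1,2,3)] by (simp only: p(4) pi_omega[OF p(1,2,3)])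
qed

text \<open>As \<open>pi_map\<close> composed with \<open>omega_map\<close> is
  \<open>Phi_map\<close>, \<pi> maps the images of the charts onto the manifold, so \<open>F\<close>
  is determined by its values at such \<open>pi_map w\<close>.\<close>

lemma restrict_via_pi_eq_iff:
  assumes f: "f \<in> symmetric_free_functions" and F: "F \<in> G_functions r s"
  shows "restrict (via_pi f) (G_man r s) = F \<longleftrightarrow> (\<forall>w\<in>image_omega. f w = F (pi_map w))"
proof
  assume "restrict (via_pi f) (G_man r s) = F"
  then show "\<forall>w\<in>image_omega. f w = F (pi_map w)" using restrict_via_pi_pi_map[OF f] by metis
next
  assume eq: "\<forall>w\<in>image_omega. f w = F (pi_map w)"
  show "restrict (via_pi f) (G_man r s) = F"
  proof (rule extensionalityI[of _ "G_man r s"])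
    show "F \<in> extensional (G_man r s)" using F by (simp add: G_functions_def)
    fix y assume "y \<in> G_man r s"
    then obtain \<gamma> \<tau> p where p: "\<gamma> \<in> Gam" "\<tau> \<in> signs \<gamma>" "p \<in> U_set r \<gamma>" "y = Phi_map r s \<gamma> \<tau> p"
      unfolding G_man_def by blast
    have w: "omega_map r s \<gamma> \<tau> p \<in> image_omega" unfolding image_omega_def using p by blast
    show "restrict (via_pi f) (G_man r s) y = F y"
      using restrict_via_pi_pi_map[OF f w] eq[rule_format, OF w] by (simp only: p(4) pi_omega[OF p(1,2,3)])
  qed simp
qed

end

context manifold_function
begin

lemma restrict_extension_in_symmetric_free_functions:
  "restrict extension (M 2) \<in> symmetric_free_functions"
proof -
  let ?f = "restrict extension (M 2)"
  have sw: "[b, a] \<in> M 2" if "[a, b] \<in> M 2" for a b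
    using that by (elim ME) (auto simp: pair_M_level intro!: MI[of "[b, a]"])
  have sym: "symmetric ?f" using extension_symmetric sw unfolding symmetric_def by simp
  have nc: "nc_function 2 (M 2) ?f"
    using extension_nc M_dsum
    unfolding nc_function_def graded_def respects_similarities_def by simp
  have M: "openin (free_topology 2) (M 2)" by (rule openin_free_M) simp
  have bd: "\<exists>U. openin (free_topology 2) U \<and> w \<in> U \<and> U \<subseteq> M 2 \<and> bounded_fun_on U ?f" if w: "w \<in> M 2" for w
  proof -
    obtain U where U: "openin (free_topology 2) U" "w \<in> U" "bounded_fun_on U extension"
      using extension_locally_bounded[OF w] by blast
    have "U \<subseteq> M 2" using free_open_subset_M[OF U(1)] .
    moreover from this have "bounded_fun_on U ?f" using U(3) unfolding bounded_fun_on_def by (auto simp: subset_iff)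
    ultimately show ?thesis using U by blast
  qed
  have "nc_holomorphic 2 (free_topology 2) (M 2) ?f"
    unfolding nc_holomorphic_def using M nc bd nc[unfolded nc_function_def] by blast
  then show ?thesis using sym nc by (simp add: symmetric_free_functions_def)
qed

lemma restrict_extension_image_omega:
  assumes "w \<in> image_omega"
  shows "restrict extension (M 2) w = F (pi_map w)"
proof -
  have "w \<in> branched" using assms omega_in_branch_set unfolding image_omega_def branched_def by blast
  then show ?thesis using extension_branched f0_image_omega[OF assms] branched_subset_M by auto
qed

end

context sqrt_branches
begin

lemma bij_betw_via_pi:
  "bij_betw (\<lambda>f. restrict (via_pi f) (G_man r s)) symmetric_free_functions (G_functions r s)"
  unfolding bij_betw_def
proof
  show "inj_on (\<lambda>f. restrict (via_pi f) (G_man r s)) symmetric_free_functions"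
  proof (rule inj_onI)
    fix f g assume f: "f \<in> symmetric_free_functions" and g: "g \<in> symmetric_free_functions"
      and eq: "restrict (via_pi f) (G_man r s) = restrict (via_pi g) (G_man r s)"
    show "f = g"
    proof (rule image_omega_determines[OF f g])
      fix w assume w: "w \<in> image_omega"
      show "f w = g w" using restrict_via_pi_pi_map[OF f w] restrict_via_pi_pi_map[OF g w] eq by simp
    qed
  qed
  show "(\<lambda>f. restrict (via_pi f) (G_man r s)) ` symmetric_free_functions = G_functions r s"
  proof
    show "(\<lambda>f. restrict (via_pi f) (G_man r s)) ` symmetric_free_functions \<subseteq> G_functions r s"
      using via_pi_in_G_functions by blast
    show "G_functions r s \<subseteq> (\<lambda>f. restrict (via_pi f) (G_man r s)) ` symmetric_free_functions"
    proof
      fix F assume F: "F \<in> G_functions r s"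
      then have cn: "conditionally_nc 3 (G_man r s) F"
        and bd: "\<forall>w\<in>M 2. \<exists>U. openin (free_topology 2) U \<and> w \<in> U \<and> bounded_fun_on (pi_map ` U \<inter> G_man r s) F"
        by (simp_all add: G_functions_def)
      from cn obtain Fh where Fh: "graded {y \<in> M 3. \<exists>x\<in>G_man r s. dsum x y \<in> G_man r s} Fh"
        "\<forall>x\<in>G_man r s. \<forall>y\<in>M 3. dsum x y \<in> G_man r s \<longrightarrow> F (dsum x y) = mat_dsum (F x) (Fh y)"
        unfolding conditionally_nc_def by blast
      \<comment> \<open>The witness from \<open>conditionally_nc\<close> becomes the parameter
        \<open>Fh\<close>; surjectivity then follows from the extension built in the locale.\<close>
      interpret manifold_function r s F Fh
        by unfold_locales (use cn bd Fh in \<open>auto simp: conditionally_nc_def\<close>)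
      have "restrict (via_pi (restrict extension (M 2))) (G_man r s) = F"
        unfolding restrict_via_pi_eq_iff[OF restrict_extension_in_symmetric_free_functions F]
        using restrict_extension_image_omega by blast
      then show "F \<in> (\<lambda>f. restrict (via_pi f) (G_man r s)) ` symmetric_free_functions"
        using restrict_extension_in_symmetric_free_functions by blast
    qed
  qed
qed

end

theorem theorem1p5:
  fixes r :: "complex set \<Rightarrow> real" and s :: "complex set \<Rightarrow> complex \<Rightarrow> complex"
  assumes "sqrt_data r s"
  shows "\<exists>\<Psi>. bij_betw \<Psi> symmetric_free_functions (G_functions r s) \<and>
    (\<forall>f\<in>symmetric_free_functions. \<forall>F\<in>G_functions r s.
       \<Psi> f = F \<longleftrightarrow>
       (\<forall>w \<in> (\<Union>\<gamma>\<in>Gam. \<Union>\<tau>\<in>signs \<gamma>. omega_map r s \<gamma> \<tau> ` U_set r \<gamma>). f w = F (pi_map w)))"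
proof -
  interpret sqrt_branches r s by unfold_locales (rule assms)
  show ?thesis
    using bij_betw_via_pi restrict_via_pi_eq_iff unfolding image_omega_def by blast
qed

end
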